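(* Let $e\ge 2$, $k\ge0$ and $0\le\alpha\le e$ be integers. Suppose that $\lambda$ and $\mu$ are partitions of $n$ of length at most $k$ and that $\mu$ is $e$-regular. Let $\lambda^+,\mu^+$ be the partitions obtained from them by inserting an empty runner before runner $\rho_\alpha$ in their $e$-abacuses with $k$ beads. Let $b_{\lambda\mu}(v)$ and $b^+_{\sigma\nu}(v)$ be the coefficients of the canonical bases of the basic representations $L(\Lambda_0)$ of $\mathbf U_v(\widehat{\mathfrak{sl}}_e)$ and $L(\Lambda_0^+)$ of $\mathbf U_v(\widehat{\mathfrak{sl}}_{e+1})$ inside the Fock space. Then $$b_{\lambda\mu}(v)=b^+_{\lambda^+\mu^+}(v).$$
   Context: Abacuses. The length of a partition $\lambda=(\lambda_1,\lambda_2,\dots)$ is the smallest integer $\ell(\lambda)\ge 0$ with $\lambda_i=0$ for all $i>\ell(\lambda)$. A partition is $e$-regular if no $e$ of its nonzero parts are equal. An $e$-abacus has $e$ runners $\rho_0,\dots,\rho_{e-1}$ (left to right), with bead positions numbered $0,1,2,\dots$ from left to right and then top to bottom, so the positions on $\rho_r$ are $r+me$, $m\ge0$. If $\ell(\lambda)\le k$, the $e$-abacus of $\lambda$ with $k$ beads has beads at positions $\lambda_k,\lambda_{k-1}+1,\dots,\lambda_1+k-1$. For fixed $0\le\alpha\le e$, $\lambda^+$ is the partition of length at most $k$ whose $(e+1)$-abacus with $k$ beads has runners $\rho^+_r=\rho_r$ for $r<\alpha$, $\rho^+_\alpha$ empty, and $\rho^+_r=\rho_{r-1}$ for $r>\alpha$,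 where $\rho_0,\dots,\rho_{e-1}$ are the runners of the $e$-abacus of $\lambda$ with $k$ beads. The partition $\mu^+$ is always $(e+1)$-regular. Fock space. Let $v$ be an indeterminate and let $\mathcal F$ be the free $\mathbb C[v,v^{-1}]$-module with basis all partitions of all integers $n\ge0$. Nodes are pairs $(c,d)$ of positive integers; the diagram of $\lambda$ is $[\lambda]=\{(c,d)\mid d\le\lambda_c\}$; $\operatorname{res}_e(c,d)=d-c \bmod e$, and a node of residue $i$ is an $i$-node. A node $x\notin[\lambda]$ is addable if $[\lambda]\cup\{x\}$ is the diagram of a partition; $x\in[\lambda]$ is removable if $[\lambda]\setminus\{x\}$ is. A node $y=(a,b)$ is above $x=(c,d)$, written $y\succ x$, if $a<c$. Write $\lambda\xrightarrow{i}\nu$ if $[\nu]=[\lambda]\cup\{x\}$ for an addable $i$-node $x$ of $\lambda$, and then let $N_i(\lambda,\nu)$ be the number of addable $i$-nodes $y\succ x$ of $\lambda$ minus the number of removable $i$-nodes $y\succ x$ of $\lambda$. For $0\le i<e$ define $F_i\lambda=\sum_{\lambda\xrightarrow{i}\nu}v^{N_i(\lambda,\nu)}\nu$ and $F_i^{(a)}=F_i^a/[a]_v!$, where $[a]_v!=\prod_{s=1}^a\frac{v^s-v^{-s}}{v-v^{-1}}$ (these are the actions of the Chevalley generators, and their divided powers, of the negative part of $\mathbf U_v(\widehat{\mathfrak{sl}}_e)$). The module $L(\Lambda_0)$ is the submodule generated by the empty partition $\varnothing$ under the $F_i$; its integral form is the $\mathbb Z[v,v^{-1}]$-span of all $F_{i_1}^{(a_1)}\cdots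 F_{i_s}^{(a_s)}\varnothing$. Canonical basis. The bar involution on $L(\Lambda_0)$ is the unique map that is semilinear with respect to $v\mapsto v^{-1}$ and satisfies $\overline\varnothing=\varnothing$ and $\overline{F_i^{(a)}x}=F_i^{(a)}\overline x$ for all $x$, $i$ and $a\ge1$. For each $e$-regular partition $\mu$ of $n$, $B_\mu$ is the unique element of the integral form of $L(\Lambda_0)$ with $\overline{B_\mu}=B_\mu$ and $B_\mu=\sum_{\lambda\vdash n,\ \mu\trianglerighteq\lambda}b_{\lambda\mu}(v)\lambda$, where $b_{\mu\mu}(v)=1$ and $b_{\lambda\mu}(v)\in v\mathbb Z[v]$ for $\lambda\ne\mu$ ($\trianglerighteq$ is the dominance order; existence and uniqueness are due to Lascoux--Leclerc--Thibon); put $b_{\lambda\mu}(v)=0$ for all other partitions $\lambda$. For an $(e+1)$-regular partition $\nu$, the elements $B^+_\nu=\sum_\sigma b^+_{\sigma\nu}(v)\sigma$ and polynomials $b^+_{\sigma\nu}(v)$ are defined in exactly the same way with $e+1$ in place of $e$. *)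

theory Defs
  imports Complex_Main "HOL-Library.Poly_Mapping" "HOL-Library.FuncSet"
begin

section \<open>Partitions\<close>

text \<open>
  The value at \<open>i \<ge> 1\<close> is the \<open>i\<close>-th part; the value at the unused index \<open>0\<close> is
  fixed to \<open>0\<close>, so that a partition is determined by its parts.
\<close>

typedef partition =
  "{f :: nat \<Rightarrow> nat. f 0 = 0 \<and> (\<forall>i\<ge>1. f (Suc i) \<le> f i) \<and> finite {i. f i \<noteq> 0}}"
  morphisms part Abs_partition
  by (rule exI[of _ "\<lambda>_. 0"]) simp

definition empty_partition :: partition where
  "empty_partition = Abs_partition (\<lambda>_. 0)"

definition plen :: "partition \<Rightarrow> nat" where
  "plen lam = (LEAST l. \<forall>i>l. part lam i = 0)"

definition psize :: "partition \<Rightarrow> nat" where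
  "psize lam = (\<Sum>i = 1..plen lam. part lam i)"

definition regular :: "nat \<Rightarrow> partition \<Rightarrow> bool" where
  "regular e lam \<longleftrightarrow> (\<forall>m\<ge>1. card {i. part lam i = m} < e)"

definition dominates :: "partition \<Rightarrow> partition \<Rightarrow> bool" where
  "dominates \<mu> lam \<longleftrightarrow> psize lam = psize \<mu> \<and>
     (\<forall>j. (\<Sum>i = 1..j. part lam i) \<le> (\<Sum>i = 1..j. part \<mu> i))"


section \<open>Abacuses\<close>

definition beads :: "nat \<Rightarrow> partition \<Rightarrow> nat set" where
  "beads k lam = (\<lambda>i. part lam i + (k - i)) ` {1..k}"

text \<open>A runner is recorded by the rows \<open>m\<close> in which it carries a bead.\<close>

definition runner :: "nat \<Rightarrow> nat \<Rightarrow> partition \<Rightarrow> nat \<Rightarrow> nat set" where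
  "runner e k lam r = {m. r + m * e \<in> beads k lam}"

definition insert_runner :: "nat \<Rightarrow> nat \<Rightarrow> nat \<Rightarrow> partition \<Rightarrow> partition" where
  "insert_runner e k \<alpha> lam = (THE \<nu>. plen \<nu> \<le> k \<and>
     (\<forall>r<\<alpha>. runner (e + 1) k \<nu> r = runner e k lam r) \<and>
     runner (e + 1) k \<nu> \<alpha> = {} \<and>
     (\<forall>r. \<alpha> < r \<and> r \<le> e \<longrightarrow> runner (e + 1) k \<nu> r = runner e k lam (r - 1)))"


section \<open>Laurent polynomials and the Fock space\<close>

text \<open>
  The ring \<open>\<complex>[v, v\<^sup>-\<^sup>1]\<close> is the group algebra of the integers: the coefficient of
  \<open>v\<^sup>n\<close> in \<open>p\<close> is \<open>Poly_Mapping.lookup p n\<close>.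
\<close>

type_synonym laurent = "int \<Rightarrow>\<^sub>0 complex"

definition vpow :: "int \<Rightarrow> laurent" where
  "vpow n = Poly_Mapping.single n 1"

lemma vpow_mult: "vpow m * vpow n = vpow (m + n)"
  by (simp add: vpow_def mult_single)

definition laurent_bar :: "laurent \<Rightarrow> laurent" where
  "laurent_bar p = Poly_Mapping.map_key uminus p"

lemma lookup_laurent_bar:
  "Poly_Mapping.lookup (laurent_bar p) n = Poly_Mapping.lookup p (- n)"
  by (simp add: laurent_bar_def map_key.rep_eq)

text \<open>The subsets \<open>\<int>[v, v\<^sup>-\<^sup>1]\<close> and \<open>v\<int>[v]\<close>.\<close>

definition int_laurent :: "laurent set" where
  "int_laurent = {p. \<forall>n. Poly_Mapping.lookup p n \<in> \<int>}"

definition v_int_poly :: "laurent set" where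
  "v_int_poly = {p \<in> int_laurent. \<forall>n<1. Poly_Mapping.lookup p n = 0}"

definition qint :: "nat \<Rightarrow> laurent" where
  "qint s = (\<Sum>j<s. vpow (int s - 1 - 2 * int j))"

text \<open>The defining quotient \<open>(v\<^sup>s - v\<^sup>-\<^sup>s) / (v - v\<^sup>-\<^sup>1)\<close>, with the division cleared.\<close>

lemma qint_mult: "qint s * (vpow 1 - vpow (- 1)) = vpow (int s) - vpow (- int s)"
proof -
  have "qint s * (vpow 1 - vpow (- 1)) =
      (\<Sum>j<s. vpow (int s - 2 * int j) - vpow (int s - 2 * int (Suc j)))"
    unfolding qint_def sum_distrib_right
    by (intro sum.cong) (simp_all add: right_diff_distrib vpow_mult algebra_simps)
  also have "\<dots> = vpow (int s) - vpow (int s - 2 * int s)"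
    using sum_lessThan_telescope'[of "\<lambda>j. vpow (int s - 2 * int j)" s] by simp
  finally show ?thesis by simp
qed

definition qfact :: "nat \<Rightarrow> laurent" where
  "qfact a = (\<Prod>s = 1..a. qint s)"

type_synonym fock = "partition \<Rightarrow>\<^sub>0 laurent"

definition basis :: "partition \<Rightarrow> fock" where
  "basis lam = Poly_Mapping.single lam 1"

definition scale :: "laurent \<Rightarrow> fock \<Rightarrow> fock" where
  "scale c x = Poly_Mapping.map ((*) c) x"

lemma lookup_scale: "Poly_Mapping.lookup (scale c x) lam = c * Poly_Mapping.lookup x lam"
  by (simp add: scale_def map.rep_eq when_def)

global_interpretation fock: module scale
  by unfold_locales
    (auto intro!: poly_mapping_eqI simp: lookup_scale lookup_add algebra_simps)


section \<open>Nodes and the Chevalley generators\<close>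

type_synonym node = "nat \<times> nat"

definition diagram :: "partition \<Rightarrow> node set" where
  "diagram lam = {(c, d). 1 \<le> c \<and> 1 \<le> d \<and> d \<le> part lam c}"

definition residue :: "nat \<Rightarrow> node \<Rightarrow> nat" where
  "residue e x = nat ((int (snd x) - int (fst x)) mod int e)"

definition addable :: "partition \<Rightarrow> node \<Rightarrow> bool" where
  "addable lam x \<longleftrightarrow> x \<notin> diagram lam \<and> (\<exists>\<nu>. diagram \<nu> = insert x (diagram lam))"

definition removable :: "partition \<Rightarrow> node \<Rightarrow> bool" where
  "removable lam x \<longleftrightarrow> x \<in> diagram lam \<and> (\<exists>\<nu>. diagram \<nu> = diagram lam - {x})"

definition above :: "node \<Rightarrow> node \<Rightarrow> bool" where
  "above y x \<longleftrightarrow> fst y < fst x"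

definition adds :: "nat \<Rightarrow> nat \<Rightarrow> partition \<Rightarrow> partition \<Rightarrow> bool" where
  "adds e i lam \<nu> \<longleftrightarrow>
     (\<exists>x. addable lam x \<and> residue e x = i \<and> diagram \<nu> = insert x (diagram lam))"

definition N :: "nat \<Rightarrow> nat \<Rightarrow> partition \<Rightarrow> partition \<Rightarrow> int" where
  "N e i lam \<nu> = (let x = the_elem (diagram \<nu> - diagram lam) in
     int (card {y. addable lam y \<and> residue e y = i \<and> above y x}) -
     int (card {y. removable lam y \<and> residue e y = i \<and> above y x}))"

definition F :: "nat \<Rightarrow> nat \<Rightarrow> fock \<Rightarrow> fock" where
  "F e i x = (\<Sum>lam\<in>Poly_Mapping.keys x. scale (Poly_Mapping.lookup x lam)
     (\<Sum>\<nu> | adds e i lam \<nu>. scale (vpow (N e i lam \<nu>)) (basis \<nu>)))"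

text \<open>
  The quotient of \<open>F\<^sub>i\<^sup>a x\<close> by \<open>[a]\<^sub>v!\<close>. It is unique because the Fock space is free over an
  integral domain, and it exists because the Fock space is stable under the divided powers.
\<close>

definition Fdiv :: "nat \<Rightarrow> nat \<Rightarrow> nat \<Rightarrow> fock \<Rightarrow> fock" where
  "Fdiv e i a x = (THE y. scale (qfact a) y = (F e i ^^ a) x)"


section \<open>The basic representation and its canonical basis\<close>

text \<open>
  Over \<open>\<complex>[v, v\<^sup>-\<^sup>1]\<close>, ``generated'' has to include the divided powers: the
  submodule must contain its integral form and carry the operators occurring in the
  characterisation of the bar involution.
\<close>

definition L :: "nat \<Rightarrow> fock set" where
  "L e = \<Inter>{M. fock.subspace M \<and> basis empty_partition \<in> M \<and>
     (\<forall>i<e. \<forall>a\<ge>1. \<forall>x\<in>M. Fdiv e i a x \<in> M)}"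

inductive_set monomials :: "nat \<Rightarrow> fock set" for e where
  empty: "basis empty_partition \<in> monomials e"
| Fdiv: "x \<in> monomials e \<Longrightarrow> i < e \<Longrightarrow> a \<ge> 1 \<Longrightarrow> Fdiv e i a x \<in> monomials e"

definition integral_form :: "nat \<Rightarrow> fock set" where
  "integral_form e = {\<Sum>x\<in>X. scale (c x) x | X c.
     finite X \<and> X \<subseteq> monomials e \<and> c ` X \<subseteq> int_laurent}"

definition is_bar_involution :: "nat \<Rightarrow> (fock \<Rightarrow> fock) \<Rightarrow> bool" where
  "is_bar_involution e \<psi> \<longleftrightarrow>
     (\<forall>x\<in>L e. \<forall>y\<in>L e. \<psi> (x + y) = \<psi> x + \<psi> y) \<and>
     (\<forall>c. \<forall>x\<in>L e. \<psi> (scale c x) = scale (laurent_bar c) (\<psi> x)) \<and>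
     \<psi> (basis empty_partition) = basis empty_partition \<and>
     (\<forall>i<e. \<forall>a\<ge>1. \<forall>x\<in>L e. \<psi> (Fdiv e i a x) = Fdiv e i a (\<psi> x))"

text \<open>
  Functions of type \<open>fock \<Rightarrow> fock\<close> stand for maps on \<open>L e\<close> only if their values
  elsewhere are fixed, hence the extensional function space.
\<close>

definition bar :: "nat \<Rightarrow> fock \<Rightarrow> fock" where
  "bar e = (THE \<psi>. \<psi> \<in> L e \<rightarrow>\<^sub>E L e \<and> is_bar_involution e \<psi>)"

definition is_canonical :: "nat \<Rightarrow> partition \<Rightarrow> fock \<Rightarrow> bool" where
  "is_canonical e \<mu> B \<longleftrightarrow> B \<in> integral_form e \<and> bar e B = B \<and>
     (\<forall>lam\<in>Poly_Mapping.keys B. dominates \<mu> lam) \<and>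
     Poly_Mapping.lookup B \<mu> = 1 \<and>
     (\<forall>lam. lam \<noteq> \<mu> \<longrightarrow> Poly_Mapping.lookup B lam \<in> v_int_poly)"

text \<open>Meaningful for \<open>e\<close>-regular \<open>\<mu>\<close> only.\<close>

definition canonical_basis :: "nat \<Rightarrow> partition \<Rightarrow> fock" where
  "canonical_basis e \<mu> = (THE B. is_canonical e \<mu> B)"

definition b :: "nat \<Rightarrow> partition \<Rightarrow> partition \<Rightarrow> laurent" where
  "b e lam \<mu> = Poly_Mapping.lookup (canonical_basis e \<mu>) lam"

end

theory Submission
  imports Defs
begin

text \<open>
  In terms of bead positions, \<open>F\<^sub>i\<^sup>(\<^sup>a\<^sup>)\<close> moves \<open>a\<close> beads from one runner to the next. A step between
  two neighbouring runners that stay neighbours has the same matrix coefficients before and after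
  the insertion; the step across the new empty runner becomes \<open>F\<^sub>j\<^sub>+\<^sub>1\<^sup>(\<^sup>a\<^sup>)F\<^sub>j\<^sup>(\<^sup>a\<^sup>)\<close>. Since lengths never
  decrease, all this holds modulo the partitions of length greater than \<open>k\<close>. As \<open>\<emptyset>\<^sup>+\<close> is itself a product of
  divided powers applied to \<open>\<emptyset>\<close> (its diagram consists of complete ladders), every bar-invariant
  \<open>x\<close> in \<open>L(\<Lambda>\<^sub>0)\<close> has a bar-invariant lift \<open>y\<close> in \<open>L(\<Lambda>\<^sub>0\<^sup>+)\<close> whose terms of length at most \<open>k\<close>
  form the image of \<open>x\<close> under \<open>\<lambda> \<mapsto> \<lambda>\<^sup>+\<close>. For \<open>x = B\<^sub>\<mu>\<close> the bar-invariant element \<open>y - B\<^sup>+\<close>, with \<open>B\<^sup>+\<close>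
  belonging to \<open>\<mu>\<^sup>+\<close>, has its coefficients in length at most \<open>k\<close> in \<open>v\<complex>[v]\<close>, so they vanish by triangularity of the ladder
  monomials.

  The bar involution exists because the transposed operators \<open>E\<^sub>i\<close> have no common kernel in
  positive degree. The coefficients of an element of \<open>L(\<Lambda>\<^sub>0)\<close> at \<open>e\<close>-regular partitions determine
  the others with a factor in \<open>v\<int>[v]\<close>: signed sums over ribbon strips define linear forms which commute with the
  \<open>F\<^sub>i\<close> and hence vanish on \<open>L(\<Lambda>\<^sub>0)\<close>.
\<close>

section \<open>Partitions and their beads\<close>

text \<open>Two mismatches force the detours. The adjunction between \<open>E\<close> and
  \<open>F\<close> controls only what the \<open>F\<close> generate without division, whereas
  \<open>L e\<close> contains the divided powers; so the bar involution is built on products of the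
  \<open>F\<close> and extended by clearing bar-invariant denominators. And ladder monomials are
  triangular only at regular partitions, whereas the canonical basis prescribes its coefficients at
  all partitions; the ribbon strip forms close this gap. They are coefficients of ribbon strip
  operators in the style of Lascoux, Leclerc and Thibon, which belong to the Heisenberg algebra
  commuting with the quantum affine algebra; each ribbon contributes (-v)^(-height).

  The lift y arises by averaging some lift with its bar image. The factor 1/2 may take it out of the
  integral form, which is why the final comparison uses complex coefficients. Nothing is known about
  y at partitions longer than k. The comparison survives because whatever is dominated by a long
  partition is long, so the ladder vectors of long partitions have no short terms.\<close>

lemma part_zero [simp]: "part lam 0 = 0"
  using part[of lam] by simp

lemma part_Suc_le: "c \<ge> 1 \<Longrightarrow> part lam (Suc c) \<le> part lam c"
  using part[of lam] by simp

lemma finite_part_support: "finite {i. part lam i \<noteq> 0}"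
  using part[of lam] by simp

lemma part_antimono:
  assumes "1 \<le> c" "c \<le> c'" shows "part lam c' \<le> part lam c"
  using assms(2,1) by (induction rule: dec_induct) (auto intro: order_trans[OF part_Suc_le])

lemma partition_eqI: "(\<And>c. c \<ge> 1 \<Longrightarrow> part lam c = part \<mu> c) \<Longrightarrow> lam = \<mu>"
  by (metis ext less_one not_le part_inject part_zero)

lemma part_Abs:
  assumes "f 0 = 0" "\<And>i. i \<ge> 1 \<Longrightarrow> f (Suc i) \<le> f i" "\<And>i. i > l \<Longrightarrow> f i = 0"
  shows "part (Abs_partition f) = f"
proof -
  have "{i. f i \<noteq> 0} \<subseteq> {..l}"
  proof
    fix i assume "i \<in> {i. f i \<noteq> 0}"
    then show "i \<in> {..l}" using assms(3)[of i] by (cases "i > l") auto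
  qed
  then show ?thesis
    using assms by (intro Abs_partition_inverse) (auto intro: finite_subset)
qed

lemma part_eventually_0: "\<exists>l. \<forall>i>l. part lam i = 0"
  using finite_part_support[of lam] unfolding finite_nat_set_iff_bounded_le
  by (metis (mono_tags, lifting) mem_Collect_eq not_le)

lemma part_beyond_plen: "i > plen lam \<Longrightarrow> part lam i = 0"
  using LeastI_ex[OF part_eventually_0[of lam]] unfolding plen_def by blast

lemma plen_le_iff: "plen lam \<le> k \<longleftrightarrow> (\<forall>i>k. part lam i = 0)"
proof
  assume "plen lam \<le> k" then show "\<forall>i>k. part lam i = 0"
    using part_beyond_plen[of lam] by simp
next
  assume "\<forall>i>k. part lam i = 0" then show "plen lam \<le> k"
    unfolding plen_def by (rule Least_le)
qed

lemma part_empty [simp]: "part empty_partition c = 0"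
  unfolding empty_partition_def by (subst part_Abs[where l=0]) auto

lemma plen_empty [simp]: "plen empty_partition = 0"
  using plen_le_iff[of empty_partition 0] by simp

lemma psize_eq_sum:
  assumes "plen lam \<le> K" shows "psize lam = (\<Sum>i=1..K. part lam i)"
  unfolding psize_def using assms
  by (intro sum.mono_neutral_left) (auto intro: part_beyond_plen)

section \<open>Bead positions and the sets they form\<close>

definition bead :: "partition \<Rightarrow> nat \<Rightarrow> int" where
  "bead lam c = int (part lam c) - int c"

text \<open>The positions in the abacus with \<open>k\<close> beads, lowered by \<open>k\<close> so that they do not depend on \<open>k\<close>.\<close>

definition maya :: "partition \<Rightarrow> int set" where
  "maya lam = bead lam ` {1..}"

lemma mayaE:
  assumes "p \<in> maya lam" obtains c where "c \<ge> 1" "bead lam c = p"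
  using assms unfolding maya_def by auto

lemma bead_in_maya [intro, simp]: "c \<ge> 1 \<Longrightarrow> bead lam c \<in> maya lam"
  unfolding maya_def by auto

lemma bead_mono: "1 \<le> c \<Longrightarrow> c < c' \<Longrightarrow> bead lam c' < bead lam c"
  using part_antimono[of c c' lam] unfolding bead_def by simp

lemma bead_less_iff: "1 \<le> c \<Longrightarrow> 1 \<le> c' \<Longrightarrow> bead lam c' < bead lam c \<longleftrightarrow> c < c'"
  by (metis bead_mono linorder_less_linear order_less_asym)

lemma bead_eq_iff: "1 \<le> c \<Longrightarrow> 1 \<le> c' \<Longrightarrow> bead lam c = bead lam c' \<longleftrightarrow> c = c'"
  by (metis bead_less_iff less_irrefl nat_neq_iff)

lemma inj_on_bead: "inj_on (bead lam) {1..}"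
  by (auto simp: inj_on_def bead_eq_iff)

text \<open>Counting beads from the right recovers the row number of a bead, so the mere set of
  positions determines the partition; \<open>maya_inject\<close> rests on this.\<close>

lemma maya_above_bead:
  assumes "c \<ge> 1" shows "card {q \<in> maya lam. q \<ge> bead lam c} = c"
proof -
  have "{q \<in> maya lam. q \<ge> bead lam c} = bead lam ` {1..c}"
    using assms bead_less_iff[of c _ lam] by (force simp: maya_def not_less[symmetric])
  moreover have "inj_on (bead lam) {1..c}"
    by (rule inj_on_subset[OF inj_on_bead]) auto
  ultimately show ?thesis by (simp add: card_image)
qed

lemma maya_inject: "maya lam = maya \<mu> \<longleftrightarrow> lam = \<mu>"
proof
  assume eq: "maya lam = maya \<mu>"
  show "lam = \<mu>"
  proof (rule partition_eqI)
    fix c :: nat assume c: "c \<ge> 1"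
    then obtain c' where c': "c' \<ge> 1" "bead \<mu> c' = bead lam c"
      by (metis bead_in_maya eq mayaE)
    then have "c' = c"
      using maya_above_bead[OF c, of lam] maya_above_bead[OF c'(1), of \<mu>] eq by simp
    with c' show "part lam c = part \<mu> c" by (simp add: bead_def)
  qed
qed auto

lemma maya_le: "p \<in> maya lam \<Longrightarrow> p < int (part lam 1)"
proof -
  assume "p \<in> maya lam"
  then obtain c where c: "c \<ge> 1" "bead lam c = p" by (rule mayaE)
  then show ?thesis using part_antimono[of 1 c lam] by (simp add: bead_def)
qed

lemma maya_low: "plen lam \<le> K \<Longrightarrow> p < - int K \<Longrightarrow> p \<in> maya lam"
proof -
  assume "plen lam \<le> K" "p < - int K"
  then have "bead lam (nat (- p)) = p" "nat (-p) \<ge> 1"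
    using part_beyond_plen[of lam "nat (-p)"] by (auto simp: bead_def)
  then show "p \<in> maya lam" by (metis bead_in_maya)
qed

lemma maya_ge_eq: "plen lam \<le> K \<Longrightarrow> maya lam \<inter> {- int K..} = bead lam ` {1..K}"
proof (intro equalityI subsetI)
  fix p assume K: "plen lam \<le> K" and "p \<in> maya lam \<inter> {- int K..}"
  then obtain c where c: "c \<ge> 1" "bead lam c = p" "p \<ge> - int K" by (auto elim: mayaE)
  have "c \<le> K"
  proof (rule ccontr)
    assume "\<not> c \<le> K"
    then show False using c part_beyond_plen[of lam c] K by (simp add: bead_def)
  qed
  with c show "p \<in> bead lam ` {1..K}" by auto
next
  fix p assume "p \<in> bead lam ` {1..K}"
  then show "p \<in> maya lam \<inter> {- int K..}" by (auto simp: bead_def maya_def)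
qed

section \<open>Moving beads by one position, that is, adding and removing nodes\<close>

definition move :: "int set \<Rightarrow> partition \<Rightarrow> partition" where
  "move S lam = Abs_partition (\<lambda>c. part lam c + (if c \<ge> 1 \<and> bead lam c \<in> S then 1 else 0))"

definition movable :: "int set \<Rightarrow> int set" where
  "movable M = {p \<in> M. p + 1 \<notin> M}"

text \<open>A bead with a free place on its right belongs to a row strictly shorter than the
  previous one, so the new rows still decrease weakly. Beyond row \<open>plen lam + 1\<close> every
  bead has an occupied right neighbour, so the new support is finite.\<close>

lemma part_move:
  assumes "S \<subseteq> movable (maya lam)"
  shows "part (move S lam) c = part lam c + (if c \<ge> 1 \<and> bead lam c \<in> S then 1 else 0)"
proof -
  let ?f = "\<lambda>c. part lam c + (if c \<ge> 1 \<and> bead lam c \<in> S then 1 else 0)"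
  have "part (Abs_partition ?f) = ?f"
  proof (rule part_Abs)
    fix i :: nat assume i: "i \<ge> 1"
    show "?f (Suc i) \<le> ?f i"
    proof (cases "bead lam (Suc i) \<in> S")
      case True
      then have "bead lam (Suc i) + 1 \<notin> maya lam" using assms by (auto simp: movable_def)
      then have "bead lam i \<noteq> bead lam (Suc i) + 1" using i by (metis bead_in_maya)
      then have "part lam (Suc i) \<noteq> part lam i" by (auto simp: bead_def)
      then show ?thesis using part_Suc_le[OF i, of lam] by simp
    qed (use part_Suc_le[OF i, of lam] in auto)
  next
    fix i assume i: "i > Suc (plen lam)"
    have "bead lam i + 1 \<in> maya lam"
      using i part_beyond_plen[of lam i] maya_low[of lam "plen lam"] by (simp add: bead_def)
    then have "bead lam i \<notin> S" using assms by (auto simp: movable_def)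
    then show "?f i = 0" using i part_beyond_plen[of lam i] by simp
  qed simp
  then show ?thesis unfolding move_def by simp
qed

lemma bead_move:
  assumes "S \<subseteq> movable (maya lam)" "c \<ge> 1"
  shows "bead (move S lam) c = bead lam c + (if bead lam c \<in> S then 1 else 0)"
  using assms by (auto simp: bead_def part_move[OF assms(1)])

lemma image_shift_subset:
  assumes "S \<subseteq> M"
  shows "(\<lambda>p. p + (if p \<in> S then 1 else 0)) ` M = (M - S) \<union> (\<lambda>p::int. p + 1) ` S" (is "?f ` M = _")
proof (intro equalityI subsetI)
  fix q assume "q \<in> ?f ` M"
  then obtain p where p: "p \<in> M" "q = p + (if p \<in> S then 1 else 0)" by (rule imageE)
  show "q \<in> (M - S) \<union> (\<lambda>p. p + 1) ` S" by (cases "p \<in> S") (use p in simp_all)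
next
  fix q assume "q \<in> (M - S) \<union> (\<lambda>p. p + 1) ` S"
  then consider "q \<in> M" "q \<notin> S" | p where "p \<in> S" "q = p + 1" by blast
  then show "q \<in> ?f ` M"
  proof cases
    case 1 then show ?thesis by (simp add: rev_image_eqI)
  next
    case (2 p) then show ?thesis using assms rev_image_eqI[of p M q ?f] by (simp add: subset_iff)
  qed
qed

lemma maya_move:
  assumes "S \<subseteq> movable (maya lam)"
  shows "maya (move S lam) = (maya lam - S) \<union> (\<lambda>p. p + 1) ` S"
proof -
  have "maya (move S lam) = (\<lambda>c. bead lam c + (if bead lam c \<in> S then 1 else 0)) ` {1..}"
    unfolding maya_def[of "move S lam"] using bead_move[OF assms] by (intro image_cong) auto
  also have "\<dots> = (\<lambda>p. p + (if p \<in> S then 1 else 0)) ` maya lam"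
    unfolding maya_def by (simp add: image_image)
  also have "\<dots> = (maya lam - S) \<union> (\<lambda>p. p + 1) ` S"
    using assms by (intro image_shift_subset) (auto simp: movable_def)
  finally show ?thesis .
qed

lemma plen_move_ge:
  assumes "S \<subseteq> movable (maya lam)" shows "plen lam \<le> plen (move S lam)"
  using part_beyond_plen[of "move S lam"] part_move[OF assms] by (auto simp: plen_le_iff)

text \<open>An empty row i > k has its bead at -i and becomes nonempty exactly when this bead moves.
  Truncating at length k therefore means allowing only moves of beads at positions from -k
  on.\<close>

lemma plen_move_le_iff:
  assumes "S \<subseteq> movable (maya lam)" "plen lam \<le> k"
  shows "plen (move S lam) \<le> k \<longleftrightarrow> S \<subseteq> {- int k..}"
proof -
  have b: "bead lam i = - int i" if "i > k" for i
    using assms(2) that part_beyond_plen[of lam i] by (simp add: bead_def)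
  have "plen (move S lam) \<le> k \<longleftrightarrow> (\<forall>i>k. - int i \<notin> S)"
    using assms(2) b part_beyond_plen[of lam]
    by (auto simp: plen_le_iff part_move[OF assms(1)])
  also have "\<dots> \<longleftrightarrow> S \<subseteq> {- int k..}"
  proof
    assume *: "\<forall>i>k. - int i \<notin> S"
    show "S \<subseteq> {- int k..}"
    proof (intro subsetI, rule ccontr)
      fix p assume "p \<in> S" "p \<notin> {- int k..}"
      then show False using *[rule_format, of "nat (- p)"] by (cases "k < nat (- p)") auto
    qed
  qed auto
  finally show ?thesis .
qed

definition unmove :: "int \<Rightarrow> partition \<Rightarrow> partition" where
  "unmove p lam = Abs_partition (\<lambda>c. part lam c - (if bead lam c = p + 1 then 1 else 0))"

lemma part_unmove:
  assumes "p \<notin> maya lam" "p + 1 \<in> maya lam"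
  shows "part (unmove p lam) c = part lam c - (if bead lam c = p + 1 then 1 else 0)"
    and "c \<ge> 1 \<Longrightarrow> bead lam c = p + 1 \<Longrightarrow> part lam c \<ge> 1"
proof -
  have *: "part lam (Suc c) < part lam c" if "c \<ge> 1" "bead lam c = p + 1" for c
  proof (rule ccontr)
    assume "\<not> part lam (Suc c) < part lam c"
    then have "bead lam (Suc c) = p" using that part_Suc_le[of c lam] by (auto simp: bead_def)
    then show False using assms(1) bead_in_maya[of "Suc c" lam] by auto
  qed
  then show "c \<ge> 1 \<Longrightarrow> bead lam c = p + 1 \<Longrightarrow> part lam c \<ge> 1" by fastforce
  let ?f = "\<lambda>c. part lam c - (if bead lam c = p + 1 then 1 else 0)"
  have "part (Abs_partition ?f) = ?f"
  proof (rule part_Abs)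
    fix i :: nat assume i: "i \<ge> 1"
    show "?f (Suc i) \<le> ?f i"
      using *[OF i] part_Suc_le[OF i, of lam] by auto
  next
    fix i assume i: "i > plen lam"
    then show "?f i = 0" using part_beyond_plen[of lam i] by simp
  qed simp
  then show "part (unmove p lam) c = part lam c - (if bead lam c = p + 1 then 1 else 0)"
    unfolding unmove_def by simp
qed

lemma maya_unmove:
  assumes "p \<notin> maya lam" "p + 1 \<in> maya lam"
  shows "maya (unmove p lam) = insert p (maya lam - {p + 1})"
proof -
  have "bead (unmove p lam) c = (if bead lam c = p + 1 then p else bead lam c)" if "c \<ge> 1" for c
    using part_unmove(1)[OF assms, of c] part_unmove(2)[OF assms, of c] that
    by (auto simp: bead_def)
  then have "maya (unmove p lam) = (\<lambda>c. if bead lam c = p + 1 then p else bead lam c) ` {1..}"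
    unfolding maya_def[of "unmove p lam"] by (intro image_cong) auto
  also have "\<dots> = (\<lambda>q. if q = p + 1 then p else q) ` maya lam"
    by (simp only: maya_def image_image)
  also have "\<dots> = insert p (maya lam - {p + 1})"
  proof (intro equalityI subsetI)
    fix q assume "q \<in> insert p (maya lam - {p + 1})"
    then consider "q = p" | "q \<in> maya lam" "q \<noteq> p + 1" by blast
    then show "q \<in> (\<lambda>q. if q = p + 1 then p else q) ` maya lam"
    proof cases
      case 1 then show ?thesis using assms by (intro image_eqI[of _ _ "p + 1"]) auto
    next
      case 2 then show ?thesis by (intro image_eqI[of _ _ q]) auto
    qed
  qed (auto split: if_splits)
  finally show ?thesis .
qed

section \<open>Laurent polynomials and linear operators\<close>

lemma laurent_bar_add: "laurent_bar (p + q) = laurent_bar p + laurent_bar q"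
  by (rule poly_mapping_eqI) (simp add: lookup_laurent_bar lookup_add)

lemma laurent_bar_0 [simp]: "laurent_bar 0 = 0"
  by (rule poly_mapping_eqI) (simp add: lookup_laurent_bar)

lemma laurent_bar_minus: "laurent_bar (- p) = - laurent_bar p"
  by (rule poly_mapping_eqI) (simp add: lookup_laurent_bar)

lemma laurent_bar_bar [simp]: "laurent_bar (laurent_bar p) = p"
  by (rule poly_mapping_eqI) (simp add: lookup_laurent_bar)

lemma laurent_bar_single [simp]:
  "laurent_bar (Poly_Mapping.single n c) = Poly_Mapping.single (- n) c"
  by (rule poly_mapping_eqI) (auto simp: lookup_laurent_bar lookup_single when_def)

lemma laurent_bar_sum: "laurent_bar (sum f A) = (\<Sum>x\<in>A. laurent_bar (f x))"
  by (rule poly_mapping_eqI) (simp add: lookup_laurent_bar lookup_sum)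

lemma laurent_expand: "(p :: laurent) = (\<Sum>n\<in>Poly_Mapping.keys p. Poly_Mapping.single n (Poly_Mapping.lookup p n))"
  by (rule poly_mapping_eqI) (simp add: lookup_sum lookup_single in_keys_iff when_def)

lemma laurent_bar_mult: "laurent_bar (p * q) = laurent_bar p * laurent_bar q"
proof -
  let ?s = "\<lambda>p::laurent. \<lambda>n. Poly_Mapping.single n (Poly_Mapping.lookup p n)"
  have "laurent_bar (p * q) =
      laurent_bar ((\<Sum>n\<in>Poly_Mapping.keys p. ?s p n) * (\<Sum>n\<in>Poly_Mapping.keys q. ?s q n))"
    using laurent_expand[of p] laurent_expand[of q] by simp
  also have "\<dots> = laurent_bar (\<Sum>n\<in>Poly_Mapping.keys p. ?s p n) * laurent_bar (\<Sum>n\<in>Poly_Mapping.keys q. ?s q n)"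
    by (simp add: sum_product laurent_bar_sum mult_single)
  finally show ?thesis using laurent_expand[of p] laurent_expand[of q] by simp
qed

lemma laurent_bar_1 [simp]: "laurent_bar 1 = 1"
  using laurent_bar_single[of 0 1] by (simp add: single_one)

lemma laurent_bar_vpow [simp]: "laurent_bar (vpow n) = vpow (- n)"
  by (simp add: vpow_def)

lemma vpow_0 [simp]: "vpow 0 = 1"
  by (simp add: vpow_def)

lemma vpow_nonzero [simp]: "vpow n \<noteq> 0"
proof
  assume "vpow n = 0"
  then have "Poly_Mapping.lookup (vpow n) n = 0" by simp
  then show False by (simp add: vpow_def)
qed

lemma vpow_inject [simp]: "vpow m = vpow n \<longleftrightarrow> m = n"
  by (metis lookup_single_eq lookup_single_not_eq vpow_def zero_neq_one)

lemma laurent_bar_qint [simp]: "laurent_bar (qint s) = qint s"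
proof -
  have "laurent_bar (qint s) = (\<Sum>j<s. vpow (1 + 2 * int j - int s))"
    unfolding qint_def laurent_bar_sum by (simp add: algebra_simps)
  also have "\<dots> = (\<Sum>j<s. vpow (int s - 1 - 2 * int j))"
    by (rule sum.reindex_bij_witness[where i="\<lambda>j. s - 1 - j" and j="\<lambda>j. s - 1 - j"])
       (auto simp: of_nat_diff algebra_simps)
  finally show ?thesis by (simp add: qint_def)
qed

lemma qint_nonzero: "s \<ge> 1 \<Longrightarrow> qint s \<noteq> 0"
  using qint_mult[of s] by (metis diff_0_right eq_iff_diff_eq_0 mult_zero_left of_nat_0_less_iff
      vpow_inject neg_equal_zero of_nat_eq_0_iff not_one_le_zero)

lemma laurent_bar_prod: "laurent_bar (prod f A) = (\<Prod>x\<in>A. laurent_bar (f x))"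
  by (induction A rule: infinite_finite_induct) (auto simp: laurent_bar_mult)

lemma laurent_bar_qfact [simp]: "laurent_bar (qfact a) = qfact a"
  unfolding qfact_def laurent_bar_prod by simp

lemma qfact_nonzero [simp]: "qfact a \<noteq> 0"
  unfolding qfact_def by (simp add: qint_nonzero)

lemma qfact_0 [simp]: "qfact 0 = 1" by (simp add: qfact_def)

lemma qfact_Suc: "qfact (Suc a) = qint (Suc a) * qfact a"
  by (simp add: qfact_def atLeastAtMostSuc_conv)

lemma scale_cancel: "c \<noteq> 0 \<Longrightarrow> scale c x = scale c y \<longleftrightarrow> x = y"
  by (auto intro!: poly_mapping_eqI dest!: arg_cong[where f=Poly_Mapping.lookup] simp: fun_eq_iff lookup_scale)

lemma scale_eq_0_iff: "scale c x = 0 \<longleftrightarrow> c = 0 \<or> x = 0"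
  using scale_cancel[of c x 0] by auto

lemma lookup_basis: "Poly_Mapping.lookup (basis lam) \<mu> = (if \<mu> = lam then 1 else 0)"
  by (auto simp: basis_def lookup_single when_def)

abbreviation "flinear \<equiv> module_hom scale scale"

text \<open>Operators are brought into the form \<open>lin K\<close>, so that linearity is proved
  once and identities reduce to basis vectors by \<open>flinear_ext\<close>.\<close>

definition lin :: "(partition \<Rightarrow> fock) \<Rightarrow> fock \<Rightarrow> fock" where
  "lin K x = (\<Sum>lam\<in>Poly_Mapping.keys x. scale (Poly_Mapping.lookup x lam) (K lam))"

lemma lin_superset:
  assumes "finite A" "Poly_Mapping.keys x \<subseteq> A"
  shows "lin K x = (\<Sum>lam\<in>A. scale (Poly_Mapping.lookup x lam) (K lam))"
  unfolding lin_def using assms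
  by (intro sum.mono_neutral_left) (auto simp: in_keys_iff)

lemma flinear_lin: "flinear (lin K)"
proof
  fix x y :: fock
  let ?A = "Poly_Mapping.keys x \<union> Poly_Mapping.keys y \<union> Poly_Mapping.keys (x + y)"
  have "lin K (x + y) = (\<Sum>lam\<in>?A. scale (Poly_Mapping.lookup (x + y) lam) (K lam))"
    by (rule lin_superset) auto
  also have "\<dots> = lin K x + lin K y"
    by (subst lin_superset[of ?A x], simp, blast, subst lin_superset[of ?A y], simp, blast)
       (simp add: sum.distrib lookup_add fock.scale_left_distrib)
  finally show "lin K (x + y) = lin K x + lin K y" .
next
  fix c and x :: fock
  have "lin K (scale c x) = (\<Sum>lam\<in>Poly_Mapping.keys x. scale (Poly_Mapping.lookup (scale c x) lam) (K lam))"
    by (rule lin_superset) (auto simp: in_keys_iff lookup_scale)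
  then show "lin K (scale c x) = scale c (lin K x)"
    by (simp add: lin_def lookup_scale fock.scale_sum_right)
qed

lemma lin_basis [simp]: "lin K (basis lam) = K lam"
  by (simp add: lin_def basis_def)

lemma fock_expand: "x = (\<Sum>lam\<in>Poly_Mapping.keys x. scale (Poly_Mapping.lookup x lam) (basis lam))"
  by (rule poly_mapping_eqI)
     (simp add: lookup_sum lookup_scale lookup_basis in_keys_iff if_distrib cong: if_cong)

lemma flinear_ext:
  assumes "flinear T" "flinear T'" "\<And>lam. T (basis lam) = T' (basis lam)"
  shows "T x = T' x"
proof -
  interpret T: module_hom scale scale T by fact
  interpret T': module_hom scale scale T' by fact
  have "T x = (\<Sum>lam\<in>Poly_Mapping.keys x. scale (Poly_Mapping.lookup x lam) (T (basis lam)))"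
    by (subst fock_expand[of x], subst T.sum) (simp add: T.scale)
  moreover have "T' x = (\<Sum>lam\<in>Poly_Mapping.keys x. scale (Poly_Mapping.lookup x lam) (T' (basis lam)))"
    by (subst fock_expand[of x], subst T'.sum) (simp add: T'.scale)
  ultimately show ?thesis using assms(3) by simp
qed

lemma flinear_compose: "flinear S \<Longrightarrow> flinear T \<Longrightarrow> flinear (\<lambda>x. S (T x))"
  using module_hom_compose[of scale scale T scale S] by (simp add: o_def)

lemma lookup_lin:
  "Poly_Mapping.lookup (lin K x) \<nu> =
    (\<Sum>lam\<in>Poly_Mapping.keys x. Poly_Mapping.lookup x lam * Poly_Mapping.lookup (K lam) \<nu>)"
  by (simp add: lin_def lookup_sum lookup_scale)

section \<open>The generators and their divided powers on beads\<close>

text \<open>A node added in row c has content \<open>bead lam c + 1\<close>, so the residue of a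
  step is read off at the place p + 1 where the bead arrives. \<open>Rem\<close> labels a removable
  node by the place p to which its bead would return; its content is again p + 1.\<close>

definition Add :: "nat \<Rightarrow> nat \<Rightarrow> int set \<Rightarrow> int set" where
  "Add e i M = {p \<in> M. p + 1 \<notin> M \<and> (p + 1) mod int e = int i}"

definition Rem :: "nat \<Rightarrow> nat \<Rightarrow> int set \<Rightarrow> int set" where
  "Rem e i M = {p. p \<notin> M \<and> p + 1 \<in> M \<and> (p + 1) mod int e = int i}"

definition mv :: "int set \<Rightarrow> int set \<Rightarrow> int set" where
  "mv M S = (M - S) \<union> (\<lambda>p. p + 1) ` S"

text \<open>Bead sets of arbitrary charge. The class is closed under single moves in both
  directions, so identities can be proved for sets without exhibiting partitions.\<close>

definition mayalike :: "int set \<Rightarrow> bool" where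
  "mayalike M \<longleftrightarrow> (\<exists>a b. {..<a} \<subseteq> M \<and> M \<subseteq> {..<b})"

lemma mayalike_maya [simp]: "mayalike (maya lam)"
  unfolding mayalike_def using maya_low[of lam "plen lam"] maya_le[of _ lam]
  by (intro exI[of _ "- int (plen lam)"] exI[of _ "int (part lam 1)"]) auto

lemma finite_movable: "mayalike M \<Longrightarrow> finite (movable M)"
proof -
  assume "mayalike M"
  then obtain a b where ab: "{..<a} \<subseteq> M" "M \<subseteq> {..<b}" unfolding mayalike_def by blast
  have "movable M \<subseteq> {a - 1..b}"
  proof
    fix p assume "p \<in> movable M"
    then have "p \<in> M" "p + 1 \<notin> M" by (auto simp: movable_def)
    then have "p \<in> {..<b}" "p + 1 \<notin> {..<a}" using ab by auto
    then show "p \<in> {a - 1..b}" by simp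
  qed
  then show "finite (movable M)" by (rule finite_subset) simp
qed

lemma Add_movable: "Add e i M \<subseteq> movable M"
  by (auto simp: Add_def movable_def)

lemma finite_Add [simp]: "mayalike M \<Longrightarrow> finite (Add e i M)"
  by (rule finite_subset[OF Add_movable finite_movable])

lemma finite_Rem [simp]: "mayalike M \<Longrightarrow> finite (Rem e i M)"
proof -
  assume "mayalike M"
  then obtain a b where ab: "{..<a} \<subseteq> M" "M \<subseteq> {..<b}" unfolding mayalike_def by blast
  have "Rem e i M \<subseteq> {a..b}"
  proof
    fix p assume "p \<in> Rem e i M"
    then have "p \<notin> M" "p + 1 \<in> M" by (auto simp: Rem_def)
    then have "p \<notin> {..<a}" "p + 1 \<in> {..<b}" using ab by auto
    then show "p \<in> {a..b}" by simp
  qed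
  then show "finite (Rem e i M)" by (rule finite_subset) simp
qed

lemma maya_move_Add: "S \<subseteq> Add e i (maya lam) \<Longrightarrow> maya (move S lam) = mv (maya lam) S"
  unfolding mv_def using Add_movable by (intro maya_move) blast

text \<open>For e >= 2 neighbouring places have different residues; hence moves of one residue
  neither create nor block each other.\<close>

lemma adjacent_classes:
  assumes "e \<ge> (2::nat)" shows "(p + 1) mod int e = int i \<Longrightarrow> (p::int) mod int e \<noteq> int i"
proof
  assume "(p + 1) mod int e = int i" "p mod int e = int i"
  then have "int e dvd (p + 1) - p" by (metis mod_eq_dvd_iff)
  then show False using assms by (simp add: zdvd1_eq)
qed

lemma mv_mem:
  assumes "e \<ge> 2" "S \<subseteq> Add e i M" "(q + 1) mod int e = int i"
  shows "q \<in> mv M S \<longleftrightarrow> q \<in> M \<and> q \<notin> S" and "q + 1 \<in> mv M S \<longleftrightarrow> q + 1 \<in> M \<or> q \<in> S"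
proof -
  have S: "p \<in> S \<Longrightarrow> (p + 1) mod int e = int i" for p using assms(2) by (auto simp: Add_def)
  have "q - 1 \<notin> S" using S[of "q - 1"] adjacent_classes[OF assms(1,3)] by auto
  then show "q \<in> mv M S \<longleftrightarrow> q \<in> M \<and> q \<notin> S" by (force simp: mv_def)
  have "q + 1 \<notin> S" using S[of "q + 1"] adjacent_classes[OF assms(1), of "q + 1" i] assms(3) by auto
  then show "q + 1 \<in> mv M S \<longleftrightarrow> q + 1 \<in> M \<or> q \<in> S" by (force simp: mv_def)
qed

lemma Add_mv: "e \<ge> 2 \<Longrightarrow> S \<subseteq> Add e i M \<Longrightarrow> Add e i (mv M S) = Add e i M - S"
  using mv_mem[of e S i M] by (auto simp: Add_def)

lemma Rem_mv: "e \<ge> 2 \<Longrightarrow> S \<subseteq> Add e i M \<Longrightarrow> Rem e i (mv M S) = Rem e i M \<union> S"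
  using mv_mem[of e S i M] by (auto simp: Rem_def Add_def)

text \<open>This is \<open>N\<close> read on beads: a higher row has its bead further to the right
  (\<open>N_move\<close>).\<close>

definition wt :: "nat \<Rightarrow> nat \<Rightarrow> int set \<Rightarrow> int \<Rightarrow> int" where
  "wt e i M p = int (card {q \<in> Add e i M. p < q}) - int (card {q \<in> Rem e i M. p < q})"

text \<open>The exponent of v in a divided power: for each moved bead only the addable places that
  stay unmoved count. This is what the exponents of the single steps leave after division by the
  quantum factorial.\<close>

definition dwt :: "nat \<Rightarrow> nat \<Rightarrow> int set \<Rightarrow> int set \<Rightarrow> int" where
  "dwt e i M S = (\<Sum>p\<in>S. int (card {q \<in> Add e i M - S. p < q}) - int (card {q \<in> Rem e i M. p < q}))"

section \<open>Nodes translated into beads\<close>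

lemma diagram_iff: "(c, d) \<in> diagram lam \<longleftrightarrow> 1 \<le> c \<and> 1 \<le> d \<and> d \<le> part lam c"
  by (simp add: diagram_def)

lemma diagram_inject: "diagram lam = diagram \<nu> \<longleftrightarrow> lam = \<nu>"
proof
  assume eq: "diagram lam = diagram \<nu>"
  have *: "1 \<le> d \<and> d \<le> part lam c \<longleftrightarrow> 1 \<le> d \<and> d \<le> part \<nu> c" if "c \<ge> 1" for c d
    using that eq diagram_iff by (metis (no_types))
  show "lam = \<nu>"
  proof (rule partition_eqI)
    fix c :: nat assume c: "c \<ge> 1"
    show "part lam c = part \<nu> c"
      using *[OF c, of "part lam c"] *[OF c, of "part \<nu> c"] by force
  qed
qed simp

lemma part_insert_node:
  assumes "x \<notin> diagram lam" "diagram \<nu> = insert x (diagram lam)"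
  shows "fst x \<ge> 1" "snd x = part lam (fst x) + 1" "part \<nu> (fst x) = part lam (fst x) + 1"
    "\<And>c'. c' \<noteq> fst x \<Longrightarrow> part \<nu> c' = part lam c'"
proof -
  obtain c d where x: "x = (c, d)" by (cases x)
  have *: "1 \<le> c' \<and> 1 \<le> d' \<and> d' \<le> part \<nu> c' \<longleftrightarrow> (c', d') = (c, d) \<or> 1 \<le> c' \<and> 1 \<le> d' \<and> d' \<le> part lam c'" for c' d'
    unfolding diagram_iff[symmetric] assms(2) x by auto
  have cd: "c \<ge> 1" "d \<ge> 1" "d \<le> part \<nu> c" using *[of c d] by auto
  then show "fst x \<ge> 1" by (simp add: x)
  have d: "d > part lam c" using assms(1) cd by (simp add: x diagram_iff)
  have up: "part lam c + 1 \<le> d" using d by simp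
  have nu: "part \<nu> c = d"
    using *[of c "part \<nu> c"] cd d by auto
  have "d = part lam c + 1"
  proof (rule ccontr)
    assume "d \<noteq> part lam c + 1"
    then show False using *[of c "part lam c + 1"] nu cd d by auto
  qed
  with nu show "snd x = part lam (fst x) + 1" "part \<nu> (fst x) = part lam (fst x) + 1" by (simp_all add: x)
  fix c' assume "c' \<noteq> fst x"
  then have c': "c' \<noteq> c" by (simp add: x)
  show "part \<nu> c' = part lam c'"
  proof (cases "c' = 0")
    case False
    have "d' \<ge> 1 \<Longrightarrow> d' \<le> part \<nu> c' \<longleftrightarrow> d' \<le> part lam c'" for d' using *[of c' d'] False c' by auto
    from this[of "part \<nu> c'"] this[of "part lam c'"] show ?thesis by force
  qed simp
qed

lemma bead_pred_eq:
  assumes "c \<ge> 1" "bead lam c + 1 \<in> maya lam"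
  shows "c \<ge> 2 \<and> part lam (c - 1) = part lam c"
proof -
  obtain c' where c': "c' \<ge> 1" "bead lam c' = bead lam c + 1" using assms(2) by (auto elim: mayaE)
  then have "c' < c" using bead_less_iff[OF c'(1) assms(1), of lam] by simp
  then have "c \<ge> 2" "c' \<le> c - 1" using c' by auto
  moreover have "bead lam (c - 1) \<le> bead lam c'"
    using bead_less_iff[of "c - 1" c' lam] c' calculation by (metis diff_is_0_eq not_le not_less_eq_eq le_add_diff_inverse2 add_leE one_add_one)
  ultimately have "bead lam (c - 1) = bead lam c + 1"
    using bead_mono[of "c - 1" c lam] c' by simp
  then show ?thesis using \<open>c \<ge> 2\<close> by (simp add: bead_def of_nat_diff)
qed

lemma diagram_move:
  assumes "c \<ge> 1" "bead lam c + 1 \<notin> maya lam"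
  shows "diagram (move {bead lam c} lam) = insert (c, part lam c + 1) (diagram lam)"
proof -
  have "{bead lam c} \<subseteq> movable (maya lam)" using assms by (auto simp: movable_def)
  from part_move[OF this] show ?thesis
    using assms(1) bead_eq_iff[of _ c lam] by (auto simp: diagram_def split: if_splits)
qed

lemma addable_iff:
  "addable lam x \<longleftrightarrow> fst x \<ge> 1 \<and> snd x = part lam (fst x) + 1 \<and> bead lam (fst x) + 1 \<notin> maya lam"
proof
  assume "addable lam x"
  then obtain \<nu> where nu: "x \<notin> diagram lam" "diagram \<nu> = insert x (diagram lam)"
    by (auto simp: addable_def)
  note p = part_insert_node[OF nu]
  have "bead lam (fst x) + 1 \<notin> maya lam"
  proof
    assume "bead lam (fst x) + 1 \<in> maya lam"
    from bead_pred_eq[OF p(1) this] have *: "fst x \<ge> 2" "part lam (fst x - 1) = part lam (fst x)" by auto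
    then have "part \<nu> (fst x - 1) < part \<nu> (fst x)" using p(3) p(4)[of "fst x - 1"] by simp
    then show False using part_antimono[of "fst x - 1" "fst x" \<nu>] * by (simp add: numeral_2_eq_2 Suc_le_eq)
  qed
  with p show "fst x \<ge> 1 \<and> snd x = part lam (fst x) + 1 \<and> bead lam (fst x) + 1 \<notin> maya lam" by simp
next
  assume a: "fst x \<ge> 1 \<and> snd x = part lam (fst x) + 1 \<and> bead lam (fst x) + 1 \<notin> maya lam"
  then have "diagram (move {bead lam (fst x)} lam) = insert x (diagram lam)"
    using diagram_move[of "fst x" lam] by (cases x) auto
  moreover have "x \<notin> diagram lam" using a by (cases x) (simp add: diagram_iff)
  ultimately show "addable lam x" by (auto simp: addable_def)
qed

lemma removable_iff:
  "removable lam x \<longleftrightarrow> fst x \<ge> 1 \<and> snd x = part lam (fst x) \<and> bead lam (fst x) - 1 \<notin> maya lam"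
proof
  assume "removable lam x"
  then obtain \<nu> where nu: "x \<in> diagram lam" "diagram \<nu> = diagram lam - {x}"
    by (auto simp: removable_def)
  then have i: "x \<notin> diagram \<nu>" "diagram lam = insert x (diagram \<nu>)" by auto
  note p = part_insert_node[OF i]
  have "bead lam (fst x) - 1 \<notin> maya lam"
  proof
    assume *: "bead lam (fst x) - 1 \<in> maya lam"
    then obtain c' where c': "c' \<ge> 1" "bead lam c' = bead lam (fst x) - 1" by (auto elim: mayaE)
    then have "c' > fst x" using bead_less_iff[OF p(1) c'(1), of lam] by simp
    then have "part lam c' \<ge> part lam (fst x)" using c' by (simp add: bead_def)
    then have "part \<nu> c' > part \<nu> (fst x)" using p(3) p(4)[of c'] \<open>c' > fst x\<close> by simp
    then show False using part_antimono[of "fst x" c' \<nu>] p(1) \<open>c' > fst x\<close> by simp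
  qed
  with p show "fst x \<ge> 1 \<and> snd x = part lam (fst x) \<and> bead lam (fst x) - 1 \<notin> maya lam" by simp
next
  assume a: "fst x \<ge> 1 \<and> snd x = part lam (fst x) \<and> bead lam (fst x) - 1 \<notin> maya lam"
  define p where "p = bead lam (fst x) - 1"
  have p: "p \<notin> maya lam" "p + 1 \<in> maya lam" using a by (auto simp: p_def)
  note pu = part_unmove[OF p]
  have [simp]: "bead lam c = p + 1 \<longleftrightarrow> c = fst x" if "c \<ge> 1" for c
    using that a bead_eq_iff[of c "fst x" lam] by (simp add: p_def)
  have ge: "part lam (fst x) \<ge> 1" using pu(2)[of "fst x"] a by simp
  have "(c, d) \<in> diagram (unmove p lam) \<longleftrightarrow> (c, d) \<in> diagram lam - {x}" for c d
    using a ge by (cases x; cases "c = 0") (auto simp: diagram_iff pu(1))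
  then have "diagram (unmove p lam) = diagram lam - {x}" by auto
  moreover have "x \<in> diagram lam" using a ge by (cases x) (simp add: diagram_iff)
  ultimately show "removable lam x" by (auto simp: removable_def)
qed

lemma residue_iff: "e \<ge> 1 \<Longrightarrow> residue e x = i \<longleftrightarrow> (int (snd x) - int (fst x)) mod int e = int i"
  by (auto simp: residue_def nat_eq_iff)

lemma adds_iff:
  assumes "e \<ge> 1"
  shows "adds e i lam \<nu> \<longleftrightarrow> (\<exists>p\<in>Add e i (maya lam). \<nu> = move {p} lam)"
proof
  assume "adds e i lam \<nu>"
  then obtain x where x: "addable lam x" "residue e x = i" "diagram \<nu> = insert x (diagram lam)"
    by (auto simp: adds_def)
  then have a: "fst x \<ge> 1" "snd x = part lam (fst x) + 1" "bead lam (fst x) + 1 \<notin> maya lam"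
    by (auto simp: addable_iff)
  have "\<nu> = move {bead lam (fst x)} lam"
    using diagram_move[OF a(1,3)] x(3) a(2) by (metis diagram_inject prod.collapse)
  moreover have "bead lam (fst x) \<in> Add e i (maya lam)"
    using a x(2) assms bead_in_maya[OF a(1), of lam]
    by (auto simp: Add_def residue_iff bead_def algebra_simps)
  ultimately show "\<exists>p\<in>Add e i (maya lam). \<nu> = move {p} lam" by blast
next
  assume "\<exists>p\<in>Add e i (maya lam). \<nu> = move {p} lam"
  then obtain p where p: "p \<in> Add e i (maya lam)" "\<nu> = move {p} lam" by blast
  then obtain c where c: "c \<ge> 1" "bead lam c = p" by (auto simp: Add_def elim: mayaE)
  let ?x = "(c, part lam c + 1)"
  have "addable lam ?x" "residue e ?x = i"
    using c p assms by (auto simp: addable_iff Add_def residue_iff bead_def algebra_simps)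
  moreover have "diagram \<nu> = insert ?x (diagram lam)"
    using diagram_move[of c lam] c p by (auto simp: Add_def)
  ultimately show "adds e i lam \<nu>" by (auto simp: adds_def)
qed

lemma N_move:
  assumes "e \<ge> 1" "p \<in> Add e i (maya lam)"
  shows "N e i lam (move {p} lam) = wt e i (maya lam) p"
proof -
  obtain c where c: "c \<ge> 1" "bead lam c = p" using assms(2) by (auto simp: Add_def elim: mayaE)
  have "diagram (move {p} lam) - diagram lam = {(c, part lam c + 1)}"
    using diagram_move[of c lam] c assms(2) by (auto simp: Add_def diagram_iff)
  then have x: "the_elem (diagram (move {p} lam) - diagram lam) = (c, part lam c + 1)" by simp
  let ?C = "{c'. 1 \<le> c' \<and> bead lam c' \<in> Add e i (maya lam) \<and> c' < c}"
  have "{y. addable lam y \<and> residue e y = i \<and> above y (c, part lam c + 1)} = (\<lambda>c'. (c', part lam c' + 1)) ` ?C"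
  proof (intro equalityI subsetI)
    fix y assume "y \<in> {y. addable lam y \<and> residue e y = i \<and> above y (c, part lam c + 1)}"
    then show "y \<in> (\<lambda>c'. (c', part lam c' + 1)) ` ?C"
      using assms(1) bead_in_maya[of "fst y" lam]
      by (intro image_eqI[of _ _ "fst y"])
         (auto simp: addable_iff residue_iff Add_def above_def bead_def algebra_simps prod_eq_iff)
  qed (use assms(1) in \<open>auto simp: addable_iff residue_iff Add_def above_def bead_def algebra_simps\<close>)
  moreover have "{q \<in> Add e i (maya lam). p < q} = bead lam ` ?C"
    using bead_less_iff[of _ c lam] c by (force simp: Add_def maya_def)
  moreover have "inj_on (bead lam) ?C" by (rule inj_on_subset[OF inj_on_bead]) auto
  ultimately have 1: "card {y. addable lam y \<and> residue e y = i \<and> above y (c, part lam c + 1)}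
      = card {q \<in> Add e i (maya lam). p < q}"
    by (simp add: card_image inj_on_def)
  let ?D = "{c'. 1 \<le> c' \<and> bead lam c' - 1 \<in> Rem e i (maya lam) \<and> c' < c}"
  have "{y. removable lam y \<and> residue e y = i \<and> above y (c, part lam c + 1)} = (\<lambda>c'. (c', part lam c')) ` ?D"
  proof (intro equalityI subsetI)
    fix y assume "y \<in> {y. removable lam y \<and> residue e y = i \<and> above y (c, part lam c + 1)}"
    then show "y \<in> (\<lambda>c'. (c', part lam c')) ` ?D"
      using assms(1) bead_in_maya[of "fst y" lam]
      by (intro image_eqI[of _ _ "fst y"])
         (auto simp: removable_iff residue_iff Rem_def above_def bead_def algebra_simps prod_eq_iff)
  qed (use assms(1) in \<open>auto simp: removable_iff residue_iff Rem_def above_def bead_def algebra_simps\<close>)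
  moreover have "{q \<in> Rem e i (maya lam). p < q} = (\<lambda>c. bead lam c - 1) ` ?D"
  proof (intro equalityI subsetI)
    fix q assume q: "q \<in> {q \<in> Rem e i (maya lam). p < q}"
    then obtain c' where c': "c' \<ge> 1" "bead lam c' = q + 1" by (auto simp: Rem_def elim: mayaE)
    then have "c' < c" using q c bead_less_iff[of c' c lam] by simp
    then show "q \<in> (\<lambda>c. bead lam c - 1) ` ?D" using c' q by (intro image_eqI[of _ _ c']) auto
  next
    fix q assume "q \<in> (\<lambda>c. bead lam c - 1) ` ?D"
    then obtain c' where c': "1 \<le> c'" "q \<in> Rem e i (maya lam)" "c' < c" "q = bead lam c' - 1" by blast
    then have "p < q + 1" using bead_less_iff[of c' c lam] c by simp
    \<comment> \<open>A higher row only gives p < q + 1; equality of p and q is excluded because p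
      is occupied and q is not.\<close>
    moreover have "p \<noteq> q" using assms(2) c'(2) by (auto simp: Add_def Rem_def)
    ultimately show "q \<in> {q \<in> Rem e i (maya lam). p < q}" using c' by simp
  qed
  moreover have "inj_on (\<lambda>c. bead lam c - 1) ?D" by (auto simp: inj_on_def bead_eq_iff)
  ultimately have 2: "card {y. removable lam y \<and> residue e y = i \<and> above y (c, part lam c + 1)}
      = card {q \<in> Rem e i (maya lam). p < q}"
    by (simp add: card_image inj_on_def)
  show ?thesis unfolding N_def x Let_def wt_def 1 2 ..
qed

lemma move_inject:
  assumes "S \<subseteq> movable (maya lam)" "T \<subseteq> movable (maya lam)" "move S lam = move T lam"
  shows "S = T"
proof -
  have "S = {p \<in> maya lam. p \<notin> maya (move S lam)}" if "S \<subseteq> movable (maya lam)" for S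
    using that by (auto simp: maya_move movable_def)
  then show ?thesis using assms by metis
qed

lemma F_eq_lin:
  assumes "e \<ge> 1"
  shows "F e i = lin (\<lambda>lam. \<Sum>p\<in>Add e i (maya lam). scale (vpow (wt e i (maya lam) p)) (basis (move {p} lam)))"
proof -
  have "(\<Sum>\<nu> | adds e i lam \<nu>. scale (vpow (N e i lam \<nu>)) (basis \<nu>)) =
     (\<Sum>p\<in>Add e i (maya lam). scale (vpow (wt e i (maya lam) p)) (basis (move {p} lam)))" for lam
  proof -
    have "{\<nu>. adds e i lam \<nu>} = (\<lambda>p. move {p} lam) ` Add e i (maya lam)"
      using adds_iff[OF assms] by auto
    moreover have "inj_on (\<lambda>p. move {p} lam) (Add e i (maya lam))"
    proof (rule inj_onI)
      fix p q assume "p \<in> Add e i (maya lam)" "q \<in> Add e i (maya lam)" "move {p} lam = move {q} lam"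
      then show "p = q" using move_inject[of "{p}" lam "{q}"] Add_movable[of e i "maya lam"] by auto
    qed
    ultimately show ?thesis by (simp add: sum.reindex N_move[OF assms])
  qed
  then show ?thesis by (simp add: fun_eq_iff F_def lin_def)
qed

text \<open>The closed formula for a divided power on a basis vector. \<open>Fdiv_eq_lin\<close>
  identifies it with the quotient by which \<open>Fdiv\<close> is defined, and so settles existence
  of that quotient.\<close>

definition Fd :: "nat \<Rightarrow> nat \<Rightarrow> nat \<Rightarrow> partition \<Rightarrow> fock" where
  "Fd e i a lam = (\<Sum>S | S \<subseteq> Add e i (maya lam) \<and> card S = a.
     scale (vpow (dwt e i (maya lam) S)) (basis (move S lam)))"

text \<open>From the largest element of T to the smallest the exponents are n - 1, n - 3, ..., 1 - n
  with n = \<open>card T\<close>, which are those of the quantum integer.\<close>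

lemma sum_vpow_ranks:
  assumes "finite T"
  shows "(\<Sum>p\<in>T. vpow (int (card {q \<in> T. q < p}) - int (card {q \<in> T. p < q}))) = qint (card (T::int set))"
  using assms
proof (induction rule: finite_linorder_max_induct)
  case empty
  then show ?case by (simp add: qint_def)
next
  case (insert M T)
  have M: "M \<notin> T" using insert.hyps by auto
  have a: "card {q \<in> insert M T. q < M} = card T"
  proof -
    have "{q \<in> insert M T. q < M} = T" using insert.hyps by auto
    then show ?thesis by simp
  qed
  have b: "{q \<in> insert M T. M < q} = {}" using insert.hyps by auto
  have c: "{q \<in> insert M T. q < p} = {q \<in> T. q < p}" if "p \<in> T" for p using that insert.hyps by force
  have d: "card {q \<in> insert M T. p < q} = Suc (card {q \<in> T. p < q})" if "p \<in> T" for p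
  proof -
    have "{q \<in> insert M T. p < q} = insert M {q \<in> T. p < q}" using that insert.hyps by auto
    then show ?thesis using M insert.hyps by simp
  qed
  have "(\<Sum>p\<in>insert M T. vpow (int (card {q \<in> insert M T. q < p}) - int (card {q \<in> insert M T. p < q})))
     = vpow (int (card T)) + (\<Sum>p\<in>T. vpow (- 1) * vpow (int (card {q \<in> T. q < p}) - int (card {q \<in> T. p < q})))"
    using insert.hyps M a b c d by (simp add: vpow_mult algebra_simps)
  also have "\<dots> = vpow (int (card T)) + vpow (-1) * qint (card T)"
    using insert.IH by (simp add: sum_distrib_left[symmetric])
  also have "\<dots> = qint (Suc (card T))"
    unfolding qint_def sum.lessThan_Suc_shift sum_distrib_left by (simp add: vpow_mult algebra_simps)
  finally show ?case using M insert.hyps by simp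
qed

text \<open>Moving T at once is compared with moving p last. Beads of T to the right of p have
  meanwhile become removable and lower the exponent of p; beads of T to the left of p still count p
  as unmoved. The discrepancy is the rank of p in T, as in \<open>sum_vpow_ranks\<close>.\<close>

lemma dwt_insert:
  assumes "e \<ge> 2" "mayalike M" "T \<subseteq> Add e i M" "p \<in> T"
  shows "dwt e i M (T - {p}) + wt e i (mv M (T - {p})) p =
    dwt e i M T + (int (card {q \<in> T. q < p}) - int (card {q \<in> T. p < q}))"
proof -
  let ?S = "T - {p}"
  have fin: "finite T" "finite (Add e i M)" "finite (Rem e i M)"
    using assms finite_subset[OF assms(3)] by simp_all
  have S: "?S \<subseteq> Add e i M" using assms by auto
  have disj: "Rem e i M \<inter> Add e i M = {}" by (auto simp: Add_def Rem_def)
  have 1: "int (card {q \<in> Add e i M - ?S. r < q}) = int (card {q \<in> Add e i M - T. r < q}) + (if r < p then 1 else 0)" for r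
  proof -
    have "{q \<in> Add e i M - ?S. r < q} = {q \<in> Add e i M - T. r < q} \<union> (if r < p then {p} else {})"
      using assms by auto
    then show ?thesis using fin assms(4) by (simp add: card_insert_if)
  qed
  have 2: "card {q \<in> Rem e i M \<union> ?S. p < q} = card {q \<in> Rem e i M. p < q} + card {q \<in> T. p < q}"
  proof -
    have "{q \<in> Rem e i M \<union> ?S. p < q} = {q \<in> Rem e i M. p < q} \<union> {q \<in> T. p < q}" by auto
    moreover have "{q \<in> Rem e i M. p < q} \<inter> {q \<in> T. p < q} = {}" using disj assms by auto
    ultimately show ?thesis using fin by (simp add: card_Un_disjoint)
  qed
  have "wt e i (mv M ?S) p = int (card {q \<in> Add e i M - T. p < q}) - int (card {q \<in> Rem e i M. p < q})
      - int (card {q \<in> T. p < q})"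
    unfolding wt_def Add_mv[OF assms(1) S] Rem_mv[OF assms(1) S] 1 2 by simp
  moreover have "dwt e i M ?S = (\<Sum>r\<in>?S. int (card {q \<in> Add e i M - T. r < q}) - int (card {q \<in> Rem e i M. r < q}))
      + (\<Sum>r\<in>?S. if r < p then 1 else 0)"
    unfolding dwt_def 1 sum.distrib[symmetric] by (intro sum.cong) auto
  moreover have "(\<Sum>r\<in>?S. if r < p then 1 else (0::int)) = int (card {q \<in> T. q < p})"
  proof -
    have "(\<Sum>r\<in>?S. if r < p then 1 else (0::int)) = (\<Sum>r\<in>{q \<in> T. q < p}. 1)"
      using fin by (intro sum.mono_neutral_cong_right) auto
    then show ?thesis by simp
  qed
  moreover have "dwt e i M T = (int (card {q \<in> Add e i M - T. p < q}) - int (card {q \<in> Rem e i M. p < q}))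
     + (\<Sum>r\<in>?S. int (card {q \<in> Add e i M - T. r < q}) - int (card {q \<in> Rem e i M. r < q}))"
    unfolding dwt_def using assms fin by (simp add: sum.remove)
  ultimately show ?thesis by simp
qed

lemma move_move:
  assumes "e \<ge> 2" "T \<subseteq> Add e i (maya lam)" "p \<in> T"
  shows "move {p} (move (T - {p}) lam) = move T lam"
proof -
  have 1: "T - {p} \<subseteq> Add e i (maya lam)" using assms by auto
  have 2: "{p} \<subseteq> Add e i (maya (move (T - {p}) lam))"
    unfolding maya_move_Add[OF 1] Add_mv[OF assms(1) 1] using assms by auto
  have np: "p \<noteq> q + 1" if "q \<in> T" for q
    using adjacent_classes[OF assms(1), of p i] assms that by (auto simp: Add_def)
  have "maya (move {p} (move (T - {p}) lam)) = maya (move T lam)"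
    unfolding maya_move_Add[OF 2] maya_move_Add[OF 1] maya_move_Add[OF assms(2)]
    using assms(3) np by (auto simp: mv_def)
  then show ?thesis by (simp add: maya_inject)
qed

text \<open>Every set T of a + 1 beads arises once for each choice of the bead p that moves last,
  and the ranks of these p sum to the quantum integer.\<close>

lemma F_Fd:
  assumes "e \<ge> 2"
  shows "F e i (Fd e i a lam) = scale (qint (Suc a)) (Fd e i (Suc a) lam)"
proof -
  let ?M = "maya lam"
  interpret F: module_hom scale scale "F e i"
    using assms by (simp add: F_eq_lin flinear_lin)
  have finA: "finite (Add e i ?M)" by simp
  have fin: "finite {S. S \<subseteq> Add e i ?M \<and> card S = b}" for b using finA by simp
  have Fb: "F e i (basis \<nu>) = (\<Sum>p\<in>Add e i (maya \<nu>). scale (vpow (wt e i (maya \<nu>) p)) (basis (move {p} \<nu>)))" for \<nu>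
    using assms by (simp add: F_eq_lin)
  have "F e i (Fd e i a lam) = (\<Sum>S | S \<subseteq> Add e i ?M \<and> card S = a.
       \<Sum>p\<in>Add e i ?M - S. scale (vpow (dwt e i ?M S + wt e i (mv ?M S) p)) (basis (move {p} (move S lam))))"
    unfolding Fd_def F.sum F.scale Fb
    by (intro sum.cong refl) (auto simp: fock.scale_sum_right vpow_mult maya_move_Add Add_mv[OF assms])
  also have "\<dots> = (\<Sum>(S, p)\<in>Sigma {S. S \<subseteq> Add e i ?M \<and> card S = a} (\<lambda>S. Add e i ?M - S).
       scale (vpow (dwt e i ?M S + wt e i (mv ?M S) p)) (basis (move {p} (move S lam))))"
    using fin finA by (subst sum.Sigma) auto
  also have "\<dots> = (\<Sum>(T, p)\<in>Sigma {T. T \<subseteq> Add e i ?M \<and> card T = Suc a} (\<lambda>T. T).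
       scale (vpow (dwt e i ?M (T - {p}) + wt e i (mv ?M (T - {p})) p)) (basis (move {p} (move (T - {p}) lam))))"
    by (rule sum.reindex_bij_witness[where j="\<lambda>(S, p). (insert p S, p)" and i="\<lambda>(T, p). (T - {p}, p)"])
       (auto simp: insert_absorb finite_subset[OF _ finA] card_Diff_singleton card_insert_if)
  also have "\<dots> = (\<Sum>(T, p)\<in>Sigma {T. T \<subseteq> Add e i ?M \<and> card T = Suc a} (\<lambda>T. T).
       scale (vpow (int (card {q \<in> T. q < p}) - int (card {q \<in> T. p < q}))) (scale (vpow (dwt e i ?M T)) (basis (move T lam))))"
    by (intro sum.cong refl) (auto simp: dwt_insert[OF assms] move_move[OF assms] vpow_mult algebra_simps)
  also have "\<dots> = (\<Sum>T | T \<subseteq> Add e i ?M \<and> card T = Suc a. \<Sum>p\<in>T.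
       scale (vpow (int (card {q \<in> T. q < p}) - int (card {q \<in> T. p < q}))) (scale (vpow (dwt e i ?M T)) (basis (move T lam))))"
    using fin finite_subset[OF _ finA] by (subst sum.Sigma) auto
  also have "\<dots> = (\<Sum>T | T \<subseteq> Add e i ?M \<and> card T = Suc a.
       scale (qint (Suc a)) (scale (vpow (dwt e i ?M T)) (basis (move T lam))))"
    unfolding fock.scale_sum_left[symmetric]
    using finite_subset[OF _ finA] by (intro sum.cong refl) (auto simp: sum_vpow_ranks)
  finally show ?thesis unfolding Fd_def fock.scale_sum_right .
qed

lemma flinear_F: "e \<ge> 1 \<Longrightarrow> flinear (F e i)"
  by (simp add: F_eq_lin flinear_lin)

lemma flinear_funpow: "flinear T \<Longrightarrow> flinear (T ^^ a)"
proof (induction a)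
  case 0
  show ?case by unfold_locales auto
next
  case (Suc a)
  then show ?case using flinear_compose[of T "T ^^ a"] by (simp add: o_def)
qed

lemma F_funpow_basis:
  assumes "e \<ge> 2"
  shows "(F e i ^^ a) (basis lam) = scale (qfact a) (Fd e i a lam)"
proof (induction a)
  case 0
  have "{S. S \<subseteq> Add e i (maya lam) \<and> card S = 0} = {{}}"
    using finite_subset[of _ "Add e i (maya lam)"] by auto
  moreover have "move {} lam = lam"
    by (rule partition_eqI) (simp add: part_move)
  ultimately show ?case by (simp add: Fd_def dwt_def)
next
  case (Suc a)
  then show ?case
    using module_hom.scale[OF flinear_F[of e i]] assms by (simp add: F_Fd qfact_Suc mult.commute)
qed

lemma Fdiv_char:
  assumes "e \<ge> 2"
  shows "scale (qfact a) (lin (Fd e i a) x) = (F e i ^^ a) x"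
proof (rule flinear_ext[where T="\<lambda>x. scale (qfact a) (lin (Fd e i a) x)" and T'="F e i ^^ a"])
  show "flinear (\<lambda>x. scale (qfact a) (lin (Fd e i a) x))"
    using flinear_compose[OF fock.module_hom_scale_self flinear_lin] .
  show "flinear (F e i ^^ a)" using assms by (intro flinear_funpow flinear_F) auto
qed (use assms in \<open>simp add: F_funpow_basis\<close>)

lemma Fdiv_eq_lin:
  assumes "e \<ge> 2"
  shows "Fdiv e i a = lin (Fd e i a)"
proof
  fix x
  show "Fdiv e i a x = lin (Fd e i a) x"
    unfolding Fdiv_def using Fdiv_char[OF assms, of a i x]
    by (intro the_equality) (auto simp: scale_cancel dest: sym)
qed

lemma Fdiv_basis: "e \<ge> 2 \<Longrightarrow> Fdiv e i a (basis lam) = Fd e i a lam"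
  by (simp add: Fdiv_eq_lin)

lemma flinear_Fdiv: "e \<ge> 2 \<Longrightarrow> flinear (Fdiv e i a)"
  by (simp add: Fdiv_eq_lin flinear_lin)

lemma scale_Fdiv: "e \<ge> 2 \<Longrightarrow> scale (qfact a) (Fdiv e i a x) = (F e i ^^ a) x"
  by (simp add: Fdiv_eq_lin Fdiv_char)

section \<open>The bar involution\<close>

text \<open>The signed number of addable minus removable sites in C. \<open>sg_eq_sum\<close>
  rewrites it as a sum that is linear in the indicator function of M, which makes the effect of a
  move computable without case distinctions on the neighbours.\<close>

definition sg :: "int set \<Rightarrow> int set \<Rightarrow> int" where
  "sg C M = int (card {q \<in> C. q \<in> M \<and> q + 1 \<notin> M}) - int (card {q \<in> C. q \<notin> M \<and> q + 1 \<in> M})"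

lemma sg_eq_sum:
  assumes "{..<a} \<subseteq> M" "M \<subseteq> {..<u}" "a' \<le> a - 1" "u \<le> b'"
  shows "sg C M = (\<Sum>q\<in>C \<inter> {a'..b'}. (if q \<in> M then 1 else 0) - (if q + 1 \<in> M then 1 else 0))"
proof -
  let ?W = "C \<inter> {a'..b'}"
  have out: "a' \<le> q \<and> q \<le> b'" if "q \<in> M \<longleftrightarrow> q + 1 \<notin> M" for q
  proof -
    have "\<not> (q < a')" "\<not> q > b'"
      using that assms subsetD[OF assms(1), of q] subsetD[OF assms(1), of "q + 1"]
        subsetD[OF assms(2), of q] subsetD[OF assms(2), of "q + 1"] by auto
    then show ?thesis by simp
  qed
  have 1: "{q \<in> C. q \<in> M \<and> q + 1 \<notin> M} = {q \<in> ?W. q \<in> M \<and> q + 1 \<notin> M}"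
    and 2: "{q \<in> C. q \<notin> M \<and> q + 1 \<in> M} = {q \<in> ?W. q \<notin> M \<and> q + 1 \<in> M}"
    using out by auto
  have fin: "finite ?W" by simp
  have "(\<Sum>q\<in>?W. (if q \<in> M then 1 else 0) - (if q + 1 \<in> M then 1 else 0)) =
     (\<Sum>q\<in>?W. (if q \<in> M \<and> q + 1 \<notin> M then 1 else 0) - (if q \<notin> M \<and> q + 1 \<in> M then (1::int) else 0))"
    by (intro sum.cong) auto
  also have "\<dots> = int (card {q \<in> ?W. q \<in> M \<and> q + 1 \<notin> M}) - int (card {q \<in> ?W. q \<notin> M \<and> q + 1 \<in> M})"
    unfolding sum_subtractf sum.inter_filter[OF fin, symmetric] by simp
  finally show ?thesis unfolding sg_def 1 2 by simp
qed

lemma mayalike_mv1: "mayalike M \<Longrightarrow> p \<in> M \<Longrightarrow> mayalike (mv M {p})"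
proof -
  assume "mayalike M" "p \<in> M"
  then obtain a b where ab: "{..<a} \<subseteq> M" "M \<subseteq> {..<b}" unfolding mayalike_def by blast
  have "{..<min a p} \<subseteq> mv M {p}" using ab(1) by (auto simp: mv_def)
  moreover have "mv M {p} \<subseteq> {..<max b (p + 2)}" using ab(2) by (auto simp: mv_def)
  ultimately show ?thesis unfolding mayalike_def by blast
qed

text \<open>The difference of the indicator function between q and q + 1 changes by -2 at q = p and
  by 1 at q = p - 1 and q = p + 1: a column of the Cartan matrix of type A, negated.\<close>

lemma sg_mv:
  assumes "mayalike M" "p \<in> M" "p + 1 \<notin> M"
  shows "sg C (mv M {p}) = sg C M + of_bool (p + 1 \<in> C) + of_bool (p - 1 \<in> C) - 2 * of_bool (p \<in> C)"
proof -
  obtain a b where ab: "{..<a} \<subseteq> M" "M \<subseteq> {..<b}" using assms(1) unfolding mayalike_def by blast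
  obtain c d where cd: "{..<c} \<subseteq> mv M {p}" "mv M {p} \<subseteq> {..<d}"
    using mayalike_mv1[OF assms(1,2)] unfolding mayalike_def by blast
  define a' where "a' = min (min a c) p - 2"
  define b' where "b' = max (max b d) p + 2"
  let ?W = "C \<inter> {a'..b'}"
  have "sg C (mv M {p}) - sg C M = (\<Sum>q\<in>?W. ((if q \<in> mv M {p} then 1 else 0) - (if q + 1 \<in> mv M {p} then 1 else 0))
      - ((if q \<in> M then 1 else 0) - (if q + 1 \<in> M then 1 else 0)))"
    using sg_eq_sum[OF ab, of a' b' C] sg_eq_sum[OF cd, of a' b' C]
    by (simp add: a'_def b'_def sum_subtractf)
  also have "\<dots> = (\<Sum>q\<in>?W. (if q = p + 1 then 1 else 0) + (if q = p - 1 then 1 else 0) - 2 * (if q = p then 1 else 0))"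
    using assms(2,3) by (intro sum.cong) (auto simp: mv_def)
  also have "\<dots> = of_bool (p + 1 \<in> C) + of_bool (p - 1 \<in> C) - 2 * of_bool (p \<in> C)"
    by (simp add: sum.distrib sum_subtractf sum_distrib_left[symmetric]) (auto simp: a'_def b'_def)
  finally show ?thesis by simp
qed

definition cls :: "nat \<Rightarrow> nat \<Rightarrow> int set" where
  "cls e i = {q. (q + 1) mod int e = int i}"

lemma wt_eq_sg: "wt e i M p = sg {q \<in> cls e i. p < q} M"
proof -
  have "{q \<in> Add e i M. p < q} = {q \<in> {q \<in> cls e i. p < q}. q \<in> M \<and> q + 1 \<notin> M}"
    "{q \<in> Rem e i M. p < q} = {q \<in> {q \<in> cls e i. p < q}. q \<notin> M \<and> q + 1 \<in> M}"
    by (auto simp: Add_def Rem_def cls_def)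
  then show ?thesis by (simp add: wt_def sg_def)
qed

definition wtb :: "nat \<Rightarrow> nat \<Rightarrow> int set \<Rightarrow> int \<Rightarrow> int" where
  "wtb e i M p = sg {q \<in> cls e i. q < p} M"

definition hwt :: "nat \<Rightarrow> nat \<Rightarrow> int set \<Rightarrow> int" where
  "hwt e i M = sg (cls e i) M"

lemma hwt_eq: "hwt e i M = int (card (Add e i M)) - int (card (Rem e i M))"
proof -
  have "Add e i M = {q \<in> cls e i. q \<in> M \<and> q + 1 \<notin> M}" "Rem e i M = {q \<in> cls e i. q \<notin> M \<and> q + 1 \<in> M}"
    by (auto simp: Add_def Rem_def cls_def)
  then show ?thesis by (simp add: hwt_def sg_def)
qed

lemma wtb_eq: "wtb e i M p = int (card {q \<in> Add e i M. q < p}) - int (card {q \<in> Rem e i M. q < p})"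
proof -
  have "{q \<in> Add e i M. q < p} = {q \<in> {q \<in> cls e i. q < p}. q \<in> M \<and> q + 1 \<notin> M}"
    "{q \<in> Rem e i M. q < p} = {q \<in> {q \<in> cls e i. q < p}. q \<notin> M \<and> q + 1 \<in> M}"
    by (auto simp: Add_def Rem_def cls_def)
  then show ?thesis by (simp add: wtb_def sg_def)
qed

definition qz :: "int \<Rightarrow> laurent" where
  "qz n = (if n \<ge> 0 then qint (nat n) else - qint (nat (- n)))"

lemma laurent_bar_qz [simp]: "laurent_bar (qz n) = qz n"
  by (simp add: qz_def laurent_bar_minus)

lemma qz_mult: "qz n * (vpow 1 - vpow (- 1)) = vpow n - vpow (- n)"
  using qint_mult[of "nat n"] qint_mult[of "nat (- n)"] by (simp add: qz_def)

lemma qz_unique: "x * (vpow 1 - vpow (- 1)) = vpow n - vpow (- n) \<Longrightarrow> x = qz n"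
  using qz_mult[of n] by (metis mult_cancel_right right_minus_eq vpow_inject neg_equal_zero one_neq_zero)

text \<open>Multiplied by v - v^(-1), a summand of sign s becomes v^s - v^(-s) times a power of v.
  Ordered by position these differences are consecutive and telescope from v^total to
  v^(-total).\<close>

lemma telescope_signs:
  fixes s :: "int \<Rightarrow> int"
  assumes "finite T" "\<And>p. p \<in> T \<Longrightarrow> s p = 1 \<or> s p = - 1"
  shows "(\<Sum>p\<in>T. of_int (s p) * vpow (sum s {q \<in> T. p < q} - sum s {q \<in> T. q < p})) = qz (sum s T)"
proof -
  have "(\<Sum>p\<in>T. of_int (s p) * vpow (sum s {q \<in> T. p < q} - sum s {q \<in> T. q < p})) * (vpow 1 - vpow (- 1))
     = vpow (sum s T) - vpow (- sum s T)"
    using assms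
  proof (induction rule: finite_linorder_max_induct)
    case empty
    then show ?case by simp
  next
    case (insert m T)
    have m: "m \<notin> T" using insert.hyps by auto
    have a: "{q \<in> insert m T. m < q} = {}" "{q \<in> insert m T. q < m} = T" using insert.hyps by auto
    have b: "sum s {q \<in> insert m T. p < q} = s m + sum s {q \<in> T. p < q}"
      "{q \<in> insert m T. q < p} = {q \<in> T. q < p}" if "p \<in> T" for p
    proof -
      have "{q \<in> insert m T. p < q} = insert m {q \<in> T. p < q}" using that insert.hyps by auto
      then show "sum s {q \<in> insert m T. p < q} = s m + sum s {q \<in> T. p < q}" using m insert.hyps by simp
      show "{q \<in> insert m T. q < p} = {q \<in> T. q < p}" using that insert.hyps by force
    qed
    have "of_int (s m) * (vpow 1 - vpow (- 1)) = vpow (s m) - vpow (- s m)"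
      using insert.prems[of m] by auto
    then have "vpow k * (of_int (s m) * (vpow 1 - vpow (- 1))) = vpow (k + s m) - vpow (k - s m)" for k
      by (simp add: vpow_mult right_diff_distrib)
    then have c: "of_int (s m) * vpow k * (vpow 1 - vpow (- 1)) = vpow (s m + k) - vpow (- s m + k)" for k
      by (simp add: ac_simps)
    have "(\<Sum>p\<in>T. of_int (s p) * vpow (sum s {q \<in> insert m T. p < q} - sum s {q \<in> insert m T. q < p})) =
      vpow (s m) * (\<Sum>p\<in>T. of_int (s p) * vpow (sum s {q \<in> T. p < q} - sum s {q \<in> T. q < p}))"
      unfolding sum_distrib_left using b
      by (intro sum.cong refl) (simp add: mult.left_commute[of "vpow (s m)"] vpow_mult add_diff_eq)
    then have "(\<Sum>p\<in>T. of_int (s p) * vpow (sum s {q \<in> insert m T. p < q} - sum s {q \<in> insert m T. q < p})) * (vpow 1 - vpow (- 1))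
      = vpow (s m) * (vpow (sum s T) - vpow (- sum s T))"
      using insert.IH insert.prems by (simp add: mult.assoc)
    moreover have "of_int (s m) * vpow (sum s {q \<in> insert m T. m < q} - sum s {q \<in> insert m T. q < m}) =
      of_int (s m) * vpow (- sum s T)" by (simp only: a) simp
    ultimately show ?case
      unfolding sum.insert[OF insert.hyps(1) m] distrib_right
      using c[of "- sum s T"] by (simp only: right_diff_distrib vpow_mult) simp
  qed
  then show ?thesis by (rule qz_unique)
qed

text \<open>Addable places come from \<open>E\<close> after \<open>F\<close>, removable ones from
  \<open>F\<close> after \<open>E\<close>; counted with signs 1 and -1 they form the telescoping
  sum.\<close>

lemma diag_commutator:
  assumes "mayalike M"
  shows "(\<Sum>p\<in>Add e i M. vpow (wt e i M p - wtb e i M p)) - (\<Sum>p\<in>Rem e i M. vpow (wt e i M p - wtb e i M p))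
     = qz (hwt e i M)"
proof -
  let ?A = "Add e i M" and ?R = "Rem e i M"
  let ?T = "?A \<union> ?R"
  define s where "s p = (if p \<in> ?A then 1 else - 1 :: int)" for p
  have fin: "finite ?A" "finite ?R" using assms by auto
  have disj: "?A \<inter> ?R = {}" by (auto simp: Add_def Rem_def)
  have sR: "p \<in> ?R \<Longrightarrow> s p = - 1" and sA: "p \<in> ?A \<Longrightarrow> s p = 1" for p using disj by (auto simp: s_def)
  have *: "sum s {q \<in> ?T. P q} = int (card {q \<in> ?A. P q}) - int (card {q \<in> ?R. P q})" for P
  proof -
    have "{q \<in> ?T. P q} = {q \<in> ?A. P q} \<union> {q \<in> ?R. P q}" by auto
    moreover have "{q \<in> ?A. P q} \<inter> {q \<in> ?R. P q} = {}" using disj by auto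
    ultimately show ?thesis using fin by (simp add: sum.union_disjoint sA sR)
  qed
  have "(\<Sum>p\<in>?T. of_int (s p) * vpow (wt e i M p - wtb e i M p)) = qz (hwt e i M)"
  proof -
    have "s p = 1 \<or> s p = - 1" for p by (simp add: s_def)
    moreover have "sum s ?T = hwt e i M" using *[of "\<lambda>_. True"] unfolding hwt_eq by (simp add: Un_def)
    ultimately show ?thesis
      using telescope_signs[of ?T s] fin unfolding wt_def wtb_eq * by simp
  qed
  moreover have "(\<Sum>p\<in>?T. of_int (s p) * vpow (wt e i M p - wtb e i M p)) =
     (\<Sum>p\<in>?A. vpow (wt e i M p - wtb e i M p)) - (\<Sum>p\<in>?R. vpow (wt e i M p - wtb e i M p))"
    using fin disj by (simp add: sum.union_disjoint sA sR sum_negf)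
  ultimately show ?thesis by simp
qed

definition umv :: "int set \<Rightarrow> int \<Rightarrow> int set" where
  "umv M p = insert p (M - {p + 1})"

lemma maya_unmove_Rem: "p \<in> Rem e i (maya lam) \<Longrightarrow> maya (unmove p lam) = umv (maya lam) p"
  by (auto simp: Rem_def umv_def maya_unmove)

lemma mv_umv: "p \<notin> M \<Longrightarrow> p + 1 \<in> M \<Longrightarrow> mv (umv M p) {p} = M"
  by (auto simp: mv_def umv_def)

lemma mayalike_umv: "mayalike M \<Longrightarrow> mayalike (umv M p)"
proof -
  assume "mayalike M"
  then obtain a b where ab: "{..<a} \<subseteq> M" "M \<subseteq> {..<b}" unfolding mayalike_def by blast
  have "{..<min a p} \<subseteq> umv M p" using ab(1) by (auto simp: umv_def)
  moreover have "umv M p \<subseteq> {..<max b (p + 2)}" using ab(2) by (auto simp: umv_def)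
  ultimately show ?thesis unfolding mayalike_def by blast
qed

text \<open>The raising operator of the Fock space: its exponents look to the left, with the sign
  opposite to that of \<open>F\<close>.\<close>

definition E :: "nat \<Rightarrow> nat \<Rightarrow> fock \<Rightarrow> fock" where
  "E e i = lin (\<lambda>\<nu>. \<Sum>p\<in>Rem e i (maya \<nu>). scale (vpow (- wtb e i (maya \<nu>) p)) (basis (unmove p \<nu>)))"

text \<open>For c = 0 this is (K - K^(-1)) / (v - v^(-1)). The shift c absorbs the change of weight
  when \<open>H\<close> is moved past an \<open>F\<close> (\<open>H_F\<close>).\<close>

definition H :: "nat \<Rightarrow> nat \<Rightarrow> int \<Rightarrow> fock \<Rightarrow> fock" where
  "H e i c = lin (\<lambda>lam. scale (qz (hwt e i (maya lam) + c)) (basis lam))"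

lemma E_basis: "E e i (basis \<nu>) = (\<Sum>p\<in>Rem e i (maya \<nu>). scale (vpow (- wtb e i (maya \<nu>) p)) (basis (unmove p \<nu>)))"
  by (simp add: E_def)

lemma F_basis: "e \<ge> 1 \<Longrightarrow> F e i (basis lam) = (\<Sum>p\<in>Add e i (maya lam). scale (vpow (wt e i (maya lam) p)) (basis (move {p} lam)))"
  by (simp add: F_eq_lin)

lemma flinear_E: "flinear (E e i)" and flinear_H: "flinear (H e i c)"
  by (simp_all add: E_def H_def flinear_lin)

lemma mod_class_shift:
  fixes p q :: int
  shows "(q + 1 + 1) mod int e = (p + 1) mod int e \<longleftrightarrow> (p - 1 + 1) mod int e = (q + 1) mod int e"
  by (metis (no_types, opaque_lifting) add_diff_cancel_right' diff_add_cancel mod_diff_cong mod_add_cong)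

text \<open>The influence of the two moves on each other is symmetric: a neighbour of q counts to
  the right of p exactly when the opposite neighbour of p counts to the left of q, and likewise for
  q and p themselves. Hence both orders of the moves give the same exponent.\<close>

lemma EF_exponents:
  assumes "mayalike M" "p \<in> Add e j M" "q \<in> Rem e i M" "q \<noteq> p + 1" "q \<noteq> p - 1"
  shows "wt e j M p - wtb e i (mv M {p}) q = - wtb e i M q + wt e j (umv M q) p"
proof -
  have q: "q \<in> umv M q" "q + 1 \<notin> umv M q" "mv (umv M q) {q} = M"
    using assms(3) mv_umv[of q M] unfolding Rem_def by (simp_all add: umv_def)
  have "p \<noteq> q" using assms by (auto simp: Add_def Rem_def)
  have i: "int i = (q + 1) mod int e" and j: "int j = (p + 1) mod int e"
    using assms by (auto simp: Add_def Rem_def)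
  have "wt e j M p = wt e j (umv M q) p + of_bool (q + 1 \<in> {t \<in> cls e j. p < t})
      + of_bool (q - 1 \<in> {t \<in> cls e j. p < t}) - 2 * of_bool (q \<in> {t \<in> cls e j. p < t})"
    using sg_mv[OF mayalike_umv[OF assms(1)] q(1,2)] unfolding q(3) wt_eq_sg by simp
  moreover have "wtb e i (mv M {p}) q = wtb e i M q + of_bool (p + 1 \<in> {t \<in> cls e i. t < q})
      + of_bool (p - 1 \<in> {t \<in> cls e i. t < q}) - 2 * of_bool (p \<in> {t \<in> cls e i. t < q})"
    using sg_mv[OF assms(1), of p] assms(2) unfolding wtb_def by (simp add: Add_def)
  moreover have "q + 1 \<in> {t \<in> cls e j. p < t} \<longleftrightarrow> p - 1 \<in> {t \<in> cls e i. t < q}"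
    using mod_class_shift[of q e p] \<open>p \<noteq> q\<close> assms(5) by (auto simp: cls_def i j)
  moreover have "q - 1 \<in> {t \<in> cls e j. p < t} \<longleftrightarrow> p + 1 \<in> {t \<in> cls e i. t < q}"
    using mod_class_shift[of p e q] by (auto simp: cls_def i j)
  moreover have "q \<in> {t \<in> cls e j. p < t} \<longleftrightarrow> p \<in> {t \<in> cls e i. t < q}"
    by (auto simp: cls_def i j)
  ultimately show ?thesis by simp
qed

lemma wt_same:
  assumes "e \<ge> 2" "mayalike M" "p \<in> Add e i M"
  shows "wtb e i (mv M {p}) p = wtb e i M p" "wt e i (mv M {p}) p = wt e i M p"
proof -
  have p: "p \<in> M" "p + 1 \<notin> M" "(p + 1) mod int e = int i" using assms by (auto simp: Add_def)
  have "p + 1 \<notin> cls e i" "p - 1 \<notin> cls e i"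
    using adjacent_classes[OF assms(1) p(3)] adjacent_classes[OF assms(1), of "p + 1" i] p(3)
    by (auto simp: cls_def)
  then show "wtb e i (mv M {p}) p = wtb e i M p" "wt e i (mv M {p}) p = wt e i M p"
    using sg_mv[OF assms(2) p(1,2)] by (auto simp: wtb_def wt_eq_sg)
qed

lemma finite_Add_maya [simp]: "finite (Add e i (maya lam))" and finite_Rem_maya [simp]: "finite (Rem e i (maya lam))"
  by simp_all

lemma unmove_move:
  assumes "p \<in> Add e i (maya lam)" shows "unmove p (move {p} lam) = lam"
proof -
  have "maya (move {p} lam) = mv (maya lam) {p}" using assms by (intro maya_move_Add) auto
  moreover have p: "p \<in> maya lam" "p + 1 \<notin> maya lam" using assms by (auto simp: Add_def)
  ultimately have "maya (unmove p (move {p} lam)) = maya lam"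
    by (subst maya_unmove) (auto simp: mv_def)
  then show ?thesis by (simp add: maya_inject)
qed

lemma move_unmove:
  assumes "p \<in> Rem e i (maya lam)" shows "move {p} (unmove p lam) = lam"
proof -
  have p: "p \<notin> maya lam" "p + 1 \<in> maya lam" using assms by (auto simp: Rem_def)
  have m: "maya (unmove p lam) = umv (maya lam) p" using assms by (rule maya_unmove_Rem)
  have "{p} \<subseteq> movable (maya (unmove p lam))" unfolding m by (auto simp: movable_def umv_def)
  then have "maya (move {p} (unmove p lam)) = maya lam"
    using p by (subst maya_move) (auto simp: m umv_def)
  then show ?thesis by (simp add: maya_inject)
qed

lemma EF_commute:
  assumes e: "e \<ge> 2"
  shows "E e i (F e j x) = F e j (E e i x) + (if i = j then H e i 0 x else 0)"
proof -
  interpret F: module_hom scale scale "F e j" using e by (intro flinear_F) simp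
  interpret E: module_hom scale scale "E e i" by (rule flinear_E)
  interpret H: module_hom scale scale "H e i 0" by (rule flinear_H)
  have L1: "flinear (\<lambda>x. E e i (F e j x))" by (rule flinear_compose[OF flinear_E]) (use e in \<open>simp add: flinear_F\<close>)
  have L2: "flinear (\<lambda>x. F e j (E e i x) + (if i = j then H e i 0 x else 0))"
    by unfold_locales (auto simp: F.add E.add H.add F.scale E.scale fock.scale_right_distrib
        module_hom.add[OF flinear_H] module_hom.scale[OF flinear_H])
  show ?thesis
  proof (rule flinear_ext[OF L1 L2])
    fix lam
    let ?M = "maya lam"
    let ?B = "\<lambda>p q. basis (unmove q (move {p} lam))"
    \<comment> \<open>After the move of p, place p is empty and p + 1 is occupied, so neither p - 1
      nor p + 1 can be a removable site. The same pairs are excluded in the other order.\<close>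
    define P where "P = {(p, q). p \<in> Add e j ?M \<and> q \<in> Rem e i ?M \<and> q \<noteq> p + 1 \<and> q \<noteq> p - 1}"
    have finP: "finite P"
      by (rule finite_subset[of _ "Add e j ?M \<times> Rem e i ?M"]) (auto simp: P_def)
    define D where "D = (if i = j then 1 else 0 :: laurent)"
    have mm: "maya (move {p} lam) = mv ?M {p}" if "p \<in> Add e j ?M" for p
      using that by (intro maya_move_Add) auto
    have R: "Rem e i (mv ?M {p}) = {q. (p, q) \<in> P} \<union> (if i = j then {p} else {})" if "p \<in> Add e j ?M" for p
      using that adjacent_classes[OF e, of p j] by (auto simp: P_def Rem_def Add_def mv_def)
    have A: "Add e j (umv ?M q) = {p. (p, q) \<in> P} \<union> (if i = j then {q} else {})" if "q \<in> Rem e i ?M" for q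
      using that adjacent_classes[OF e, of q i] by (auto simp: P_def Rem_def Add_def umv_def)
    have finq: "finite {q. (p, q) \<in> P}" for p
      by (rule finite_subset[of _ "Rem e i ?M"]) (auto simp: P_def)
    have finp: "finite {q. (q, p) \<in> P}" for p
      by (rule finite_subset[of _ "Add e j ?M"]) (auto simp: P_def)
    have np: "(p, p) \<notin> P" for p by (auto simp: P_def Add_def Rem_def)
    have "E e i (F e j (basis lam)) = (\<Sum>p\<in>Add e j ?M. \<Sum>q\<in>Rem e i (mv ?M {p}).
        scale (vpow (wt e j ?M p - wtb e i (mv ?M {p}) q)) (?B p q))"
      using e by (simp add: F_basis E.sum E.scale E_basis mm fock.scale_sum_right vpow_mult)
    also have "\<dots> = (\<Sum>p\<in>Add e j ?M. (\<Sum>q\<in>{q. (p, q) \<in> P}.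
        scale (vpow (wt e j ?M p - wtb e i (mv ?M {p}) q)) (?B p q)) +
        scale (D * vpow (wt e j ?M p - wtb e i ?M p)) (basis lam))"
    proof (rule sum.cong[OF refl])
      fix p assume p: "p \<in> Add e j ?M"
      show "(\<Sum>q\<in>Rem e i (mv ?M {p}). scale (vpow (wt e j ?M p - wtb e i (mv ?M {p}) q)) (?B p q)) =
        (\<Sum>q\<in>{q. (p, q) \<in> P}. scale (vpow (wt e j ?M p - wtb e i (mv ?M {p}) q)) (?B p q)) +
        scale (D * vpow (wt e j ?M p - wtb e i ?M p)) (basis lam)"
        unfolding R[OF p] using finq[of p] np[of p] p wt_same[OF e _ p] unmove_move[OF p]
        by (simp add: D_def sum.union_disjoint)
    qed
    also have "\<dots> = (\<Sum>p\<in>Add e j ?M. \<Sum>q\<in>{q. (p, q) \<in> P}.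
        scale (vpow (wt e j ?M p - wtb e i (mv ?M {p}) q)) (?B p q)) +
        scale (D * (\<Sum>p\<in>Add e j ?M. vpow (wt e j ?M p - wtb e i ?M p))) (basis lam)"
      by (simp add: sum.distrib fock.scale_sum_left sum_distrib_left)
    also have "(\<Sum>p\<in>Add e j ?M. \<Sum>q\<in>{q. (p, q) \<in> P}.
        scale (vpow (wt e j ?M p - wtb e i (mv ?M {p}) q)) (?B p q)) =
        (\<Sum>(p, q)\<in>P. scale (vpow (wt e j ?M p - wtb e i (mv ?M {p}) q)) (?B p q))"
      using finq by (subst sum.Sigma) (auto simp: P_def intro!: sum.cong)
    finally have 1: "E e i (F e j (basis lam)) = (\<Sum>(p, q)\<in>P. scale (vpow (wt e j ?M p - wtb e i (mv ?M {p}) q)) (?B p q)) +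
        scale (D * (\<Sum>p\<in>Add e j ?M. vpow (wt e j ?M p - wtb e i ?M p))) (basis lam)" .
    let ?C = "\<lambda>p q. basis (move {p} (unmove q lam))"
    have "F e j (E e i (basis lam)) = (\<Sum>q\<in>Rem e i ?M. \<Sum>p\<in>Add e j (umv ?M q).
        scale (vpow (- wtb e i ?M q + wt e j (umv ?M q) p)) (?C p q))"
      using e by (simp add: F_basis F.sum F.scale E_basis maya_unmove_Rem fock.scale_sum_right vpow_mult)
    also have "\<dots> = (\<Sum>q\<in>Rem e i ?M. (\<Sum>p\<in>{p. (p, q) \<in> P}.
        scale (vpow (- wtb e i ?M q + wt e j (umv ?M q) p)) (?C p q)) +
        scale (D * vpow (wt e j ?M q - wtb e i ?M q)) (basis lam))"
    proof (rule sum.cong[OF refl])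
      fix q assume q: "q \<in> Rem e i ?M"
      have w: "wt e i (umv ?M q) q = wt e i ?M q"
      proof -
        have "q \<in> Add e i (umv ?M q)"
          using q by (auto simp: Add_def Rem_def umv_def)
        moreover have "mv (umv ?M q) {q} = ?M"
          using q by (intro mv_umv) (auto simp: Rem_def)
        ultimately show ?thesis using wt_same(2)[OF e, of "umv ?M q" q i] mayalike_umv[of ?M q] by simp
      qed
      show "(\<Sum>p\<in>Add e j (umv ?M q). scale (vpow (- wtb e i ?M q + wt e j (umv ?M q) p)) (?C p q)) =
        (\<Sum>p\<in>{p. (p, q) \<in> P}. scale (vpow (- wtb e i ?M q + wt e j (umv ?M q) p)) (?C p q)) +
        scale (D * vpow (wt e j ?M q - wtb e i ?M q)) (basis lam)"
        unfolding A[OF q] using finp[of q] np[of q] w move_unmove[OF q]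
        by (cases "i = j") (simp_all add: D_def sum.union_disjoint)
    qed
    also have "\<dots> = (\<Sum>q\<in>Rem e i ?M. \<Sum>p\<in>{p. (p, q) \<in> P}.
        scale (vpow (- wtb e i ?M q + wt e j (umv ?M q) p)) (?C p q)) +
        scale (D * (\<Sum>p\<in>Rem e i ?M. vpow (wt e j ?M p - wtb e i ?M p))) (basis lam)"
      by (simp add: sum.distrib fock.scale_sum_left sum_distrib_left)
    also have "(\<Sum>q\<in>Rem e i ?M. \<Sum>p\<in>{p. (p, q) \<in> P}.
        scale (vpow (- wtb e i ?M q + wt e j (umv ?M q) p)) (?C p q)) =
        (\<Sum>(p, q)\<in>P. scale (vpow (- wtb e i ?M q + wt e j (umv ?M q) p)) (?C p q))"
      using finp
      by (subst sum.Sigma, simp, simp)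
         (rule sum.reindex_bij_witness[where i="\<lambda>(p, q). (q, p)" and j="\<lambda>(q, p). (p, q)"], auto simp: P_def)
    finally have 2: "F e j (E e i (basis lam)) = (\<Sum>(p, q)\<in>P. scale (vpow (- wtb e i ?M q + wt e j (umv ?M q) p)) (?C p q)) +
        scale (D * (\<Sum>p\<in>Rem e i ?M. vpow (wt e j ?M p - wtb e i ?M p))) (basis lam)" .
    have 3: "(\<Sum>(p, q)\<in>P. scale (vpow (wt e j ?M p - wtb e i (mv ?M {p}) q)) (?B p q)) =
      (\<Sum>(p, q)\<in>P. scale (vpow (- wtb e i ?M q + wt e j (umv ?M q) p)) (?C p q))"
    proof (intro sum.cong refl, clarify)
      fix p q assume pq: "(p, q) \<in> P"
      then have p: "p \<in> Add e j ?M" and q: "q \<in> Rem e i ?M" and ne: "q \<noteq> p + 1" "q \<noteq> p - 1" by (auto simp: P_def)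
      have "maya (unmove q (move {p} lam)) = umv (mv ?M {p}) q"
        using pq R[OF p] by (subst maya_unmove_Rem[of q e i]) (auto simp: mm[OF p])
      also have "\<dots> = mv (umv ?M q) {p}"
        using p q ne by (auto simp: umv_def mv_def Add_def Rem_def)
      also have "\<dots> = maya (move {p} (unmove q lam))"
        using pq A[OF q] by (subst maya_move_Add[of "{p}" e j]) (auto simp: maya_unmove_Rem[OF q])
      finally have "unmove q (move {p} lam) = move {p} (unmove q lam)" by (simp add: maya_inject)
      then show "scale (vpow (wt e j ?M p - wtb e i (mv ?M {p}) q)) (?B p q) =
        scale (vpow (- wtb e i ?M q + wt e j (umv ?M q) p)) (?C p q)"
        using EF_exponents[OF _ p q ne] by simp
    qed
    have 4: "scale (D * (\<Sum>p\<in>Add e j ?M. vpow (wt e j ?M p - wtb e i ?M p))) (basis lam) =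
       scale (D * (\<Sum>p\<in>Rem e i ?M. vpow (wt e j ?M p - wtb e i ?M p))) (basis lam) + (if i = j then H e i 0 (basis lam) else 0)"
    proof (cases "i = j")
      case True
      have "(\<Sum>p\<in>Add e j ?M. vpow (wt e j ?M p - wtb e j ?M p)) =
          (\<Sum>p\<in>Rem e j ?M. vpow (wt e j ?M p - wtb e j ?M p)) + qz (hwt e j ?M)"
        using diag_commutator[of ?M e j] by (simp add: diff_eq_eq)
      with True show ?thesis by (simp add: D_def H_def fock.scale_left_distrib)
    qed (simp add: D_def)
    show "E e i (F e j (basis lam)) = F e j (E e i (basis lam)) + (if i = j then H e i 0 (basis lam) else 0)"
      unfolding 1 2 3 4 by (simp add: add.assoc)
  qed
qed

section \<open>The form with orthonormal partitions and the joint kernel of the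
  \<open>E\<close>\<close>

definition pair :: "fock \<Rightarrow> fock \<Rightarrow> laurent" where
  "pair x y = (\<Sum>\<nu>\<in>Poly_Mapping.keys y. Poly_Mapping.lookup x \<nu> * Poly_Mapping.lookup y \<nu>)"

lemma pair_superset:
  "finite A \<Longrightarrow> Poly_Mapping.keys y \<subseteq> A \<Longrightarrow>
    pair x y = (\<Sum>\<nu>\<in>A. Poly_Mapping.lookup x \<nu> * Poly_Mapping.lookup y \<nu>)"
  unfolding pair_def by (intro sum.mono_neutral_left) (auto simp: in_keys_iff)

lemma pair_add: "pair x (y + z) = pair x y + pair x z"
proof -
  let ?A = "Poly_Mapping.keys y \<union> Poly_Mapping.keys z \<union> Poly_Mapping.keys (y + z)"
  have "pair x (y + z) = (\<Sum>\<nu>\<in>?A. Poly_Mapping.lookup x \<nu> * Poly_Mapping.lookup (y + z) \<nu>)"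
    "pair x y = (\<Sum>\<nu>\<in>?A. Poly_Mapping.lookup x \<nu> * Poly_Mapping.lookup y \<nu>)"
    "pair x z = (\<Sum>\<nu>\<in>?A. Poly_Mapping.lookup x \<nu> * Poly_Mapping.lookup z \<nu>)"
    by (rule pair_superset; force)+
  then show ?thesis by (simp add: lookup_add distrib_left sum.distrib)
qed

lemma pair_scale: "pair x (scale c y) = c * pair x y"
proof -
  have "pair x (scale c y) = (\<Sum>\<nu>\<in>Poly_Mapping.keys y. Poly_Mapping.lookup x \<nu> * Poly_Mapping.lookup (scale c y) \<nu>)"
    by (rule pair_superset) (auto simp: in_keys_iff lookup_scale)
  then show ?thesis by (simp add: pair_def lookup_scale sum_distrib_left mult.left_commute)
qed

lemma pair_0 [simp]: "pair x 0 = 0"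
  by (simp add: pair_def)

lemma pair_sum: "pair x (sum f A) = (\<Sum>a\<in>A. pair x (f a))"
  by (induction A rule: infinite_finite_induct) (auto simp: pair_add)

lemma pair_basis: "pair x (basis lam) = Poly_Mapping.lookup x lam"
  by (simp add: pair_def basis_def)

lemma lookup_E: "Poly_Mapping.lookup (E e i x) lam =
    (\<Sum>p\<in>Add e i (maya lam). vpow (- wtb e i (mv (maya lam) {p}) p) * Poly_Mapping.lookup x (move {p} lam))"
proof -
  have "Poly_Mapping.lookup (\<Sum>p\<in>Rem e i (maya \<nu>). scale (vpow (- wtb e i (maya \<nu>) p)) (basis (unmove p \<nu>))) lam =
     (\<Sum>p\<in>Add e i (maya lam). if move {p} lam = \<nu> then vpow (- wtb e i (mv (maya lam) {p}) p) else 0)" for \<nu>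
  proof -
    have "Poly_Mapping.lookup (\<Sum>p\<in>Rem e i (maya \<nu>). scale (vpow (- wtb e i (maya \<nu>) p)) (basis (unmove p \<nu>))) lam =
      (\<Sum>p\<in>Rem e i (maya \<nu>). if unmove p \<nu> = lam then vpow (- wtb e i (maya \<nu>) p) else 0)"
      unfolding lookup_sum lookup_scale lookup_basis by (intro sum.cong) auto
    also have "\<dots> = (\<Sum>p\<in>{p \<in> Rem e i (maya \<nu>). unmove p \<nu> = lam}. vpow (- wtb e i (maya \<nu>) p))"
      by (rule sum.inter_filter[symmetric]) simp
    also have "{p \<in> Rem e i (maya \<nu>). unmove p \<nu> = lam} = {p \<in> Add e i (maya lam). move {p} lam = \<nu>}"
    proof (intro equalityI subsetI)
      fix p assume p: "p \<in> {p \<in> Rem e i (maya \<nu>). unmove p \<nu> = lam}"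
      then have "maya lam = umv (maya \<nu>) p" using maya_unmove_Rem[of p e i \<nu>] by auto
      then have "p \<in> Add e i (maya lam)" using p by (auto simp: Rem_def Add_def umv_def)
      moreover have "move {p} lam = \<nu>" using p move_unmove[of p e i \<nu>] by auto
      ultimately show "p \<in> {p \<in> Add e i (maya lam). move {p} lam = \<nu>}" by simp
    next
      fix p assume p: "p \<in> {p \<in> Add e i (maya lam). move {p} lam = \<nu>}"
      then have "maya \<nu> = mv (maya lam) {p}" using maya_move_Add[of "{p}" e i lam] by auto
      then have "p \<in> Rem e i (maya \<nu>)" using p by (auto simp: Rem_def Add_def mv_def)
      moreover have "unmove p \<nu> = lam" using p unmove_move[of p e i lam] by auto
      ultimately show "p \<in> {p \<in> Rem e i (maya \<nu>). unmove p \<nu> = lam}" by simp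
    qed
    also have "(\<Sum>p\<in>{p \<in> Add e i (maya lam). move {p} lam = \<nu>}. vpow (- wtb e i (maya \<nu>) p)) =
       (\<Sum>p\<in>{p \<in> Add e i (maya lam). move {p} lam = \<nu>}. vpow (- wtb e i (mv (maya lam) {p}) p))"
      using maya_move_Add[of "{_}" e i lam] by (intro sum.cong refl) auto
    also have "\<dots> = (\<Sum>p\<in>Add e i (maya lam). if move {p} lam = \<nu> then vpow (- wtb e i (mv (maya lam) {p}) p) else 0)"
      by (rule sum.inter_filter) simp
    finally show ?thesis .
  qed
  then have "Poly_Mapping.lookup (E e i x) lam =
     (\<Sum>\<nu>\<in>Poly_Mapping.keys x. \<Sum>p\<in>Add e i (maya lam). Poly_Mapping.lookup x \<nu> *
       (if move {p} lam = \<nu> then vpow (- wtb e i (mv (maya lam) {p}) p) else 0))"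
    by (simp add: E_def lookup_lin sum_distrib_left)
  also have "\<dots> = (\<Sum>p\<in>Add e i (maya lam). \<Sum>\<nu>\<in>Poly_Mapping.keys x.
       (if \<nu> = move {p} lam then vpow (- wtb e i (mv (maya lam) {p}) p) * Poly_Mapping.lookup x (move {p} lam) else 0))"
    by (subst sum.swap) (intro sum.cong refl, auto)
  also have "\<dots> = (\<Sum>p\<in>Add e i (maya lam). vpow (- wtb e i (mv (maya lam) {p}) p) * Poly_Mapping.lookup x (move {p} lam))"
    by (intro sum.cong refl) (auto simp: in_keys_iff)
  finally show ?thesis .
qed

lemma wt_plus_wtb:
  assumes "mayalike M" "p \<in> Add e i M"
  shows "wt e i M p = hwt e i M - 1 - wtb e i M p"
proof -
  have "Add e i M = insert p ({q \<in> Add e i M. q < p} \<union> {q \<in> Add e i M. p < q})" using assms(2) by auto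
  moreover have "card \<dots> = Suc (card {q \<in> Add e i M. q < p} + card {q \<in> Add e i M. p < q})"
    using assms(1) by (subst card_insert_disjoint, simp, simp, subst card_Un_disjoint) auto
  ultimately have 1: "card (Add e i M) = Suc (card {q \<in> Add e i M. q < p} + card {q \<in> Add e i M. p < q})" by simp
  have "p \<notin> Rem e i M" using assms(2) by (auto simp: Add_def Rem_def)
  then have "Rem e i M = {q \<in> Rem e i M. q < p} \<union> {q \<in> Rem e i M. p < q}"
    by (auto simp: neq_iff) (metis linorder_neqE)
  moreover have "card \<dots> = card {q \<in> Rem e i M. q < p} + card {q \<in> Rem e i M. p < q}"
    using assms(1) by (intro card_Un_disjoint) auto
  ultimately have 2: "card (Rem e i M) = card {q \<in> Rem e i M. q < p} + card {q \<in> Rem e i M. p < q}" by simp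
  show ?thesis using 1 2 by (simp add: wt_def wtb_eq hwt_eq)
qed

text \<open>Coefficientwise, \<open>E\<^sub>i\<close> is the transpose of \<open>F\<^sub>i\<close> up to an invertible factor.\<close>

lemma pair_F_basis:
  assumes "e \<ge> 2"
  shows "pair x (F e i (basis lam)) = vpow (hwt e i (maya lam) - 1) * Poly_Mapping.lookup (E e i x) lam"
proof -
  have "pair x (F e i (basis lam)) = (\<Sum>p\<in>Add e i (maya lam). vpow (wt e i (maya lam) p) * Poly_Mapping.lookup x (move {p} lam))"
    using assms by (simp add: F_basis pair_sum pair_scale pair_basis)
  also have "\<dots> = (\<Sum>p\<in>Add e i (maya lam). vpow (hwt e i (maya lam) - 1) *
      (vpow (- wtb e i (mv (maya lam) {p}) p) * Poly_Mapping.lookup x (move {p} lam)))"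
    using assms by (intro sum.cong refl) (simp add: wt_plus_wtb wt_same mult.assoc[symmetric] vpow_mult)
  finally show ?thesis by (simp add: lookup_E sum_distrib_left)
qed

lemma pair_F_zero:
  assumes "e \<ge> 2" "E e i x = 0"
  shows "pair x (F e i y) = 0"
proof -
  interpret F: module_hom scale scale "F e i" using assms(1) by (intro flinear_F) simp
  have "pair x (F e i y) = (\<Sum>lam\<in>Poly_Mapping.keys y. Poly_Mapping.lookup y lam * pair x (F e i (basis lam)))"
    by (subst fock_expand[of y]) (simp add: F.sum F.scale pair_sum pair_scale)
  then show ?thesis using assms by (simp add: pair_F_basis)
qed

text \<open>Only the \<open>F\<close> are used, no divided powers: orthogonality to the image of an
  \<open>F\<close> follows from the kernel of the corresponding \<open>E\<close> directly
  (\<open>pair_F_zero\<close>).\<close>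

inductive Lgen :: "nat \<Rightarrow> fock \<Rightarrow> bool" for e where
  empty: "Lgen e (basis empty_partition)"
| add: "Lgen e x \<Longrightarrow> Lgen e y \<Longrightarrow> Lgen e (x + y)"
| scale: "Lgen e x \<Longrightarrow> Lgen e (scale c x)"
| F: "Lgen e x \<Longrightarrow> i < e \<Longrightarrow> Lgen e (F e i x)"

text \<open>Over the complex numbers the bilinear form \<open>pair\<close> has isotropic vectors;
  conjugating coefficients in one argument while fixing v removes them.\<close>

definition lcnj :: "laurent \<Rightarrow> laurent" where
  "lcnj p = Poly_Mapping.map cnj p"

definition fcnj :: "fock \<Rightarrow> fock" where
  "fcnj x = Poly_Mapping.map lcnj x"

lemma lookup_lcnj: "Poly_Mapping.lookup (lcnj p) n = cnj (Poly_Mapping.lookup p n)"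
  by (simp add: lcnj_def map.rep_eq when_def)

lemma lcnj_0 [simp]: "lcnj 0 = 0"
  by (rule poly_mapping_eqI) (simp add: lookup_lcnj)

lemma lookup_fcnj: "Poly_Mapping.lookup (fcnj x) lam = lcnj (Poly_Mapping.lookup x lam)"
  by (simp add: fcnj_def map.rep_eq when_def)

lemma lcnj_sum: "lcnj (sum f A) = (\<Sum>x\<in>A. lcnj (f x))"
  by (rule poly_mapping_eqI) (simp add: lookup_lcnj lookup_sum)

lemma lcnj_add: "lcnj (p + q) = lcnj p + lcnj q"
  by (rule poly_mapping_eqI) (simp add: lookup_lcnj lookup_add)

lemma lcnj_single: "lcnj (Poly_Mapping.single n c) = Poly_Mapping.single n (cnj c)"
  by (rule poly_mapping_eqI) (simp add: lookup_lcnj lookup_single when_def)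

lemma lcnj_mult: "lcnj (p * q) = lcnj p * lcnj q"
proof -
  let ?s = "\<lambda>p::laurent. \<lambda>n. Poly_Mapping.single n (Poly_Mapping.lookup p n)"
  have "lcnj (p * q) = lcnj ((\<Sum>n\<in>Poly_Mapping.keys p. ?s p n) * (\<Sum>n\<in>Poly_Mapping.keys q. ?s q n))"
    using laurent_expand[of p] laurent_expand[of q] by simp
  also have "\<dots> = lcnj (\<Sum>n\<in>Poly_Mapping.keys p. ?s p n) * lcnj (\<Sum>n\<in>Poly_Mapping.keys q. ?s q n)"
    by (simp add: sum_product lcnj_sum lcnj_single mult_single)
  finally show ?thesis using laurent_expand[of p] laurent_expand[of q] by simp
qed

lemma lcnj_vpow [simp]: "lcnj (vpow n) = vpow n"
  by (simp add: vpow_def lcnj_single)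

lemma fcnj_add: "fcnj (x + y) = fcnj x + fcnj y"
  by (rule poly_mapping_eqI) (simp add: lookup_fcnj lookup_add lcnj_add)

lemma fcnj_0 [simp]: "fcnj 0 = 0"
  by (rule poly_mapping_eqI) (simp add: lookup_fcnj)

lemma fcnj_sum: "fcnj (sum f A) = (\<Sum>a\<in>A. fcnj (f a))"
  by (induction A rule: infinite_finite_induct) (auto simp: fcnj_add)

lemma fcnj_scale: "fcnj (scale c x) = scale (lcnj c) (fcnj x)"
  by (rule poly_mapping_eqI) (simp add: lookup_fcnj lookup_scale lcnj_mult)

lemma fcnj_basis [simp]: "fcnj (basis lam) = basis lam"
proof -
  have "lcnj 1 = 1" using lcnj_vpow[of 0] by simp
  then show ?thesis by (intro poly_mapping_eqI) (simp add: lookup_fcnj lookup_basis)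
qed

lemma fcnj_F: assumes "e \<ge> 1" shows "fcnj (F e i x) = F e i (fcnj x)"
proof -
  interpret F: module_hom scale scale "F e i" using assms by (rule flinear_F)
  have b: "fcnj (F e i (basis lam)) = F e i (basis lam)" for lam
    using assms by (simp add: F_basis fcnj_sum fcnj_scale)
  have "fcnj (F e i x) = (\<Sum>lam\<in>Poly_Mapping.keys x. scale (lcnj (Poly_Mapping.lookup x lam)) (F e i (basis lam)))"
    by (subst fock_expand[of x]) (simp add: F.sum F.scale fcnj_sum fcnj_scale b)
  also have "\<dots> = F e i (fcnj (\<Sum>lam\<in>Poly_Mapping.keys x. scale (Poly_Mapping.lookup x lam) (basis lam)))"
    by (simp add: F.sum F.scale fcnj_sum fcnj_scale)
  finally show ?thesis using fock_expand[of x] by simp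
qed

lemma Lgen_fcnj: "e \<ge> 1 \<Longrightarrow> Lgen e x \<Longrightarrow> Lgen e (fcnj x)"
  by (rotate_tac 1, induction rule: Lgen.induct) (auto simp: fcnj_add fcnj_scale fcnj_F intro: Lgen.intros)

lemma lookup_mult_lowest:
  fixes p q :: laurent
  assumes "\<And>n. n < d \<Longrightarrow> Poly_Mapping.lookup p n = 0" "\<And>n. n < d \<Longrightarrow> Poly_Mapping.lookup q n = 0"
  shows "Poly_Mapping.lookup (p * q) (2 * d) = Poly_Mapping.lookup p d * Poly_Mapping.lookup q d"
proof -
  let ?P = "Poly_Mapping.keys p" and ?Q = "Poly_Mapping.keys q"
  have ge: "n \<ge> d" if "n \<in> ?P \<or> n \<in> ?Q" for n
    using that assms by (metis in_keys_iff not_le)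
  have "(\<Sum>n\<in>?P. Poly_Mapping.single n (Poly_Mapping.lookup p n)) * (\<Sum>n\<in>?Q. Poly_Mapping.single n (Poly_Mapping.lookup q n))
     = (\<Sum>n\<in>?P. \<Sum>m\<in>?Q. Poly_Mapping.single (n + m) (Poly_Mapping.lookup p n * Poly_Mapping.lookup q m))"
    by (simp add: sum_product mult_single)
  then have "p * q = (\<Sum>n\<in>?P. \<Sum>m\<in>?Q. Poly_Mapping.single (n + m) (Poly_Mapping.lookup p n * Poly_Mapping.lookup q m))"
    using laurent_expand[of p] laurent_expand[of q] by simp
  then have "Poly_Mapping.lookup (p * q) (2 * d) =
     (\<Sum>n\<in>?P. \<Sum>m\<in>?Q. if n + m = 2 * d then Poly_Mapping.lookup p n * Poly_Mapping.lookup q m else 0)"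
    by (simp add: lookup_sum lookup_single when_def)
  also have "\<dots> = (\<Sum>n\<in>?P. \<Sum>m\<in>?Q. if m = d then (if n = d then Poly_Mapping.lookup p n * Poly_Mapping.lookup q m else 0) else 0)"
  proof (intro sum.cong refl)
    fix n m assume "n \<in> ?P" "m \<in> ?Q"
    then have "n \<ge> d" "m \<ge> d" using ge by auto
    then show "(if n + m = 2 * d then Poly_Mapping.lookup p n * Poly_Mapping.lookup q m else 0) =
      (if m = d then (if n = d then Poly_Mapping.lookup p n * Poly_Mapping.lookup q m else 0) else 0)" by auto
  qed
  also have "\<dots> = Poly_Mapping.lookup p d * Poly_Mapping.lookup q d"
    by (cases "Poly_Mapping.lookup q d = 0") (auto simp: in_keys_iff)
  finally show ?thesis .
qed

text \<open>Let d be the lowest power of v in any coefficient of x. The coefficient of v^(2d) in the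
  form is the sum of the squared moduli of the coefficients of v^d, hence positive.\<close>

lemma pair_fcnj_zero:
  assumes "pair x (fcnj x) = 0" shows "x = 0"
proof (rule ccontr)
  assume "x \<noteq> 0"
  define K where "K = (\<Union>lam\<in>Poly_Mapping.keys x. Poly_Mapping.keys (Poly_Mapping.lookup x lam))"
  have finK: "finite K" by (simp add: K_def)
  have inK: "n \<in> K" if "Poly_Mapping.lookup (Poly_Mapping.lookup x lam) n \<noteq> 0" for n lam
    unfolding K_def using that by (intro UN_I[of lam]) (auto simp: in_keys_iff)
  obtain lam where "Poly_Mapping.lookup x lam \<noteq> 0" using \<open>x \<noteq> 0\<close> by (metis poly_mapping_eqI lookup_zero)
  then obtain n where "Poly_Mapping.lookup (Poly_Mapping.lookup x lam) n \<noteq> 0"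
    by (metis poly_mapping_eqI lookup_zero)
  then have "K \<noteq> {}" using inK by auto
  define d where "d = Min K"
  have d: "d \<in> K" using finK \<open>K \<noteq> {}\<close> by (simp add: d_def)
  have low: "Poly_Mapping.lookup (Poly_Mapping.lookup x lam) n = 0" if "n < d" for n lam
    using inK[of lam n] Min_le[OF finK, of n] that by (force simp: d_def)
  have "keys_sub": "Poly_Mapping.keys (fcnj x) \<subseteq> Poly_Mapping.keys x"
    by (auto simp: in_keys_iff lookup_fcnj)
  have "0 = Poly_Mapping.lookup (pair x (fcnj x)) (2 * d)" using assms by simp
  also have "\<dots> = (\<Sum>\<nu>\<in>Poly_Mapping.keys x. Poly_Mapping.lookup (Poly_Mapping.lookup x \<nu> * lcnj (Poly_Mapping.lookup x \<nu>)) (2 * d))"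
    by (subst pair_superset[OF _ keys_sub]) (simp_all add: lookup_sum lookup_fcnj)
  also have "\<dots> = (\<Sum>\<nu>\<in>Poly_Mapping.keys x. of_real ((norm (Poly_Mapping.lookup (Poly_Mapping.lookup x \<nu>) d))\<^sup>2))"
    using low by (intro sum.cong refl) (simp add: lookup_mult_lowest lookup_lcnj complex_norm_square del: of_real_power)
  finally have "complex_of_real (\<Sum>\<nu>\<in>Poly_Mapping.keys x. (norm (Poly_Mapping.lookup (Poly_Mapping.lookup x \<nu>) d))\<^sup>2) = 0"
    by (simp only: of_real_sum)
  then have "(\<Sum>\<nu>\<in>Poly_Mapping.keys x. (norm (Poly_Mapping.lookup (Poly_Mapping.lookup x \<nu>) d))\<^sup>2) = 0"
    by (simp only: of_real_eq_0_iff)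
  then have "Poly_Mapping.lookup (Poly_Mapping.lookup x \<nu>) d = 0" if "\<nu> \<in> Poly_Mapping.keys x" for \<nu>
    using that by (subst (asm) sum_nonneg_eq_0_iff) auto
  with d show False by (auto simp: K_def in_keys_iff)
qed

text \<open>Such an x is orthogonal to the vacuum and to every image of an \<open>F\<close>, hence
  to all of \<open>Lgen e\<close> and in particular to its own conjugate.\<close>

lemma Lgen_zero:
  assumes "e \<ge> 2" "Lgen e x" "\<And>i. i < e \<Longrightarrow> E e i x = 0" "Poly_Mapping.lookup x empty_partition = 0"
  shows "x = 0"
proof -
  have "pair x y = 0" if "Lgen e y" for y
    using that by (induction rule: Lgen.induct) (use assms in \<open>auto simp: pair_basis pair_add pair_scale pair_F_zero\<close>)
  then show ?thesis using assms(1,2) by (intro pair_fcnj_zero) (simp add: Lgen_fcnj)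
qed

text \<open>
  A candidate graph of the bar involution, filtered by degree. The operators \<open>E\<^sub>i\<close> respect it and
  lower the degree, and only \<open>0\<close> is killed by all of them; this makes it single-valued.
\<close>

inductive bar_pair :: "nat \<Rightarrow> nat \<Rightarrow> fock \<Rightarrow> fock \<Rightarrow> bool" for e where
  empty: "bar_pair e 0 (basis empty_partition) (basis empty_partition)"
| add: "bar_pair e n x y \<Longrightarrow> bar_pair e n x' y' \<Longrightarrow> bar_pair e n (x + x') (y + y')"
| scale: "bar_pair e n x y \<Longrightarrow> bar_pair e n (scale c x) (scale (laurent_bar c) y)"
| F: "bar_pair e n x y \<Longrightarrow> i < e \<Longrightarrow> bar_pair e (Suc n) (F e i x) (F e i y)"
| Suc: "bar_pair e n x y \<Longrightarrow> bar_pair e (Suc n) x y"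

lemma bar_pair_mono: "bar_pair e n x y \<Longrightarrow> n \<le> m \<Longrightarrow> bar_pair e m x y"
  by (rotate_tac 1, induction rule: dec_induct) (auto intro: bar_pair.Suc)

lemma bar_pair_zero: "bar_pair e n 0 0"
  using bar_pair.scale[OF bar_pair_mono[OF bar_pair.empty, of n e], of 0] by simp

lemma bar_pair_Lgen: "bar_pair e n x y \<Longrightarrow> Lgen e y"
  by (induction rule: bar_pair.induct) (auto intro: Lgen.intros)

text \<open>The change of weight depends on i and j alone and is a negated entry of the affine
  Cartan matrix. For e = 2 the two neighbours of j coincide, and both summands contribute.\<close>

lemma hwt_mv:
  assumes "mayalike M" "p \<in> Add e j M"
  shows "hwt e i (mv M {p}) = hwt e i M +
     (of_bool ((int j + 1) mod int e = int i) + of_bool ((int j - 1) mod int e = int i) - 2 * of_bool (j = i))"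
proof -
  have p: "p \<in> M" "p + 1 \<notin> M" "int j = (p + 1) mod int e" using assms(2) by (auto simp: Add_def)
  have "p + 1 \<in> cls e i \<longleftrightarrow> (int j + 1) mod int e = int i" unfolding p(3) cls_def by (simp add: mod_simps)
  moreover have "p - 1 \<in> cls e i \<longleftrightarrow> (int j - 1) mod int e = int i" unfolding p(3) cls_def by (simp add: mod_simps)
  moreover have "p \<in> cls e i \<longleftrightarrow> j = i" using p(3) by (auto simp: cls_def)
  ultimately show ?thesis using sg_mv[OF assms(1) p(1,2), of "cls e i"] by (simp add: hwt_def)
qed

lemma H_F:
  assumes "e \<ge> 2"
  shows "H e i c (F e j x) = F e j (H e i (c +
     (of_bool ((int j + 1) mod int e = int i) + of_bool ((int j - 1) mod int e = int i) - 2 * of_bool (j = i))) x)"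
    (is "_ = F e j (H e i (c + ?a) x)")
proof -
  have "flinear (F e j)" using assms by (intro flinear_F) simp
  then have L: "flinear (\<lambda>x. H e i c (F e j x))" "flinear (\<lambda>x. F e j (H e i (c + ?a) x))"
    by (auto intro: flinear_compose flinear_H)
  show ?thesis
  proof (rule flinear_ext[OF L])
    fix lam
    interpret F: module_hom scale scale "F e j" by fact
    interpret H: module_hom scale scale "H e i c" by (rule flinear_H)
    have "H e i c (F e j (basis lam)) = (\<Sum>p\<in>Add e j (maya lam). scale (vpow (wt e j (maya lam) p))
       (scale (qz (hwt e i (mv (maya lam) {p}) + c)) (basis (move {p} lam))))"
      using assms maya_move_Add[of "{_}" e j lam]
      by (simp add: F_basis H.sum H.scale) (simp add: H_def)
    also have "\<dots> = (\<Sum>p\<in>Add e j (maya lam). scale (qz (hwt e i (maya lam) + (c + ?a)))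
       (scale (vpow (wt e j (maya lam) p)) (basis (move {p} lam))))"
      by (intro sum.cong refl) (subst hwt_mv, auto simp: algebra_simps)
    also have "\<dots> = F e j (H e i (c + ?a) (basis lam))"
      using assms by (simp add: F_basis fock.scale_sum_right H_def F.scale)
    finally show "H e i c (F e j (basis lam)) = F e j (H e i (c + ?a) (basis lam))" .
  qed
qed

lemma bar_pair_H:
  assumes "e \<ge> 2" "bar_pair e n x y" shows "bar_pair e n (H e i c x) (H e i c y)"
  using assms(2)
proof (induction arbitrary: c rule: bar_pair.induct)
  case empty
  show ?case using bar_pair.scale[OF bar_pair.empty, of e "qz (hwt e i (maya empty_partition) + c)"]
    by (simp add: H_def)
next
  case (add n x y x' y')
  then show ?case by (simp add: module_hom.add[OF flinear_H] bar_pair.add)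
next
  case (scale n x y d)
  then show ?case by (simp add: module_hom.scale[OF flinear_H] bar_pair.scale)
next
  case (F n x y j)
  then show ?case by (simp add: H_F[OF assms(1)] bar_pair.F)
next
  case (Suc n x y)
  then show ?case by (simp add: bar_pair.Suc)
qed

lemma Rem_empty: "Rem e i (maya empty_partition) = {}"
proof -
  have "p \<in> maya empty_partition \<longleftrightarrow> p < 0" for p
    using maya_low[of empty_partition 0 p] maya_le[of p empty_partition] by auto
  then show ?thesis by (auto simp: Rem_def)
qed

lemma E_empty [simp]: "E e i (basis empty_partition) = 0"
  by (simp add: E_basis Rem_empty)

text \<open>Pulling \<open>E\<close> through an \<open>F\<close> produces an \<open>H\<close>, whose
  eigenvalues are bar-invariant quantum integers; so the two components of a pair are treated
  alike.\<close>

lemma bar_pair_E: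
  assumes "e \<ge> 2" "bar_pair e n x y"
  shows "case n of 0 \<Rightarrow> E e i x = 0 \<and> E e i y = 0 | Suc m \<Rightarrow> bar_pair e m (E e i x) (E e i y)"
  using assms(2)
proof (induction rule: bar_pair.induct)
  case (add n x y x' y')
  then show ?case by (cases n) (simp_all add: module_hom.add[OF flinear_E] bar_pair.add)
next
  case (scale n x y d)
  then show ?case by (cases n) (simp_all add: module_hom.scale[OF flinear_E] bar_pair.scale)
next
  case (F n x y j)
  have "bar_pair e n (F e j (E e i x)) (F e j (E e i y))"
  proof (cases n)
    case 0
    have "F e j 0 = 0" using assms(1) by (intro module_hom.zero[OF flinear_F]) simp
    then show ?thesis using F.IH 0 by (simp add: bar_pair_zero)
  next
    case (Suc m)
    then show ?thesis using F by (simp add: bar_pair.F)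
  qed
  moreover have "bar_pair e n (if i = j then H e i 0 x else 0) (if i = j then H e i 0 y else 0)"
    using F.hyps bar_pair_H[OF assms(1)] by (simp add: bar_pair_zero)
  ultimately show ?case by (simp add: EF_commute[OF assms(1)] bar_pair.add)
next
  case (Suc n x y)
  then show ?case by (cases n) (simp_all add: bar_pair_zero bar_pair.Suc)
qed simp

lemma lookup_F_empty: "e \<ge> 1 \<Longrightarrow> Poly_Mapping.lookup (F e i x) empty_partition = 0"
proof -
  assume e: "e \<ge> 1"
  have "move {p} lam \<noteq> empty_partition" if "p \<in> Add e i (maya lam)" for p lam
  proof
    assume *: "move {p} lam = empty_partition"
    obtain c where "c \<ge> 1" "bead lam c = p" using \<open>p \<in> Add e i (maya lam)\<close> by (auto simp: Add_def elim: mayaE)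
    then have "part (move {p} lam) c \<ge> 1"
      using that Add_movable[of e i "maya lam"] by (subst part_move) auto
    with * show False by simp
  qed
  then have "empty_partition \<noteq> move {p} lam" if "p \<in> Add e i (maya lam)" for p lam
    using that by metis
  then show ?thesis using e
    by (simp add: F_eq_lin lookup_lin lookup_sum lookup_scale lookup_basis)
qed

lemma bar_pair_lookup_empty: "e \<ge> 1 \<Longrightarrow> bar_pair e n x y \<Longrightarrow>
    Poly_Mapping.lookup y empty_partition = laurent_bar (Poly_Mapping.lookup x empty_partition)"
  by (rotate_tac 1, induction rule: bar_pair.induct)
     (auto simp: lookup_basis lookup_add lookup_scale laurent_bar_add laurent_bar_mult lookup_F_empty)

text \<open>If 0 is related to y, then 0 is related to each \<open>E e i y\<close> one degree lower;
  by induction these vanish, and \<open>Lgen_zero\<close> applies to y.\<close>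

lemma bar_pair_functional:
  assumes "e \<ge> 2" "bar_pair e n 0 y" shows "y = 0"
  using assms(2)
proof (induction n arbitrary: y)
  case 0
  show ?case
  proof (rule Lgen_zero[OF assms(1) bar_pair_Lgen[OF 0]])
    show "E e i y = 0" if "i < e" for i using bar_pair_E[OF assms(1) 0, of i] by simp
    show "Poly_Mapping.lookup y empty_partition = 0"
      using bar_pair_lookup_empty[OF _ 0] assms(1) by simp
  qed
next
  case (Suc n)
  show ?case
  proof (rule Lgen_zero[OF assms(1) bar_pair_Lgen[OF Suc.prems]])
    fix i assume "i < e"
    have "E e i 0 = 0" by (rule module_hom.zero[OF flinear_E])
    then show "E e i y = 0" using bar_pair_E[OF assms(1) Suc.prems, of i] Suc.IH by simp
  next
    show "Poly_Mapping.lookup y empty_partition = 0"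
      using bar_pair_lookup_empty[OF _ Suc.prems] assms(1) by simp
  qed
qed

text \<open>Divided powers are reached by the \<open>F\<close> only after multiplication by quantum
  factorials. Such denominators d are bar-invariant, so clearing them is compatible with the bar
  involution, and it loses nothing because the Fock space is torsion free.\<close>

definition bar_related :: "nat \<Rightarrow> fock \<Rightarrow> fock \<Rightarrow> bool" where
  "bar_related e x y \<longleftrightarrow> (\<exists>d n. d \<noteq> 0 \<and> laurent_bar d = d \<and> bar_pair e n (scale d x) (scale d y))"

lemma bar_related_add: assumes "bar_related e x y" "bar_related e x' y'" shows "bar_related e (x + x') (y + y')"
proof -
  obtain d n where 1: "d \<noteq> 0" "laurent_bar d = d" "bar_pair e n (scale d x) (scale d y)" using assms(1) by (auto simp: bar_related_def)
  obtain d' n' where 2: "d' \<noteq> 0" "laurent_bar d' = d'" "bar_pair e n' (scale d' x') (scale d' y')" using assms(2) by (auto simp: bar_related_def)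
  have "bar_pair e (n + n') (scale d' (scale d x)) (scale d' (scale d y))"
    using bar_pair.scale[OF bar_pair_mono[OF 1(3), of "n + n'"], of d'] 2(2) by simp
  moreover have "bar_pair e (n + n') (scale d (scale d' x')) (scale d (scale d' y'))"
    using bar_pair.scale[OF bar_pair_mono[OF 2(3), of "n + n'"], of d] 1(2) by simp
  ultimately have "bar_pair e (n + n') (scale (d * d') (x + x')) (scale (d * d') (y + y'))"
    using bar_pair.add by (fastforce simp: fock.scale_right_distrib mult.commute)
  moreover have "laurent_bar (d * d') = d * d'" "d * d' \<noteq> 0" using 1 2 by (auto simp: laurent_bar_mult)
  ultimately show ?thesis unfolding bar_related_def by blast
qed

lemma bar_related_scale: assumes "bar_related e x y" shows "bar_related e (scale c x) (scale (laurent_bar c) y)"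
proof -
  obtain d n where 1: "d \<noteq> 0" "laurent_bar d = d" "bar_pair e n (scale d x) (scale d y)" using assms(1) by (auto simp: bar_related_def)
  have "bar_pair e n (scale d (scale c x)) (scale d (scale (laurent_bar c) y))"
    using bar_pair.scale[OF 1(3), of c] by (simp add: mult.commute)
  then show ?thesis using 1 unfolding bar_related_def by blast
qed

lemma bar_pair_funpow: "bar_pair e n x y \<Longrightarrow> i < e \<Longrightarrow> bar_pair e (n + a) ((F e i ^^ a) x) ((F e i ^^ a) y)"
  by (induction a) (auto intro: bar_pair.F)

lemma bar_related_Fdiv:
  assumes "e \<ge> 2" "i < e" "bar_related e x y" shows "bar_related e (Fdiv e i a x) (Fdiv e i a y)"
proof -
  obtain d n where 1: "d \<noteq> 0" "laurent_bar d = d" "bar_pair e n (scale d x) (scale d y)" using assms(3) by (auto simp: bar_related_def)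
  have "scale (d * qfact a) (Fdiv e i a z) = (F e i ^^ a) (scale d z)" for z
    using scale_Fdiv[OF assms(1), of a i z] module_hom.scale[OF flinear_funpow[OF flinear_F[of e i]], of a d z] assms(1)
    by (simp flip: fock.scale_scale)
  then have "bar_pair e (n + a) (scale (d * qfact a) (Fdiv e i a x)) (scale (d * qfact a) (Fdiv e i a y))"
    using bar_pair_funpow[OF 1(3) assms(2)] by simp
  moreover have "laurent_bar (d * qfact a) = d * qfact a" "d * qfact a \<noteq> 0" using 1 by (auto simp: laurent_bar_mult)
  ultimately show ?thesis unfolding bar_related_def by blast
qed

lemma bar_related_unique:
  assumes "e \<ge> 2" "bar_related e x y" "bar_related e x z" shows "y = z"
proof -
  have "bar_related e (scale (- 1) x) (scale (- 1) z)"
    using bar_related_scale[OF assms(3), of "- 1"] by (simp add: laurent_bar_minus)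
  from bar_related_add[OF assms(2) this] have "bar_related e 0 (y - z)" by simp
  then obtain d n where "d \<noteq> 0" "bar_pair e n 0 (scale d (y - z))" by (auto simp: bar_related_def)
  then have "scale d (y - z) = 0" using bar_pair_functional[OF assms(1)] by blast
  then show ?thesis using \<open>d \<noteq> 0\<close> by (simp add: scale_eq_0_iff)
qed

section \<open>The module \<open>L e\<close> and its bar involution\<close>

lemma L_subspace: "fock.subspace (L e)"
  unfolding L_def by (rule fock.subspace_Inter) auto

lemma empty_in_L: "basis empty_partition \<in> L e"
  by (auto simp: L_def)

lemma Fdiv_in_L_pos: "x \<in> L e \<Longrightarrow> i < e \<Longrightarrow> a \<ge> 1 \<Longrightarrow> Fdiv e i a x \<in> L e"
  unfolding L_def by blast

lemma Fdiv_0 [simp]: "e \<ge> 2 \<Longrightarrow> Fdiv e i 0 x = x"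
  using scale_Fdiv[of e 0 i x] by simp

lemma Fdiv_in_L: "e \<ge> 2 \<Longrightarrow> x \<in> L e \<Longrightarrow> i < e \<Longrightarrow> Fdiv e i a x \<in> L e"
  using Fdiv_in_L_pos[of x e i a] by (cases a) auto

lemma L_add: "x \<in> L e \<Longrightarrow> y \<in> L e \<Longrightarrow> x + y \<in> L e"
  and L_scale: "x \<in> L e \<Longrightarrow> scale c x \<in> L e"
  and L_0: "0 \<in> L e"
  and L_diff: "x \<in> L e \<Longrightarrow> y \<in> L e \<Longrightarrow> x - y \<in> L e"
  and L_sum: "(\<And>a. a \<in> A \<Longrightarrow> f a \<in> L e) \<Longrightarrow> sum f A \<in> L e"
  using L_subspace[of e] fock.subspace_add fock.subspace_scale fock.subspace_0 fock.subspace_diff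
    fock.subspace_sum[of "L e" A f] by blast+

lemma L_induct [consumes 1, case_names empty add scale Fdiv]:
  assumes "x \<in> L e" "P (basis empty_partition)"
    "\<And>x y. x \<in> L e \<Longrightarrow> y \<in> L e \<Longrightarrow> P x \<Longrightarrow> P y \<Longrightarrow> P (x + y)"
    "\<And>c x. x \<in> L e \<Longrightarrow> P x \<Longrightarrow> P (scale c x)"
    "\<And>i a x. x \<in> L e \<Longrightarrow> P x \<Longrightarrow> i < e \<Longrightarrow> a \<ge> 1 \<Longrightarrow> P (Fdiv e i a x)"
  shows "P x"
proof -
  have "P (scale 0 (basis empty_partition))" using assms(2) empty_in_L by (rule assms(4)[rotated])
  then have "P 0" by simp
  let ?M = "{x \<in> L e. P x}"
  have "fock.subspace ?M"
    unfolding fock.subspace_def using \<open>P 0\<close> assms(3,4) L_0 L_add L_scale by simp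
  moreover have "\<forall>i<e. \<forall>a\<ge>1. \<forall>x\<in>?M. Fdiv e i a x \<in> ?M"
    using assms(5) Fdiv_in_L_pos by simp
  ultimately have "?M \<in> {M. fock.subspace M \<and> basis empty_partition \<in> M \<and> (\<forall>i<e. \<forall>a\<ge>1. \<forall>x\<in>M. Fdiv e i a x \<in> M)}"
    using assms(2) empty_in_L[of e] by simp
  then have "\<Inter>{M. fock.subspace M \<and> basis empty_partition \<in> M \<and> (\<forall>i<e. \<forall>a\<ge>1. \<forall>x\<in>M. Fdiv e i a x \<in> M)} \<subseteq> ?M"
    by (rule Inter_lower)
  then have "L e \<subseteq> ?M" by (simp only: L_def[symmetric])
  then show ?thesis using assms(1) by auto
qed

lemma bar_related_empty: "bar_related e (basis empty_partition) (basis empty_partition)"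
proof -
  have "bar_pair e 0 (scale 1 (basis empty_partition)) (scale 1 (basis empty_partition))" using bar_pair.empty[of e] by simp
  then show ?thesis unfolding bar_related_def by (intro exI[of _ 1] exI[of _ 0]) simp
qed

lemma bar_related_total: assumes "e \<ge> 2" "x \<in> L e" shows "\<exists>y\<in>L e. bar_related e x y"
  using assms(2)
proof (induction rule: L_induct)
  case empty
  then show ?case using bar_related_empty empty_in_L by blast
next
  case (add x y)
  then show ?case using bar_related_add L_add by blast
next
  case (scale c x)
  then show ?case using bar_related_scale L_scale by blast
next
  case (Fdiv i a x)
  then show ?case using bar_related_Fdiv[OF assms(1)] Fdiv_in_L_pos by blast
qed

theorem bar_exists:
  assumes "e \<ge> 2"
  shows "bar e \<in> L e \<rightarrow>\<^sub>E L e" "is_bar_involution e (bar e)"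
proof -
  define \<psi> where "\<psi> = restrict (\<lambda>x. THE y. bar_related e x y) (L e)"
  have \<psi>: "bar_related e x y \<Longrightarrow> x \<in> L e \<Longrightarrow> \<psi> x = y" for x y
    unfolding \<psi>_def using bar_related_unique[OF assms] by (simp add: the_equality)
  have \<psi>L: "\<psi> x \<in> L e \<and> bar_related e x (\<psi> x)" if "x \<in> L e" for x
    using bar_related_total[OF assms that] \<psi> that by blast
  have 1: "\<psi> \<in> L e \<rightarrow>\<^sub>E L e" using \<psi>L by (auto simp: \<psi>_def)
  have 2: "is_bar_involution e \<psi>"
    unfolding is_bar_involution_def
  proof (intro conjI ballI allI impI)
    show "\<psi> (basis empty_partition) = basis empty_partition"
      by (intro \<psi> bar_related_empty empty_in_L)
  qed (use \<psi>L assms in \<open>auto intro!: \<psi> bar_related_add bar_related_scale bar_related_Fdiv L_add L_scale Fdiv_in_L\<close>)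
  have 3: "\<phi> = \<psi>" if "\<phi> \<in> L e \<rightarrow>\<^sub>E L e" "is_bar_involution e \<phi>" for \<phi>
  proof (rule PiE_ext[OF that(1) 1])
    fix x assume "x \<in> L e"
    then show "\<phi> x = \<psi> x"
      by (induction rule: L_induct) (use that(2) 2 in \<open>auto simp: is_bar_involution_def\<close>)
  qed
  have "bar e = \<psi>" unfolding bar_def
  proof (rule the_equality)
    fix \<phi> assume "\<phi> \<in> L e \<rightarrow>\<^sub>E L e \<and> is_bar_involution e \<phi>"
    then show "\<phi> = \<psi>" by (intro 3) simp_all
  qed (rule conjI[OF 1 2])
  then show "bar e \<in> L e \<rightarrow>\<^sub>E L e" "is_bar_involution e (bar e)" by (simp_all only: 1 2)
qed

section \<open>Ribbon strip relations on the basic representation\<close>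

text \<open>The power (-v)^n for an integer n.\<close>

definition negv :: "int \<Rightarrow> laurent" where
  "negv n = (if even n then vpow n else - vpow n)"

lemma negv_add: "negv (m + n) = negv m * negv n"
  by (simp add: negv_def vpow_mult)

lemma negv_0 [simp]: "negv 0 = 1"
  by (simp add: negv_def)

lemma negv_nonzero [simp]: "negv n \<noteq> 0"
  by (simp add: negv_def)

lemma negv_sum: "negv (sum f A) = (\<Prod>a\<in>A. negv (f a))"
  by (induction A rule: infinite_finite_induct) (auto simp: negv_add)

text \<open>The weight of one row j of a strip on two neighbouring runners, left and right (primed).
  Here a, a' are the flows arriving from row j + 1, c, c' those leaving for row j - 1, and u, u' the
  final occupation. The exponent records that the arriving left flow jumps over the right place of
  the row and the leaving right flow over the left place.\<close>

definition rw :: "int \<Rightarrow> int \<Rightarrow> int \<Rightarrow> int \<Rightarrow> int \<Rightarrow> int \<Rightarrow> laurent" where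
  "rw a a' c c' u u' = (if {a, a', c, c', u + c, u' + c'} \<subseteq> {0, 1}
     then negv (- (a * (u' + c') + c' * (u + c))) else 0)"

text \<open>A finite check of 0/1 configurations. The four terms are, in order: the move before the
  strip, a switch of the flow on the boundary above the row, a switch on the boundary below it, and
  the move after the strip. This is the exchange relation behind the telescoping in
  \<open>two_runner\<close>.\<close>

lemma rw_local:
  assumes "u \<in> {0, 1}" "u' \<in> {0, 1}" "s \<in> {0, 1}" "s' \<in> {0, 1}"
    and "c = s + a - u" "c' = s' + a' - u'"
  shows "(if s = 1 \<and> s' = 0 then vpow (a - a') * rw a a' (c - 1) (c' + 1) u u' else 0) +
      (if a = 1 \<and> a' = 0 then rw 0 1 (c - 1) (c' + 1) u u' else 0) =
    (if c = 1 \<and> c' = 0 then vpow (u - u') * rw a a' 1 0 u u' else 0) +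
      (if u' = 1 \<and> u = 0 then rw a a' (c - 1) (c' + 1) (u + 1) (u' - 1) else 0)"
proof (cases "a \<in> {0, 1} \<and> a' \<in> {0, 1}")
  case True
  then have "a = 0 \<or> a = 1" "a' = 0 \<or> a' = 1" by auto
  with assms show ?thesis
    by (elim insertE emptyE disjE) (simp_all add: rw_def negv_def vpow_mult)
next
  case False
  then have "rw a a' x x' y y' = 0" for x x' y y' by (auto simp: rw_def)
  with False show ?thesis by auto
qed

lemma int_telescope:
  fixes g :: "int \<Rightarrow> 'a::ab_group_add"
  assumes "l \<le> h + 1"
  shows "(\<Sum>m\<in>{l..h}. g m - g (m + 1)) = g l - g (h + 1)"
proof -
  have "(\<Sum>m\<in>{l..l + int n - 1}. g m - g (m + 1)) = g l - g (l + int n)" for n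
  proof (induction n)
    case (Suc n)
    have "{l..l + int (Suc n) - 1} = insert (l + int n) {l..l + int n - 1}" by auto
    then show ?case using Suc by (simp add: algebra_simps)
  qed simp
  from this[of "nat (h + 1 - l)"] assms show ?thesis by simp
qed

definition cutf :: "(int \<Rightarrow> int) \<Rightarrow> int \<Rightarrow> int \<Rightarrow> int \<Rightarrow> int" where
  "cutf f d m j = f j + (if j \<le> m then d else 0)"

text \<open>
  Two runners: \<open>f\<close>, \<open>f'\<close> are the numbers of beads carried down across each row boundary.
  Moving a bead in row \<open>m\<close> before or after the strip gives the same flow, and the
  difference of the two contributions telescopes through the flow that is switched
  from one runner to the other on a boundary.
\<close>

lemma two_runner:
  fixes f f' u u' :: "int \<Rightarrow> int" and K :: int
  defines "s \<equiv> \<lambda>j. u j + f j - f (j + 1)" and "s' \<equiv> \<lambda>j. u' j + f' j - f' (j + 1)"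
  defines "k \<equiv> \<lambda>m. \<Sum>j\<in>{m..K}. u j - u' j"
  assumes "\<And>j. u j \<in> {0, 1} \<and> u' j \<in> {0, 1} \<and> s j \<in> {0, 1} \<and> s' j \<in> {0, 1}"
    and "K \<ge> 0" "f (K + 1) = 0" "f' (- K) \<noteq> 0"
  shows "(\<Sum>m\<in>{- K..K}. if s m = 1 \<and> s' m = 0 then vpow (k (m + 1) + f (m + 1) - f' (m + 1)) *
      (\<Prod>j\<in>{- K..K}. rw (cutf f (-1) m (j + 1)) (cutf f' 1 m (j + 1)) (cutf f (-1) m j) (cutf f' 1 m j) (u j) (u' j)) else 0) =
    (\<Sum>m\<in>{- K..K}. if u' m = 1 \<and> u m = 0 then vpow (k (m + 1)) *
      (\<Prod>j\<in>{- K..K}. rw (cutf f (-1) m (j + 1)) (cutf f' 1 m (j + 1)) (cutf f (-1) m j) (cutf f' 1 m j)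
         (u j + of_bool (j = m)) (u' j - of_bool (j = m))) else 0)"
    (is "(\<Sum>m\<in>_. ?L m) = (\<Sum>m\<in>_. ?R m)")
proof -
  define T where "T j = rw (f (j + 1)) (f' (j + 1)) (f j) (f' j) (u j) (u' j)" for j
  define S where "S j = rw (f (j + 1) - 1) (f' (j + 1) + 1) (f j - 1) (f' j + 1) (u j) (u' j)" for j
  define P where "P m = (\<Prod>j\<in>{m..K}. T j)" for m
  define Q where "Q m = (\<Prod>j\<in>{- K..m}. S j)" for m
  \<comment> \<open>The term of a switch at boundary m: the original flow in the rows from m on, the
    switched flow in the rows before, glued where left flow 1 becomes right flow 1.\<close>
  define C where "C m = (if f m = 1 \<and> f' m = 0 then vpow (k m) * P m * Q (m - 1) else 0)" for m
  have split: "(\<Prod>j\<in>{- K..K}. h j) = (\<Prod>j\<in>{m + 1..K}. h j) * h m * (\<Prod>j\<in>{- K..m - 1}. h j)"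
    if "m \<in> {- K..K}" for m and h :: "int \<Rightarrow> laurent"
  proof -
    have "{- K..K} = {m + 1..K} \<union> insert m {- K..m - 1}" using that by auto
    moreover have "(\<Prod>j\<in>{m + 1..K} \<union> insert m {- K..m - 1}. h j) =
      (\<Prod>j\<in>{m + 1..K}. h j) * (\<Prod>j\<in>insert m {- K..m - 1}. h j)"
      by (rule prod.union_disjoint) auto
    ultimately show ?thesis by (simp add: mult.assoc)
  qed
  have main: "?L m - ?R m = C m - C (m + 1)" if m: "m \<in> {- K..K}" for m
  proof -
    let ?a = "f (m + 1)" and ?a' = "f' (m + 1)" and ?c = "f m" and ?c' = "f' m"
    have P: "P m = P (m + 1) * T m"
    proof -
      have "{m..K} = insert m {m + 1..K}" using m by auto
      then show ?thesis by (simp add: P_def mult.commute)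
    qed
    have Q: "Q m = S m * Q (m - 1)"
    proof -
      have "{- K..m} = insert m {- K..m - 1}" using m by auto
      then show ?thesis by (simp add: Q_def)
    qed
    have k: "k m = k (m + 1) + (u m - u' m)"
    proof -
      have "{m..K} = insert m {m + 1..K}" using m by auto
      then show ?thesis by (simp add: k_def)
    qed
    have pL: "(\<Prod>j\<in>{- K..K}. rw (cutf f (-1) m (j + 1)) (cutf f' 1 m (j + 1)) (cutf f (-1) m j) (cutf f' 1 m j) (u j) (u' j))
      = P (m + 1) * rw ?a ?a' (?c - 1) (?c' + 1) (u m) (u' m) * Q (m - 1)"
      unfolding split[OF m] P_def Q_def T_def S_def
      by (intro arg_cong2[where f="(*)"] prod.cong refl) (auto simp: cutf_def)
    have pR: "(\<Prod>j\<in>{- K..K}. rw (cutf f (-1) m (j + 1)) (cutf f' 1 m (j + 1)) (cutf f (-1) m j) (cutf f' 1 m j)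
        (u j + of_bool (j = m)) (u' j - of_bool (j = m)))
      = P (m + 1) * rw ?a ?a' (?c - 1) (?c' + 1) (u m + 1) (u' m - 1) * Q (m - 1)"
      unfolding split[OF m] P_def Q_def T_def S_def
      by (intro arg_cong2[where f="(*)"] prod.cong refl) (auto simp: cutf_def)
    define G where "G = vpow (k (m + 1)) * P (m + 1) * Q (m - 1)"
    have L: "?L m = G * (if s m = 1 \<and> s' m = 0 then vpow (?a - ?a') * rw ?a ?a' (?c - 1) (?c' + 1) (u m) (u' m) else 0)"
    proof -
      have "vpow (k (m + 1) + ?a - ?a') = vpow (k (m + 1)) * vpow (?a - ?a')"
        by (simp add: vpow_mult add_diff_eq)
      then show ?thesis
        unfolding pL G_def by (cases "s m = 1 \<and> s' m = 0") (simp_all only: if_True if_False simp_thms ac_simps mult_zero_right mult_zero_left)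
    qed
    have R: "?R m = G * (if u' m = 1 \<and> u m = 0 then rw ?a ?a' (?c - 1) (?c' + 1) (u m + 1) (u' m - 1) else 0)"
      unfolding pR G_def by (simp add: ac_simps)
    have C1: "C (m + 1) = G * (if ?a = 1 \<and> ?a' = 0 then rw 0 1 (?c - 1) (?c' + 1) (u m) (u' m) else 0)"
      unfolding C_def G_def by (simp add: Q S_def ac_simps)
    have C0: "C m = G * (if ?c = 1 \<and> ?c' = 0 then vpow (u m - u' m) * rw ?a ?a' 1 0 (u m) (u' m) else 0)"
      unfolding C_def G_def P k vpow_mult[symmetric] by (simp add: T_def ac_simps)
    have "?c = s m + ?a - u m" "?c' = s' m + ?a' - u' m" by (simp_all add: s_def s'_def)
    note loc = rw_local[OF _ _ _ _ this]
    have "?L m + C (m + 1) = C m + ?R m"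
      unfolding L R C1 C0 distrib_left[symmetric]
      using assms(4)[of m] by (intro arg_cong2[where f="(*)"] refl loc) auto
    then show ?thesis by (simp add: algebra_simps)
  qed
  have "(\<Sum>m\<in>{- K..K}. ?L m) - (\<Sum>m\<in>{- K..K}. ?R m) = (\<Sum>m\<in>{- K..K}. C m - C (m + 1))"
    unfolding sum_subtractf[symmetric] by (intro sum.cong refl main)
  also have "\<dots> = C (- K) - C (K + 1)" using \<open>K \<ge> 0\<close> by (intro int_telescope) simp
  also have "\<dots> = 0" using assms(6,7) by (simp add: C_def)
  finally show ?thesis by simp
qed

text \<open>A difference of counts, so that it exists for all bead sets. It is negative or fails to
  vanish far to the left when M and X cannot be joined by a strip, and \<open>strip_coeff\<close>
  excludes these cases.\<close>

definition flow :: "nat \<Rightarrow> int set \<Rightarrow> int set \<Rightarrow> int \<Rightarrow> int" where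
  "flow e M X p = int (card {q \<in> M. p \<le> q \<and> int e dvd q - p}) - int (card {q \<in> X. p \<le> q \<and> int e dvd q - p})"

definition mem :: "int set \<Rightarrow> int \<Rightarrow> int" where
  "mem X p = (if p \<in> X then 1 else 0)"

text \<open>
  The coefficient of the strip that leads from \<open>M\<close> down to \<open>X\<close>: \<open>flow e M X p\<close> tells whether
  a bead passes from position \<open>p\<close> to \<open>p - e\<close>, and \<open>mem X q + flow e M X q\<close> whether position
  \<open>q\<close> is occupied while the strip passes it.
\<close>

definition strip_coeff :: "nat \<Rightarrow> nat \<Rightarrow> int set \<Rightarrow> int set \<Rightarrow> laurent" where
  "strip_coeff e m M X = (if finite {p. flow e M X p \<noteq> 0} \<and> (\<Sum>p | flow e M X p \<noteq> 0. flow e M X p) = int m \<and>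
      (\<forall>p. flow e M X p \<in> {0, 1} \<and> mem X p + flow e M X p \<in> {0, 1})
    then negv (- (\<Sum>p | flow e M X p \<noteq> 0. flow e M X p * (\<Sum>q\<in>{p - int e + 1..p - 1}. mem X q + flow e M X q)))
    else 0)"

text \<open>Confines everything to the rows from -K to K, counted from place r. Row K is empty and
  the rows -K and 1 - K are full; these serve as a margin for moves near the ends.\<close>

definition settled :: "nat \<Rightarrow> int \<Rightarrow> int \<Rightarrow> int set \<Rightarrow> bool" where
  "settled e r K M \<longleftrightarrow> (\<forall>p \<ge> r + int e * K. p \<notin> M) \<and> (\<forall>p < r + int e * (2 - K). p \<in> M)"

lemma settled_mono:
  assumes "settled e r K M" "K \<le> K'" shows "settled e r K' M"
proof -
  have "int e * K \<le> int e * K'" "int e * (2 - K') \<le> int e * (2 - K)"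
    using assms(2) by (simp_all add: mult_left_mono)
  then show ?thesis using assms(1) unfolding settled_def by auto
qed

lemma settled_ex:
  assumes "mayalike M" "e \<ge> 1" shows "\<exists>K. settled e r K M"
proof -
  obtain a z where az: "{..<a} \<subseteq> M" "M \<subseteq> {..<z}" using assms(1) unfolding mayalike_def by blast
  define K where "K = \<bar>z\<bar> + \<bar>a\<bar> + \<bar>r\<bar> + 2"
  have K: "K \<ge> 2" "K \<ge> z - r" "2 - K \<le> a - r" unfolding K_def by arith+
  have "1 * K \<le> int e * K" using assms(2) K by (intro mult_right_mono) auto
  then have z: "r + int e * K \<ge> z" using K by linarith
  define D where "D = 2 - K"
  have "int e * D \<le> 1 * D" using assms(2) K by (intro mult_right_mono_neg) (auto simp: D_def)
  moreover have "D \<le> a - r" using K by (simp add: D_def)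
  ultimately have "r + int e * D \<le> a" by linarith
  then have a: "r + int e * (2 - K) \<le> a" by (simp only: D_def)
  have "settled e r K M"
    unfolding settled_def
  proof (intro conjI allI impI)
    fix p assume "p \<ge> r + int e * K"
    then have "p \<notin> {..<z}" using z by simp
    then show "p \<notin> M" using az(2) by auto
  next
    fix p assume "p < r + int e * (2 - K)"
    then have "p \<in> {..<a}" using a by simp
    then show "p \<in> M" using az(1) by auto
  qed
  then show ?thesis by blast
qed

lemma settled_mayalike: "settled e r K M \<Longrightarrow> mayalike M"
  unfolding settled_def mayalike_def
  by (intro exI[of _ "r + int e * (2 - K)"] exI[of _ "r + int e * K"] conjI subsetI;
      simp; metis linorder_not_le)

lemma finite_up: "mayalike M \<Longrightarrow> finite {q \<in> M. (p::int) \<le> q \<and> P q}"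
proof -
  assume "mayalike M"
  then obtain z where "M \<subseteq> {..<z}" unfolding mayalike_def by blast
  then have "{q \<in> M. p \<le> q \<and> P q} \<subseteq> {p..<z}" by auto
  then show ?thesis by (rule finite_subset) simp
qed

lemma flow_rec:
  assumes "mayalike M" "mayalike X" "e \<ge> 1"
  shows "flow e M X p = flow e M X (p + int e) + mem M p - mem X p"
proof -
  have "int (card {q \<in> Y. p \<le> q \<and> int e dvd q - p}) =
     int (card {q \<in> Y. p + int e \<le> q \<and> int e dvd q - (p + int e)}) + mem Y p" if "mayalike Y" for Y
  proof -
    let ?Z = "{q \<in> Y. p + int e \<le> q \<and> int e dvd q - (p + int e)}"
    have d: "int e dvd q - (p + int e) \<longleftrightarrow> int e dvd q - p" for q
      using dvd_add_left_iff[of "int e" "- int e" "q - p"] by (simp add: algebra_simps)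
    have g: "q = p \<or> p + int e \<le> q" if "p \<le> q" "int e dvd q - p" for q
      using that zdvd_imp_le[of "int e" "q - p"] by force
    have "{q \<in> Y. p \<le> q \<and> int e dvd q - p} = (if p \<in> Y then insert p ?Z else ?Z)"
      unfolding d using g assms(3) by auto
    moreover have "p \<notin> ?Z" using assms(3) by simp
    ultimately show ?thesis using finite_up[OF that, of "p + int e"] by (simp add: mem_def)
  qed
  from this[OF assms(1)] this[OF assms(2)] show ?thesis by (simp add: flow_def)
qed

lemma flow_high:
  assumes "settled e r K M" "settled e r K X" "p \<ge> r + int e * K"
  shows "flow e M X p = 0"
proof -
  have *: "{q \<in> Y. p \<le> q \<and> int e dvd q - p} = {}" if "settled e r K Y" for Y
    using that assms(3) by (auto simp: settled_def)
  show ?thesis unfolding flow_def *[OF assms(1)] *[OF assms(2)] by simp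
qed

lemma flow_low:
  assumes "settled e r K M" "settled e r K X" "p < r + int e * (2 - K)" "e \<ge> 1"
  shows "flow e M X p = flow e M X (p + int e)"
  using flow_rec[of M X e p] settled_mayalike[OF assms(1)] settled_mayalike[OF assms(2)] assms
  by (simp add: settled_def mem_def)

lemma card_mv:
  assumes "finite {q \<in> M. P q}" "p \<in> M" "p + 1 \<notin> M"
  shows "int (card {q \<in> mv M {p}. P q}) = int (card {q \<in> M. P q}) - of_bool (P p) + of_bool (P (p + 1))"
proof -
  have eq: "{q \<in> mv M {p}. P q} = ({q \<in> M. P q} - {p}) \<union> (if P (p + 1) then {p + 1} else {})"
    by (auto simp: mv_def)
  have "card {q \<in> M. P q} > 0" if "P p" using that assms by (auto simp: card_gt_0_iff)
  then show ?thesis unfolding eq using assms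
    by (auto simp: card_insert_if card_Diff_singleton_if of_nat_diff Suc_le_eq)
qed

lemma flow_mv:
  assumes "mayalike M" "p \<in> M" "p + 1 \<notin> M"
  shows "flow e (mv M {p}) X q = flow e M X q - of_bool (q \<le> p \<and> int e dvd p - q)
     + of_bool (q \<le> p + 1 \<and> int e dvd p + 1 - q)"
  unfolding flow_def using card_mv[OF finite_up[OF assms(1)] assms(2,3), of q "\<lambda>t. int e dvd t - q"] by simp

lemma flow_umv:
  assumes "mayalike X" "p \<notin> X" "p + 1 \<in> X"
  shows "flow e M (umv X p) q = flow e M X q - of_bool (q \<le> p \<and> int e dvd p - q)
     + of_bool (q \<le> p + 1 \<and> int e dvd p + 1 - q)"
proof -
  have *: "p \<in> umv X p" "p + 1 \<notin> umv X p" by (auto simp: umv_def)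
  show ?thesis
    unfolding flow_def
    using card_mv[OF finite_up[OF mayalike_umv[OF assms(1)]] *, of q "\<lambda>t. int e dvd t - q"] mv_umv[OF assms(2,3)] by simp
qed

text \<open>Row j and column k of an abacus cut at place r. With r = i - 1 the steps of residue i go
  from column 0 to column 1 within one row.\<close>

definition pos :: "nat \<Rightarrow> int \<Rightarrow> int \<Rightarrow> int \<Rightarrow> int" where
  "pos e r j k = r + int e * j + k"

lemma pos_cases:
  assumes "e \<ge> 1" obtains j k where "p = pos e r j k" "0 \<le> k" "k < int e"
  using assms that[of "(p - r) div int e" "(p - r) mod int e"] by (auto simp: pos_def)

lemma pos_eq_iff:
  assumes "0 \<le> k" "k < int e" "0 \<le> k'" "k' < int e"
  shows "pos e r j k = pos e r j' k' \<longleftrightarrow> j = j' \<and> k = k'"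
proof
  assume "pos e r j k = pos e r j' k'"
  then have "int e * j + k = int e * j' + k'" by (simp add: pos_def)
  then have "(int e * j + k) div int e = (int e * j' + k') div int e" "(int e * j + k) mod int e = (int e * j' + k') mod int e" by simp_all
  then show "j = j' \<and> k = k'" using assms by simp
qed auto

lemma sum_rows:
  assumes "e \<ge> 1"
  shows "(\<Sum>p\<in>{r - int e * K..<r + int e * K + int e}. g p) = (\<Sum>j\<in>{- K..K}. \<Sum>k\<in>{0..<int e}. g (pos e r j k))"
proof -
  have lt: "int e * j + k < int e * K + int e" if "j \<le> K" "k < int e" for j k
    using mult_left_mono[of j K "int e"] that by simp
  have ge: "- (int e * K) \<le> int e * j + k" if "- K \<le> j" "0 \<le> k" for j k
    using mult_left_mono[of "- K" j "int e"] that by simp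
  have "(\<Sum>p\<in>{r - int e * K..<r + int e * K + int e}. g p) =
    (\<Sum>(j, k)\<in>{- K..K} \<times> {0..<int e}. g (pos e r j k))"
  proof (rule sum.reindex_bij_witness[where i="\<lambda>(j, k). pos e r j k" and j="\<lambda>p. ((p - r) div int e, (p - r) mod int e)"])
    fix p assume p: "p \<in> {r - int e * K..<r + int e * K + int e}"
    obtain j k where jk: "p = pos e r j k" "0 \<le> k" "k < int e" using assms by (rule pos_cases)
    have "- K \<le> j"
    proof (rule ccontr)
      assume "\<not> - K \<le> j"
      then have "int e * j \<le> int e * (- K - 1)" by (intro mult_left_mono) auto
      then show False using p jk by (simp add: pos_def algebra_simps)
    qed
    moreover have "j \<le> K"
    proof (rule ccontr)
      assume "\<not> j \<le> K"
      then have "int e * (K + 1) \<le> int e * j" by (intro mult_left_mono) auto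
      then show False using p jk by (simp add: pos_def algebra_simps)
    qed
    moreover have "(p - r) div int e = j" using jk assms by (simp add: pos_def)
    ultimately have "- K \<le> (p - r) div int e" "(p - r) div int e < K + 1" by simp_all
    then show "((p - r) div int e, (p - r) mod int e) \<in> {- K..K} \<times> {0..<int e}" using assms by simp
  qed (use assms lt ge in \<open>auto simp: pos_def\<close>)
  then show ?thesis by (simp add: sum.cartesian_product)
qed

lemma sum_split2:
  "e \<ge> 2 \<Longrightarrow> (\<Sum>k\<in>{0..<int e}. g k) = g 0 + g 1 + (\<Sum>k\<in>{2..<int e}. g k)"
proof -
  assume "e \<ge> 2"
  then have "{0..<int e} = insert 0 (insert 1 {2..<int e})" by auto
  then show ?thesis by (simp add: add.assoc)
qed

lemma sum_shift_int: "(\<Sum>q\<in>{a + c..<d + c}. h q) = (\<Sum>q\<in>{a..<d::int}. h (c + q))"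
  by (rule sum.reindex_bij_witness[where i="\<lambda>q. c + q" and j="\<lambda>q. q - c"]) auto

lemma sum_between:
  assumes "0 \<le> k" "k < int e"
  shows "(\<Sum>q\<in>{pos e r j k - int e + 1..pos e r j k - 1}. h q) =
     (\<Sum>k'\<in>{0..<k}. h (pos e r j k')) + (\<Sum>k'\<in>{k + 1..<int e}. h (pos e r (j - 1) k'))"
proof -
  have "{pos e r j k - int e + 1..pos e r j k - 1} = {0 + pos e r j 0..<k + pos e r j 0} \<union>
     {(k + 1) + pos e r (j - 1) 0..<int e + pos e r (j - 1) 0}"
    using assms by (auto simp: pos_def algebra_simps)
  moreover have "{0 + pos e r j 0..<k + pos e r j 0} \<inter> {(k + 1) + pos e r (j - 1) 0..<int e + pos e r (j - 1) 0} = {}"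
    by (auto simp: pos_def algebra_simps)
  ultimately have "(\<Sum>q\<in>{pos e r j k - int e + 1..pos e r j k - 1}. h q) =
    (\<Sum>q\<in>{0 + pos e r j 0..<k + pos e r j 0}. h q) + (\<Sum>q\<in>{(k + 1) + pos e r (j - 1) 0..<int e + pos e r (j - 1) 0}. h q)"
    by (simp only: sum.union_disjoint finite_atLeastLessThan_int)
  then show ?thesis unfolding sum_shift_int by (simp add: pos_def)
qed

text \<open>The part of \<open>strip_coeff\<close> that sees columns 0 and 1 only through the row
  totals T of their flows and U of their final occupation. A step between these columns changes
  neither total, so this factor is common to all terms of \<open>strip_commute\<close>. The flag
  \<open>low\<close> carries the finiteness condition for the two columns.\<close>

definition oth :: "nat \<Rightarrow> int \<Rightarrow> int \<Rightarrow> nat \<Rightarrow> bool \<Rightarrow> (int \<Rightarrow> int) \<Rightarrow> (int \<Rightarrow> int) \<Rightarrow> (int \<Rightarrow> int \<Rightarrow> int) \<Rightarrow> (int \<Rightarrow> int \<Rightarrow> int) \<Rightarrow> laurent" where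
  "oth e r K m low T U f x = (if low \<and> (\<forall>k\<in>{2..<int e}. f (- K) k = 0) \<and>
      (\<Sum>j\<in>{- K..K}. T j + (\<Sum>k\<in>{2..<int e}. f j k)) = int m \<and>
      (\<forall>j\<in>{- K..K}. \<forall>k\<in>{2..<int e}. f j k \<in> {0, 1} \<and> x j k + f j k \<in> {0, 1})
    then negv (- (\<Sum>j\<in>{- K..K}. T j * (\<Sum>k\<in>{2..<int e}. x (j - 1) k + f (j - 1) k) +
      (\<Sum>k\<in>{2..<int e}. f j k * (U j + T j + (\<Sum>k'\<in>{2..<k}. x j k' + f j k') + (\<Sum>k'\<in>{k + 1..<int e}. x (j - 1) k' + f (j - 1) k')))))
    else 0)"

lemma oth_cong:
  assumes "low = low'" "\<And>j. T j = T' j" "\<And>j. U j = U' j"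
    "\<And>j k. k \<in> {2..<int e} \<Longrightarrow> f j k = f' j k" "\<And>j k. k \<in> {2..<int e} \<Longrightarrow> x j k = x' j k"
  shows "oth e r K m low T U f x = oth e r K m low' T' U' f' x'"
proof -
  have c1: "(\<forall>k\<in>{2..<int e}. f (- K) k = 0) \<longleftrightarrow> (\<forall>k\<in>{2..<int e}. f' (- K) k = 0)"
    using assms(4) by (intro ball_cong) auto
  have c2: "(\<Sum>j\<in>{- K..K}. T j + (\<Sum>k\<in>{2..<int e}. f j k)) = (\<Sum>j\<in>{- K..K}. T' j + (\<Sum>k\<in>{2..<int e}. f' j k))"
    by (intro sum.cong refl arg_cong2[where f="(+)"] assms)
  have c3: "(\<forall>j\<in>{- K..K}. \<forall>k\<in>{2..<int e}. f j k \<in> {0, 1} \<and> x j k + f j k \<in> {0, 1}) \<longleftrightarrow>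
      (\<forall>j\<in>{- K..K}. \<forall>k\<in>{2..<int e}. f' j k \<in> {0, 1} \<and> x' j k + f' j k \<in> {0, 1})"
    by (intro ball_cong refl) (simp only: assms)
  have i1: "(\<Sum>k'\<in>{2..<k}. x j k' + f j k') = (\<Sum>k'\<in>{2..<k}. x' j k' + f' j k')" if "k \<le> int e" for j k
    using that by (intro sum.cong refl arg_cong2[where f="(+)"] assms) auto
  have i2: "(\<Sum>k'\<in>{k..<int e}. x j k' + f j k') = (\<Sum>k'\<in>{k..<int e}. x' j k' + f' j k')" if "2 \<le> k" for j k
    using that by (intro sum.cong refl arg_cong2[where f="(+)"] assms) auto
  have c4: "(\<Sum>j\<in>{- K..K}. T j * (\<Sum>k\<in>{2..<int e}. x (j - 1) k + f (j - 1) k) +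
      (\<Sum>k\<in>{2..<int e}. f j k * (U j + T j + (\<Sum>k'\<in>{2..<k}. x j k' + f j k') + (\<Sum>k'\<in>{k + 1..<int e}. x (j - 1) k' + f (j - 1) k'))))
    = (\<Sum>j\<in>{- K..K}. T' j * (\<Sum>k\<in>{2..<int e}. x' (j - 1) k + f' (j - 1) k) +
      (\<Sum>k\<in>{2..<int e}. f' j k * (U' j + T' j + (\<Sum>k'\<in>{2..<k}. x' j k' + f' j k') + (\<Sum>k'\<in>{k + 1..<int e}. x' (j - 1) k' + f' (j - 1) k'))))"
    by (intro sum.cong refl arg_cong2[where f="(+)"] arg_cong2[where f="(*)"] assms i1 i2) auto
  show ?thesis unfolding oth_def assms(1) c1 c2 c3 c4 ..
qed

lemma prod_if_zero:
  "finite A \<Longrightarrow> (\<Prod>j\<in>A. if P j then g j else (0::laurent)) = (if \<forall>j\<in>A. P j then \<Prod>j\<in>A. g j else 0)"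
  by (induction A rule: finite_induct) auto

text \<open>The exponent counts pairs of a crossing and an occupied place that it jumps over. Pairs
  inside columns 0 and 1 are collected in the product of \<open>rw\<close>; all other pairs involve
  these columns only through their row totals.\<close>

lemma strip_coeff_rows:
  fixes K :: int
  assumes e: "e \<ge> 2" and K: "K \<ge> 0" and M: "settled e r K M" and X: "settled e r K X"
  defines "f \<equiv> \<lambda>j k. flow e M X (pos e r j k)" and "x \<equiv> \<lambda>j k. mem X (pos e r j k)"
  shows "strip_coeff e n M X = oth e r K n (f (- K) 0 = 0 \<and> f (- K) 1 = 0) (\<lambda>j. f j 0 + f j 1) (\<lambda>j. x j 0 + x j 1) f x *
     (\<Prod>j\<in>{- K..K}. rw (f (j + 1) 0) (f (j + 1) 1) (f j 0) (f j 1) (x j 0) (x j 1))"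
proof -
  let ?f = "flow e M X"
  let ?S = "{p. ?f p \<noteq> 0}"
  let ?W = "{r - int e * K..<r + int e * K + int e}"
  have e1: "e \<ge> 1" using e by simp
  have high: "f j k = 0" if "j > K" "0 \<le> k" for j k
  proof -
    have "int e * K + int e \<le> int e * j" using that(1) mult_left_mono[of "K + 1" j "int e"] by (simp add: distrib_left)
    then show ?thesis unfolding f_def using that(2) by (intro flow_high[OF M X]) (simp add: pos_def)
  qed
  have low_step: "f j k = f (j + 1) k" if "j < - K" "k < int e" for j k
  proof -
    have "int e * j \<le> int e * (- K - 1)" using that(1) by (intro mult_left_mono) auto
    then have "pos e r j k < r + int e * (2 - K)" using that(2) e by (simp add: pos_def algebra_simps)
    then have "f j k = ?f (pos e r j k + int e)" unfolding f_def by (rule flow_low[OF M X _ e1])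
    then show ?thesis by (simp add: f_def pos_def algebra_simps)
  qed
  have low: "f (- K - int t) k = f (- K) k" if "k < int e" for k t
  proof (induction t)
    case (Suc t)
    show ?case using low_step[of "- K - int (Suc t)" k] that Suc by (simp add: algebra_simps)
  qed simp
  let ?B = "\<forall>k\<in>{0..<int e}. f (- K) k = 0"
  have sub: "?S \<subseteq> ?W" if ?B
  proof
    fix p assume p: "p \<in> ?S"
    obtain j k where jk: "p = pos e r j k" "0 \<le> k" "k < int e" using e1 by (rule pos_cases)
    have "j \<le> K" using high[of j k] p jk by (force simp: f_def)
    moreover have "- K \<le> j"
    proof (rule ccontr)
      assume "\<not> - K \<le> j"
      then have "f j k = f (- K) k" using low[of k "nat (- K - j)"] jk by simp
      then show False using that p jk by (auto simp: f_def)
    qed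
    ultimately have "int e * j \<le> int e * K" "int e * (- K) \<le> int e * j" by (intro mult_left_mono; simp)+
    then show "p \<in> ?W" unfolding atLeastLessThan_iff jk(1) pos_def using jk(2,3) by linarith
  qed
  have fin: "finite ?S \<longleftrightarrow> ?B"
  proof
    assume fin: "finite ?S"
    show ?B
    proof (rule ballI, rule ccontr)
      fix k assume k: "k \<in> {0..<int e}" and nz: "f (- K) k \<noteq> 0"
      have "range (\<lambda>t. pos e r (- K - int t) k) \<subseteq> ?S"
        using low[of k] nz k by (auto simp: f_def)
      then have "finite (range (\<lambda>t. pos e r (- K - int t) k))" using fin finite_subset by blast
      moreover have "inj (\<lambda>t. pos e r (- K - int t) k)" using e by (auto simp: inj_def pos_def)
      ultimately show False using finite_imageD infinite_UNIV_nat by blast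
    qed
  qed (use sub finite_subset in blast)
  have B: "?B \<longleftrightarrow> (f (- K) 0 = 0 \<and> f (- K) 1 = 0) \<and> (\<forall>k\<in>{2..<int e}. f (- K) k = 0)"
  proof -
    have "{0..<int e} = insert 0 (insert 1 {2..<int e})" using e by auto
    then show ?thesis by simp
  qed
  show ?thesis
  proof (cases ?B)
    case False
    then have "strip_coeff e n M X = 0" using fin by (simp add: strip_coeff_def)
    moreover have "oth e r K n (f (- K) 0 = 0 \<and> f (- K) 1 = 0) (\<lambda>j. f j 0 + f j 1) (\<lambda>j. x j 0 + x j 1) f x = 0"
      using False B by (auto simp: oth_def)
    ultimately show ?thesis by simp
  next
    case True
    have sums: "(\<Sum>p\<in>?S. ?f p * g p) = (\<Sum>j\<in>{- K..K}. \<Sum>k\<in>{0..<int e}. f j k * g (pos e r j k))" for g :: "int \<Rightarrow> int"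
    proof -
      have "(\<Sum>p\<in>?S. ?f p * g p) = (\<Sum>p\<in>?W. ?f p * g p)"
        by (rule sum.mono_neutral_left) (use sub[OF True] in auto)
      then show ?thesis by (simp only: sum_rows[OF e1] f_def)
    qed
    have tot: "sum ?f ?S = (\<Sum>j\<in>{- K..K}. f j 0 + f j 1 + (\<Sum>k\<in>{2..<int e}. f j k))"
      using sums[of "\<lambda>_. 1"] by (simp add: sum_split2[OF e])
    let ?w = "\<lambda>j k. x j k + f j k"
    let ?O = "\<lambda>j. \<Sum>k\<in>{2..<int e}. ?w j k"
    have btw: "(\<Sum>q\<in>{pos e r j k - int e + 1..pos e r j k - 1}. mem X q + ?f q) =
       (\<Sum>k'\<in>{0..<k}. ?w j k') + (\<Sum>k'\<in>{k + 1..<int e}. ?w (j - 1) k')" if "0 \<le> k" "k < int e" for j k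
      unfolding sum_between[OF that] by (simp add: x_def f_def)
    have b0: "(\<Sum>k'\<in>{0 + 1..<int e}. ?w j k') = ?w j 1 + ?O j" for j
    proof -
      have "{0 + 1..<int e} = insert 1 {2..<int e}" using e by auto
      then show ?thesis by simp
    qed
    have b2: "(\<Sum>k'\<in>{0..<k}. ?w j k') = ?w j 0 + ?w j 1 + (\<Sum>k'\<in>{2..<k}. ?w j k')" if "2 \<le> k" for j k
    proof -
      have "{0..<k} = insert 0 (insert 1 {2..<k})" using that by auto
      then show ?thesis by (simp add: add.assoc)
    qed
    let ?Eo = "\<lambda>j. (f j 0 + f j 1) * ?O (j - 1) + (\<Sum>k\<in>{2..<int e}. f j k * ((x j 0 + x j 1) + (f j 0 + f j 1) +
        (\<Sum>k'\<in>{2..<k}. ?w j k') + (\<Sum>k'\<in>{k + 1..<int e}. ?w (j - 1) k')))"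
    have row: "(\<Sum>k\<in>{0..<int e}. f j k * ((\<Sum>k'\<in>{0..<k}. ?w j k') + (\<Sum>k'\<in>{k + 1..<int e}. ?w (j - 1) k'))) =
      ?Eo j + (f j 0 * ?w (j - 1) 1 + f j 1 * ?w j 0)" for j
    proof -
      have "{0..<1::int} = {0}" by auto
      then have "(\<Sum>k\<in>{0..<int e}. f j k * ((\<Sum>k'\<in>{0..<k}. ?w j k') + (\<Sum>k'\<in>{k + 1..<int e}. ?w (j - 1) k'))) =
        f j 0 * (?w (j - 1) 1 + ?O (j - 1)) + f j 1 * (?w j 0 + ?O (j - 1)) +
        (\<Sum>k\<in>{2..<int e}. f j k * ((\<Sum>k'\<in>{0..<k}. ?w j k') + (\<Sum>k'\<in>{k + 1..<int e}. ?w (j - 1) k')))"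
        unfolding sum_split2[OF e] b0 by simp
      also have "(\<Sum>k\<in>{2..<int e}. f j k * ((\<Sum>k'\<in>{0..<k}. ?w j k') + (\<Sum>k'\<in>{k + 1..<int e}. ?w (j - 1) k'))) =
        (\<Sum>k\<in>{2..<int e}. f j k * ((x j 0 + x j 1) + (f j 0 + f j 1) +
        (\<Sum>k'\<in>{2..<k}. ?w j k') + (\<Sum>k'\<in>{k + 1..<int e}. ?w (j - 1) k')))"
        by (intro sum.cong refl) (simp add: b2)
      finally show ?thesis by (simp add: algebra_simps)
    qed
    \<comment> \<open>A crossing in column 0 jumps over column 1 of the preceding row; reindexing
      books it there, as \<open>rw\<close> does. The flow vanishes at both ends of the
      window.\<close>
    have shift: "(\<Sum>j\<in>{- K..K}. f j 0 * ?w (j - 1) 1) = (\<Sum>j\<in>{- K..K}. f (j + 1) 0 * ?w j 1)"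
    proof -
      have "(\<Sum>j\<in>{- K..K}. f j 0 * ?w (j - 1) 1 - f (j + 1) 0 * ?w (j + 1 - 1) 1) =
        f (- K) 0 * ?w (- K - 1) 1 - f (K + 1) 0 * ?w (K + 1 - 1) 1"
        using K by (intro int_telescope) simp
      also have "\<dots> = 0" using True e high[of "K + 1" 0] by simp
      finally show ?thesis by (simp add: sum_subtractf)
    qed
    have en: "(\<Sum>p\<in>?S. ?f p * (\<Sum>q\<in>{p - int e + 1..p - 1}. mem X q + ?f q)) =
      (\<Sum>j\<in>{- K..K}. ?Eo j) + (\<Sum>j\<in>{- K..K}. f (j + 1) 0 * (x j 1 + f j 1) + f j 1 * (x j 0 + f j 0))"
    proof -
      have "(\<Sum>p\<in>?S. ?f p * (\<Sum>q\<in>{p - int e + 1..p - 1}. mem X q + ?f q)) =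
        (\<Sum>j\<in>{- K..K}. \<Sum>k\<in>{0..<int e}. f j k * ((\<Sum>k'\<in>{0..<k}. ?w j k') + (\<Sum>k'\<in>{k + 1..<int e}. ?w (j - 1) k')))"
        unfolding sums by (intro sum.cong refl) (simp add: btw)
      also have "\<dots> = (\<Sum>j\<in>{- K..K}. ?Eo j) + ((\<Sum>j\<in>{- K..K}. f j 0 * ?w (j - 1) 1) + (\<Sum>j\<in>{- K..K}. f j 1 * ?w j 0))"
        unfolding row by (rule trans[OF sum.distrib], rule arg_cong2[where f="(+)"], rule refl, rule sum.distrib)
      also have "\<dots> = (\<Sum>j\<in>{- K..K}. ?Eo j) + (\<Sum>j\<in>{- K..K}. f (j + 1) 0 * (x j 1 + f j 1) + f j 1 * (x j 0 + f j 0))"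
        unfolding shift by (rule arg_cong2[where f="(+)", OF refl sum.distrib[symmetric]])
      finally show ?thesis .
    qed
    let ?V = "\<lambda>j k. f j k \<in> {0, 1} \<and> x j k + f j k \<in> {0, 1}"
    have valid: "(\<forall>p. ?f p \<in> {0, 1} \<and> mem X p + ?f p \<in> {0, 1}) \<longleftrightarrow> (\<forall>j\<in>{- K..K}. \<forall>k\<in>{0..<int e}. ?V j k)"
    proof
      assume *: "\<forall>j\<in>{- K..K}. \<forall>k\<in>{0..<int e}. ?V j k"
      show "\<forall>p. ?f p \<in> {0, 1} \<and> mem X p + ?f p \<in> {0, 1}"
      proof
        fix p
        obtain j k where jk: "p = pos e r j k" "0 \<le> k" "k < int e" using e1 by (rule pos_cases)
        show "?f p \<in> {0, 1} \<and> mem X p + ?f p \<in> {0, 1}"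
        proof (cases "j \<in> {- K..K}")
          case True
          then have "?V j k" using * jk by simp
          then show ?thesis by (simp only: jk(1) x_def f_def)
        next
          case False
          then have "f j k = 0"
            using high[of j k] low[of k "nat (- K - j)"] \<open>?B\<close> jk by (cases "j > K") auto
          then show ?thesis by (simp add: jk(1) f_def mem_def)
        qed
      qed
    qed (simp add: x_def f_def)
    have V2: "(\<forall>j\<in>{- K..K}. \<forall>k\<in>{0..<int e}. ?V j k) \<longleftrightarrow>
      (\<forall>j\<in>{- K..K}. \<forall>k\<in>{2..<int e}. ?V j k) \<and> (\<forall>j\<in>{- K..K}. {f (j + 1) 0, f (j + 1) 1, f j 0, f j 1, x j 0 + f j 0, x j 1 + f j 1} \<subseteq> {0, 1})"
    proof -
      have s: "{0..<int e} = insert 0 (insert 1 {2..<int e})" using e by auto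
      have nxt: "(\<forall>j\<in>{- K..K}. f j k \<in> {0, 1}) \<longrightarrow> (\<forall>j\<in>{- K..K}. f (j + 1) k \<in> {0, 1})" if "0 \<le> k" for k
      proof (intro impI ballI)
        fix j assume "\<forall>j\<in>{- K..K}. f j k \<in> {0, 1}" "j \<in> {- K..K}"
        then show "f (j + 1) k \<in> {0, 1}" using that high[of "j + 1" k] by (cases "j = K") auto
      qed
      have "(0::int) \<le> 0" "(0::int) \<le> 1" by simp_all
      from nxt[OF this(1)] nxt[OF this(2)] show ?thesis
        unfolding s by (simp only: ball_simps ball_conj_distrib insert_subset empty_subsetI simp_thms) blast
    qed
    have prw: "(\<Prod>j\<in>{- K..K}. rw (f (j + 1) 0) (f (j + 1) 1) (f j 0) (f j 1) (x j 0) (x j 1)) =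
      (if \<forall>j\<in>{- K..K}. {f (j + 1) 0, f (j + 1) 1, f j 0, f j 1, x j 0 + f j 0, x j 1 + f j 1} \<subseteq> {0, 1}
       then negv (- (\<Sum>j\<in>{- K..K}. f (j + 1) 0 * (x j 1 + f j 1) + f j 1 * (x j 0 + f j 0))) else 0)"
      unfolding rw_def prod_if_zero[OF finite_atLeastAtMost_int] negv_sum sum_negf[symmetric] ..
    have strip_coeff: "strip_coeff e n M X = (if sum ?f ?S = int n \<and> (\<forall>j\<in>{- K..K}. \<forall>k\<in>{0..<int e}. ?V j k)
      then negv (- ((\<Sum>j\<in>{- K..K}. ?Eo j) + (\<Sum>j\<in>{- K..K}. f (j + 1) 0 * (x j 1 + f j 1) + f j 1 * (x j 0 + f j 0)))) else 0)"
      unfolding strip_coeff_def en valid using fin True by simp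
    have ot: "oth e r K n (f (- K) 0 = 0 \<and> f (- K) 1 = 0) (\<lambda>j. f j 0 + f j 1) (\<lambda>j. x j 0 + x j 1) f x =
      (if sum ?f ?S = int n \<and> (\<forall>j\<in>{- K..K}. \<forall>k\<in>{2..<int e}. ?V j k) then negv (- (\<Sum>j\<in>{- K..K}. ?Eo j)) else 0)"
      unfolding oth_def tot using True B by simp
    have nn: "negv (- (a + c)) = negv (- a) * negv (- c)" for a c
      using negv_add[of "- a" "- c"] by simp
    show ?thesis unfolding strip_coeff ot prw V2 nn by simp
  qed
qed

lemma sum_Add_rows:
  fixes G :: "int \<Rightarrow> laurent"
  assumes "e \<ge> 2" "i < e" "settled e (int i - 1) K M"
  shows "(\<Sum>p\<in>Add e i M. G p) = (\<Sum>j\<in>{- K..K}.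
      if mem M (pos e (int i - 1) j 0) = 1 \<and> mem M (pos e (int i - 1) j 1) = 0 then G (pos e (int i - 1) j 0) else 0)"
    and "(\<Sum>p\<in>Rem e i M. G p) = (\<Sum>j\<in>{- K..K}.
      if mem M (pos e (int i - 1) j 1) = 1 \<and> mem M (pos e (int i - 1) j 0) = 0 then G (pos e (int i - 1) j 0) else 0)"
    and "wt e i M (pos e (int i - 1) m 0) = (\<Sum>j\<in>{m + 1..K}. mem M (pos e (int i - 1) j 0) - mem M (pos e (int i - 1) j 1))"
proof -
  let ?p = "\<lambda>j. pos e (int i - 1) j 0"
  have p1: "pos e (int i - 1) j 1 = ?p j + 1" for j by (simp add: pos_def)
  have res: "(p + 1) mod int e = int i \<longleftrightarrow> (\<exists>j. p = ?p j)" for p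
  proof
    assume "(p + 1) mod int e = int i"
    then have "p = ?p ((p + 1) div int e)"
      using mult_div_mod_eq[of "int e" "p + 1"] by (simp add: pos_def)
    then show "\<exists>j. p = ?p j" ..
  qed (use assms(2) in \<open>auto simp: pos_def\<close>)
  have inj: "inj ?p" using assms(1) by (auto simp: inj_def pos_def)
  have rng: "- K \<le> j \<and> j \<le> K" if "(?p j \<in> M) \<noteq> (?p j + 1 \<in> M)" for j
  proof (rule ccontr)
    assume "\<not> (- K \<le> j \<and> j \<le> K)"
    then consider "j \<le> - K - 1" | "j \<ge> K + 1" by linarith
    then show False
    proof cases
      case 1
      have "int e * j \<le> int e * (- K - 1)" using 1 by (rule mult_left_mono) simp
      then have "?p j + 1 < int i - 1 + int e * (2 - K)" using assms(1) by (simp add: pos_def algebra_simps)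
      then show False using that assms(3) by (simp add: settled_def)
    next
      case 2
      have "?p j \<ge> int i - 1 + int e * K" using 2 assms(1) by (simp add: pos_def)
      then show False using that assms(3) by (simp add: settled_def)
    qed
  qed
  have A: "Add e i M = ?p ` {j \<in> {- K..K}. mem M (?p j) = 1 \<and> mem M (pos e (int i - 1) j 1) = 0}"
    using rng by (auto simp: Add_def res mem_def p1 split: if_splits)
  have R: "Rem e i M = ?p ` {j \<in> {- K..K}. mem M (pos e (int i - 1) j 1) = 1 \<and> mem M (?p j) = 0}"
    using rng by (auto simp: Rem_def res mem_def p1 split: if_splits)
  show "(\<Sum>p\<in>Add e i M. G p) = (\<Sum>j\<in>{- K..K}.
      if mem M (?p j) = 1 \<and> mem M (pos e (int i - 1) j 1) = 0 then G (?p j) else 0)"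
    unfolding A using inj by (subst sum.reindex) (auto intro: inj_on_subset simp: sum.inter_filter[symmetric])
  show "(\<Sum>p\<in>Rem e i M. G p) = (\<Sum>j\<in>{- K..K}.
      if mem M (pos e (int i - 1) j 1) = 1 \<and> mem M (?p j) = 0 then G (?p j) else 0)"
    unfolding R using inj by (subst sum.reindex) (auto intro: inj_on_subset simp: sum.inter_filter[symmetric])
  have less: "?p m < ?p j \<longleftrightarrow> m < j" for j using assms(1) by (simp add: pos_def)
  let ?J = "{m + 1..K}"
  have A': "{q \<in> Add e i M. ?p m < q} = ?p ` {j \<in> ?J. mem M (?p j) = 1 \<and> mem M (pos e (int i - 1) j 1) = 0}"
    using rng less by (force simp: Add_def res mem_def p1 split: if_splits)
  have R': "{q \<in> Rem e i M. ?p m < q} = ?p ` {j \<in> ?J. mem M (pos e (int i - 1) j 1) = 1 \<and> mem M (?p j) = 0}"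
    using rng less by (force simp: Rem_def res mem_def p1 split: if_splits)
  have "int (card {j \<in> ?J. P j}) = (\<Sum>j\<in>?J. if P j then 1 else 0)" for P
    by (subst sum.inter_filter[symmetric]) auto
  then have "wt e i M (?p m) = (\<Sum>j\<in>?J. (if mem M (?p j) = 1 \<and> mem M (pos e (int i - 1) j 1) = 0 then 1 else 0) -
     (if mem M (pos e (int i - 1) j 1) = 1 \<and> mem M (?p j) = 0 then 1 else 0))"
    unfolding wt_def A' R' using inj by (simp add: card_image inj_on_subset sum_subtractf)
  also have "\<dots> = (\<Sum>j\<in>?J. mem M (?p j) - mem M (pos e (int i - 1) j 1))"
    by (intro sum.cong refl) (auto simp: mem_def)
  finally show "wt e i M (?p m) = (\<Sum>j\<in>{m + 1..K}. mem M (?p j) - mem M (pos e (int i - 1) j 1))" .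
qed

lemma settled_mv:
  assumes "settled e r K M" "p < r + int e * K - 1" "p \<ge> r + int e * (2 - K)"
  shows "settled e r K (mv M {p})"
  using assms by (auto simp: settled_def mv_def)

lemma settled_umv:
  assumes "settled e r K M" "p < r + int e * K" "p + 1 \<ge> r + int e * (2 - K)"
  shows "settled e r K (umv M p)"
  using assms by (auto simp: settled_def umv_def)

text \<open>Moving a bead of M into column 1 and moving a bead of X back into column 0 in the same
  row have the same effect on the flow. After the common factor \<open>OT\<close> is taken out, both
  sides are those of \<open>two_runner\<close>.\<close>

theorem strip_commute:
  assumes e: "e \<ge> 2" "i < e" and "mayalike M" "mayalike X"
  shows "(\<Sum>p\<in>Add e i M. vpow (wt e i M p) * strip_coeff e n (mv M {p}) X) =
    (\<Sum>p\<in>Rem e i X. vpow (wt e i X p) * strip_coeff e n M (umv X p))"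
proof -
  define r where "r = int i - 1"
  obtain K1 K2 where "settled e r K1 M" "settled e r K2 X" using settled_ex[of _ e r] assms by fastforce
  \<comment> \<open>One more than both sets require, so that they remain settled after a
    move.\<close>
  define K where "K = max (max K1 K2) 0 + 1"
  have M0: "settled e r (K - 1) M" and X0: "settled e r (K - 1) X"
    by (rule settled_mono, fact, simp add: K_def)+
  have M: "settled e r K M" and X: "settled e r K X"
    using settled_mono[OF M0, of K] settled_mono[OF X0, of K] by simp_all
  have K: "K \<ge> 0" by (simp add: K_def)
  let ?P = "pos e r"
  define f where "f j k = flow e M X (?P j k)" for j k
  define x where "x j k = mem X (?P j k)" for j k
  define y where "y j k = mem M (?P j k)" for j k
  \<comment> \<open>Here f is the flow between M and X before either is changed. A move lowers the
    bottom flow in column 0 by one and raises it in column 1 by one, so the changed flow is finite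
    exactly when f has the bottom values 1 and -1.\<close>
  define OT where "OT = oth e r K n (f (- K) 0 = 1 \<and> f (- K) 1 = - 1) (\<lambda>j. f j 0 + f j 1) (\<lambda>j. x j 0 + x j 1) f x"
  have e1: "e \<ge> 1" using e by simp
  have y: "y j k = x j k + f j k - f (j + 1) k" for j k
    using flow_rec[OF assms(3,4) e1, of "?P j k"] by (simp add: y_def x_def f_def pos_def algebra_simps)
  have dv: "int e dvd (r + int e * m) - (?P j k) \<longleftrightarrow> k = 0" "int e dvd (r + int e * m) + 1 - (?P j k) \<longleftrightarrow> k = 1"
    if "0 \<le> k" "k < int e" for j k m
  proof -
    have "(r + int e * m) - (?P j k) = int e * (m - j) + (- k)" "(r + int e * m) + 1 - (?P j k) = int e * (m - j) + (1 - k)"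
      by (simp_all add: pos_def algebra_simps)
    then have "int e dvd (r + int e * m) - (?P j k) \<longleftrightarrow> int e dvd k" "int e dvd (r + int e * m) + 1 - (?P j k) \<longleftrightarrow> int e dvd k - 1"
      by (simp_all only: dvd_add_triv_left_iff dvd_add_right_iff[OF dvd_triv_left] dvd_minus_iff) (metis dvd_minus_iff minus_diff_eq)
    moreover have "int e dvd k \<longleftrightarrow> k = 0" using that zdvd_imp_le[of "int e" k] by force
    moreover have "int e dvd k - 1 \<longleftrightarrow> k = 1"
      using that e zdvd_imp_le[of "int e" "k - 1"] zdvd_imp_le[of "int e" "1 - k"] dvd_minus_iff[of "int e" "k - 1"] by force
    ultimately show "int e dvd (r + int e * m) - (?P j k) \<longleftrightarrow> k = 0" "int e dvd (r + int e * m) + 1 - (?P j k) \<longleftrightarrow> k = 1" by blast+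
  qed
  define g where "g m j k = (if k = 0 then cutf (\<lambda>j. f j 0) (- 1) m j else if k = 1 then cutf (\<lambda>j. f j 1) 1 m j else f j k)" for m j k
  have gf: "flow e M X (?P j k) - of_bool (?P j k \<le> ?P m 0 \<and> int e dvd ?P m 0 - ?P j k)
     + of_bool (?P j k \<le> ?P m 0 + 1 \<and> int e dvd ?P m 0 + 1 - ?P j k) = g m j k" if k: "0 \<le> k" "k < int e" for j k m
  proof -
    have pm: "?P m 0 = r + int e * m" by (simp add: pos_def)
    have "r + int e * j \<le> r + int e * m \<longleftrightarrow> j \<le> m" using e by simp
    then show ?thesis unfolding pm dv[OF k] by (auto simp: g_def cutf_def f_def pos_def)
  qed
  let ?W = "\<lambda>m h. \<Prod>j\<in>{- K..K}. rw (cutf (\<lambda>j. f j 0) (- 1) m (j + 1)) (cutf (\<lambda>j. f j 1) 1 m (j + 1))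
      (cutf (\<lambda>j. f j 0) (- 1) m j) (cutf (\<lambda>j. f j 1) 1 m j) (x j 0 + h m j) (x j 1 - h m j)"
  have in_rng: "m < K \<and> - K + 1 < m" if "mem Y (?P m 0) \<noteq> mem Y (?P m 1)" "settled e r (K - 1) Y" for m Y
  proof (rule ccontr)
    assume "\<not> (m < K \<and> - K + 1 < m)"
    then consider "m \<ge> K" | "m \<le> - K + 1" by linarith
    then show False
    proof cases
      case 1
      then have "int e * (K - 1) \<le> int e * m" by (intro mult_left_mono) auto
      then have "?P m 0 \<ge> r + int e * (K - 1)" "?P m 1 \<ge> r + int e * (K - 1)" unfolding pos_def by linarith+
      then show False using that by (simp add: settled_def mem_def)
    next
      case 2
      then have "int e * m \<le> int e * (- K + 1)" by (intro mult_left_mono) auto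
      moreover have "int e * (2 - (K - 1)) = int e * (- K + 1) + 2 * int e" by (simp add: algebra_simps)
      moreover have "int e \<ge> 2" using e by simp
      ultimately have "?P m 0 < r + int e * (2 - (K - 1))" "?P m 1 < r + int e * (2 - (K - 1))" unfolding pos_def by linarith+
      then show False using that by (simp add: settled_def mem_def)
    qed
  qed
  have bounds: "?P m 0 < r + int e * K - 1 \<and> ?P m 0 \<ge> r + int e * (2 - K)" if "m < K \<and> - K + 1 < m" for m
  proof -
    have "int e * m \<le> int e * (K - 1)" "int e * (2 - K) \<le> int e * m" using that by (intro mult_left_mono; simp)+
    moreover have "int e * (K - 1) = int e * K - int e" by (simp add: algebra_simps)
    moreover have "int e \<ge> 2" using e by simp
    ultimately show ?thesis unfolding pos_def by linarith
  qed
  have gl: "(g m (- K) 0 = 0 \<and> g m (- K) 1 = 0) \<longleftrightarrow> (f (- K) 0 = 1 \<and> f (- K) 1 = - 1)" if "- K \<le> m" for m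
    using that by (auto simp: g_def cutf_def)
  have gt: "g m j 0 + g m j 1 = f j 0 + f j 1" for m j by (simp add: g_def cutf_def)
  have L: "strip_coeff e n (mv M {?P m 0}) X = OT * ?W m (\<lambda>_ _. 0)" if m: "y m 0 = 1" "y m 1 = 0" for m
  proof -
    have mr: "m < K \<and> - K + 1 < m" using in_rng[OF _ M0, of m] m by (simp add: y_def)
    have mem: "?P m 0 \<in> M" "?P m 0 + 1 \<notin> M" using m by (auto simp: y_def mem_def pos_def split: if_splits)
    have S: "settled e r K (mv M {?P m 0})" using bounds[OF mr] by (intro settled_mv M) auto
    have fl: "flow e (mv M {?P m 0}) X (?P j k) = g m j k" if "0 \<le> k" "k < int e" for j k
      using flow_mv[OF assms(3) mem] gf[OF that] by simp
    have fl0: "flow e (mv M {?P m 0}) X (?P j 0) = g m j 0" and fl1: "flow e (mv M {?P m 0}) X (?P j 1) = g m j 1" for j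
      using e by (auto intro: fl)
    show ?thesis
      unfolding strip_coeff_rows[OF e(1) K S X] fl0 fl1 OT_def
    proof (rule arg_cong2[where f="(*)"])
      show "oth e r K n (g m (- K) 0 = 0 \<and> g m (- K) 1 = 0) (\<lambda>j. g m j 0 + g m j 1) (\<lambda>j. mem X (?P j 0) + mem X (?P j 1))
         (\<lambda>j k. flow e (mv M {?P m 0}) X (?P j k)) (\<lambda>j k. mem X (?P j k)) =
        oth e r K n (f (- K) 0 = 1 \<and> f (- K) 1 = - 1) (\<lambda>j. f j 0 + f j 1) (\<lambda>j. x j 0 + x j 1) f x"
      proof (rule oth_cong)
        show "(g m (- K) 0 = 0 \<and> g m (- K) 1 = 0) = (f (- K) 0 = 1 \<and> f (- K) 1 = - 1)" using mr by (intro gl) simp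
        show "flow e (mv M {?P m 0}) X (?P j k) = f j k" if "k \<in> {2..<int e}" for j k
          using that fl[of k j] by (simp add: g_def)
      qed (simp_all only: gt x_def)
    qed (simp add: g_def x_def)
  qed
  have R: "strip_coeff e n M (umv X (?P m 0)) = OT * ?W m (\<lambda>m j. of_bool (j = m))" if m: "x m 1 = 1" "x m 0 = 0" for m
  proof -
    have mr: "m < K \<and> - K + 1 < m" using in_rng[OF _ X0, of m] m by (simp add: x_def)
    have mem: "?P m 0 \<notin> X" "?P m 0 + 1 \<in> X"
      using m by (auto simp: x_def mem_def pos_def split: if_splits)
    have S: "settled e r K (umv X (?P m 0))" using bounds[OF mr] by (intro settled_umv X) auto
    have fl: "flow e M (umv X (?P m 0)) (?P j k) = g m j k" if "0 \<le> k" "k < int e" for j k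
      using flow_umv[OF assms(4) mem] gf[OF that] by simp
    have fl0: "flow e M (umv X (?P m 0)) (?P j 0) = g m j 0" and fl1: "flow e M (umv X (?P m 0)) (?P j 1) = g m j 1" for j
      using e by (auto intro: fl)
    have pe: "?P j k = ?P m 0 \<longleftrightarrow> j = m \<and> k = 0" "?P j k = ?P m 0 + 1 \<longleftrightarrow> j = m \<and> k = 1" if "0 \<le> k" "k < int e" for j k
      using pos_eq_iff[of k e 0 r j m] pos_eq_iff[of k e 1 r j m] that e by (auto simp: pos_def)
    have xm: "mem (umv X (?P m 0)) (?P j k) = x j k + of_bool (j = m \<and> k = 0) - of_bool (j = m \<and> k = 1)" if "0 \<le> k" "k < int e" for j k
      using pe[OF that, of j] mem by (auto simp: umv_def mem_def x_def)
    have xm0: "mem (umv X (?P m 0)) (?P j 0) = x j 0 + of_bool (j = m)" and xm1: "mem (umv X (?P m 0)) (?P j 1) = x j 1 - of_bool (j = m)" for j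
      using e xm[of 0 j] xm[of 1 j] by auto
    show ?thesis
      unfolding strip_coeff_rows[OF e(1) K M S] fl0 fl1 xm0 xm1 OT_def
    proof (rule arg_cong2[where f="(*)"])
      show "oth e r K n (g m (- K) 0 = 0 \<and> g m (- K) 1 = 0) (\<lambda>j. g m j 0 + g m j 1) (\<lambda>j. x j 0 + of_bool (j = m) + (x j 1 - of_bool (j = m)))
         (\<lambda>j k. flow e M (umv X (?P m 0)) (?P j k)) (\<lambda>j k. mem (umv X (?P m 0)) (?P j k)) =
        oth e r K n (f (- K) 0 = 1 \<and> f (- K) 1 = - 1) (\<lambda>j. f j 0 + f j 1) (\<lambda>j. x j 0 + x j 1) f x"
      proof (rule oth_cong)
        show "(g m (- K) 0 = 0 \<and> g m (- K) 1 = 0) = (f (- K) 0 = 1 \<and> f (- K) 1 = - 1)" using mr by (intro gl) simp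
        show "flow e M (umv X (?P m 0)) (?P j k) = f j k" if "k \<in> {2..<int e}" for j k
          using that fl[of k j] by (simp add: g_def)
        show "mem (umv X (?P m 0)) (?P j k) = x j k" if "k \<in> {2..<int e}" for j k
          using that xm[of k j] by simp
      qed (simp_all add: gt)
    qed (simp add: g_def)
  qed
  define k where "k m = (\<Sum>j\<in>{m..K}. x j 0 - x j 1)" for m
  have fK: "f (K + 1) j = 0" if "j \<ge> 0" for j
    unfolding f_def by (rule flow_high[OF M X]) (use that e in \<open>simp add: pos_def algebra_simps\<close>)
  have wtX: "wt e i X (?P m 0) = k (m + 1)" for m
    using sum_Add_rows(3)[OF e X[unfolded r_def], of m] by (simp add: k_def x_def r_def)
  have wtM: "wt e i M (?P m 0) = k (m + 1) + f (m + 1) 0 - f (m + 1) 1" if "m \<in> {- K..K}" for m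
  proof -
    have "wt e i M (?P m 0) = (\<Sum>j\<in>{m + 1..K}. y j 0 - y j 1)"
      using sum_Add_rows(3)[OF e M[unfolded r_def], of m] by (simp add: y_def r_def)
    also have "\<dots> = (\<Sum>j\<in>{m + 1..K}. (x j 0 - x j 1) + ((f j 0 - f j 1) - (f (j + 1) 0 - f (j + 1) 1)))"
      by (intro sum.cong refl) (simp add: y)
    also have "\<dots> = k (m + 1) + ((f (m + 1) 0 - f (m + 1) 1) - (f (K + 1) 0 - f (K + 1) 1))"
      unfolding sum.distrib k_def using that
      by (subst int_telescope[of "m + 1" K "\<lambda>j. f j 0 - f j 1"]) auto
    finally show ?thesis by (simp add: fK)
  qed
  have "(\<Sum>p\<in>Add e i M. vpow (wt e i M p) * strip_coeff e n (mv M {p}) X) =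
    (\<Sum>m\<in>{- K..K}. if y m 0 = 1 \<and> y m 1 = 0 then vpow (wt e i M (?P m 0)) * strip_coeff e n (mv M {?P m 0}) X else 0)"
    using sum_Add_rows(1)[OF e M[unfolded r_def], of "\<lambda>p. vpow (wt e i M p) * strip_coeff e n (mv M {p}) X"]
    unfolding y_def r_def .
  also have "\<dots> = OT * (\<Sum>m\<in>{- K..K}. if y m 0 = 1 \<and> y m 1 = 0 then vpow (k (m + 1) + f (m + 1) 0 - f (m + 1) 1) * ?W m (\<lambda>_ _. 0) else 0)"
    unfolding sum_distrib_left by (intro sum.cong refl) (simp add: wtM L mult.left_commute)
  finally have LHS: "(\<Sum>p\<in>Add e i M. vpow (wt e i M p) * strip_coeff e n (mv M {p}) X) = \<dots>" .
  have "(\<Sum>p\<in>Rem e i X. vpow (wt e i X p) * strip_coeff e n M (umv X p)) =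
    (\<Sum>m\<in>{- K..K}. if x m 1 = 1 \<and> x m 0 = 0 then vpow (wt e i X (?P m 0)) * strip_coeff e n M (umv X (?P m 0)) else 0)"
    using sum_Add_rows(2)[OF e X[unfolded r_def], of "\<lambda>p. vpow (wt e i X p) * strip_coeff e n M (umv X p)"]
    unfolding x_def r_def .
  also have "\<dots> = OT * (\<Sum>m\<in>{- K..K}. if x m 1 = 1 \<and> x m 0 = 0 then vpow (k (m + 1)) * ?W m (\<lambda>m j. of_bool (j = m)) else 0)"
    unfolding sum_distrib_left by (intro sum.cong refl) (simp add: wtX R mult.left_commute)
  finally have RHS: "(\<Sum>p\<in>Rem e i X. vpow (wt e i X p) * strip_coeff e n M (umv X p)) = \<dots>" .
  show ?thesis
  proof (cases "f (- K) 1 = - 1")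
    case False
    then have "OT = 0" by (simp add: OT_def oth_def)
    then show ?thesis unfolding LHS RHS by simp
  next
    case True
    have bin: "x j 0 \<in> {0, 1} \<and> x j 1 \<in> {0, 1} \<and> x j 0 + f j 0 - f (j + 1) 0 \<in> {0, 1} \<and> x j 1 + f j 1 - f (j + 1) 1 \<in> {0, 1}" for j
      unfolding y[symmetric] by (simp add: x_def y_def mem_def)
    have "f (- K) 1 \<noteq> 0" using True by simp
    from two_runner[where u="\<lambda>j. x j 0" and f="\<lambda>j. f j 0" and u'="\<lambda>j. x j 1" and f'="\<lambda>j. f j 1",
      OF bin K fK[OF order_refl] this]
    show ?thesis unfolding LHS RHS y k_def by (simp only: add_0_right diff_0_right)
  qed
qed

section \<open>The strip forms vanish on \<open>L e\<close>\<close>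

definition strip_form :: "nat \<Rightarrow> nat \<Rightarrow> int set \<Rightarrow> fock \<Rightarrow> laurent" where
  "strip_form e n X x = (\<Sum>lam\<in>Poly_Mapping.keys x. Poly_Mapping.lookup x lam * strip_coeff e n (maya lam) X)"

lemma strip_form_superset:
  "finite A \<Longrightarrow> Poly_Mapping.keys x \<subseteq> A \<Longrightarrow>
    strip_form e n X x = (\<Sum>lam\<in>A. Poly_Mapping.lookup x lam * strip_coeff e n (maya lam) X)"
  unfolding strip_form_def by (intro sum.mono_neutral_left) (auto simp: in_keys_iff)

lemma strip_form_add: "strip_form e n X (x + y) = strip_form e n X x + strip_form e n X y"
proof -
  let ?A = "Poly_Mapping.keys x \<union> Poly_Mapping.keys y \<union> Poly_Mapping.keys (x + y)"
  have "strip_form e n X (x + y) = (\<Sum>lam\<in>?A. Poly_Mapping.lookup (x + y) lam * strip_coeff e n (maya lam) X)"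
    "strip_form e n X x = (\<Sum>lam\<in>?A. Poly_Mapping.lookup x lam * strip_coeff e n (maya lam) X)"
    "strip_form e n X y = (\<Sum>lam\<in>?A. Poly_Mapping.lookup y lam * strip_coeff e n (maya lam) X)"
    by (rule strip_form_superset; force)+
  then show ?thesis by (simp add: lookup_add distrib_right sum.distrib)
qed

lemma strip_form_scale: "strip_form e n X (scale c x) = c * strip_form e n X x"
proof -
  have "strip_form e n X (scale c x) = (\<Sum>lam\<in>Poly_Mapping.keys x. Poly_Mapping.lookup (scale c x) lam * strip_coeff e n (maya lam) X)"
    by (rule strip_form_superset) (auto simp: in_keys_iff lookup_scale)
  then show ?thesis by (simp add: strip_form_def lookup_scale sum_distrib_left mult.assoc)
qed

lemma strip_form_0 [simp]: "strip_form e n X 0 = 0"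
  by (simp add: strip_form_def)

lemma strip_form_sum: "strip_form e n X (sum f A) = (\<Sum>a\<in>A. strip_form e n X (f a))"
  by (induction A rule: infinite_finite_induct) (auto simp: strip_form_add)

lemma strip_form_basis: "strip_form e n X (basis lam) = strip_coeff e n (maya lam) X"
  by (simp add: strip_form_def basis_def)

lemma strip_form_F:
  assumes "e \<ge> 2" "i < e" "mayalike X"
  shows "strip_form e n X (F e i x) = (\<Sum>p\<in>Rem e i X. vpow (wt e i X p) * strip_form e n (umv X p) x)"
proof -
  interpret F: module_hom scale scale "F e i" using assms(1) by (intro flinear_F) simp
  have b: "strip_form e n X (F e i (basis lam)) = (\<Sum>p\<in>Rem e i X. vpow (wt e i X p) * strip_coeff e n (maya lam) (umv X p))" for lam
    using assms maya_move_Add[of "{_}" e i lam] strip_commute[OF assms(1,2) mayalike_maya assms(3), of lam n]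
    by (simp add: F_basis strip_form_sum strip_form_scale strip_form_basis)
  have "strip_form e n X (F e i x) = (\<Sum>lam\<in>Poly_Mapping.keys x. Poly_Mapping.lookup x lam * strip_form e n X (F e i (basis lam)))"
    by (subst fock_expand[of x]) (simp add: F.sum F.scale strip_form_sum strip_form_scale)
  also have "\<dots> = (\<Sum>p\<in>Rem e i X. vpow (wt e i X p) * strip_form e n (umv X p) x)"
    unfolding b sum_distrib_left
    by (subst sum.swap) (simp add: strip_form_def sum_distrib_left mult.left_commute)
  finally show ?thesis .
qed

lemma maya_empty: "maya empty_partition = {..<0}"
  using maya_low[of empty_partition 0] maya_le[of _ empty_partition] by auto

lemma strip_coeff_nonzeroD:
  assumes "strip_coeff e n M X \<noteq> 0" "mayalike M" "mayalike X" "e \<ge> 1"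
  defines "f \<equiv> flow e M X" and "Z \<equiv> {p. flow e M X p \<noteq> 0}"
  shows "finite Z" "card Z = n" "\<And>p. f p = (if p \<in> Z then 1 else 0)" "Z \<inter> X = {}"
    "\<And>p. mem M p = mem X p + f p - f (p + int e)"
    "strip_coeff e n M X = negv (- (\<Sum>p\<in>Z. \<Sum>q\<in>{p - int e + 1..p - 1}. mem X q + f q))"
    "\<And>p. mem X p + f p \<in> {0, 1}"
proof -
  have *: "finite Z" "sum f Z = int n" "\<And>p. f p \<in> {0, 1} \<and> mem X p + f p \<in> {0, 1}"
    using assms(1) unfolding strip_coeff_def f_def Z_def by (auto split: if_splits)
  show f: "f p = (if p \<in> Z then 1 else 0)" for p using *(3)[of p] by (auto simp: Z_def f_def)
  show "finite Z" by fact
  show "card Z = n" using *(2) f by simp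
  show "Z \<inter> X = {}"
  proof (rule equals0I)
    fix p assume "p \<in> Z \<inter> X"
    then show False using *(3)[of p] f[of p] by (simp add: mem_def)
  qed
  show "mem M p = mem X p + f p - f (p + int e)" for p
    using flow_rec[OF assms(2,3,4), of p] by (simp add: f_def)
  show "mem X p + f p \<in> {0, 1}" for p using *(3) by blast
  have "strip_coeff e n M X = negv (- (\<Sum>p\<in>Z. f p * (\<Sum>q\<in>{p - int e + 1..p - 1}. mem X q + f q)))"
    using assms(1) unfolding strip_coeff_def f_def Z_def by (auto split: if_splits)
  also have "(\<Sum>p\<in>Z. f p * (\<Sum>q\<in>{p - int e + 1..p - 1}. mem X q + f q)) = (\<Sum>p\<in>Z. \<Sum>q\<in>{p - int e + 1..p - 1}. mem X q + f q)"
    by (intro sum.cong refl) (simp add: f)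
  finally show "strip_coeff e n M X = negv (- (\<Sum>p\<in>Z. \<Sum>q\<in>{p - int e + 1..p - 1}. mem X q + f q))" .
qed

lemma mem_nonneg: "0 \<le> mem X p" and mem_le_1: "mem X p \<le> 1"
  by (simp_all add: mem_def)

text \<open>The rightmost crossing starts at a bead of M, and the leftmost one ends at a place that
  is free in M. For the vacuum the bead is at a negative place and the free place is not, which
  contradicts their order.\<close>

lemma strip_coeff_empty:
  assumes "e \<ge> 1" "n \<ge> 1" "mayalike X" shows "strip_coeff e n (maya empty_partition) X = 0"
proof (rule ccontr)
  assume nz: "strip_coeff e n (maya empty_partition) X \<noteq> 0"
  let ?Z = "{p. flow e (maya empty_partition) X p \<noteq> 0}"
  note D = strip_coeff_nonzeroD[OF nz mayalike_maya assms(3,1)]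
  have ne: "?Z \<noteq> {}"
  proof
    assume "?Z = {}"
    with D(2) assms(2) show False by (simp only: card.empty)
  qed
  define q where "q = Max ?Z"
  define p where "p = Min ?Z"
  have q: "q \<in> ?Z" unfolding q_def by (rule Max_in[OF D(1) ne])
  have p: "p \<in> ?Z" unfolding p_def by (rule Min_in[OF D(1) ne])
  have "p \<le> q" unfolding p_def by (rule Min_le[OF D(1) q])
  have q': "q + int e \<notin> ?Z" using Max_ge[OF D(1), of "q + int e"] assms(1) unfolding q_def by linarith
  have p': "p - int e \<notin> ?Z" using Min_le[OF D(1), of "p - int e"] assms(1) unfolding p_def by linarith
  let ?M = "maya empty_partition"
  have fs: "flow e ?M X q = 1" "flow e ?M X (q + int e) = 0" "flow e ?M X p = 1" "flow e ?M X (p - int e) = 0"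
    using D(3)[of q] D(3)[of "q + int e"] D(3)[of p] D(3)[of "p - int e"] q q' p p' by (simp_all only: if_True if_False)
  have "mem ?M q \<ge> 1" using D(5)[of q] mem_nonneg[of X q] unfolding fs by linarith
  moreover have "mem ?M (p - int e) \<le> 0"
    using D(5)[of "p - int e"] mem_le_1[of X "p - int e"] fs by simp
  ultimately have "q \<in> ?M" "p - int e \<notin> ?M" by (simp_all add: mem_def split: if_splits)
  then have "q < 0" "\<not> p - int e < 0" by (simp_all add: maya_empty)
  then show False using \<open>p \<le> q\<close> assms(1) by simp
qed

text \<open>All sets X are treated at once, since pulling the form through an \<open>F\<close>
  replaces X by sets with one bead moved back. The quantum factorial of a divided power cancels
  because the Laurent polynomials form a domain.\<close>

theorem strip_relation:
  assumes "e \<ge> 2" "x \<in> L e" "n \<ge> 1" "mayalike X"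
  shows "strip_form e n X x = 0"
  using assms(2,4)
proof (induction arbitrary: X rule: L_induct)
  case empty
  then show ?case using strip_coeff_empty[of e n X] assms by (simp add: strip_form_basis)
next
  case (add x y)
  then show ?case by (simp add: strip_form_add)
next
  case (scale c x)
  then show ?case by (simp add: strip_form_scale)
next
  case (Fdiv i a x)
  have "strip_form e n X ((F e i ^^ a) x) = 0" if "mayalike X" for X
    using that
  proof (induction a arbitrary: X)
    case (Suc a)
    then show ?case using assms(1) Fdiv.hyps by (simp add: strip_form_F mayalike_umv)
  qed (use Fdiv.IH in simp)
  from this[OF Fdiv.prems] show ?case
    unfolding scale_Fdiv[OF assms(1), symmetric] strip_form_scale by simp
qed

section \<open>Dominance, rank and regularity\<close>

text \<open>
  The sum of the squared bead positions, normalised: it is strictly increasing for dominance, and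
  moving beads apart increases it.
\<close>

definition rk :: "partition \<Rightarrow> int" where
  "rk lam = (\<Sum>c=1..plen lam. int (part lam c) * (int (part lam c) - 2 * int c))"

lemma rk_eq: "plen lam \<le> K \<Longrightarrow> rk lam = (\<Sum>c=1..K. int (part lam c) * (int (part lam c) - 2 * int c))"
  unfolding rk_def by (intro sum.mono_neutral_left) (auto intro: part_beyond_plen)

lemma rk_beads:
  assumes "plen lam \<le> K"
  shows "rk lam = (\<Sum>p\<in>maya lam \<inter> {- int K..}. p\<^sup>2) - (\<Sum>c=1..K. (int c)\<^sup>2)"
proof -
  have "inj_on (bead lam) {1..K}" by (rule inj_on_subset[OF inj_on_bead]) auto
  then have eq: "(\<Sum>p\<in>maya lam \<inter> {- int K..}. p\<^sup>2) = (\<Sum>c=1..K. (bead lam c)\<^sup>2)"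
    unfolding maya_ge_eq[OF assms] by (simp add: sum.reindex)
  show ?thesis unfolding rk_eq[OF assms] eq sum_subtractf[symmetric]
    by (intro sum.cong refl) (simp add: bead_def power2_eq_square algebra_simps)
qed

lemma dominates_trans: "dominates \<mu> \<nu> \<Longrightarrow> dominates \<nu> lam \<Longrightarrow> dominates \<mu> lam"
  unfolding dominates_def by (metis order_trans)

lemma abel_sum:
  fixes d g :: "nat \<Rightarrow> int"
  shows "(\<Sum>c=1..K. d c * g c) = (\<Sum>c=1..K. (\<Sum>i=1..c. d i) * (g c - g (Suc c))) + (\<Sum>i=1..K. d i) * g (Suc K)"
  by (induction K) (simp_all add: algebra_simps)

text \<open>By Abel summation the difference of ranks is the sum of the differences of partial sums,
  which dominance makes nonnegative, each times a drop of g by at least 2; one of them is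
  positive.\<close>

lemma dominates_rk:
  assumes "dominates \<mu> lam" "lam \<noteq> \<mu>" shows "rk lam < rk \<mu>"
proof -
  define K where "K = max (plen lam) (plen \<mu>)"
  have pl: "plen lam \<le> K" "plen \<mu> \<le> K" by (simp_all add: K_def)
  define d where "d c = int (part \<mu> c) - int (part lam c)" for c
  define g where "g c = int (part \<mu> c) + int (part lam c) - 2 * int c" for c
  have D: "(\<Sum>i=1..c. d i) \<ge> 0" for c
  proof -
    have "int (\<Sum>i=1..c. part lam i) \<le> int (\<Sum>i=1..c. part \<mu> i)"
      using assms(1) unfolding dominates_def by (intro of_nat_mono) blast
    then show ?thesis by (simp add: d_def sum_subtractf)
  qed
  have "psize lam = psize \<mu>" using assms(1) by (simp add: dominates_def)
  then have "(\<Sum>i=1..K. part lam i) = (\<Sum>i=1..K. part \<mu> i)"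
    unfolding psize_eq_sum[OF pl(1)] psize_eq_sum[OF pl(2)] .
  then have DK: "(\<Sum>i=1..K. d i) = 0" unfolding d_def sum_subtractf by (simp flip: of_nat_sum)
  have g: "g c - g (Suc c) \<ge> 2" if "c \<ge> 1" for c
    using part_Suc_le[OF that, of \<mu>] part_Suc_le[OF that, of lam] by (simp add: g_def)
  have "rk \<mu> - rk lam = (\<Sum>c=1..K. d c * g c)"
    unfolding rk_eq[OF pl(1)] rk_eq[OF pl(2)] sum_subtractf[symmetric]
    by (intro sum.cong refl) (simp add: d_def g_def algebra_simps)
  also have "\<dots> = (\<Sum>c=1..K. (\<Sum>i=1..c. d i) * (g c - g (Suc c)))"
    using abel_sum[of d g K] DK by simp
  also have "\<dots> > 0"
  proof -
    have "\<exists>c\<ge>1. d c \<noteq> 0"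
    proof (rule ccontr)
      assume "\<not> (\<exists>c\<ge>1. d c \<noteq> 0)"
      then have "lam = \<mu>" by (intro partition_eqI) (simp add: d_def)
      with assms(2) show False ..
    qed
    then obtain c where c: "c \<ge> 1" "d c \<noteq> 0" by blast
    have "\<exists>c\<in>{1..K}. (\<Sum>i=1..c. d i) \<noteq> 0"
    proof (rule ccontr)
      assume *: "\<not> (\<exists>c\<in>{1..K}. (\<Sum>i=1..c. d i) \<noteq> 0)"
      have "c \<le> K"
      proof (rule ccontr)
        assume "\<not> c \<le> K"
        then show False using c(2) part_beyond_plen[of lam c] part_beyond_plen[of \<mu> c] pl by (simp add: d_def)
      qed
      then have "(\<Sum>i=1..c. d i) = 0" using * c(1) by simp
      moreover have "(\<Sum>i=1..c - 1. d i) = 0"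
      proof (cases "c = 1")
        case False
        then have "c - 1 \<in> {1..K}" using c(1) \<open>c \<le> K\<close> unfolding atLeastAtMost_iff by arith
        then show ?thesis using * by blast
      qed simp
      moreover have "(\<Sum>i=1..c. d i) = (\<Sum>i=1..c - 1. d i) + d c" using c(1) by (cases c) auto
      ultimately show False using c(2) by simp
    qed
    then obtain a where a: "a \<in> {1..K}" "(\<Sum>i=1..a. d i) > 0" using D by (metis order_le_less)
    show ?thesis
    proof (rule sum_pos2[OF _ a(1)])
      show "0 < (\<Sum>i=1..a. d i) * (g a - g (Suc a))" using a g[of a] by (intro mult_pos_pos) auto
      show "0 \<le> (\<Sum>i=1..i. d i) * (g i - g (Suc i))" if "i \<in> {1..K}" for i
        using that g[of i] D[of i] by (intro mult_nonneg_nonneg) auto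
    qed simp
  qed
  finally show ?thesis by simp
qed

text \<open>Rows of equal length have consecutive beads. The place p before the bead of the last of
  them is free because the next row is shorter.\<close>

lemma nonregularD:
  assumes "e \<ge> 1" "\<not> regular e lam"
  shows "\<exists>p. p \<notin> maya lam \<and> {p + 1..p + int e} \<subseteq> maya lam"
proof -
  obtain m where m: "m \<ge> 1" "card {i. part lam i = m} \<ge> e" using assms(2) by (auto simp: regular_def not_less)
  let ?I = "{i. part lam i = m}"
  have fin: "finite ?I" by (rule finite_subset[OF _ finite_part_support[of lam]]) (use m in auto)
  have ne: "?I \<noteq> {}"
  proof
    assume "?I = {}"
    with m assms(1) show False by (simp only: card.empty)
  qed
  define c where "c = Max ?I"
  have c: "part lam c = m" using Max_in[OF fin ne] by (simp add: c_def)
  have c1: "c \<ge> 1" using c m by (cases c) auto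
  have cmax: "i \<le> c" if "part lam i = m" for i using Max_ge[OF fin, of i] that by (simp add: c_def)
  have cmin: "\<exists>i. part lam i = m \<and> i + e \<le> c + 1"
  proof (rule ccontr)
    assume "\<not> ?thesis"
    then have "?I \<subseteq> {c + 2 - e..c}" using cmax by force
    then have "card ?I \<le> card {c + 2 - e..c}" by (intro card_mono) auto
    moreover have "0 \<notin> ?I" using m by auto
    then have "?I \<subseteq> {1..c}" using cmax by (force simp: Suc_le_eq)
    then have "card ?I \<le> c" using card_mono[of "{1..c}" ?I] by simp
    ultimately show False using m assms(1) c1 by auto
  qed
  then obtain a where a: "part lam a = m" "a + e \<le> c + 1" by blast
  have a1: "a \<ge> 1" using a m by (cases a) auto
  define p where "p = bead lam c - 1"
  have "p \<notin> maya lam"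
  proof
    assume "p \<in> maya lam"
    then obtain c' where c': "c' \<ge> 1" "bead lam c' = p" by (auto elim: mayaE)
    then have "c < c'" using bead_less_iff[OF c1 c'(1), of lam] by (simp add: p_def)
    then have "part lam c' \<le> m" using part_antimono[of c c' lam] c c1 by simp
    then have "part lam c' = m" using c' \<open>c < c'\<close> c by (simp add: p_def bead_def)
    then show False using cmax[of c'] \<open>c < c'\<close> by simp
  qed
  moreover have "{p + 1..p + int e} \<subseteq> maya lam"
  proof
    fix q assume q: "q \<in> {p + 1..p + int e}"
    define i where "i = c - nat (q - (p + 1))"
    have nat: "nat (q - (p + 1)) \<le> e - 1" using q by auto
    then have i: "a \<le> i" "i \<le> c" "int i = int c - (q - (p + 1))" using a(2) a1 q by (auto simp: i_def)
    then have "part lam i = m" using part_antimono[of a i lam] part_antimono[of i c lam] a c a1 by simp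
    then have "bead lam i = q" using i c by (simp add: bead_def p_def)
    then show "q \<in> maya lam" using i a1 by (metis bead_in_maya le_trans)
  qed
  ultimately show ?thesis by blast
qed

lemma consecutive_beads:
  assumes "c \<ge> 1" "\<And>q. q \<in> {bead lam c - int t..bead lam c} \<Longrightarrow> q \<in> maya lam" "i \<le> t"
  shows "bead lam (c + i) = bead lam c - int i"
  using assms(3)
proof (induction i)
  case (Suc i)
  then have IH: "bead lam (c + i) = bead lam c - int i" by simp
  have "bead lam (c + i) - 1 \<in> maya lam" using assms(2) Suc.prems IH by simp
  then obtain c' where c': "c' \<ge> 1" "bead lam c' = bead lam (c + i) - 1" by (auto elim: mayaE)
  then have "c + i < c'" using bead_less_iff[of "c + i" c' lam] assms(1) by simp
  moreover have "bead lam (c + Suc i) < bead lam (c + i)" using assms(1) by (intro bead_mono) auto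
  ultimately have "bead lam (c + Suc i) = bead lam (c + i) - 1"
    using bead_mono[of "c + Suc i" c' lam] c' assms(1) by (cases "c' = c + Suc i") auto
  then show ?case using IH by simp
qed simp

lemma nonregularI:
  assumes "e \<ge> 1" "p \<notin> maya lam" "{p + 1..p + int e} \<subseteq> maya lam"
  shows "\<not> regular e lam"
proof -
  have "p + int e \<in> maya lam" using assms by auto
  then obtain c where c: "c \<ge> 1" "bead lam c = p + int e" by (auto elim: mayaE)
  have b: "bead lam (c + i) = bead lam c - int i" if "i \<le> e - 1" for i
    using assms(1,3) by (intro consecutive_beads[OF c(1) _ that]) (auto simp: c(2) of_nat_diff)
  have eq: "part lam (c + i) = part lam c" if "i \<le> e - 1" for i
    using b[OF that] by (simp add: bead_def)
  \<comment> \<open>If row c were empty, row c + e would be empty too and its bead would occupy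
    p.\<close>
  have "part lam c \<ge> 1"
  proof (rule ccontr)
    assume "\<not> part lam c \<ge> 1"
    then have "part lam c = 0" "part lam (c + e) = 0" using part_antimono[of c "c + e" lam] c by auto
    then have "bead lam (c + e) = p" using c by (simp add: bead_def)
    then show False using assms(2) bead_in_maya[of "c + e" lam] c(1) by simp
  qed
  moreover have "e \<le> card {i. part lam i = part lam c}"
  proof -
    have "(\<lambda>i. c + i) ` {..e - 1} \<subseteq> {i. part lam i = part lam c}" using eq by auto
    moreover have "finite {i. part lam i = part lam c}"
      by (rule finite_subset[OF _ finite_part_support[of lam]]) (use calculation \<open>part lam c \<ge> 1\<close> in auto)
    ultimately have "card ((\<lambda>i. c + i) ` {..e - 1}) \<le> card {i. part lam i = part lam c}" by (rule card_mono[rotated])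
    then show ?thesis using assms(1) by (simp add: card_image)
  qed
  ultimately show ?thesis by (auto simp: regular_def not_less)
qed

text \<open>Conservation of beads along each runner is a recursion towards smaller places, and it
  starts from zero far to the right.\<close>

lemma flow_unique:
  assumes "mayalike M" "mayalike X" "e \<ge> 1" "\<And>p. g p = g (p + int e) + mem M p - mem X p" "\<And>p. p \<ge> B \<Longrightarrow> g p = 0"
  shows "flow e M X p = g p"
proof -
  obtain K where "settled e 0 K M" "settled e 0 K X"
    using settled_ex[OF assms(1,3), of 0] settled_ex[OF assms(2,3), of 0] settled_mono by (metis linorder_le_cases)
  then have high: "p \<ge> int e * K \<Longrightarrow> flow e M X p = 0" for p using flow_high by fastforce
  define C where "C = max B (int e * K)"
  have "p \<ge> C - int n * int e \<Longrightarrow> flow e M X p = g p" for n p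
  proof (induction n arbitrary: p)
    case 0
    then show ?case using high assms(5) by (simp add: C_def)
  next
    case (Suc n)
    have "p + int e \<ge> C - int n * int e" using Suc.prems by (simp add: algebra_simps)
    from Suc.IH[OF this] show ?case using flow_rec[OF assms(1-3), of p] assms(4)[of p] by simp
  qed
  moreover have "p \<ge> C - int (nat (C - p)) * int e"
  proof -
    have "int (nat (C - p)) * 1 \<le> int (nat (C - p)) * int e" using assms(3) by (intro mult_left_mono) auto
    then show ?thesis by linarith
  qed
  ultimately show ?thesis by blast
qed

text \<open>For a nonregular \<open>lam0\<close> the strip is chosen as high as possible, so that
  (-v) occurs to its lowest power. Every other partition over the same X has larger rank, and it has
  the same power of -v only if it is nonregular as well. So the relation from X expresses the
  coefficient at \<open>lam0\<close> by coefficients of larger rank, with a positive power of -v in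
  front of every regular one.\<close>

lemma strip_coeff_nonregular:
  assumes e: "e \<ge> 1" and p: "p \<notin> maya lam0" "{p + 1..p + int e} \<subseteq> maya lam0"
  obtains X m where "mayalike X" "m \<ge> 1" "strip_coeff e m (maya lam0) X = negv (- (int m * (int e - 1)))"
    "\<And>lam. strip_coeff e m (maya lam) X \<noteq> 0 \<Longrightarrow> lam \<noteq> lam0 \<Longrightarrow> rk lam0 < rk lam"
    "\<And>lam. strip_coeff e m (maya lam) X \<noteq> 0 \<Longrightarrow> \<exists>E. strip_coeff e m (maya lam) X = negv (- E) \<and> E \<le> int m * (int e - 1) \<and>
       (E = int m * (int e - 1) \<longrightarrow> \<not> regular e lam)"
proof -
  let ?M = "maya lam0"
  \<comment> \<open>All gaps up to p are filled at once, each by a single crossing from e places to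
    the right. During the passage every place up to p + e is occupied, so each of the m crossings
    jumps over e - 1 beads.\<close>
  define Y where "Y = {q. q \<le> p \<and> q \<notin> ?M}"
  define Z where "Z = (\<lambda>q. q + int e) ` Y"
  define W where "W = ?M \<union> {..p + int e}"
  define X where "X = W - Z"
  define m where "m = card Y"
  obtain a z where az: "{..<a} \<subseteq> ?M" "?M \<subseteq> {..<z}" using mayalike_maya[of lam0] unfolding mayalike_def by blast
  have "Y \<subseteq> {a..p}"
  proof
    fix q assume "q \<in> Y"
    then have "q \<notin> {..<a}" "q \<le> p" using az by (auto simp: Y_def)
    then show "q \<in> {a..p}" by simp
  qed
  then have finY: "finite Y" by (rule finite_subset) simp
  have YW: "q \<in> Y \<longleftrightarrow> q \<in> W \<and> q \<notin> ?M" for q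
    using p(2) by (auto simp: Y_def W_def) (metis atLeastAtMost_iff not_less subsetD zle_add1_eq_le add.commute)
  have ZW: "Z \<subseteq> {..p + int e}" by (auto simp: Z_def Y_def)
  then have ZW': "Z \<subseteq> W" by (auto simp: W_def)
  have finZ: "finite Z" using finY by (simp add: Z_def)
  have cZ: "card Z = m" by (simp add: Z_def m_def card_image)
  have m1: "m \<ge> 1" using finY p(1) by (auto simp: m_def Y_def Suc_le_eq card_gt_0_iff)
  have Zcompl: "q \<in> Z \<longleftrightarrow> q \<notin> X" if "q \<le> p + int e" for q
    using that ZW' by (auto simp: X_def W_def)
  have X: "mayalike X"
  proof -
    have "{..<a} \<subseteq> X"
    proof
      fix q assume q: "q \<in> {..<a}"
      then have "q \<in> W" using az by (auto simp: W_def)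
      moreover have "q \<notin> Z"
      proof
        assume "q \<in> Z"
        then have "q - int e \<notin> ?M" by (auto simp: Z_def Y_def)
        moreover have "q - int e \<in> {..<a}" using q by simp
        ultimately show False using az by auto
      qed
      ultimately show "q \<in> X" by (simp add: X_def)
    qed
    moreover have "X \<subseteq> {..<max z (p + int e + 1)}" using az(2) by (auto simp: X_def W_def)
    ultimately show ?thesis unfolding mayalike_def by blast
  qed
  let ?g = "\<lambda>q. if q \<in> Z then 1 else (0::int)"
  have flow0: "flow e ?M X q = ?g q" for q
  proof (rule flow_unique[OF mayalike_maya X e])
    show "?g q = ?g (q + int e) + mem ?M q - mem X q" for q
    proof -
      have "q + int e \<in> Z \<longleftrightarrow> q \<in> Y" by (auto simp: Z_def)
      then show ?thesis using YW[of q] ZW' by (auto simp: mem_def X_def Y_def W_def)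
    qed
    show "?g q = 0" if "q \<ge> p + int e + 1" for q using that ZW by auto
  qed
  have "{q. flow e ?M X q \<noteq> 0} = Z" by (auto simp: flow0)
  moreover have "(\<Sum>q\<in>Z. ?g q) = int m" using cZ by simp
  moreover have "\<forall>q. ?g q \<in> {0, 1} \<and> mem X q + ?g q \<in> {0, 1}" by (auto simp: mem_def X_def)
  moreover have "(\<Sum>q\<in>Z. ?g q * (\<Sum>t\<in>{q - int e + 1..q - 1}. mem X t + ?g t)) = int m * (int e - 1)"
  proof -
    have "(\<Sum>t\<in>{q - int e + 1..q - 1}. mem X t + ?g t) = int e - 1" if "q \<in> Z" for q
    proof -
      have "mem X t + ?g t = 1" if "t \<in> {q - int e + 1..q - 1}" for t
        using Zcompl[of t] that \<open>q \<in> Z\<close> ZW by (auto simp: mem_def)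
      then show ?thesis using e by simp
    qed
    then show ?thesis using cZ by simp
  qed
  ultimately have 1: "strip_coeff e m ?M X = negv (- (int m * (int e - 1)))"
    using finZ by (simp add: strip_coeff_def flow0)
  have 2: "rk lam0 < rk lam" if nz: "strip_coeff e m (maya lam) X \<noteq> 0" and ne: "lam \<noteq> lam0" for lam
  proof -
    note D = strip_coeff_nonzeroD[OF nz mayalike_maya X e]
    let ?V = "{q. flow e (maya lam) X q \<noteq> 0}"
    define f where "f = flow e (maya lam) X"
    have fV: "f q = (if q \<in> ?V then 1 else 0)" for q unfolding f_def by (rule D(3))
    \<comment> \<open>A crossing from q to q - e lowers the sum of squares by 2eq - e^2, so over a
      fixed X the rank depends only on the set of crossings.\<close>
    have rkf: "rk \<nu> - rk \<nu>' = (\<Sum>q\<in>A. 2 * int e * q - (int e)\<^sup>2) - (\<Sum>q\<in>A'. 2 * int e * q - (int e)\<^sup>2)"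
      if A: "finite A" "finite A'" "\<And>q. mem (maya \<nu>) q = mem X q + (if q \<in> A then 1 else 0) - (if q + int e \<in> A then 1 else 0)"
        "\<And>q. mem (maya \<nu>') q = mem X q + (if q \<in> A' then 1 else 0) - (if q + int e \<in> A' then 1 else 0)" for \<nu> \<nu>' A A'
    proof -
      define B where "B = Max (insert 0 (abs ` (A \<union> A')))"
      have B: "\<bar>q\<bar> \<le> B" if "q \<in> A \<union> A'" for q
        unfolding B_def using A that by (intro Max_ge) auto
      define K where "K = plen \<nu> + plen \<nu>' + nat \<bar>B\<bar> + e"
      define H where "H = int (part \<nu> 1) + int (part \<nu>' 1) + \<bar>B\<bar>"
      let ?I = "{- int K..H}"
      have sq: "(\<Sum>q\<in>maya \<kappa> \<inter> {- int K..}. q\<^sup>2) = (\<Sum>q\<in>?I. mem X q * q\<^sup>2) + (\<Sum>q\<in>C. 2 * int e * q - (int e)\<^sup>2)"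
        if k: "\<kappa> \<in> {\<nu>, \<nu>'}" and C: "C \<subseteq> A \<union> A'" "\<And>q. mem (maya \<kappa>) q = mem X q + (if q \<in> C then 1 else 0) - (if q + int e \<in> C then 1 else 0)" for \<kappa> C
      proof -
        have "finite C" using C(1) A finite_subset by blast
        have Cb: "q \<in> C \<Longrightarrow> \<bar>q\<bar> \<le> \<bar>B\<bar>" for q using B[of q] C(1) by fastforce
        have I: "q \<in> C \<Longrightarrow> q \<in> ?I" "q + int e \<in> C \<Longrightarrow> q \<in> ?I" for q
          using Cb[of q] Cb[of "q + int e"] by (auto simp: K_def H_def)
        have "maya \<kappa> \<inter> {- int K..} = {q \<in> ?I. q \<in> maya \<kappa>}"
          using maya_le[of _ \<kappa>] k by (force simp: H_def)
        then have "(\<Sum>q\<in>maya \<kappa> \<inter> {- int K..}. q\<^sup>2) = (\<Sum>q\<in>?I. if q \<in> maya \<kappa> then q\<^sup>2 else 0)"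
          by (simp only: sum.inter_filter[OF finite_atLeastAtMost_int])
        also have "\<dots> = (\<Sum>q\<in>?I. mem (maya \<kappa>) q * q\<^sup>2)"
          by (intro sum.cong refl) (simp add: mem_def)
        also have "\<dots> = (\<Sum>q\<in>?I. mem X q * q\<^sup>2 + ((if q \<in> C then q\<^sup>2 else 0) - (if q + int e \<in> C then q\<^sup>2 else 0)))"
          by (intro sum.cong refl) (simp add: C(2) algebra_simps)
        also have "\<dots> = (\<Sum>q\<in>?I. mem X q * q\<^sup>2) + ((\<Sum>q\<in>?I. if q \<in> C then q\<^sup>2 else 0) - (\<Sum>q\<in>?I. if q + int e \<in> C then q\<^sup>2 else 0))"
          by (simp add: sum.distrib sum_subtractf)
        also have "(\<Sum>q\<in>?I. if q \<in> C then q\<^sup>2 else 0) = (\<Sum>q\<in>C. q\<^sup>2)"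
          using I by (intro sum.mono_neutral_cong_right) auto
        also have "(\<Sum>q\<in>?I. if q + int e \<in> C then q\<^sup>2 else 0) = (\<Sum>q\<in>{q. q + int e \<in> C}. q\<^sup>2)"
          using I by (intro sum.mono_neutral_cong_right) auto
        also have "\<dots> = (\<Sum>q\<in>C. (q - int e)\<^sup>2)"
          by (rule sum.reindex_bij_witness[where i="\<lambda>q. q - int e" and j="\<lambda>q. q + int e"]) auto
        also have "(\<Sum>q\<in>C. q\<^sup>2) - (\<Sum>q\<in>C. (q - int e)\<^sup>2) = (\<Sum>q\<in>C. 2 * int e * q - (int e)\<^sup>2)"
          unfolding sum_subtractf[symmetric] by (intro sum.cong refl) (simp add: power2_eq_square algebra_simps)
        finally show ?thesis .
      qed
      have "plen \<nu> \<le> K" "plen \<nu>' \<le> K" by (simp_all add: K_def)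
      then show ?thesis
        using sq[of \<nu> A] sq[of \<nu>' A'] A(3,4) by (simp add: rk_beads)
    qed
    have mV: "mem (maya lam) q = mem X q + (if q \<in> ?V then 1 else 0) - (if q + int e \<in> ?V then 1 else 0)" for q
      using D(5)[of q] fV[of q] fV[of "q + int e"] unfolding f_def[symmetric] by (simp only:)
    have mZ: "mem ?M q = mem X q + (if q \<in> Z then 1 else 0) - (if q + int e \<in> Z then 1 else 0)" for q
      using flow_rec[OF mayalike_maya X e, of lam0 q] unfolding flow0 by linarith
    have VZ: "?V \<noteq> Z"
    proof
      assume eq: "?V = Z"
      have "mem (maya lam) q = mem ?M q" for q unfolding mV mZ eq ..
      then have "q \<in> maya lam \<longleftrightarrow> q \<in> ?M" for q by (metis mem_def zero_neq_one)
      then have "maya lam = ?M" by blast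
      with ne show False by (simp add: maya_inject)
    qed
    have cV: "card ?V = card Z" using D(2) cZ by simp
    have d: "?V - Z \<noteq> {}" "card (?V - Z) = card (Z - ?V)"
    proof -
      show "card (?V - Z) = card (Z - ?V)"
        using cV D(1) finZ card_le_sym_Diff by (simp add: card_Diff_subset_Int Int_commute)
      show "?V - Z \<noteq> {}"
      proof
        assume "?V - Z = {}"
        then have "?V \<subseteq> Z" by blast
        then have "?V = Z" using cV finZ by (intro card_subset_eq) auto
        with VZ show False ..
      qed
    qed
    \<comment> \<open>Crossings start outside X, and Z already contains every place outside X up to
      p + e; all other crossings therefore lie beyond p + e.\<close>
    have "sum id (Z - ?V) < sum id (?V - Z)"
    proof -
      have "sum id (Z - ?V) \<le> (\<Sum>q\<in>Z - ?V. p + int e)" by (intro sum_mono) (use ZW in auto)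
      also have "\<dots> = (\<Sum>q\<in>?V - Z. p + int e)" using d(2) by simp
      also have "\<dots> < sum id (?V - Z)"
      proof (rule sum_strict_mono)
        fix q assume q: "q \<in> ?V - Z"
        then have "q \<notin> X" using D(4) by blast
        then show "p + int e < id q" using q Zcompl[of q] by force
      qed (use D(1) d in auto)
      finally show ?thesis .
    qed
    moreover have "sum id ?V = sum id (?V \<inter> Z) + sum id (?V - Z)" by (rule sum.Int_Diff[OF D(1)])
    moreover have "sum id Z = sum id (?V \<inter> Z) + sum id (Z - ?V)"
      using sum.Int_Diff[OF finZ, of id ?V] by (simp only: Int_commute)
    ultimately have "sum id Z < sum id ?V" by linarith
    moreover have lin: "(\<Sum>q\<in>A. 2 * int e * q - (int e)\<^sup>2) = 2 * int e * sum id A - int (card A) * (int e)\<^sup>2" for A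
      by (simp add: sum_subtractf sum_distrib_left)
    moreover have "2 * int e * sum id Z < 2 * int e * sum id ?V"
      using calculation(1) e by (intro mult_strict_left_mono) auto
    ultimately show ?thesis
      using rkf[OF D(1) finZ mV mZ] unfolding lin cV by linarith
  qed
  have 3: "\<exists>E. strip_coeff e m (maya lam) X = negv (- E) \<and> E \<le> int m * (int e - 1) \<and>
       (E = int m * (int e - 1) \<longrightarrow> \<not> regular e lam)" if nz: "strip_coeff e m (maya lam) X \<noteq> 0" for lam
  proof -
    note D = strip_coeff_nonzeroD[OF nz mayalike_maya X e]
    let ?f = "flow e (maya lam) X"
    let ?V = "{q. ?f q \<noteq> 0}"
    let ?w = "\<lambda>q. \<Sum>t\<in>{q - int e + 1..q - 1}. mem X t + ?f t"
    have w01: "mem X t + ?f t \<le> 1" for t using D(7)[of t] by auto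
    have wle: "?w q \<le> int e - 1" for q
    proof -
      have "?w q \<le> (\<Sum>t\<in>{q - int e + 1..q - 1}. 1)" by (rule sum_mono[OF w01])
      then show ?thesis using e by simp
    qed
    have le: "(\<Sum>q\<in>?V. ?w q) \<le> int m * (int e - 1)"
      using sum_mono[of ?V ?w "\<lambda>_. int e - 1"] wle D(2) by simp
    \<comment> \<open>Equality forces the rightmost crossing q to jump over e - 1 occupied places.
      Since nothing crosses from beyond q, these and q itself are beads of \<open>lam\<close>, while
      q - e is free.\<close>
    have "\<not> regular e lam" if eq: "(\<Sum>q\<in>?V. ?w q) = int m * (int e - 1)"
    proof -
      have ne: "?V \<noteq> {}"
      proof
        assume "?V = {}"
        with D(2) m1 show False by (simp only: card.empty)
      qed
      define q where "q = Max ?V"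
      have q: "q \<in> ?V" unfolding q_def by (rule Max_in[OF D(1) ne])
      have top: "?f t = 0" if "t > q" for t
        using Max_ge[OF D(1), of t] that unfolding q_def by force
      have fq: "?f q = 1" using D(3)[of q] q by (simp only: if_True)
      have "?w q = int e - 1"
      proof (rule ccontr)
        assume "?w q \<noteq> int e - 1"
        then have "?w q < int e - 1" using wle[of q] by simp
        then have "(\<Sum>q\<in>?V. ?w q) < (\<Sum>q\<in>?V. int e - 1)"
          using q wle D(1) by (intro sum_strict_mono_ex1) auto
        then show False using eq D(2) by simp
      qed
      then have full: "mem X t + ?f t = 1" if "t \<in> {q - int e + 1..q - 1}" for t
      proof -
        have "(\<Sum>t\<in>{q - int e + 1..q - 1}. 1 - (mem X t + ?f t)) = 0"
          using \<open>?w q = int e - 1\<close> e by (simp add: sum_subtractf sum.distrib)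
        then have "\<forall>t\<in>{q - int e + 1..q - 1}. 1 - (mem X t + ?f t) = 0"
          using w01 by (subst (asm) sum_nonneg_eq_0_iff) auto
        then show ?thesis using that by simp
      qed
      have "{q - int e + 1..q - int e + int e} \<subseteq> maya lam"
      proof
        fix t assume t: "t \<in> {q - int e + 1..q - int e + int e}"
        have "mem X t + ?f t \<ge> 1"
        proof (cases "t = q")
          case True
          then show ?thesis using fq mem_nonneg[of X q] by simp
        next
          case False
          then show ?thesis using full[of t] t by simp
        qed
        moreover have "?f (t + int e) = 0" using t by (intro top) simp
        ultimately have "mem (maya lam) t \<ge> 1" using D(5)[of t] by simp
        then show "t \<in> maya lam" by (simp add: mem_def split: if_splits)
      qed
      moreover have "q - int e \<notin> maya lam"
        using D(5)[of "q - int e"] w01[of "q - int e"] fq by (simp add: mem_def split: if_splits)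
      ultimately show ?thesis using nonregularI[OF e] by blast
    qed
    then show ?thesis using D(6) le by blast
  qed
  show thesis by (rule that[OF X m1 1 2 3])
qed

text \<open>Induction on rank from above by the relations of \<open>strip_coeff_nonregular\<close>.
  P is the set allowed at regular partitions, Q the one obtained at the others. The choice of {0}
  for both gives \<open>regular_zero\<close>; polynomials with and without constant term give the
  integrality part of \<open>canonical_exists\<close>.\<close>

theorem nonregular_coeffs:
  assumes e: "e \<ge> 2" and x: "x \<in> L e"
    and P: "\<And>lam. regular e lam \<Longrightarrow> Poly_Mapping.lookup x lam \<in> P"
    and Q: "0 \<in> Q" "\<And>a c. a \<in> Q \<Longrightarrow> c \<in> Q \<Longrightarrow> a + c \<in> Q" "\<And>a. a \<in> Q \<Longrightarrow> - a \<in> Q" "Q \<subseteq> P"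
    and PQ: "\<And>a j. a \<in> P \<Longrightarrow> j \<ge> 1 \<Longrightarrow> negv j * a \<in> Q"
    and nr: "\<not> regular e lam"
  shows "Poly_Mapping.lookup x lam \<in> Q"
proof -
  define hi where "hi = Max (insert 0 (rk ` Poly_Mapping.keys x))"
  have hi: "rk \<nu> \<le> hi" if "\<nu> \<in> Poly_Mapping.keys x" for \<nu>
    unfolding hi_def using that by (intro Max_ge) auto
  show ?thesis
    using nr
  proof (induction "nat (hi - rk lam)" arbitrary: lam rule: less_induct)
    case less
    show ?case
    proof (cases "lam \<in> Poly_Mapping.keys x")
      case False
      then show ?thesis using Q(1) by (simp add: in_keys_iff)
    next
      case True
      obtain p where p: "p \<notin> maya lam" "{p + 1..p + int e} \<subseteq> maya lam"
        using nonregularD[of e lam] less.prems e by auto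
      have "e \<ge> 1" using e by simp
      from strip_coeff_nonregular[OF this p] obtain X m where X: "mayalike X" and m: "m \<ge> 1"
        and c0: "strip_coeff e m (maya lam) X = negv (- (int m * (int e - 1)))"
        and up: "\<And>\<nu>. strip_coeff e m (maya \<nu>) X \<noteq> 0 \<Longrightarrow> \<nu> \<noteq> lam \<Longrightarrow> rk lam < rk \<nu>"
        and sp: "\<And>\<nu>. strip_coeff e m (maya \<nu>) X \<noteq> 0 \<Longrightarrow> \<exists>E. strip_coeff e m (maya \<nu>) X = negv (- E) \<and> E \<le> int m * (int e - 1) \<and>
          (E = int m * (int e - 1) \<longrightarrow> \<not> regular e \<nu>)" by blast
      let ?D = "int m * (int e - 1)"
      let ?x = "Poly_Mapping.lookup x"
      have summand: "negv ?D * (?x \<nu> * strip_coeff e m (maya \<nu>) X) \<in> Q" if nu: "\<nu> \<in> Poly_Mapping.keys x - {lam}" for \<nu>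
      proof (cases "strip_coeff e m (maya \<nu>) X = 0")
        case False
        obtain E where E: "strip_coeff e m (maya \<nu>) X = negv (- E)" "E \<le> ?D" "E = ?D \<longrightarrow> \<not> regular e \<nu>"
          using sp[OF False] by blast
        have rk: "rk lam < rk \<nu>" using up[OF False] nu by simp
        have IH: "?x \<nu> \<in> Q" if "\<not> regular e \<nu>"
          using less.hyps[of \<nu>] that rk hi[of \<nu>] nu by simp
        have xP: "?x \<nu> \<in> P" using P[of \<nu>] IH Q(4) by blast
        have "negv ?D * (?x \<nu> * strip_coeff e m (maya \<nu>) X) = negv (?D - E) * ?x \<nu>"
          using negv_add[of ?D "- E"] by (simp add: E(1) ac_simps)
        also have "\<dots> \<in> Q"
        proof (cases "E = ?D")
          case True
          then show ?thesis using IH E(3) by simp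
        next
          case False
          then show ?thesis using E(2) by (intro PQ xP) simp
        qed
        finally show ?thesis .
      qed (simp add: Q(1))
      have sumQ: "(\<Sum>\<nu>\<in>A. g \<nu>) \<in> Q" if "finite A" "\<And>\<nu>. \<nu> \<in> A \<Longrightarrow> g \<nu> \<in> Q" for A and g :: "partition \<Rightarrow> laurent"
        using that by (induction A rule: finite_induct) (auto intro: Q)
      have "0 = negv ?D * strip_form e m X x" using strip_relation[OF e x m X] by simp
      also have "\<dots> = negv ?D * (?x lam * strip_coeff e m (maya lam) X) + (\<Sum>\<nu>\<in>Poly_Mapping.keys x - {lam}. negv ?D * (?x \<nu> * strip_coeff e m (maya \<nu>) X))"
        unfolding strip_form_def using True by (subst sum.remove[of _ lam]) (auto simp: distrib_left sum_distrib_left)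
      also have "negv ?D * (?x lam * strip_coeff e m (maya lam) X) = ?x lam"
        unfolding c0 using negv_add[of ?D "- ?D"] by (simp add: ac_simps)
      finally have "?x lam = - (\<Sum>\<nu>\<in>Poly_Mapping.keys x - {lam}. negv ?D * (?x \<nu> * strip_coeff e m (maya \<nu>) X))"
        by (simp add: eq_neg_iff_add_eq_0)
      moreover have "(\<Sum>\<nu>\<in>Poly_Mapping.keys x - {lam}. negv ?D * (?x \<nu> * strip_coeff e m (maya \<nu>) X)) \<in> Q"
        by (rule sumQ) (use summand in auto)
      ultimately show ?thesis using Q(3) by simp
    qed
  qed
qed

section \<open>Ladder monomials\<close>

text \<open>A ladder consists of the nodes obtained from each other by going up e - 1 rows and right
  by one column; this keeps the residue for e.\<close>

definition ladder :: "nat \<Rightarrow> node \<Rightarrow> nat" where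
  "ladder e x = fst x + (e - 1) * (snd x - 1)"

definition cnt :: "nat \<Rightarrow> nat \<Rightarrow> partition \<Rightarrow> nat" where
  "cnt e l lam = card {x \<in> diagram lam. ladder e x \<le> l}"

lemma diagram_eq_Sigma:
  assumes "plen lam \<le> K" shows "diagram lam = (SIGMA c:{1..K}. {1..part lam c})"
proof -
  have "c \<le> K" if "1 \<le> d" "d \<le> part lam c" for c d
    using that part_beyond_plen[of lam c] assms by (cases "c \<le> K") auto
  then show ?thesis by (auto simp: diagram_def)
qed

lemma finite_diagram [simp]: "finite (diagram lam)"
  by (subst diagram_eq_Sigma[OF order_refl]) auto

lemma card_diagram: "card (diagram lam) = psize lam"
  by (subst diagram_eq_Sigma[OF order_refl]) (simp add: psize_def)

lemma card_rows: "card {x \<in> diagram lam. fst x \<le> j} = (\<Sum>i=1..j. part lam i)"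
proof -
  have "{x \<in> diagram lam. fst x \<le> j} = (SIGMA c:{1..j}. {1..part lam c})"
    by (auto simp: diagram_def)
  then show ?thesis by simp
qed

lemma diagram_move_set:
  assumes "S \<subseteq> movable (maya lam)"
  shows "diagram (move S lam) = diagram lam \<union> (\<lambda>c. (c, part lam c + 1)) ` {c. 1 \<le> c \<and> bead lam c \<in> S}"
  by (auto simp: diagram_def part_move[OF assms] split: if_splits)

lemma card_diagram_move:
  assumes "S \<subseteq> movable (maya lam)"
  shows "card (diagram (move S lam)) = card (diagram lam) + card S"
proof -
  let ?C = "{c. 1 \<le> c \<and> bead lam c \<in> S}"
  have S: "S = bead lam ` ?C"
  proof (intro equalityI subsetI)
    fix p assume p: "p \<in> S"
    then have "p \<in> maya lam" using assms by (auto simp: movable_def)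
    then obtain c where "c \<ge> 1" "bead lam c = p" by (rule mayaE)
    with p show "p \<in> bead lam ` ?C" by auto
  qed auto
  have inj: "inj_on (bead lam) ?C" by (rule inj_on_subset[OF inj_on_bead]) auto
  have fS: "finite S" by (rule finite_subset[OF assms finite_movable]) simp
  have cS: "card S = card ?C" by (subst S) (rule card_image[OF inj])
  have fC: "finite ?C" using fS S inj finite_imageD by metis
  have "card (diagram lam \<union> (\<lambda>c. (c, part lam c + 1)) ` ?C) = card (diagram lam) + card ((\<lambda>c. (c, part lam c + 1)) ` ?C)"
    by (rule card_Un_disjoint) (use fC in \<open>simp, simp, auto simp: diagram_def\<close>)
  also have "card ((\<lambda>c. (c, part lam c + 1)) ` ?C) = card ?C" by (rule card_image) (auto simp: inj_on_def)
  finally show ?thesis unfolding diagram_move_set[OF assms] cS .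
qed

lemma keys_Fdiv:
  assumes "e \<ge> 2" "\<nu> \<in> Poly_Mapping.keys (Fdiv e i a x)"
  shows "\<exists>lam\<in>Poly_Mapping.keys x. \<exists>S. S \<subseteq> Add e i (maya lam) \<and> card S = a \<and> \<nu> = move S lam"
proof -
  have "(\<Sum>lam\<in>Poly_Mapping.keys x. Poly_Mapping.lookup x lam * Poly_Mapping.lookup (Fd e i a lam) \<nu>) \<noteq> 0"
    using assms by (simp add: in_keys_iff Fdiv_eq_lin lookup_lin)
  then obtain lam where lam: "lam \<in> Poly_Mapping.keys x" "Poly_Mapping.lookup (Fd e i a lam) \<nu> \<noteq> 0"
    by (metis (no_types, lifting) mult_zero_right sum.neutral)
  then have "(\<Sum>S | S \<subseteq> Add e i (maya lam) \<and> card S = a. vpow (dwt e i (maya lam) S) * (if \<nu> = move S lam then 1 else 0)) \<noteq> 0"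
    by (simp add: Fd_def lookup_sum lookup_scale lookup_basis)
  then obtain S where "S \<subseteq> Add e i (maya lam) \<and> card S = a" "\<nu> = move S lam"
  proof (rule contrapos_np)
    assume no: "\<not> thesis"
    show "(\<Sum>S | S \<subseteq> Add e i (maya lam) \<and> card S = a. vpow (dwt e i (maya lam) S) * (if \<nu> = move S lam then 1 else 0)) = 0"
      by (rule sum.neutral) (use no that in auto)
  qed
  with lam(1) show ?thesis by blast
qed

text \<open>The residue on ladder \<open>Suc l\<close>, not l: from c + (e - 1)(d - 1) = l + 1 it
  follows that d - c is congruent to -l modulo e.\<close>

definition ladres :: "nat \<Rightarrow> nat \<Rightarrow> nat" where
  "ladres e l = nat ((- int l) mod int e)"

fun ladA :: "nat \<Rightarrow> partition \<Rightarrow> nat \<Rightarrow> fock" where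
  "ladA e \<mu> 0 = basis empty_partition"
| "ladA e \<mu> (Suc l) = Fdiv e (ladres e l) (cnt e (Suc l) \<mu> - cnt e l \<mu>) (ladA e \<mu> l)"

lemma ladres_less: "e \<ge> 1 \<Longrightarrow> ladres e l < e"
  by (simp add: ladres_def nat_less_iff)

lemma ladder_residue:
  assumes "e \<ge> 2" "c \<ge> 1" "d \<ge> 1"
  shows "(int d - int c) mod int e = int (ladres e l) \<longleftrightarrow> int e dvd int (ladder e (c, d)) - int (Suc l)"
proof -
  have lad: "int (ladder e (c, d)) = int c + (int e - 1) * (int d - 1)"
    using assms by (simp add: ladder_def of_nat_diff)
  have "int (ladres e l) = (- int l) mod int e" using assms(1) by (simp add: ladres_def)
  then have "(int d - int c) mod int e = int (ladres e l) \<longleftrightarrow> int e dvd (int d - int c) - (- int l)"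
    by (simp add: mod_eq_dvd_iff)
  also have "(int d - int c) - (- int l) = int e * (int d - 1) - (int (ladder e (c, d)) - int (Suc l))"
    unfolding lad by (simp add: algebra_simps)
  also have "int e dvd \<dots> \<longleftrightarrow> int e dvd int (ladder e (c, d)) - int (Suc l)"
    by (rule dvd_diff_right_iff) simp
  finally show ?thesis .
qed

text \<open>The left or upper neighbour of an addable node lies on a ladder up to l, so the node
  itself lies at most on ladder l + e - 1. With the residue of ladder l + 1 this leaves no ladder
  beyond l + 1.\<close>

lemma addable_ladder_le:
  assumes "e \<ge> 2" "\<And>x. x \<in> diagram lam \<Longrightarrow> ladder e x \<le> l" "c \<ge> 1" "bead lam c \<in> Add e (ladres e l) (maya lam)"
  shows "ladder e (c, part lam c + 1) \<le> Suc l" "int e dvd int (ladder e (c, part lam c + 1)) - int (Suc l)"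
proof -
  let ?L = "ladder e (c, part lam c + 1)"
  have "(int (part lam c + 1) - int c) mod int e = int (ladres e l)"
    using assms(4) by (auto simp: Add_def bead_def algebra_simps)
  then show dv: "int e dvd int ?L - int (Suc l)" using ladder_residue[OF assms(1,3), of "part lam c + 1" l] by simp
  have "?L \<le> l + e - 1"
  proof (cases "part lam c = 0")
    case False
    then have "(c, part lam c) \<in> diagram lam" using assms(3) by (simp add: diagram_iff)
    then have "ladder e (c, part lam c) \<le> l" by (rule assms(2))
    moreover have "?L = ladder e (c, part lam c) + (e - 1)"
      using False by (cases "part lam c") (simp_all add: ladder_def)
    ultimately show ?thesis using assms(1) by simp
  next
    case 0: True
    show ?thesis
    proof (cases "c = 1")
      case True
      then show ?thesis using 0 assms(1) by (simp add: ladder_def)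
    next
      case False
      have "bead lam c + 1 \<notin> maya lam" using assms(4) by (simp add: Add_def)
      then have "bead lam (c - 1) \<noteq> bead lam c + 1"
      proof -
        have "1 \<le> c - 1" using assms(3) False by arith
        from bead_in_maya[OF this, of lam] \<open>bead lam c + 1 \<notin> maya lam\<close> show ?thesis by metis
      qed
      then have "part lam (c - 1) \<noteq> part lam c" using assms(3) False by (simp add: bead_def of_nat_diff)
      then have "(c - 1, 1) \<in> diagram lam" using 0 False assms(3) by (simp add: diagram_iff)
      then have "ladder e (c - 1, 1) \<le> l" by (rule assms(2))
      then show ?thesis using 0 assms(1,3) by (simp add: ladder_def)
    qed
  qed
  then show "?L \<le> Suc l"
    using dv zdvd_imp_le[of "int e" "int ?L - int (Suc l)"] assms(1) by (cases "?L \<le> Suc l") auto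
qed

lemma cnt_mono: "l \<le> l' \<Longrightarrow> cnt e l lam \<le> cnt e l' lam"
  unfolding cnt_def by (intro card_mono) auto

lemma cnt_full: "(\<And>x. x \<in> diagram lam \<Longrightarrow> ladder e x \<le> l) \<Longrightarrow> cnt e l lam = card (diagram lam)"
  unfolding cnt_def by (intro arg_cong[where f=card]) auto

lemma keys_ladA:
  assumes "e \<ge> 2" "\<nu> \<in> Poly_Mapping.keys (ladA e \<mu> l)"
  shows "(\<forall>x\<in>diagram \<nu>. ladder e x \<le> l) \<and> card (diagram \<nu>) = cnt e l \<mu> \<and> (\<forall>l'\<le>l. cnt e l' \<mu> \<le> cnt e l' \<nu>)"
  using assms(2)
proof (induction l arbitrary: \<nu>)
  case 0
  then have "\<nu> = empty_partition" by (simp add: basis_def split: if_splits)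
  moreover have "diagram empty_partition = {}" by (auto simp: diagram_def)
  moreover have "{x \<in> diagram \<mu>. ladder e x \<le> 0} = {}" by (auto simp: diagram_def ladder_def)
  ultimately show ?case by (simp add: cnt_def)
next
  case (Suc l)
  obtain lam S where lam: "lam \<in> Poly_Mapping.keys (ladA e \<mu> l)" and S: "S \<subseteq> Add e (ladres e l) (maya lam)"
    "card S = cnt e (Suc l) \<mu> - cnt e l \<mu>" "\<nu> = move S lam"
    using keys_Fdiv[OF assms(1)] Suc.prems by (metis ladA.simps(2))
  note IH = Suc.IH[OF lam]
  have Sm: "S \<subseteq> movable (maya lam)" using S(1) Add_movable by blast
  note dm = diagram_move_set[OF Sm]
  have 1: "\<forall>x\<in>diagram \<nu>. ladder e x \<le> Suc l"
  proof
    fix x assume "x \<in> diagram \<nu>"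
    then consider "x \<in> diagram lam" | c where "1 \<le> c" "bead lam c \<in> S" "x = (c, part lam c + 1)"
      unfolding S(3) dm by blast
    then show "ladder e x \<le> Suc l"
    proof cases
      case 1
      then show ?thesis using IH by (simp add: le_SucI)
    next
      case 2
      then show ?thesis using addable_ladder_le(1)[OF assms(1), of lam l c] IH S(1) by auto
    qed
  qed
  have 2: "card (diagram \<nu>) = cnt e (Suc l) \<mu>"
    unfolding S(3) card_diagram_move[OF Sm] S(2) using IH cnt_mono[of l "Suc l" e \<mu>] by simp
  have "cnt e l' \<mu> \<le> cnt e l' \<nu>" if "l' \<le> Suc l" for l'
  proof (cases "l' = Suc l")
    case True
    then show ?thesis using cnt_full[of \<nu> e "Suc l"] 1 2 by simp
  next
    case False
    then have "cnt e l' \<mu> \<le> cnt e l' lam" using IH that by simp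
    also have "\<dots> \<le> cnt e l' \<nu>"
    proof -
      have "diagram lam \<subseteq> diagram \<nu>" unfolding S(3) dm by blast
      then show ?thesis unfolding cnt_def by (intro card_mono) auto
    qed
    finally show ?thesis .
  qed
  with 1 2 show ?case by blast
qed

text \<open>Otherwise the e rows from c - (e - 1) to c would all have length d.\<close>

lemma regular_step:
  assumes "regular e \<mu>" "e \<ge> 2" "d \<ge> 1" "d \<le> part \<mu> c" "e \<le> c"
  shows "d + 1 \<le> part \<mu> (c - (e - 1))"
proof (rule ccontr)
  assume *: "\<not> d + 1 \<le> part \<mu> (c - (e - 1))"
  let ?I = "{c - (e - 1)..c}"
  have "?I \<subseteq> {i. part \<mu> i = d}"
  proof
    fix i assume i: "i \<in> ?I"
    have "1 \<le> c - (e - 1)" using assms(2,5) by simp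
    then have "part \<mu> i \<le> part \<mu> (c - (e - 1))" "part \<mu> c \<le> part \<mu> i"
      using i part_antimono[of "c - (e - 1)" i \<mu>] part_antimono[of i c \<mu>] by auto
    then show "i \<in> {i. part \<mu> i = d}" using * assms(4) by simp
  qed
  moreover have "finite {i. part \<mu> i = d}"
    by (rule finite_subset[OF _ finite_part_support[of \<mu>]]) (use assms(3) in auto)
  ultimately have "card ?I \<le> card {i. part \<mu> i = d}" by (intro card_mono)
  moreover have "card ?I = e" using assms(2,5) by simp
  ultimately show False using assms(1,3) by (fastforce simp: regular_def)
qed

text \<open>Going up along a ladder never leaves a regular diagram, since each e - 1 rows gain at
  least one column. In this sense regular partitions fill their ladders from the top.\<close>

lemma regular_closure:
  assumes "regular e \<mu>" "e \<ge> 2" "(c0, d0) \<in> diagram \<mu>" "1 \<le> c" "c < c0" "1 \<le> d"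
    "ladder e (c, d) \<le> ladder e (c0, d0)"
  shows "(c, d) \<in> diagram \<mu>"
proof (cases "d \<le> d0")
  case True
  then show ?thesis using assms(3-6) part_antimono[of c c0 \<mu>] by (auto simp: diagram_iff)
next
  case False
  have up: "d0 + t \<le> part \<mu> (c0 - t * (e - 1))" if "t * (e - 1) < c0" for t
    using that
  proof (induction t)
    case 0
    then show ?case using assms(3) by (simp add: diagram_iff)
  next
    case (Suc t)
    then have IH: "d0 + t \<le> part \<mu> (c0 - t * (e - 1))" by simp
    have "e \<le> c0 - t * (e - 1)" using Suc.prems assms(2) by (simp add: algebra_simps)
    moreover have "c0 - Suc t * (e - 1) = c0 - t * (e - 1) - (e - 1)" by simp
    ultimately show ?case
      using regular_step[OF assms(1,2) _ IH] assms(3) by (simp only: diagram_iff) simp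
  qed
  define t where "t = d - d0"
  have "d0 \<ge> 1" using assms(3) by (simp add: diagram_iff)
  then have "d - 1 = t + (d0 - 1)" using False by (simp add: t_def)
  then have "c + (e - 1) * t + (e - 1) * (d0 - 1) \<le> c0 + (e - 1) * (d0 - 1)"
    using assms(7) by (simp add: ladder_def add_mult_distrib2)
  then have c: "c + t * (e - 1) \<le> c0" by (simp add: mult.commute)
  then have "d0 + t \<le> part \<mu> (c0 - t * (e - 1))" using assms(4) by (intro up) simp
  also have "\<dots> \<le> part \<mu> c" using c assms(4) by (intro part_antimono) auto
  finally show ?thesis using False assms(4,6) by (simp add: diagram_iff t_def)
qed

text \<open>Given j, let m be the last ladder that \<mu> meets below row j. In the first j rows
  \<mu> contains all nodes of the ladders up to m, so \<nu> has no more of them; beyond ladder m it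
  has no more nodes by the hypothesis on counts. All nodes of \<mu> beyond ladder m lie in the first
  j rows.\<close>

lemma ladder_dominates:
  assumes "regular e \<mu>" "e \<ge> 2" "psize \<nu> = psize \<mu>" "\<And>l. cnt e l \<mu> \<le> cnt e l \<nu>"
  shows "dominates \<mu> \<nu>"
  unfolding dominates_def
proof (intro conjI allI)
  show "psize \<nu> = psize \<mu>" by fact
  fix j
  let ?D = "\<lambda>lam. {x \<in> diagram lam. fst x \<le> j}"
  show "(\<Sum>i = 1..j. part \<nu> i) \<le> (\<Sum>i = 1..j. part \<mu> i)"
  proof (cases "\<exists>x\<in>diagram \<mu>. fst x > j")
    case False
    then have "?D \<mu> = diagram \<mu>" by (auto simp: not_less)
    then have "(\<Sum>i = 1..j. part \<mu> i) = psize \<nu>" using card_rows[of \<mu> j] card_diagram[of \<mu>] assms(3) by simp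
    moreover have "card (?D \<nu>) \<le> card (diagram \<nu>)" by (intro card_mono) auto
    ultimately show ?thesis unfolding card_rows[symmetric] card_diagram by simp
  next
    case True
    define m where "m = Max (ladder e ` {x \<in> diagram \<mu>. fst x > j})"
    have fin: "finite (ladder e ` {x \<in> diagram \<mu>. fst x > j})" by simp
    have "m \<in> ladder e ` {x \<in> diagram \<mu>. fst x > j}" unfolding m_def using True by (intro Max_in fin) auto
    then obtain c0 d0 where x0: "(c0, d0) \<in> diagram \<mu>" "c0 > j" "ladder e (c0, d0) = m" by auto
    have mx: "ladder e x \<le> m" if "x \<in> diagram \<mu>" "fst x > j" for x
      unfolding m_def using that by (intro Max_ge fin) auto
    have full: "{x \<in> diagram \<nu>. fst x \<le> j \<and> ladder e x \<le> m} \<subseteq> {x \<in> diagram \<mu>. fst x \<le> j \<and> ladder e x \<le> m}"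
    proof
      fix x assume x: "x \<in> {x \<in> diagram \<nu>. fst x \<le> j \<and> ladder e x \<le> m}"
      obtain c d where cd: "x = (c, d)" by (cases x)
      have "(c, d) \<in> diagram \<mu>"
        using x x0 by (intro regular_closure[OF assms(1,2) x0(1)]) (auto simp: cd diagram_iff)
      then show "x \<in> {x \<in> diagram \<mu>. fst x \<le> j \<and> ladder e x \<le> m}" using x by (simp add: cd)
    qed
    have tail: "card {x \<in> diagram lam. \<not> ladder e x \<le> m} = psize lam - cnt e m lam" for lam
    proof -
      have "{x \<in> diagram lam. \<not> ladder e x \<le> m} = diagram lam - {x \<in> diagram lam. ladder e x \<le> m}" by auto
      then show ?thesis unfolding cnt_def card_diagram[symmetric] by (simp add: card_Diff_subset)
    qed
    have "card (?D \<nu>) \<le> card ({x \<in> diagram \<nu>. fst x \<le> j \<and> ladder e x \<le> m} \<union> {x \<in> diagram \<nu>. \<not> ladder e x \<le> m})"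
      by (intro card_mono) auto
    also have "\<dots> \<le> card {x \<in> diagram \<nu>. fst x \<le> j \<and> ladder e x \<le> m} + card {x \<in> diagram \<nu>. \<not> ladder e x \<le> m}"
      by (rule card_Un_le)
    also have "\<dots> \<le> card {x \<in> diagram \<mu>. fst x \<le> j \<and> ladder e x \<le> m} + card {x \<in> diagram \<mu>. \<not> ladder e x \<le> m}"
      unfolding tail assms(3) using full assms(4)[of m] by (intro add_mono card_mono diff_le_mono2) auto
    also have "\<dots> = card ({x \<in> diagram \<mu>. fst x \<le> j \<and> ladder e x \<le> m} \<union> {x \<in> diagram \<mu>. \<not> ladder e x \<le> m})"
      by (rule card_Un_disjoint[symmetric]) auto
    also have "{x \<in> diagram \<mu>. fst x \<le> j \<and> ladder e x \<le> m} \<union> {x \<in> diagram \<mu>. \<not> ladder e x \<le> m} = ?D \<mu>"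
      using mx by (auto simp: not_less[symmetric])
    finally show ?thesis unfolding card_rows .
  qed
qed

text \<open>The part of \<mu> on the ladders up to l. In row c these ladders occupy the first (l -
  c) div (e - 1) + 1 columns.\<close>

definition trunc :: "nat \<Rightarrow> nat \<Rightarrow> partition \<Rightarrow> partition" where
  "trunc e l \<mu> = Abs_partition (\<lambda>c. if c \<ge> 1 \<and> c \<le> l then min (part \<mu> c) ((l - c) div (e - 1) + 1) else 0)"

lemma part_trunc: "part (trunc e l \<mu>) c = (if c \<ge> 1 \<and> c \<le> l then min (part \<mu> c) ((l - c) div (e - 1) + 1) else 0)"
  unfolding trunc_def
proof (subst part_Abs[where l=l])
  fix i :: nat assume "i \<ge> 1"
  moreover have "(l - Suc i) div (e - 1) \<le> (l - i) div (e - 1)" by (rule div_le_mono) simp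
  ultimately show "(if Suc i \<ge> 1 \<and> Suc i \<le> l then min (part \<mu> (Suc i)) ((l - Suc i) div (e - 1) + 1) else 0)
      \<le> (if i \<ge> 1 \<and> i \<le> l then min (part \<mu> i) ((l - i) div (e - 1) + 1) else 0)"
    using part_Suc_le[of i \<mu>] by auto
qed auto

lemma diagram_trunc:
  assumes "e \<ge> 2" shows "diagram (trunc e l \<mu>) = {x \<in> diagram \<mu>. ladder e x \<le> l}"
proof -
  have "d \<le> (l - c) div (e - 1) + 1 \<longleftrightarrow> c + (e - 1) * (d - 1) \<le> l" if "c \<le> l" for c d
  proof -
    have "d \<le> (l - c) div (e - 1) + 1 \<longleftrightarrow> d - 1 \<le> (l - c) div (e - 1)" by auto
    also have "\<dots> \<longleftrightarrow> (d - 1) * (e - 1) \<le> l - c" using assms by (simp add: less_eq_div_iff_mult_less_eq)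
    also have "\<dots> \<longleftrightarrow> c + (e - 1) * (d - 1) \<le> l" using that by (auto simp: mult.commute)
    finally show ?thesis .
  qed
  then show ?thesis by (auto simp: diagram_def part_trunc ladder_def split: if_splits)
qed

lemma trunc_0: "e \<ge> 2 \<Longrightarrow> trunc e 0 \<mu> = empty_partition"
  by (rule partition_eqI) (simp add: part_trunc)

lemma lookup_Fd:
  assumes "S \<subseteq> Add e i (maya lam)" "card S = a"
  shows "Poly_Mapping.lookup (Fd e i a lam) (move S lam) = vpow (dwt e i (maya lam) S)"
proof -
  have "Poly_Mapping.lookup (Fd e i a lam) (move S lam) =
    (\<Sum>T | T \<subseteq> Add e i (maya lam) \<and> card T = a. if T = S then vpow (dwt e i (maya lam) S) else 0)"
    unfolding Fd_def lookup_sum lookup_scale lookup_basis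
  proof (intro sum.cong refl)
    fix T assume T: "T \<in> {T. T \<subseteq> Add e i (maya lam) \<and> card T = a}"
    have "move S lam = move T lam \<longleftrightarrow> T = S"
      using move_inject[of S lam T] T assms Add_movable[of e i "maya lam"] by auto
    then show "vpow (dwt e i (maya lam) T) * (if move S lam = move T lam then 1 else 0) =
      (if T = S then vpow (dwt e i (maya lam) S) else 0)" by simp
  qed
  also have "\<dots> = vpow (dwt e i (maya lam) S)"
  proof -
    have "finite {T. T \<subseteq> Add e i (maya lam) \<and> card T = a}" by simp
    then show ?thesis using assms by (simp add: sum.delta)
  qed
  finally show ?thesis .
qed

text \<open>The exponent is 0 by \<open>regular_closure\<close>: an addable node of the same residue
  in a higher row lies in \<mu> on ladder l + 1 and is therefore added as well. For a removable one,
  the node on its right would lie in \<mu> on a ladder up to l, hence already in \<tau>.\<close>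

lemma trunc_step:
  assumes reg: "regular e \<mu>" and e: "e \<ge> 2"
    and \<tau>_def: "\<tau> = trunc e l \<mu>"
  obtains S where "S \<subseteq> Add e (ladres e l) (maya \<tau>)" "card S = cnt e (Suc l) \<mu> - cnt e l \<mu>"
    "trunc e (Suc l) \<mu> = move S \<tau>" "dwt e (ladres e l) (maya \<tau>) S = 0"
proof -
  let ?\<sigma> = "trunc e (Suc l) \<mu>" and ?i = "ladres e l"
  have dt: "diagram \<tau> = {x \<in> diagram \<mu>. ladder e x \<le> l}" and ds: "diagram ?\<sigma> = {x \<in> diagram \<mu>. ladder e x \<le> Suc l}"
    unfolding \<tau>_def by (rule diagram_trunc[OF e])+
  define C where "C = {c. 1 \<le> c \<and> (c, part \<tau> c + 1) \<in> diagram \<mu> \<and> ladder e (c, part \<tau> c + 1) = Suc l}"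
  define S where "S = bead \<tau> ` C"
  have SC: "bead \<tau> c \<in> S \<longleftrightarrow> c \<in> C" if "c \<ge> 1" for c
    using that bead_eq_iff[of c _ \<tau>] by (force simp: S_def C_def)
  have lad_le: "ladder e x \<le> l" if "x \<in> diagram \<tau>" for x using that by (simp add: dt)
  have SAdd: "S \<subseteq> Add e ?i (maya \<tau>)"
  proof
    fix p assume "p \<in> S"
    then obtain c where c: "c \<in> C" "p = bead \<tau> c" by (auto simp: S_def)
    then have c1: "c \<ge> 1" and cm: "(c, part \<tau> c + 1) \<in> diagram \<mu>" "ladder e (c, part \<tau> c + 1) = Suc l" by (auto simp: C_def)
    have "bead \<tau> c + 1 \<notin> maya \<tau>"
    proof
      assume "bead \<tau> c + 1 \<in> maya \<tau>"
      from bead_pred_eq[OF c1 this] have c2: "c \<ge> 2" "part \<tau> (c - 1) = part \<tau> c" by auto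
      have "(c - 1, part \<tau> c + 1) \<in> diagram \<mu>"
      proof -
        have "part \<mu> c \<le> part \<mu> (c - 1)" using c2(1) by (intro part_antimono) auto
        then show ?thesis using cm(1) c2(1) by (auto simp: diagram_iff)
      qed
      moreover have "ladder e (c - 1, part \<tau> c + 1) \<le> l" using cm(2) c2 by (simp add: ladder_def)
      ultimately have "(c - 1, part \<tau> c + 1) \<in> diagram \<tau>" by (simp add: dt)
      then show False using c2 by (simp add: diagram_iff)
    qed
    moreover have "(bead \<tau> c + 1) mod int e = int ?i"
    proof -
      have "(int (part \<tau> c + 1) - int c) mod int e = int ?i"
        using ladder_residue[OF e c1, of "part \<tau> c + 1" l] cm(2) by simp
      moreover have "int (part \<tau> c + 1) - int c = bead \<tau> c + 1" by (simp add: bead_def)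
      ultimately show ?thesis by (simp only:)
    qed
    ultimately show "p \<in> Add e ?i (maya \<tau>)" using c(2) c1 unfolding Add_def by simp
  qed
  have Sm: "S \<subseteq> movable (maya \<tau>)" using SAdd Add_movable by blast
  have sub: "diagram \<tau> \<subseteq> diagram ?\<sigma>" unfolding dt ds by auto
  have mv: "?\<sigma> = move S \<tau>"
  proof -
    have "diagram ?\<sigma> = diagram (move S \<tau>)"
    proof (intro equalityI subsetI)
      fix x assume x: "x \<in> diagram ?\<sigma>"
      obtain c d where cd: "x = (c, d)" by (cases x)
      show "x \<in> diagram (move S \<tau>)"
      proof (cases "x \<in> diagram \<tau>")
        case False
        then have L: "ladder e (c, d) = Suc l" and cm: "(c, d) \<in> diagram \<mu>" using x by (auto simp: dt ds cd)
        have c1: "c \<ge> 1" "d \<ge> 1" using cm by (auto simp: diagram_iff)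
        have "d \<le> part \<tau> c + 1"
        proof (rule ccontr)
          assume "\<not> d \<le> part \<tau> c + 1"
          then have d: "d \<ge> part \<tau> c + 2" by simp
          have "(c, d - 1) \<in> diagram \<mu>" using cm d by (auto simp: diagram_iff)
          moreover have "ladder e (c, d - 1) \<le> l"
          proof -
            have "ladder e (c, d - 1) + (e - 1) = ladder e (c, d)"
            proof -
              have "d = Suc (Suc (d - 2))" using d by simp
              then obtain d' where "d = Suc (Suc d')" ..
              then show ?thesis by (simp add: ladder_def)
            qed
            then show ?thesis using L e by simp
          qed
          ultimately have "(c, d - 1) \<in> diagram \<tau>" by (simp add: dt)
          then show False using d by (auto simp: diagram_iff)
        qed
        moreover have "\<not> d \<le> part \<tau> c" using False c1 by (auto simp: cd diagram_iff)
        ultimately have "d = part \<tau> c + 1" by simp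
        then have "c \<in> C" using L cm c1 by (simp add: C_def)
        then show ?thesis using SC[OF c1(1)] c1 \<open>d = part \<tau> c + 1\<close> unfolding diagram_move_set[OF Sm] cd by blast
      qed (auto simp: diagram_move_set[OF Sm])
    next
      fix x assume "x \<in> diagram (move S \<tau>)"
      then consider "x \<in> diagram \<tau>" | c where "1 \<le> c" "bead \<tau> c \<in> S" "x = (c, part \<tau> c + 1)"
        unfolding diagram_move_set[OF Sm] by blast
      then show "x \<in> diagram ?\<sigma>"
      proof cases
        case 2
        then have "c \<in> C" using SC by simp
        then show ?thesis using 2 by (simp add: ds C_def)
      qed (use sub in blast)
    qed
    then show ?thesis by (simp add: diagram_inject)
  qed
  have card: "card S = cnt e (Suc l) \<mu> - cnt e l \<mu>"
  proof -
    have "card (diagram ?\<sigma>) = card (diagram \<tau>) + card S" unfolding mv by (rule card_diagram_move[OF Sm])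
    then show ?thesis unfolding ds dt cnt_def by simp
  qed
  have dw: "dwt e ?i (maya \<tau>) S = 0"
    unfolding dwt_def
  proof (rule sum.neutral, rule ballI)
    fix p assume "p \<in> S"
    then obtain c where c: "c \<in> C" "p = bead \<tau> c" by (auto simp: S_def)
    then have c1: "c \<ge> 1" and cm: "(c, part \<tau> c + 1) \<in> diagram \<mu>" "ladder e (c, part \<tau> c + 1) = Suc l" by (auto simp: C_def)
    have "{q \<in> Add e ?i (maya \<tau>) - S. p < q} = {}"
    proof (rule equals0I)
      fix q assume q: "q \<in> {q \<in> Add e ?i (maya \<tau>) - S. p < q}"
      then obtain c' where c': "c' \<ge> 1" "bead \<tau> c' = q" by (auto simp: Add_def elim: mayaE)
      have lt: "c' < c" using q c c' c1 bead_less_iff[of c' c \<tau>] by simp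
      have le: "ladder e (c', part \<tau> c' + 1) \<le> Suc l"
        using addable_ladder_le(1)[OF e lad_le c'(1)] q c'(2) by auto
      have in\<mu>: "(c', part \<tau> c' + 1) \<in> diagram \<mu>"
        using le cm c'(1) lt by (intro regular_closure[OF reg e cm(1)]) auto
      moreover have "\<not> ladder e (c', part \<tau> c' + 1) \<le> l"
      proof
        assume "ladder e (c', part \<tau> c' + 1) \<le> l"
        then have "(c', part \<tau> c' + 1) \<in> diagram \<tau>" using in\<mu> by (simp add: dt)
        then show False by (simp add: diagram_iff)
      qed
      ultimately have "c' \<in> C" using le c'(1) by (simp add: C_def)
      then show False using q c' SC[OF c'(1)] by auto
    qed
    moreover have "{q \<in> Rem e ?i (maya \<tau>). p < q} = {}"
    proof (rule equals0I)
      fix q assume q: "q \<in> {q \<in> Rem e ?i (maya \<tau>). p < q}"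
      then obtain c' where c': "c' \<ge> 1" "bead \<tau> c' = q + 1" by (auto simp: Rem_def elim: mayaE)
      have lt: "c' < c" using q c c' c1 bead_less_iff[of c' c \<tau>] by simp
      have ge1: "part \<tau> c' \<ge> 1" using part_unmove(2)[of q \<tau> c'] q c' by (auto simp: Rem_def)
      then have int: "(c', part \<tau> c') \<in> diagram \<tau>" using c'(1) by (simp add: diagram_iff)
      have "(int (part \<tau> c') - int c') mod int e = int ?i" using q c'(2) by (simp add: Rem_def bead_def)
      then have dv: "int e dvd int (ladder e (c', part \<tau> c')) - int (Suc l)" using ladder_residue[OF e c'(1) ge1] by simp
      have "ladder e (c', part \<tau> c') \<le> l" by (rule lad_le[OF int])
      then have "int e \<le> int (Suc l) - int (ladder e (c', part \<tau> c'))"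
        using dv by (intro zdvd_imp_le) (auto simp: dvd_diff_commute)
      moreover have "ladder e (c', part \<tau> c' + 1) = ladder e (c', part \<tau> c') + (e - 1)"
        using ge1 by (cases "part \<tau> c'") (simp_all add: ladder_def)
      ultimately have le: "ladder e (c', part \<tau> c' + 1) \<le> l" using e by simp
      have "(c', part \<tau> c' + 1) \<in> diagram \<mu>"
        using le cm c'(1) lt by (intro regular_closure[OF reg e cm(1)]) auto
      then have "(c', part \<tau> c' + 1) \<in> diagram \<tau>" using le by (simp add: dt)
      then show False by (simp add: diagram_iff)
    qed
    ultimately show "int (card {q \<in> Add e ?i (maya \<tau>) - S. p < q}) - int (card {q \<in> Rem e ?i (maya \<tau>). p < q}) = 0"
      by (simp only: card.empty diff_self)
  qed
  show thesis by (rule that[OF SAdd card mv dw])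
qed

text \<open>A term that reaches the next truncation is contained in it, uses no ladder beyond l and
  has the size of \<open>trunc e l \<mu>\<close>; so it is this truncation, and
  \<open>trunc_step\<close> supplies the factor 1.\<close>

lemma lookup_ladA_trunc:
  assumes "regular e \<mu>" "e \<ge> 2"
  shows "Poly_Mapping.lookup (ladA e \<mu> l) (trunc e l \<mu>) = 1"
proof (induction l)
  case 0
  then show ?case using trunc_0[OF assms(2)] by (simp add: lookup_basis)
next
  case (Suc l)
  let ?\<tau> = "trunc e l \<mu>" and ?\<sigma> = "trunc e (Suc l) \<mu>" and ?i = "ladres e l" and ?a = "cnt e (Suc l) \<mu> - cnt e l \<mu>"
  obtain S where S: "S \<subseteq> Add e ?i (maya ?\<tau>)" "card S = ?a" "?\<sigma> = move S ?\<tau>" "dwt e ?i (maya ?\<tau>) S = 0"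
    by (rule trunc_step[OF assms refl])
  have only: "Poly_Mapping.lookup (Fd e ?i ?a lam) ?\<sigma> = 0" if "lam \<in> Poly_Mapping.keys (ladA e \<mu> l)" "lam \<noteq> ?\<tau>" for lam
  proof (rule ccontr)
    assume "Poly_Mapping.lookup (Fd e ?i ?a lam) ?\<sigma> \<noteq> 0"
    then have "?\<sigma> \<in> Poly_Mapping.keys (Fdiv e ?i ?a (basis lam))" by (simp add: in_keys_iff Fdiv_basis assms(2))
    from keys_Fdiv[OF assms(2) this] obtain T where T: "T \<subseteq> Add e ?i (maya lam)" "?\<sigma> = move T lam"
      by (auto simp: basis_def)
    have "T \<subseteq> movable (maya lam)" using T(1) Add_movable by blast
    then have "diagram lam \<subseteq> diagram ?\<sigma>" unfolding T(2) by (auto simp: diagram_move_set)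
    moreover note keys_ladA[OF assms(2) that(1)]
    ultimately have "diagram lam \<subseteq> diagram ?\<tau>" "card (diagram lam) = card (diagram ?\<tau>)"
      unfolding diagram_trunc[OF assms(2)] cnt_def by auto
    then have "diagram lam = diagram ?\<tau>" by (intro card_subset_eq) auto
    then show False using that(2) by (simp add: diagram_inject)
  qed
  have k: "?\<tau> \<in> Poly_Mapping.keys (ladA e \<mu> l)" using Suc by (simp add: in_keys_iff)
  have "Poly_Mapping.lookup (ladA e \<mu> (Suc l)) ?\<sigma> =
     (\<Sum>lam\<in>Poly_Mapping.keys (ladA e \<mu> l). Poly_Mapping.lookup (ladA e \<mu> l) lam * Poly_Mapping.lookup (Fd e ?i ?a lam) ?\<sigma>)"
    using assms(2) by (simp add: Fdiv_eq_lin lookup_lin)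
  also have "\<dots> = Poly_Mapping.lookup (ladA e \<mu> l) ?\<tau> * Poly_Mapping.lookup (Fd e ?i ?a ?\<tau>) ?\<sigma>"
    using only by (subst sum.remove[OF _ k]) (auto intro!: sum.neutral)
  also have "\<dots> = 1" unfolding Suc using lookup_Fd[OF S(1,2)] S(3,4) by simp
  finally show ?case .
qed

lemma ladA_monomial: "e \<ge> 2 \<Longrightarrow> ladA e \<mu> l \<in> monomials e"
proof (induction l)
  case (Suc l)
  then show ?case
    using monomials.Fdiv[OF Suc.IH ladres_less[of e l], of "cnt e (Suc l) \<mu> - cnt e l \<mu>"]
    by (cases "cnt e (Suc l) \<mu> - cnt e l \<mu> = 0") auto
qed (simp add: monomials.empty)

lemma ladder_bounded: "\<exists>l. \<forall>x\<in>diagram \<mu>. ladder e x \<le> l"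
  using finite_nat_set_iff_bounded_le[of "ladder e ` diagram \<mu>"] by auto

theorem ladder_vector:
  assumes "regular e \<mu>" "e \<ge> 2"
  shows "\<exists>A\<in>monomials e. Poly_Mapping.lookup A \<mu> = 1 \<and> (\<forall>\<nu>\<in>Poly_Mapping.keys A. dominates \<mu> \<nu>)"
proof -
  obtain l where l: "\<forall>x\<in>diagram \<mu>. ladder e x \<le> l" using ladder_bounded by blast
  have "diagram (trunc e l \<mu>) = diagram \<mu>" using l by (auto simp: diagram_trunc[OF assms(2)])
  then have t: "trunc e l \<mu> = \<mu>" by (simp add: diagram_inject)
  have "dominates \<mu> \<nu>" if "\<nu> \<in> Poly_Mapping.keys (ladA e \<mu> l)" for \<nu>
  proof (rule ladder_dominates[OF assms])
    note K = keys_ladA[OF assms(2) that]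
    have full: "cnt e l \<mu> = card (diagram \<mu>)" using l by (intro cnt_full) auto
    then show "psize \<nu> = psize \<mu>" using K by (simp add: card_diagram)
    show "cnt e l' \<mu> \<le> cnt e l' \<nu>" for l'
    proof (cases "l' \<le> l")
      case False
      have "cnt e l' \<nu> = card (diagram \<nu>)" using K False by (intro cnt_full) force
      moreover have "cnt e l' \<mu> \<le> card (diagram \<mu>)" unfolding cnt_def by (intro card_mono) auto
      ultimately show ?thesis using K full by simp
    qed (use K in blast)
  qed
  then show ?thesis using ladA_monomial[OF assms(2)] lookup_ladA_trunc[OF assms, of l] unfolding t by blast
qed

text \<open>All terms of the ladder monomial are contained in the complete ladders up to l and have
  the size of \<mu>. This provides the starting vector of the lift, see
  \<open>diagram_plus_empty\<close>.\<close>

theorem complete_ladders_monomial: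
  assumes "regular e \<mu>" "e \<ge> 2" "diagram \<mu> = {(c, d). 1 \<le> c \<and> 1 \<le> d \<and> ladder e (c, d) \<le> l}"
  shows "basis \<mu> \<in> monomials e"
proof -
  have "diagram (trunc e l \<mu>) = diagram \<mu>" by (auto simp: diagram_trunc[OF assms(2)] assms(3))
  then have t: "trunc e l \<mu> = \<mu>" by (simp add: diagram_inject)
  have "\<nu> = \<mu>" if "\<nu> \<in> Poly_Mapping.keys (ladA e \<mu> l)" for \<nu>
  proof -
    note K = keys_ladA[OF assms(2) that]
    have "cnt e l \<mu> = card (diagram \<mu>)" using assms(3) by (intro cnt_full) auto
    moreover have "diagram \<nu> \<subseteq> diagram \<mu>" using K unfolding assms(3) by (auto simp: diagram_iff)
    ultimately have "diagram \<nu> = diagram \<mu>" using K by (intro card_subset_eq) auto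
    then show ?thesis by (simp add: diagram_inject)
  qed
  then have "ladA e \<mu> l = basis \<mu>"
    using lookup_ladA_trunc[OF assms(1,2), of l] unfolding t
    by (intro poly_mapping_eqI[of "ladA e \<mu> l"]) (simp add: lookup_basis in_keys_iff; blast)
  then show ?thesis using ladA_monomial[OF assms(2), of \<mu> l] by simp
qed

section \<open>Existence and uniqueness of the canonical basis\<close>

lemma int_laurent_add: "p \<in> int_laurent \<Longrightarrow> q \<in> int_laurent \<Longrightarrow> p + q \<in> int_laurent"
  by (simp add: int_laurent_def lookup_add)

lemma int_laurent_minus: "p \<in> int_laurent \<Longrightarrow> - p \<in> int_laurent"
  by (simp add: int_laurent_def)

lemma int_laurent_0: "0 \<in> int_laurent"
  by (simp add: int_laurent_def)

lemma int_laurent_sum: "(\<And>a. a \<in> A \<Longrightarrow> f a \<in> int_laurent) \<Longrightarrow> sum f A \<in> int_laurent"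
  by (induction A rule: infinite_finite_induct) (auto simp: int_laurent_0 int_laurent_add)

lemma lookup_mult_laurent:
  fixes p q :: laurent
  shows "Poly_Mapping.lookup (p * q) k = (\<Sum>n\<in>Poly_Mapping.keys p. Poly_Mapping.lookup p n * Poly_Mapping.lookup q (k - n))"
proof -
  let ?P = "Poly_Mapping.keys p" and ?Q = "Poly_Mapping.keys q"
  have "(\<Sum>n\<in>?P. Poly_Mapping.single n (Poly_Mapping.lookup p n)) * (\<Sum>n\<in>?Q. Poly_Mapping.single n (Poly_Mapping.lookup q n))
     = (\<Sum>n\<in>?P. \<Sum>m\<in>?Q. Poly_Mapping.single (n + m) (Poly_Mapping.lookup p n * Poly_Mapping.lookup q m))"
    by (simp add: sum_product mult_single)
  then have "p * q = (\<Sum>n\<in>?P. \<Sum>m\<in>?Q. Poly_Mapping.single (n + m) (Poly_Mapping.lookup p n * Poly_Mapping.lookup q m))"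
    using laurent_expand[of p] laurent_expand[of q] by simp
  then have "Poly_Mapping.lookup (p * q) k =
     (\<Sum>n\<in>?P. \<Sum>m\<in>?Q. if n + m = k then Poly_Mapping.lookup p n * Poly_Mapping.lookup q m else 0)"
    by (simp add: lookup_sum lookup_single when_def)
  also have "\<dots> = (\<Sum>n\<in>?P. \<Sum>m\<in>?Q. if m = k - n then Poly_Mapping.lookup p n * Poly_Mapping.lookup q m else 0)"
    by (intro sum.cong refl if_cong) auto
  also have "\<dots> = (\<Sum>n\<in>?P. Poly_Mapping.lookup p n * Poly_Mapping.lookup q (k - n))"
    by (intro sum.cong refl) (auto simp: in_keys_iff)
  finally show ?thesis .
qed

lemma int_laurent_mult: "p \<in> int_laurent \<Longrightarrow> q \<in> int_laurent \<Longrightarrow> p * q \<in> int_laurent"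
  by (auto simp: int_laurent_def lookup_mult_laurent)

lemma int_laurent_vpow: "vpow n \<in> int_laurent"
  by (simp add: int_laurent_def vpow_def lookup_single when_def)

text \<open>Polynomials in v without constant term, with complex coefficients, because
  \<open>invariant_lift\<close> divides by 2.\<close>

definition v_poly :: "laurent set" where
  "v_poly = {p. \<forall>n<1. Poly_Mapping.lookup p n = 0}"

lemma v_int_poly_iff: "p \<in> v_int_poly \<longleftrightarrow> p \<in> int_laurent \<and> p \<in> v_poly"
  by (simp add: v_int_poly_def v_poly_def)

lemma v_poly_bar_zero: "p \<in> v_poly \<Longrightarrow> laurent_bar p = p \<Longrightarrow> p = 0"
proof (rule poly_mapping_eqI)
  fix n assume p: "p \<in> v_poly" "laurent_bar p = p"
  have "Poly_Mapping.lookup p n = Poly_Mapping.lookup p (- n)"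
    using lookup_laurent_bar[of p n] p(2) by simp
  moreover have "n < 1 \<or> - n < 1" by linarith
  ultimately show "Poly_Mapping.lookup p n = Poly_Mapping.lookup 0 n" using p(1) by (auto simp: v_poly_def)
qed

text \<open>The bar-invariant Laurent polynomial that agrees with p in all degrees up to 0, so that
  subtracting it leaves only positive powers of v.\<close>

definition sym_part :: "laurent \<Rightarrow> laurent" where
  "sym_part p = Abs_poly_mapping (\<lambda>n. Poly_Mapping.lookup p (- \<bar>n\<bar>))"

lemma lookup_sym_part: "Poly_Mapping.lookup (sym_part p) n = Poly_Mapping.lookup p (- \<bar>n\<bar>)"
proof -
  have "{n. Poly_Mapping.lookup p (- \<bar>n\<bar>) \<noteq> 0} \<subseteq> uminus ` Poly_Mapping.keys p \<union> Poly_Mapping.keys p"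
  proof
    fix n assume "n \<in> {n. Poly_Mapping.lookup p (- \<bar>n\<bar>) \<noteq> 0}"
    then have "- \<bar>n\<bar> \<in> Poly_Mapping.keys p" by (simp add: in_keys_iff)
    then show "n \<in> uminus ` Poly_Mapping.keys p \<union> Poly_Mapping.keys p"
      by (cases "n \<ge> 0") (auto simp: image_iff intro: bexI[of _ "- n"])
  qed
  then have "finite {n. Poly_Mapping.lookup p (- \<bar>n\<bar>) \<noteq> 0}" by (rule finite_subset) simp
  then show ?thesis by (simp add: sym_part_def Abs_poly_mapping_inverse)
qed

lemma sym_part_bar: "laurent_bar (sym_part p) = sym_part p"
  by (rule poly_mapping_eqI) (simp add: lookup_laurent_bar lookup_sym_part)

lemma sym_part_int: "p \<in> int_laurent \<Longrightarrow> sym_part p \<in> int_laurent"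
  by (simp add: int_laurent_def lookup_sym_part)

lemma sym_part_diff: "p \<in> int_laurent \<Longrightarrow> p - sym_part p \<in> v_int_poly"
  using int_laurent_add[OF _ int_laurent_minus[OF sym_part_int], of p p]
  by (auto simp: v_int_poly_def lookup_minus lookup_sym_part)

lemma monomials_in_L: "e \<ge> 2 \<Longrightarrow> x \<in> monomials e \<Longrightarrow> x \<in> L e"
  by (rotate_tac 1, induction rule: monomials.induct) (auto simp: empty_in_L Fdiv_in_L)

lemma bar_add: "e \<ge> 2 \<Longrightarrow> x \<in> L e \<Longrightarrow> y \<in> L e \<Longrightarrow> bar e (x + y) = bar e x + bar e y"
  and bar_scale: "e \<ge> 2 \<Longrightarrow> x \<in> L e \<Longrightarrow> bar e (scale c x) = scale (laurent_bar c) (bar e x)"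
  and bar_empty: "e \<ge> 2 \<Longrightarrow> bar e (basis empty_partition) = basis empty_partition"
  and bar_Fdiv: "e \<ge> 2 \<Longrightarrow> x \<in> L e \<Longrightarrow> i < e \<Longrightarrow> a \<ge> 1 \<Longrightarrow> bar e (Fdiv e i a x) = Fdiv e i a (bar e x)"
  using bar_exists(2)[of e] unfolding is_bar_involution_def by blast+

lemma bar_in_L: "e \<ge> 2 \<Longrightarrow> x \<in> L e \<Longrightarrow> bar e x \<in> L e"
  using bar_exists(1)[of e] by (auto simp: PiE_def)

lemma bar_0: "e \<ge> 2 \<Longrightarrow> bar e 0 = 0"
  using bar_scale[OF _ empty_in_L, of e 0] by simp

lemma bar_sum: "e \<ge> 2 \<Longrightarrow> (\<And>a. a \<in> A \<Longrightarrow> f a \<in> L e) \<Longrightarrow> bar e (sum f A) = (\<Sum>a\<in>A. bar e (f a))"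
  by (induction A rule: infinite_finite_induct) (auto simp: bar_0 bar_add L_sum)

lemma bar_diff: "e \<ge> 2 \<Longrightarrow> x \<in> L e \<Longrightarrow> y \<in> L e \<Longrightarrow> bar e (x - y) = bar e x - bar e y"
  using bar_add[of e x "scale (- 1) y"] bar_scale[of e y "- 1"] L_scale[of y e "- 1"]
  by (simp add: laurent_bar_minus)

lemma bar_monomial: "e \<ge> 2 \<Longrightarrow> x \<in> monomials e \<Longrightarrow> bar e x = x"
  by (rotate_tac 1, induction rule: monomials.induct) (auto simp: bar_empty bar_Fdiv monomials_in_L)

lemma monomial_int: "e \<ge> 2 \<Longrightarrow> x \<in> monomials e \<Longrightarrow> Poly_Mapping.lookup x lam \<in> int_laurent"
proof (rotate_tac 1, induction arbitrary: lam rule: monomials.induct)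
  case empty
  then show ?case using int_laurent_vpow[of 0] by (simp add: lookup_basis int_laurent_0)
next
  case (Fdiv x i a)
  have "Poly_Mapping.lookup (Fd e i a \<nu>) lam \<in> int_laurent" for \<nu>
    unfolding Fd_def lookup_sum lookup_scale lookup_basis
    by (intro int_laurent_sum) (auto simp: int_laurent_vpow int_laurent_0)
  then show ?case
    using Fdiv by (auto simp: Fdiv_eq_lin lookup_lin intro!: int_laurent_sum int_laurent_mult)
qed

section \<open>The integral form\<close>

lemma integral_form_monomial: "x \<in> monomials e \<Longrightarrow> x \<in> integral_form e"
proof -
  assume "x \<in> monomials e"
  moreover have "1 \<in> int_laurent" using int_laurent_vpow[of 0] by simp
  ultimately show ?thesis unfolding integral_form_def
    by (intro CollectI exI[of _ "{x}"] exI[of _ "\<lambda>_. 1"]) auto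
qed

lemma integral_form_add: assumes "x \<in> integral_form e" "y \<in> integral_form e" shows "x + y \<in> integral_form e"
proof -
  obtain X c where X: "finite X" "X \<subseteq> monomials e" "c ` X \<subseteq> int_laurent" "x = (\<Sum>a\<in>X. scale (c a) a)"
    using assms(1) by (auto simp: integral_form_def)
  obtain Y d where Y: "finite Y" "Y \<subseteq> monomials e" "d ` Y \<subseteq> int_laurent" "y = (\<Sum>a\<in>Y. scale (d a) a)"
    using assms(2) by (auto simp: integral_form_def)
  define f where "f a = (if a \<in> X then c a else 0) + (if a \<in> Y then d a else 0)" for a
  have "x = (\<Sum>a\<in>X \<union> Y. scale (if a \<in> X then c a else 0) a)"
    unfolding X(4) using X(1) Y(1) by (intro sum.mono_neutral_cong_left) auto
  moreover have "y = (\<Sum>a\<in>X \<union> Y. scale (if a \<in> Y then d a else 0) a)"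
    unfolding Y(4) using X(1) Y(1) by (intro sum.mono_neutral_cong_left) auto
  ultimately have "x + y = (\<Sum>a\<in>X \<union> Y. scale (f a) a)"
    by (simp add: f_def fock.scale_left_distrib sum.distrib)
  moreover have "f a \<in> int_laurent" for a
    unfolding f_def using X(3) Y(3) by (auto intro!: int_laurent_add simp: int_laurent_0)
  ultimately show ?thesis unfolding integral_form_def
    using X Y by (intro CollectI exI[of _ "X \<union> Y"] exI[of _ f]) auto
qed

lemma integral_form_scale: assumes "x \<in> integral_form e" "k \<in> int_laurent" shows "scale k x \<in> integral_form e"
proof -
  obtain X c where X: "finite X" "X \<subseteq> monomials e" "c ` X \<subseteq> int_laurent" "x = (\<Sum>a\<in>X. scale (c a) a)"
    using assms(1) by (auto simp: integral_form_def)
  have "scale k x = (\<Sum>a\<in>X. scale (k * c a) a)" unfolding X(4) by (simp add: fock.scale_sum_right)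
  then show ?thesis unfolding integral_form_def
    using X assms(2) by (intro CollectI exI[of _ X] exI[of _ "\<lambda>a. k * c a"]) (auto intro!: int_laurent_mult)
qed

lemma integral_form_0: "0 \<in> integral_form e"
  using integral_form_scale[OF integral_form_monomial[OF monomials.empty], of 0] by (simp add: int_laurent_0)

lemma integral_form_sum: "(\<And>a. a \<in> A \<Longrightarrow> f a \<in> integral_form e) \<Longrightarrow> sum f A \<in> integral_form e"
  by (induction A rule: infinite_finite_induct) (auto simp: integral_form_0 integral_form_add)

lemma integral_form_L: assumes "e \<ge> 2" "x \<in> integral_form e" shows "x \<in> L e"
proof -
  obtain X c where X: "X \<subseteq> monomials e" "x = (\<Sum>a\<in>X. scale (c a) a)"
    using assms(2) by (auto simp: integral_form_def)
  have "scale (c a) a \<in> L e" if "a \<in> X" for a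
    using that X(1) by (intro L_scale monomials_in_L[OF assms(1)]) blast
  then show ?thesis unfolding X(2) by (rule L_sum)
qed

lemma integral_form_int:
  assumes "e \<ge> 2" "x \<in> integral_form e" shows "Poly_Mapping.lookup x lam \<in> int_laurent"
proof -
  obtain X c where X: "X \<subseteq> monomials e" "c ` X \<subseteq> int_laurent" "x = (\<Sum>a\<in>X. scale (c a) a)"
    using assms(2) by (auto simp: integral_form_def)
  have "c a * Poly_Mapping.lookup a lam \<in> int_laurent" if "a \<in> X" for a
    using that X(1,2) by (intro int_laurent_mult monomial_int[OF assms(1)]) blast+
  then show ?thesis unfolding X(3) lookup_sum lookup_scale by (rule int_laurent_sum)
qed

definition lvec :: "nat \<Rightarrow> partition \<Rightarrow> fock" where
  "lvec e \<mu> = (SOME A. A \<in> monomials e \<and> Poly_Mapping.lookup A \<mu> = 1 \<and> (\<forall>\<nu>\<in>Poly_Mapping.keys A. dominates \<mu> \<nu>))"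

lemma lvec:
  assumes "regular e \<mu>" "e \<ge> 2"
  shows "lvec e \<mu> \<in> monomials e" "Poly_Mapping.lookup (lvec e \<mu>) \<mu> = 1"
    "\<nu> \<in> Poly_Mapping.keys (lvec e \<mu>) \<Longrightarrow> dominates \<mu> \<nu>"
proof -
  have "\<exists>A. A \<in> monomials e \<and> Poly_Mapping.lookup A \<mu> = 1 \<and> (\<forall>\<nu>\<in>Poly_Mapping.keys A. dominates \<mu> \<nu>)"
    using ladder_vector[OF assms] by blast
  from someI_ex[OF this] show "lvec e \<mu> \<in> monomials e" "Poly_Mapping.lookup (lvec e \<mu>) \<mu> = 1"
    "\<nu> \<in> Poly_Mapping.keys (lvec e \<mu>) \<Longrightarrow> dominates \<mu> \<nu>"
    unfolding lvec_def by blast+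
qed

lemma lookup_lvec_zero:
  assumes "regular e \<mu>" "e \<ge> 2" "\<nu> \<noteq> \<mu>" "rk \<nu> \<ge> rk \<mu>"
  shows "Poly_Mapping.lookup (lvec e \<mu>) \<nu> = 0"
  using lvec(3)[OF assms(1,2), of \<nu>] dominates_rk[of \<mu> \<nu>] assms(3,4) by (force simp: in_keys_iff)

lemma plen_le_psize: "plen lam \<le> psize lam"
proof -
  have "part lam i \<ge> 1" if "i \<in> {1..plen lam}" for i
  proof (rule ccontr)
    assume "\<not> part lam i \<ge> 1"
    then have "\<forall>j>i - 1. part lam j = 0" using that part_antimono[of i _ lam] by (metis Suc_pred' atLeastAtMost_iff le_zero_eq less_one not_le Suc_leI)
    then have "plen lam \<le> i - 1" by (simp add: plen_le_iff)
    then show False using that by auto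
  qed
  then have "(\<Sum>i=1..plen lam. 1) \<le> psize lam" unfolding psize_def by (intro sum_mono) auto
  then show ?thesis by simp
qed

text \<open>A crude bound that serves as the starting point of the inductions on rank
  (\<open>below_bottom\<close>).\<close>

lemma rk_lower: assumes "psize lam \<le> w" shows "rk lam \<ge> - 2 * int w * int w"
proof -
  have "plen lam \<le> w" using plen_le_psize[of lam] assms by simp
  have "(\<Sum>c=1..plen lam. - 2 * int w * int (part lam c)) \<le> rk lam"
    unfolding rk_def
  proof (rule sum_mono)
    fix c assume "c \<in> {1..plen lam}"
    then have "- 2 * int w \<le> int (part lam c) - 2 * int c" using \<open>plen lam \<le> w\<close> by auto
    then have "int (part lam c) * (- 2 * int w) \<le> int (part lam c) * (int (part lam c) - 2 * int c)"
      by (rule mult_left_mono) simp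
    then show "- 2 * int w * int (part lam c) \<le> int (part lam c) * (int (part lam c) - 2 * int c)"
      by (simp add: mult.commute)
  qed
  moreover have "(\<Sum>c=1..plen lam. - 2 * int w * int (part lam c)) = - 2 * int w * int (psize lam)"
    unfolding psize_def of_nat_sum sum_distrib_left ..
  moreover have "- 2 * int w * int w \<le> - 2 * int w * int (psize lam)"
    using assms by (intro mult_left_mono_neg) auto
  ultimately show ?thesis by linarith
qed

text \<open>Elements of \<open>L e\<close> are determined by their coefficients at regular
  partitions, so eliminations need to look only there.\<close>

lemma regular_zero:
  assumes "e \<ge> 2" "x \<in> L e" "\<And>lam. regular e lam \<Longrightarrow> Poly_Mapping.lookup x lam = 0"
  shows "x = 0"
proof (rule poly_mapping_eqI)
  fix lam
  show "Poly_Mapping.lookup x lam = Poly_Mapping.lookup 0 lam"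
    using nonregular_coeffs[OF assms(1,2), of "{0}" "{0}" lam] assms(3) by (cases "regular e lam") auto
qed

section \<open>Elimination by ladder vectors, one rank at a time\<close>

definition below :: "nat \<Rightarrow> nat \<Rightarrow> int \<Rightarrow> fock set" where
  "below e w r = {z \<in> L e. (\<forall>lam\<in>Poly_Mapping.keys z. psize lam \<le> w \<and> (regular e lam \<longrightarrow> rk lam < r))}"

definition peel :: "nat \<Rightarrow> int \<Rightarrow> fock \<Rightarrow> partition set" where
  "peel e r z = {lam \<in> Poly_Mapping.keys z. regular e lam \<and> rk lam = r}"

lemma finite_peel [simp]: "finite (peel e r z)"
  unfolding peel_def by (rule finite_subset[OF _ finite_keys[of z]]) auto

lemma lvec_sum_in_L: "e \<ge> 2 \<Longrightarrow> (\<And>\<nu>. \<nu> \<in> T \<Longrightarrow> regular e \<nu>) \<Longrightarrow> (\<Sum>\<nu>\<in>T. scale (c \<nu>) (lvec e \<nu>)) \<in> L e"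
  by (intro L_sum L_scale monomials_in_L lvec) auto

lemma lookup_lvec_sum:
  assumes "e \<ge> 2" "finite T" "\<And>\<nu>. \<nu> \<in> T \<Longrightarrow> regular e \<nu> \<and> rk \<nu> = r" "rk lam \<ge> r"
  shows "Poly_Mapping.lookup (\<Sum>\<nu>\<in>T. scale (c \<nu>) (lvec e \<nu>)) lam = (if lam \<in> T then c lam else 0)"
proof -
  have "Poly_Mapping.lookup (\<Sum>\<nu>\<in>T. scale (c \<nu>) (lvec e \<nu>)) lam = (\<Sum>\<nu>\<in>T. if \<nu> = lam then c lam else 0)"
    unfolding lookup_sum lookup_scale
    by (intro sum.cong refl) (use assms lvec(2) lookup_lvec_zero in auto)
  then show ?thesis using assms(2) by simp
qed

lemma below_peel:
  assumes "e \<ge> 2" "z \<in> below e w (r + 1)" "\<And>\<nu>. \<nu> \<in> peel e r z \<Longrightarrow> c \<nu> = Poly_Mapping.lookup z \<nu>"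
  shows "z - (\<Sum>\<nu>\<in>peel e r z. scale (c \<nu>) (lvec e \<nu>)) \<in> below e w r" (is "z - ?s \<in> _")
proof -
  have sL: "?s \<in> L e" by (rule lvec_sum_in_L[OF assms(1)]) (simp add: peel_def)
  have "psize lam \<le> w \<and> (regular e lam \<longrightarrow> rk lam < r)" if "lam \<in> Poly_Mapping.keys (z - ?s)" for lam
  proof -
    have ne: "Poly_Mapping.lookup z lam - Poly_Mapping.lookup ?s lam \<noteq> 0" using that by (simp add: in_keys_iff lookup_minus)
    have ps: "psize lam \<le> w"
    proof (cases "lam \<in> Poly_Mapping.keys z")
      case True
      then show ?thesis using assms(2) by (simp add: below_def)
    next
      case False
      then have "Poly_Mapping.lookup ?s lam \<noteq> 0" using ne by (simp add: in_keys_iff)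
      then obtain \<nu> where nu: "\<nu> \<in> peel e r z" "Poly_Mapping.lookup (lvec e \<nu>) lam \<noteq> 0"
        unfolding lookup_sum lookup_scale by (metis (no_types, lifting) mult_zero_right sum.neutral)
      then have "dominates \<nu> lam" using lvec(3)[of e \<nu> lam] assms(1) by (simp add: peel_def in_keys_iff)
      moreover have "psize \<nu> \<le> w" using nu(1) assms(2) by (simp add: below_def peel_def)
      ultimately show ?thesis by (simp add: dominates_def)
    qed
    have "rk lam < r" if reg: "regular e lam"
    proof (rule ccontr)
      assume "\<not> rk lam < r"
      then have s: "Poly_Mapping.lookup ?s lam = (if lam \<in> peel e r z then c lam else 0)"
        by (intro lookup_lvec_sum[OF assms(1)]) (auto simp: peel_def)
      show False
      proof (cases "lam \<in> peel e r z")
        case True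
        then show False using ne s assms(3) by simp
      next
        case False
        then have "lam \<in> Poly_Mapping.keys z" using ne s by (simp add: in_keys_iff)
        then have "rk lam < r + 1" using assms(2) reg by (simp add: below_def)
        then show False using False reg \<open>\<not> rk lam < r\<close> \<open>lam \<in> Poly_Mapping.keys z\<close> by (simp add: peel_def)
      qed
    qed
    with ps show ?thesis by simp
  qed
  moreover have "z - ?s \<in> L e" using assms(2) sL by (intro L_diff) (simp_all add: below_def)
  ultimately show ?thesis by (simp add: below_def)
qed

lemma below_bottom: "e \<ge> 2 \<Longrightarrow> z \<in> below e w (- 2 * int w * int w) \<Longrightarrow> z = 0"
  using rk_lower[of _ w] by (intro regular_zero) (force simp: below_def in_keys_iff)+

text \<open>The top layer is removed by ladder vectors, which are bar-invariant and unitriangular at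
  regular partitions. On this layer the bar involution acts by \<open>laurent_bar\<close>; the
  remainder has lower rank and is covered by induction.\<close>

lemma below_bar:
  assumes "e \<ge> 2"
  shows "z \<in> below e w (- 2 * int w * int w + int n) \<Longrightarrow> bar e z \<in> below e w (- 2 * int w * int w + int n) \<and>
    (\<forall>lam. regular e lam \<and> rk lam = - 2 * int w * int w + int n - 1 \<longrightarrow>
      Poly_Mapping.lookup (bar e z) lam = laurent_bar (Poly_Mapping.lookup z lam))"
proof (induction n arbitrary: z)
  case 0
  then have "z = 0" using below_bottom[OF assms] by simp
  then show ?case using assms by (simp add: bar_0 below_def L_0)
next
  case (Suc n)
  define r where "r = - 2 * int w * int w + int n"
  have z: "z \<in> below e w (r + 1)" using Suc.prems by (simp add: r_def algebra_simps)
  let ?T = "peel e r z"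
  let ?s = "\<Sum>\<nu>\<in>?T. scale (Poly_Mapping.lookup z \<nu>) (lvec e \<nu>)"
  let ?t = "\<Sum>\<nu>\<in>?T. scale (laurent_bar (Poly_Mapping.lookup z \<nu>)) (lvec e \<nu>)"
  have T: "regular e \<nu> \<and> rk \<nu> = r \<and> psize \<nu> \<le> w" if "\<nu> \<in> ?T" for \<nu> using that z by (simp add: peel_def below_def)
  have z': "z - ?s \<in> below e w r" by (rule below_peel[OF assms z]) simp
  from Suc.IH[of "z - ?s"] z' have IH: "bar e (z - ?s) \<in> below e w r" by (simp add: r_def)
  have sL: "?s \<in> L e" by (rule lvec_sum_in_L[OF assms]) (use T in blast)
  have zL: "z \<in> L e" using z by (simp add: below_def)
  have bs: "bar e ?s = ?t"
    using T assms by (subst bar_sum) (auto simp: bar_scale bar_monomial lvec monomials_in_L intro!: L_scale)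
  have bz: "bar e z = bar e (z - ?s) + ?t" using bar_diff[OF assms zL sL] bs by simp
  have tk: "\<exists>\<nu>\<in>?T. dominates \<nu> lam" if "lam \<in> Poly_Mapping.keys ?t" for lam
  proof -
    have "Poly_Mapping.lookup ?t lam \<noteq> 0" using that by (simp add: in_keys_iff)
    then obtain \<nu> where "\<nu> \<in> ?T" "Poly_Mapping.lookup (lvec e \<nu>) lam \<noteq> 0"
      unfolding lookup_sum lookup_scale by (metis (no_types, lifting) mult_zero_right sum.neutral)
    then show ?thesis using lvec(3)[of e \<nu> lam] T assms by (auto simp: in_keys_iff)
  qed
  have "psize lam \<le> w \<and> (regular e lam \<longrightarrow> rk lam < r + 1)" if "lam \<in> Poly_Mapping.keys (bar e z)" for lam
  proof -
    have "lam \<in> Poly_Mapping.keys (bar e (z - ?s)) \<or> lam \<in> Poly_Mapping.keys ?t"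
      using that unfolding bz by (auto simp: in_keys_iff lookup_add)
    then show ?thesis
    proof
      assume "lam \<in> Poly_Mapping.keys (bar e (z - ?s))"
      then show ?thesis using IH by (force simp: below_def)
    next
      assume "lam \<in> Poly_Mapping.keys ?t"
      then obtain \<nu> where nu: "\<nu> \<in> ?T" "dominates \<nu> lam" using tk by blast
      then show ?thesis using T[OF nu(1)] dominates_rk[OF nu(2)] by (cases "lam = \<nu>") (auto simp: dominates_def)
    qed
  qed
  moreover have "bar e z \<in> L e" by (rule bar_in_L[OF assms zL])
  ultimately have 1: "bar e z \<in> below e w (r + 1)" by (simp add: below_def)
  have 2: "Poly_Mapping.lookup (bar e z) lam = laurent_bar (Poly_Mapping.lookup z lam)" if lam: "regular e lam" "rk lam = r" for lam
  proof -
    have "Poly_Mapping.lookup (bar e (z - ?s)) lam = 0" using IH lam by (force simp: below_def in_keys_iff)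
    moreover have "Poly_Mapping.lookup ?t lam = (if lam \<in> ?T then laurent_bar (Poly_Mapping.lookup z lam) else 0)"
      by (rule lookup_lvec_sum[OF assms]) (use T lam in auto)
    moreover have "Poly_Mapping.lookup z lam = 0" if "lam \<notin> ?T" using that lam by (simp add: peel_def in_keys_iff)
    ultimately show ?thesis unfolding bz lookup_add by auto
  qed
  show ?case using 1 2 by (simp add: r_def algebra_simps)
qed

text \<open>The first \<open>plen \<nu>\<close> rows of \<mu> already hold at least as many nodes as
  \<nu> has altogether, so no further row of \<mu> is nonempty.\<close>

lemma dominates_plen:
  assumes "dominates \<mu> \<nu>" shows "plen \<mu> \<le> plen \<nu>"
  unfolding plen_le_iff
proof (intro allI impI)
  fix i assume i: "i > plen \<nu>"
  define K where "K = max i (plen \<mu>)"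
  have "(\<Sum>c=1..K. part \<mu> c) = psize \<mu>" by (rule psize_eq_sum[symmetric]) (simp add: K_def)
  also have "\<dots> = (\<Sum>c=1..plen \<nu>. part \<nu> c)" using assms by (simp add: dominates_def psize_def)
  also have "\<dots> \<le> (\<Sum>c=1..plen \<nu>. part \<mu> c)" using assms by (simp add: dominates_def)
  finally have "(\<Sum>c=1..K. part \<mu> c) \<le> (\<Sum>c=1..plen \<nu>. part \<mu> c)" .
  moreover have "{1..K} = {1..plen \<nu>} \<union> {plen \<nu> + 1..K}" using i by (auto simp: K_def)
  then have "(\<Sum>c=1..K. part \<mu> c) = (\<Sum>c=1..plen \<nu>. part \<mu> c) + (\<Sum>c=plen \<nu> + 1..K. part \<mu> c)"
    by (simp only:) (rule sum.union_disjoint, auto)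
  ultimately have "(\<Sum>c=plen \<nu> + 1..K. part \<mu> c) = 0" by simp
  then show "part \<mu> i = 0" using i by (simp add: K_def)
qed

text \<open>Coefficients in the top layer are bar-invariant; at short partitions they are also in
  \<open>v_poly\<close>, hence 0. So only ladder vectors of long partitions are peeled off, and by
  \<open>dominates_plen\<close> these change no coefficient at a short partition.\<close>

theorem bar_invariant_small:
  assumes "e \<ge> 2" "y \<in> L e" "bar e y = y" "\<And>lam. plen lam \<le> k \<Longrightarrow> Poly_Mapping.lookup y lam \<in> v_poly" "plen lam \<le> k"
  shows "Poly_Mapping.lookup y lam = 0"
proof -
  define w where "w = Max (insert 0 (psize ` Poly_Mapping.keys y))"
  have w: "psize \<nu> \<le> w" if "\<nu> \<in> Poly_Mapping.keys y" for \<nu>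
    unfolding w_def using that by (intro Max_ge) auto
  have gen: "Poly_Mapping.lookup z lam = 0"
    if "z \<in> below e w (- 2 * int w * int w + int n)" "bar e z = z"
      "\<And>lam. plen lam \<le> k \<Longrightarrow> Poly_Mapping.lookup z lam \<in> v_poly" "plen lam \<le> k" for n z lam
    using that
  proof (induction n arbitrary: z lam)
    case 0
    then have "z = 0" using below_bottom[OF assms(1)] by simp
    then show ?case by simp
  next
    case (Suc n)
    define r where "r = - 2 * int w * int w + int n"
    have z: "z \<in> below e w (r + 1)" using Suc.prems(1) by (simp add: r_def algebra_simps)
    let ?T = "peel e r z"
    let ?s = "\<Sum>\<nu>\<in>?T. scale (Poly_Mapping.lookup z \<nu>) (lvec e \<nu>)"
    have T: "regular e \<nu> \<and> rk \<nu> = r \<and> psize \<nu> \<le> w" if "\<nu> \<in> ?T" for \<nu> using that z by (simp add: peel_def below_def)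
    have inv: "laurent_bar (Poly_Mapping.lookup z \<nu>) = Poly_Mapping.lookup z \<nu>" if "\<nu> \<in> ?T" for \<nu>
      using below_bar[OF assms(1) Suc.prems(1)] T[OF that] Suc.prems(2) by (simp add: r_def)
    have long: "plen \<nu> > k" if "\<nu> \<in> ?T" for \<nu>
    proof (rule ccontr)
      assume "\<not> plen \<nu> > k"
      then have "Poly_Mapping.lookup z \<nu> = 0" using Suc.prems(3)[of \<nu>] inv[OF that] by (intro v_poly_bar_zero) simp_all
      then show False using that by (simp add: peel_def in_keys_iff)
    qed
    have s0: "Poly_Mapping.lookup ?s \<nu> = 0" if "plen \<nu> \<le> k" for \<nu>
      unfolding lookup_sum lookup_scale
    proof (rule sum.neutral, rule ballI)
      fix \<kappa> assume \<kappa>: "\<kappa> \<in> ?T"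
      have "\<nu> \<notin> Poly_Mapping.keys (lvec e \<kappa>)"
      proof
        assume "\<nu> \<in> Poly_Mapping.keys (lvec e \<kappa>)"
        then have "dominates \<kappa> \<nu>" using lvec(3) T[OF \<kappa>] assms(1) by blast
        then show False using dominates_plen[of \<kappa> \<nu>] long[OF \<kappa>] that by simp
      qed
      then show "Poly_Mapping.lookup z \<kappa> * Poly_Mapping.lookup (lvec e \<kappa>) \<nu> = 0" by (simp add: in_keys_iff)
    qed
    have z': "z - ?s \<in> below e w r" by (rule below_peel[OF assms(1) z]) simp
    have sL: "?s \<in> L e" by (rule lvec_sum_in_L[OF assms(1)]) (use T in blast)
    have zL: "z \<in> L e" using z by (simp add: below_def)
    have bs: "bar e ?s = ?s"
      using T assms(1) inv by (subst bar_sum) (auto simp: bar_scale bar_monomial lvec monomials_in_L intro!: L_scale)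
    have "bar e (z - ?s) = z - ?s" using bar_diff[OF assms(1) zL sL] bs Suc.prems(2) by simp
    then have "Poly_Mapping.lookup (z - ?s) lam = 0"
      using Suc.IH[of "z - ?s" lam] z' Suc.prems(3,4) s0 by (simp add: r_def lookup_minus)
    then show ?case using s0[OF Suc.prems(4)] by (simp add: lookup_minus)
  qed
  define R where "R = Max (insert 0 (rk ` Poly_Mapping.keys y))"
  have R: "rk \<nu> \<le> R" if "\<nu> \<in> Poly_Mapping.keys y" for \<nu>
    unfolding R_def using that by (intro Max_ge) auto
  have "R \<ge> 0" unfolding R_def by (intro Max_ge) auto
  \<comment> \<open>The number of layers is chosen to reach from the bound of
    \<open>rk_lower\<close> to just above every rank occurring in y.\<close>
  then have "- 2 * int w * int w + int (2 * w * w + nat R + 1) = R + 1" by simp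
  then have "y \<in> below e w (- 2 * int w * int w + int (2 * w * w + nat R + 1))"
    using assms(2) w R by (force simp: below_def)
  from gen[OF this assms(3,4,5)] show ?thesis .
qed

text \<open>The ladder vector of \<mu> is corrected at regular partitions in order of decreasing
  rank, by symmetric parts of the unwanted coefficients. The nonregular coefficients then follow
  from \<open>nonregular_coeffs\<close>.\<close>

theorem canonical_exists:
  assumes e: "e \<ge> 2" and reg: "regular e \<mu>"
  shows "\<exists>B. is_canonical e \<mu> B"
proof -
  have step: "\<exists>x. x \<in> integral_form e \<and> bar e x = x \<and> (\<forall>lam\<in>Poly_Mapping.keys x. dominates \<mu> lam) \<and>
     Poly_Mapping.lookup x \<mu> = 1 \<and> (\<forall>lam. regular e lam \<and> lam \<noteq> \<mu> \<and> rk lam \<ge> rk \<mu> - int n \<longrightarrow> Poly_Mapping.lookup x lam \<in> v_int_poly)" for n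
  proof (induction n)
    case 0
    have "0 \<in> v_int_poly" by (simp add: v_int_poly_def int_laurent_0)
    then show ?case
      using lvec[OF reg e] lookup_lvec_zero[OF reg e] bar_monomial[OF e lvec(1)[OF reg e]]
      by (intro exI[of _ "lvec e \<mu>"]) (auto simp: integral_form_monomial)
  next
    case (Suc n)
    then obtain x where x: "x \<in> integral_form e" "bar e x = x" "\<And>lam. lam \<in> Poly_Mapping.keys x \<Longrightarrow> dominates \<mu> lam"
      "Poly_Mapping.lookup x \<mu> = 1" "\<And>lam. regular e lam \<Longrightarrow> lam \<noteq> \<mu> \<Longrightarrow> rk lam \<ge> rk \<mu> - int n \<Longrightarrow> Poly_Mapping.lookup x lam \<in> v_int_poly"
      by blast
    define r where "r = rk \<mu> - int (Suc n)"
    let ?T = "peel e r x"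
    let ?c = "\<lambda>\<nu>. sym_part (Poly_Mapping.lookup x \<nu>)"
    let ?s = "\<Sum>\<nu>\<in>?T. scale (?c \<nu>) (lvec e \<nu>)"
    have T: "regular e \<nu> \<and> rk \<nu> = r \<and> dominates \<mu> \<nu>" if "\<nu> \<in> ?T" for \<nu> using that x(3) by (simp add: peel_def)
    have xi: "Poly_Mapping.lookup x lam \<in> int_laurent" for lam by (rule integral_form_int[OF e x(1)])
    have s: "Poly_Mapping.lookup ?s lam = (if lam \<in> ?T then ?c lam else 0)" if "rk lam \<ge> r" for lam
      by (rule lookup_lvec_sum[OF e]) (use T that in auto)
    have sI: "?s \<in> integral_form e"
      by (intro integral_form_sum integral_form_scale integral_form_monomial lvec sym_part_int xi) (use T e in auto)
    have bs: "bar e ?s = ?s"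
      using T e by (subst bar_sum) (auto simp: bar_scale bar_monomial lvec monomials_in_L sym_part_bar intro!: L_scale)
    have \<mu>T: "\<mu> \<notin> ?T" by (auto simp: peel_def r_def)
    show ?case
    proof (intro exI[of _ "x - ?s"] conjI ballI allI impI)
      have "x + scale (- 1) ?s \<in> integral_form e"
        using int_laurent_minus[OF int_laurent_vpow[of 0]] by (intro integral_form_add x(1) integral_form_scale sI) simp
      then show "x - ?s \<in> integral_form e" by simp
      show "bar e (x - ?s) = x - ?s"
        using bar_diff[OF e integral_form_L[OF e x(1)] integral_form_L[OF e sI]] bs x(2) by simp
      show "Poly_Mapping.lookup (x - ?s) \<mu> = 1" using s[of \<mu>] \<mu>T x(4) by (simp add: lookup_minus r_def)
    next
      fix lam assume "lam \<in> Poly_Mapping.keys (x - ?s)"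
      then have "lam \<in> Poly_Mapping.keys x \<or> Poly_Mapping.lookup ?s lam \<noteq> 0" by (auto simp: in_keys_iff lookup_minus)
      then show "dominates \<mu> lam"
      proof
        assume "Poly_Mapping.lookup ?s lam \<noteq> 0"
        then obtain \<nu> where "\<nu> \<in> ?T" "Poly_Mapping.lookup (lvec e \<nu>) lam \<noteq> 0"
          unfolding lookup_sum lookup_scale by (metis (no_types, lifting) mult_zero_right sum.neutral)
        then have "dominates \<mu> \<nu>" "dominates \<nu> lam"
          using lvec(3)[of e \<nu> lam] T e by (auto simp: in_keys_iff)
        then show ?thesis by (rule dominates_trans)
      qed (rule x(3))
    next
      fix lam assume lam: "regular e lam \<and> lam \<noteq> \<mu> \<and> rk lam \<ge> rk \<mu> - int (Suc n)"
      show "Poly_Mapping.lookup (x - ?s) lam \<in> v_int_poly"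
      proof (cases "lam \<in> ?T")
        case True
        then show ?thesis using s[of lam] lam sym_part_diff[OF xi[of lam]] by (simp add: lookup_minus r_def)
      next
        case False
        then have "Poly_Mapping.lookup (x - ?s) lam = Poly_Mapping.lookup x lam"
          using s[of lam] lam by (simp add: lookup_minus r_def)
        moreover have "Poly_Mapping.lookup x lam \<in> v_int_poly"
        proof (cases "rk lam = r")
          case True
          then have "Poly_Mapping.lookup x lam = 0" using False lam by (simp add: peel_def in_keys_iff)
          then show ?thesis by (simp add: v_int_poly_def int_laurent_0)
        next
          case False
          then show ?thesis using x(5) lam by (simp add: r_def)
        qed
        ultimately show ?thesis by simp
      qed
    qed
  qed
  define n where "n = nat (rk \<mu> + 2 * int (psize \<mu>) * int (psize \<mu>))"
  obtain x where x: "x \<in> integral_form e" "bar e x = x" "\<And>lam. lam \<in> Poly_Mapping.keys x \<Longrightarrow> dominates \<mu> lam"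
      "Poly_Mapping.lookup x \<mu> = 1" "\<And>lam. regular e lam \<Longrightarrow> lam \<noteq> \<mu> \<Longrightarrow> rk lam \<ge> rk \<mu> - int n \<Longrightarrow> Poly_Mapping.lookup x lam \<in> v_int_poly"
    using step[of n] by blast
  have z: "0 \<in> v_int_poly" by (simp add: v_int_poly_def int_laurent_0)
  have reg_small: "Poly_Mapping.lookup x lam \<in> v_int_poly" if "regular e lam" "lam \<noteq> \<mu>" for lam
  proof (cases "lam \<in> Poly_Mapping.keys x")
    case True
    then have "psize lam = psize \<mu>" using x(3) by (simp add: dominates_def)
    then have "rk lam \<ge> - 2 * int (psize \<mu>) * int (psize \<mu>)" using rk_lower[of lam "psize \<mu>"] by simp
    then have "rk lam \<ge> rk \<mu> - int n" using rk_lower[of \<mu> "psize \<mu>"] by (simp add: n_def)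
    then show ?thesis using x(5) that by blast
  qed (simp add: in_keys_iff z)
  let ?P = "{p \<in> int_laurent. \<forall>n<0. Poly_Mapping.lookup p n = 0}"
  have nonreg: "Poly_Mapping.lookup x lam \<in> v_int_poly" if "\<not> regular e lam" for lam
  proof (rule nonregular_coeffs[OF e integral_form_L[OF e x(1)], where P="?P"])
    show "Poly_Mapping.lookup x lam \<in> ?P" if "regular e lam" for lam
      using reg_small[OF that] x(4) int_laurent_vpow[of 0]
      by (cases "lam = \<mu>") (auto simp: v_int_poly_def lookup_one when_def)
    show "negv j * a \<in> v_int_poly" if "a \<in> ?P" "j \<ge> 1" for a j
    proof -
      have "vpow j * a \<in> v_int_poly"
        using that int_laurent_mult[OF int_laurent_vpow[of j], of a]
        by (auto simp: v_int_poly_def lookup_mult_laurent vpow_def)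
      then show ?thesis by (auto simp: negv_def v_int_poly_def int_laurent_minus)
    qed
  qed (use that in \<open>auto simp: v_int_poly_def int_laurent_0 int_laurent_add int_laurent_minus lookup_add\<close>)
  have "is_canonical e \<mu> x"
    unfolding is_canonical_def using x reg_small nonreg by blast
  then show ?thesis ..
qed

lemma canonical_basis:
  assumes e: "e \<ge> 2" and reg: "regular e \<mu>"
  shows "is_canonical e \<mu> (canonical_basis e \<mu>)"
proof -
  have "B = C" if B: "is_canonical e \<mu> B" and C: "is_canonical e \<mu> C" for B C
  proof (rule poly_mapping_eqI)
    fix lam
    have L: "B \<in> L e" "C \<in> L e" using B C integral_form_L[OF e] by (simp_all add: is_canonical_def)
    have "Poly_Mapping.lookup (B - C) lam = 0"
    proof (rule bar_invariant_small[OF e L_diff[OF L], where k="plen lam"])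
      show "bar e (B - C) = B - C" using bar_diff[OF e L] B C by (simp add: is_canonical_def)
      show "Poly_Mapping.lookup (B - C) \<nu> \<in> v_poly" for \<nu>
        using B C by (cases "\<nu> = \<mu>") (auto simp: is_canonical_def v_int_poly_iff v_poly_def lookup_minus)
    qed simp
    then show "Poly_Mapping.lookup B lam = Poly_Mapping.lookup C lam" by (simp add: lookup_minus)
  qed
  then have "\<exists>!B. is_canonical e \<mu> B" using canonical_exists[OF assms] by blast
  then show ?thesis unfolding canonical_basis_def by (rule theI')
qed

section \<open>Inserting an empty runner\<close>

lemma div_Suc_int:
  fixes x n :: int assumes "n > 1"
  shows "(x + 1) div n = x div n + (if (x + 1) mod n = 0 then 1 else 0)"
proof -
  define q where "q = x div n"
  define r where "r = x mod n"
  have x: "x = n * q + r" by (simp add: q_def r_def)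
  have r: "0 \<le> r" "r < n" using assms by (simp_all add: r_def)
  show ?thesis
  proof (cases "r = n - 1")
    case True
    then have eq: "x + 1 = (q + 1) * n" using x by (simp add: algebra_simps)
    have "(x + 1) div n = q + 1" "(x + 1) mod n = 0" unfolding eq using assms by auto
    then show ?thesis unfolding q_def by simp
  next
    case False
    then have eq: "x + 1 = n * q + (r + 1)" and r1: "0 \<le> r + 1" "r + 1 < n" using x r by simp_all
    have "(x + 1) div n = q" "(x + 1) mod n = r + 1"
      using int_div_pos_eq[OF eq r1] int_mod_pos_eq[OF eq r1] by auto
    then show ?thesis unfolding q_def using r by simp
  qed
qed

locale runner_insertion =
  fixes e k \<alpha> :: nat
  assumes e2: "e \<ge> 2" and \<alpha>e: "\<alpha> \<le> e"
begin

text \<open>The new position of a bead, in the numbering of \<open>maya\<close>.\<close>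

definition Phi :: "int \<Rightarrow> int" where
  "Phi p = p + (p + int k + int e - int \<alpha>) div int e"

text \<open>The quotient in \<open>Phi\<close> counts the places of the new runner before the bead,
  with the count starting at the left end of the abacus. A step of 2 jumps over one such
  place.\<close>

lemma Phi_Suc: "Phi (p + 1) = Phi p + (if (p + 1 + int k - int \<alpha>) mod int e = 0 then 2 else 1)"
proof -
  define x where "x = p + int k + int e - int \<alpha>"
  have x1: "p + 1 + int k + int e - int \<alpha> = x + 1" by (simp add: x_def)
  have "x + 1 = (p + 1 + int k - int \<alpha>) + int e" by (simp add: x_def)
  then have "(x + 1) mod int e = (p + 1 + int k - int \<alpha>) mod int e" by (simp only: mod_add_self2)
  then show ?thesis unfolding Phi_def x1 x_def[symmetric] using div_Suc_int[of "int e" x] e2 by simp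
qed

lemma Phi_strict_mono: "p < q \<Longrightarrow> Phi p < Phi q"
proof -
  assume "p < q"
  then have "(p + int k + int e - int \<alpha>) div int e \<le> (q + int k + int e - int \<alpha>) div int e"
    by (intro zdiv_mono1) (use e2 in auto)
  then show ?thesis using \<open>p < q\<close> by (simp add: Phi_def)
qed

lemma Phi_less_iff: "Phi p < Phi q \<longleftrightarrow> p < q"
  by (metis Phi_strict_mono linorder_less_linear order_less_asym)

lemma Phi_eq_iff [simp]: "Phi p = Phi q \<longleftrightarrow> p = q"
  by (metis Phi_strict_mono less_irrefl linorder_less_linear)

lemma inj_Phi: "inj_on Phi A"
  by (simp add: inj_on_def)

text \<open>No bead crosses the left end of the abacus, which lies at -k in the numbering of
  \<open>maya\<close>. Hence the truncation to moves from -k on means the same before and after the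
  insertion.\<close>

lemma Phi_ge_iff: "Phi p \<ge> - int k \<longleftrightarrow> p \<ge> - int k"
proof
  assume "p \<ge> - int k"
  then have "0 \<le> (p + int k + int e - int \<alpha>) div int e"
    using \<alpha>e e2 by (simp add: pos_imp_zdiv_nonneg_iff)
  then show "Phi p \<ge> - int k" using \<open>p \<ge> - int k\<close> by (simp add: Phi_def)
next
  assume *: "Phi p \<ge> - int k"
  show "p \<ge> - int k"
  proof (rule ccontr)
    assume "\<not> p \<ge> - int k"
    then have "p + int k + int e - int \<alpha> < int e" by simp
    then have "(p + int k + int e - int \<alpha>) div int e < 1"
      using zdiv_mono1[of "p + int k + int e - int \<alpha>" "int e - 1" "int e"] e2 by simp
    then show False using * \<open>\<not> p \<ge> - int k\<close> by (simp add: Phi_def)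
  qed
qed

text \<open>Counted cyclically from the old runner \<alpha>, the runners 0, ..., e - 1 become the
  runners 1, ..., e counted from the new one, which has number 0.\<close>

lemma Phi_mod: "(Phi p + int k - int \<alpha>) mod int (e + 1) = (p + int k - int \<alpha>) mod int e + 1"
proof -
  let ?x = "p + int k + int e - int \<alpha>"
  have x: "?x = int e * (?x div int e) + ?x mod int e" by simp
  have xm: "?x mod int e = (p + int k - int \<alpha>) mod int e"
    by (metis add.commute add_diff_eq mod_add_self1)
  have "Phi p + int k - int \<alpha> = (?x mod int e + 1) + int (e + 1) * (?x div int e - 1)"
    using x by (simp add: Phi_def algebra_simps)
  then have "(Phi p + int k - int \<alpha>) mod int (e + 1) = (?x mod int e + 1) mod int (e + 1)"
    by (simp only: mod_mult_self2)
  also have "\<dots> = ?x mod int e + 1" using e2 by (intro mod_pos_pos_trivial) auto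
  finally show ?thesis unfolding xm .
qed

text \<open>Explicit form of the insertion: row c gains one column for each place of the new runner
  before its bead.\<close>

definition plus :: "partition \<Rightarrow> partition" where
  "plus lam = Abs_partition (\<lambda>c. if 1 \<le> c \<and> c \<le> k then part lam c + (part lam c + (k - c) + (e - \<alpha>)) div e else 0)"

lemma part_plus: "part (plus lam) c = (if 1 \<le> c \<and> c \<le> k then part lam c + (part lam c + (k - c) + (e - \<alpha>)) div e else 0)"
  unfolding plus_def
proof (subst part_Abs[where l=k])
  fix i :: nat assume i: "i \<ge> 1"
  have le: "part lam (Suc i) \<le> part lam i" by (rule part_Suc_le[OF i])
  then have "(part lam (Suc i) + (k - Suc i) + (e - \<alpha>)) div e \<le> (part lam i + (k - i) + (e - \<alpha>)) div e"
    by (intro div_le_mono) simp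
  then show "(if 1 \<le> Suc i \<and> Suc i \<le> k then part lam (Suc i) + (part lam (Suc i) + (k - Suc i) + (e - \<alpha>)) div e else 0)
     \<le> (if 1 \<le> i \<and> i \<le> k then part lam i + (part lam i + (k - i) + (e - \<alpha>)) div e else 0)"
    using le i by (auto simp only: if_True if_False intro!: add_mono split: if_split)
qed auto

lemma plen_plus: "plen (plus lam) \<le> k"
  by (simp add: plen_le_iff part_plus)

lemma bead_plus: "1 \<le> c \<Longrightarrow> c \<le> k \<Longrightarrow> bead (plus lam) c = Phi (bead lam c)"
proof -
  assume c: "1 \<le> c" "c \<le> k"
  have "int ((part lam c + (k - c) + (e - \<alpha>)) div e) = (bead lam c + int k + int e - int \<alpha>) div int e"
    using c \<alpha>e by (simp add: bead_def zdiv_int of_nat_diff algebra_simps)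
  then show ?thesis using c by (simp add: bead_def Phi_def part_plus)
qed

lemma maya_split: "plen lam \<le> k \<Longrightarrow> maya lam = {..< - int k} \<union> (maya lam \<inter> {- int k..})"
  using maya_low[of lam k] by auto

lemma maya_plus_ge:
  assumes "plen lam \<le> k" shows "maya (plus lam) \<inter> {- int k..} = Phi ` (maya lam \<inter> {- int k..})"
  unfolding maya_ge_eq[OF assms] maya_ge_eq[OF plen_plus] image_image
  by (intro image_cong refl bead_plus) auto

lemma Phi_in_plus:
  assumes "plen lam \<le> k" shows "Phi p \<in> maya (plus lam) \<longleftrightarrow> p \<in> maya lam"
proof (cases "p \<ge> - int k")
  case True
  then have "Phi p \<in> maya (plus lam) \<longleftrightarrow> Phi p \<in> Phi ` (maya lam \<inter> {- int k..})"
    unfolding maya_plus_ge[OF assms, symmetric] by (simp add: Phi_ge_iff)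
  then show ?thesis using True by (auto simp: image_iff)
next
  case False
  then have "p < - int k" "Phi p < - int k" using Phi_ge_iff[of p] by linarith+
  from maya_low[OF assms this(1)] maya_low[OF plen_plus this(2)] show ?thesis by blast
qed

lemma in_plusE:
  assumes "plen lam \<le> k" "P \<in> maya (plus lam)" "P \<ge> - int k"
  obtains p where "p \<in> maya lam" "P = Phi p" "p \<ge> - int k"
proof -
  have "P \<in> Phi ` (maya lam \<inter> {- int k..})"
    unfolding maya_plus_ge[OF assms(1), symmetric] using assms(2,3) by simp
  then show ?thesis using that by blast
qed

lemma empty_runner:
  assumes "plen lam \<le> k" "P \<ge> - int k" "(P + int k - int \<alpha>) mod int (e + 1) = 0"
  shows "P \<notin> maya (plus lam)"
proof
  assume "P \<in> maya (plus lam)"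
  then obtain p where "P = Phi p" using in_plusE[OF assms(1) _ assms(2)] by blast
  moreover have "0 \<le> (p + int k - int \<alpha>) mod int e" using e2 by simp
  ultimately show False using Phi_mod[of p] assms(3) by simp
qed

lemma plus_inject:
  assumes "plen lam \<le> k" "plen \<mu> \<le> k" "plus lam = plus \<mu>" shows "lam = \<mu>"
proof -
  have "p \<in> maya lam \<longleftrightarrow> p \<in> maya \<mu>" for p
    using Phi_in_plus[OF assms(1), of p] Phi_in_plus[OF assms(2), of p] assms(3) by simp
  then have "maya lam = maya \<mu>" by blast
  then show ?thesis by (simp add: maya_inject)
qed

text \<open>Among any e + 1 consecutive places of the abacus one lies on the empty runner.\<close>

lemma regular_plus:
  assumes "plen lam \<le> k" shows "regular (e + 1) (plus lam)"
proof (rule ccontr)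
  assume "\<not> regular (e + 1) (plus lam)"
  then obtain p where p: "p \<notin> maya (plus lam)" "{p + 1..p + int (e + 1)} \<subseteq> maya (plus lam)"
    using nonregularD[of "e + 1" "plus lam"] by auto
  have pk: "p \<ge> - int k" using p(1) maya_low[OF plen_plus, of p lam] by force
  let ?m = "int (e + 1)"
  \<comment> \<open>The distance from p + 1 to the next place of the new runner.\<close>
  define t where "t = (- (p + 1 + int k - int \<alpha>)) mod ?m"
  have t: "0 \<le> t" "t < ?m" by (simp_all add: t_def)
  have "(p + 1 + t + int k - int \<alpha>) mod ?m = ((p + 1 + int k - int \<alpha>) + t) mod ?m" by (simp add: algebra_simps)
  also have "\<dots> = 0" unfolding t_def by (simp add: mod_add_right_eq)
  finally have "p + 1 + t \<notin> maya (plus lam)" using pk t by (intro empty_runner[OF assms]) auto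
  moreover have "p + 1 + t \<in> {p + 1..p + ?m}" using t by simp
  ultimately show False using p(2) by blast
qed

lemma beads_eq:
  assumes "plen lam \<le> k" shows "m \<in> beads k lam \<longleftrightarrow> int m - int k \<in> maya lam"
proof -
  have "m \<in> beads k lam \<longleftrightarrow> int m - int k \<in> bead lam ` {1..k}"
    by (auto simp: beads_def bead_def image_iff of_nat_diff intro!: bexI)
  also have "\<dots> \<longleftrightarrow> int m - int k \<in> maya lam \<inter> {- int k..}" unfolding maya_ge_eq[OF assms] ..
  finally show ?thesis by simp
qed

text \<open>\<open>Phi\<close> in the numbering 0, 1, 2, ... of the abacus with k beads, from which
  runners are read off.\<close>

definition phi :: "nat \<Rightarrow> nat" where
  "phi m = m + (m + (e - \<alpha>)) div e"

lemma phi_eq: "r < e \<Longrightarrow> phi (r + m * e) = r + (if r \<ge> \<alpha> then 1 else 0) + m * (e + 1)"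
proof -
  assume r: "r < e"
  have "r + m * e + (e - \<alpha>) = (r + (e - \<alpha>)) + m * e" by simp
  then have "(r + m * e + (e - \<alpha>)) div e = m + (r + (e - \<alpha>)) div e"
    using e2 by (simp only: div_mult_self1)
  moreover have "(r + (e - \<alpha>)) div e = (if r \<ge> \<alpha> then 1 else 0)"
  proof (cases "r \<ge> \<alpha>")
    case True
    then have "r + (e - \<alpha>) = e + (r - \<alpha>)" using \<alpha>e by simp
    moreover have "(r - \<alpha>) div e = 0" using r by (intro div_less) simp
    ultimately show ?thesis using True e2 by (metis div_add_self1 not_numeral_le_zero add_0)
  qed (use \<alpha>e in auto)
  ultimately show ?thesis by (simp add: phi_def)
qed

lemma beads_plus:
  assumes "plen lam \<le> k" shows "beads k (plus lam) = phi ` beads k lam"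
proof -
  have Phi: "Phi (int m - int k) = int (phi m) - int k" for m
    using \<alpha>e by (simp add: Phi_def phi_def zdiv_int of_nat_diff add_diff_eq)
  show ?thesis
  proof (intro equalityI subsetI)
    fix n assume "n \<in> beads k (plus lam)"
    then have "int n - int k \<in> maya (plus lam)" using beads_eq[OF plen_plus] by simp
    then obtain p where p: "p \<in> maya lam" "int n - int k = Phi p" "p \<ge> - int k" by (rule in_plusE[OF assms]) simp_all
    then have pm: "p = int (nat (p + int k)) - int k" by simp
    have "int n - int k = int (phi (nat (p + int k))) - int k" using p(2) Phi[of "nat (p + int k)"] pm by simp
    then have "n = phi (nat (p + int k))" by simp
    moreover have "nat (p + int k) \<in> beads k lam" using beads_eq[OF assms] p(1) pm by simp
    ultimately show "n \<in> phi ` beads k lam" by blast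
  next
    fix n assume "n \<in> phi ` beads k lam"
    then obtain m where "m \<in> beads k lam" "n = phi m" by blast
    then show "n \<in> beads k (plus lam)"
      using beads_eq[OF assms, of m] beads_eq[OF plen_plus, of n lam] Phi_in_plus[OF assms, of "int m - int k"] by (simp add: Phi)
  qed
qed

lemma runner_plus:
  assumes "plen lam \<le> k" "r \<le> e"
  shows "runner (e + 1) k (plus lam) r = (if r < \<alpha> then runner e k lam r else if r = \<alpha> then {} else runner e k lam (r - 1))"
proof -
  have *: "r + m * (e + 1) \<in> phi ` beads k lam \<longleftrightarrow>
     (\<exists>r'<e. r = r' + (if r' \<ge> \<alpha> then 1 else 0) \<and> r' + m * e \<in> beads k lam)" for m
  proof
    assume "r + m * (e + 1) \<in> phi ` beads k lam"
    then obtain n where n: "n \<in> beads k lam" "r + m * (e + 1) = phi n" by blast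
    define r' where "r' = n mod e"
    define m' where "m' = n div e"
    have r': "r' < e" and nn: "n = r' + m' * e" using e2 by (simp_all add: r'_def m'_def)
    let ?s = "r' + (if r' \<ge> \<alpha> then 1 else 0)"
    have eq: "r + m * (e + 1) = ?s + m' * (e + 1)" using n(2) phi_eq[OF r'] nn by simp
    have s: "?s < e + 1" "r < e + 1" using r' assms(2) by auto
    have "(r + m * (e + 1)) mod (e + 1) = (?s + m' * (e + 1)) mod (e + 1)" "(r + m * (e + 1)) div (e + 1) = (?s + m' * (e + 1)) div (e + 1)"
      using eq by simp_all
    then have "r = ?s" "m = m'"
      unfolding mod_mult_self1 div_mult_self1[OF Suc_eq_plus1[THEN subst[where P="\<lambda>z. z \<noteq> 0"], OF nat.distinct(2)]] mod_less[OF s(1)] mod_less[OF s(2)] div_less[OF s(1)] div_less[OF s(2)] by simp_all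
    then show "\<exists>r'<e. r = r' + (if r' \<ge> \<alpha> then 1 else 0) \<and> r' + m * e \<in> beads k lam" using r' n(1) nn by blast
  next
    assume "\<exists>r'<e. r = r' + (if r' \<ge> \<alpha> then 1 else 0) \<and> r' + m * e \<in> beads k lam"
    then obtain r' where r': "r' < e" "r = r' + (if r' \<ge> \<alpha> then 1 else 0)" "r' + m * e \<in> beads k lam" by blast
    then have "r + m * (e + 1) = phi (r' + m * e)" using phi_eq[OF r'(1), of m] by simp
    then show "r + m * (e + 1) \<in> phi ` beads k lam" using r'(3) by blast
  qed
  have ex: "(\<exists>r'<e. r = r' + (if r' \<ge> \<alpha> then 1 else 0) \<and> Q r') \<longleftrightarrow>
     (if r < \<alpha> then Q r else if r = \<alpha> then False else Q (r - 1))" for Q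
  proof -
    consider "r < \<alpha>" | "r = \<alpha>" | "r > \<alpha>" by linarith
    then show ?thesis
    proof cases
      case 1
      then have "r' < e \<and> r = r' + (if r' \<ge> \<alpha> then 1 else 0) \<longleftrightarrow> r' = r" for r' using \<alpha>e by auto
      then have "r' < e \<and> r = r' + (if r' \<ge> \<alpha> then 1 else 0) \<and> Q r' \<longleftrightarrow> r' = r \<and> Q r'" for r' by blast
      then show ?thesis using 1 by (simp only: simp_thms if_True if_False)
    next
      case 2
      then show ?thesis by auto
    next
      case 3
      then have "r' < e \<and> r = r' + (if r' \<ge> \<alpha> then 1 else 0) \<longleftrightarrow> r' = r - 1" for r' using assms(2) by auto
      then have *: "r' < e \<and> r = r' + (if r' \<ge> \<alpha> then 1 else 0) \<and> Q r' \<longleftrightarrow> r' = r - 1 \<and> Q r'" for r' by blast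
      show ?thesis using 3 unfolding * by simp
    qed
  qed
  have "m \<in> runner (e + 1) k (plus lam) r \<longleftrightarrow>
     (if r < \<alpha> then r + m * e \<in> beads k lam else if r = \<alpha> then False else (r - 1) + m * e \<in> beads k lam)" (is "_ \<longleftrightarrow> ?P m") for m
    unfolding runner_def mem_Collect_eq beads_plus[OF assms(1)] * by (rule ex)
  then have R: "runner (e + 1) k (plus lam) r = {m. ?P m}" by (intro set_eqI) (simp only: mem_Collect_eq)
  consider "r < \<alpha>" | "r = \<alpha>" | "r > \<alpha>" by linarith
  then show ?thesis
  proof cases
    case 1
    then show ?thesis unfolding R unfolding runner_def by (simp only: if_True)
  next
    case 2
    then show ?thesis unfolding R by simp
  next
    case 3
    then have "\<not> r < \<alpha>" "r \<noteq> \<alpha>" by auto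
    then show ?thesis unfolding R unfolding runner_def by (simp only: if_False)
  qed
qed

text \<open>The runners 0, ..., e exhaust the places of the new abacus, so the conditions on runners
  fix all beads there; the bound on the length fixes the remaining ones.\<close>

lemma insert_runner_eq:
  assumes "plen lam \<le> k" shows "insert_runner e k \<alpha> lam = plus lam"
  unfolding insert_runner_def
proof (rule the_equality)
  show "plen (plus lam) \<le> k \<and> (\<forall>r<\<alpha>. runner (e + 1) k (plus lam) r = runner e k lam r) \<and>
     runner (e + 1) k (plus lam) \<alpha> = {} \<and>
     (\<forall>r. \<alpha> < r \<and> r \<le> e \<longrightarrow> runner (e + 1) k (plus lam) r = runner e k lam (r - 1))"
  proof (intro conjI allI impI)
    show "plen (plus lam) \<le> k" by (rule plen_plus)
    show "runner (e + 1) k (plus lam) \<alpha> = {}"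
      unfolding runner_plus[OF assms \<alpha>e] by simp
  next
    fix r assume "r < \<alpha>"
    moreover from this have "r \<le> e" using \<alpha>e by linarith
    ultimately show "runner (e + 1) k (plus lam) r = runner e k lam r"
      unfolding runner_plus[OF assms \<open>r \<le> e\<close>] by (simp only: if_True)
  next
    fix r assume r: "\<alpha> < r \<and> r \<le> e"
    then have "\<not> r < \<alpha>" "r \<noteq> \<alpha>" "r \<le> e" by linarith+
    then show "runner (e + 1) k (plus lam) r = runner e k lam (r - 1)"
      unfolding runner_plus[OF assms \<open>r \<le> e\<close>] by (simp only: if_False)
  qed
next
  fix \<nu> assume nu: "plen \<nu> \<le> k \<and> (\<forall>r<\<alpha>. runner (e + 1) k \<nu> r = runner e k lam r) \<and>
     runner (e + 1) k \<nu> \<alpha> = {} \<and>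
     (\<forall>r. \<alpha> < r \<and> r \<le> e \<longrightarrow> runner (e + 1) k \<nu> r = runner e k lam (r - 1))"
  have R: "runner (e + 1) k \<nu> r = runner (e + 1) k (plus lam) r" if "r \<le> e" for r
    unfolding runner_plus[OF assms that] using nu that by auto
  have "n \<in> beads k \<nu> \<longleftrightarrow> n \<in> beads k (plus lam)" for n
  proof -
    have "n mod (e + 1) \<le> e" using mod_less_divisor[of "e + 1" n] by simp
    from R[OF this] have "n div (e + 1) \<in> runner (e + 1) k \<nu> (n mod (e + 1)) \<longleftrightarrow> n div (e + 1) \<in> runner (e + 1) k (plus lam) (n mod (e + 1))" by simp
    then show ?thesis unfolding runner_def mem_Collect_eq by (simp only: mod_div_mult_eq)
  qed
  then have **: "int n - int k \<in> maya \<nu> \<longleftrightarrow> int n - int k \<in> maya (plus lam)" for n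
    using beads_eq[of \<nu> n] beads_eq[OF plen_plus, of n lam] nu by simp
  have *: "p \<in> maya \<nu> \<longleftrightarrow> p \<in> maya (plus lam)" if "p \<ge> - int k" for p
    using **[of "nat (p + int k)"] that by simp
  have "maya \<nu> = maya (plus lam)"
  proof (intro set_eqI)
    fix p show "p \<in> maya \<nu> \<longleftrightarrow> p \<in> maya (plus lam)"
      using * maya_low[of \<nu> k p] maya_low[OF plen_plus, of p lam] nu by (cases "p \<ge> - int k") auto
  qed
  then show "\<nu> = plus lam" by (simp add: maya_inject)
qed

section \<open>Truncation at length k and transfer along the insertion\<close>

definition trk :: "fock \<Rightarrow> fock" where
  "trk = lin (\<lambda>lam. if plen lam \<le> k then basis lam else 0)"

definition Th :: "fock \<Rightarrow> fock" where
  "Th = lin (\<lambda>lam. if plen lam \<le> k then basis (plus lam) else 0)"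

lemma flinear_trk: "flinear trk" and flinear_Th: "flinear Th"
  by (simp_all add: trk_def Th_def flinear_lin)

lemma trk_basis: "trk (basis lam) = (if plen lam \<le> k then basis lam else 0)"
  and Th_basis: "Th (basis lam) = (if plen lam \<le> k then basis (plus lam) else 0)"
  by (simp_all add: trk_def Th_def)

lemma lookup_trk: "plen lam \<le> k \<Longrightarrow> Poly_Mapping.lookup (trk x) lam = Poly_Mapping.lookup x lam"
proof -
  assume "plen lam \<le> k"
  then have "Poly_Mapping.lookup (trk x) lam = (\<Sum>\<nu>\<in>Poly_Mapping.keys x. if \<nu> = lam then Poly_Mapping.lookup x lam else 0)"
    unfolding trk_def lookup_lin by (intro sum.cong refl) (auto simp: lookup_basis)
  then show ?thesis by (auto simp: in_keys_iff)
qed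

lemma lookup_Th: "plen lam \<le> k \<Longrightarrow> Poly_Mapping.lookup (Th x) (plus lam) = Poly_Mapping.lookup x lam"
proof -
  assume "plen lam \<le> k"
  then have "Poly_Mapping.lookup (Th x) (plus lam) = (\<Sum>\<nu>\<in>Poly_Mapping.keys x. if \<nu> = lam then Poly_Mapping.lookup x lam else 0)"
    unfolding Th_def lookup_lin by (intro sum.cong refl) (auto simp: lookup_basis dest: plus_inject)
  then show ?thesis by (auto simp: in_keys_iff)
qed

lemma lookup_Th_other: "(\<And>lam. plen lam \<le> k \<Longrightarrow> \<nu> \<noteq> plus lam) \<Longrightarrow> Poly_Mapping.lookup (Th x) \<nu> = 0"
  unfolding Th_def lookup_lin by (intro sum.neutral) (auto simp: lookup_basis)

abbreviation (input) "adm e' i lam \<equiv> Add e' i (maya lam) \<inter> {- int k..}"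

text \<open>T stands for any linear map that kills long partitions. It is applied to
  \<open>trk\<close>, to \<open>Th\<close>, and to \<open>trk\<close> after a further divided
  power.\<close>

lemma trunc_Fd:
  assumes "plen lam \<le> k" "flinear T" "\<And>\<nu>. \<not> plen \<nu> \<le> k \<Longrightarrow> T (basis \<nu>) = 0"
  shows "T (Fd e' i a lam) = (\<Sum>S | S \<subseteq> adm e' i lam \<and> card S = a. scale (vpow (dwt e' i (maya lam) S)) (T (basis (move S lam))))"
proof -
  interpret T: module_hom scale scale T by fact
  have "T (Fd e' i a lam) = (\<Sum>S | S \<subseteq> Add e' i (maya lam) \<and> card S = a. scale (vpow (dwt e' i (maya lam) S)) (T (basis (move S lam))))"
    unfolding Fd_def T.sum T.scale ..
  also have "\<dots> = (\<Sum>S | S \<subseteq> adm e' i lam \<and> card S = a. scale (vpow (dwt e' i (maya lam) S)) (T (basis (move S lam))))"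
  proof (rule sum.mono_neutral_right)
    show "finite {S. S \<subseteq> Add e' i (maya lam) \<and> card S = a}" by simp
    show "\<forall>S\<in>{S. S \<subseteq> Add e' i (maya lam) \<and> card S = a} - {S. S \<subseteq> adm e' i lam \<and> card S = a}.
       scale (vpow (dwt e' i (maya lam) S)) (T (basis (move S lam))) = 0"
    proof
      fix S assume S: "S \<in> {S. S \<subseteq> Add e' i (maya lam) \<and> card S = a} - {S. S \<subseteq> adm e' i lam \<and> card S = a}"
      then have "S \<subseteq> movable (maya lam)" "\<not> S \<subseteq> {- int k..}" using Add_movable by blast+
      then show "scale (vpow (dwt e' i (maya lam) S)) (T (basis (move S lam))) = 0"
        using plen_move_le_iff[OF _ assms(1)] assms(3) by simp
    qed
  qed auto
  finally show ?thesis .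
qed

lemma long_Fd:
  assumes "\<not> plen lam \<le> k" "flinear T" "\<And>\<nu>. \<not> plen \<nu> \<le> k \<Longrightarrow> T (basis \<nu>) = 0"
  shows "T (Fd e' i a lam) = 0"
proof -
  interpret T: module_hom scale scale T by fact
  show ?thesis unfolding Fd_def T.sum T.scale
  proof (rule sum.neutral, rule ballI)
    fix S assume "S \<in> {S. S \<subseteq> Add e' i (maya lam) \<and> card S = a}"
    then have "S \<subseteq> movable (maya lam)" using Add_movable by blast
    then have "plen lam \<le> plen (move S lam)" by (rule plen_move_ge)
    with assms(1) have "\<not> plen (move S lam) \<le> k" by linarith
    then have "T (basis (move S lam)) = 0" by (rule assms(3))
    then show "scale (vpow (dwt e' i (maya lam) S)) (T (basis (move S lam))) = 0"
      by (simp only: fock.scale_zero_right)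
  qed
qed

lemma trk_Fdiv_trk: assumes "e' \<ge> 2" shows "trk (Fdiv e' i a (trk x)) = trk (Fdiv e' i a x)"
proof (rule flinear_ext[where T="\<lambda>x. trk (Fdiv e' i a (trk x))" and T'="\<lambda>x. trk (Fdiv e' i a x)"])
  show "flinear (\<lambda>x. trk (Fdiv e' i a (trk x)))" "flinear (\<lambda>x. trk (Fdiv e' i a x))"
    by (rule flinear_compose[OF flinear_trk flinear_compose[OF flinear_Fdiv[OF assms] flinear_trk]],
        rule flinear_compose[OF flinear_trk flinear_Fdiv[OF assms]])
  fix lam
  have z: "Fdiv e' i a 0 = 0" "trk 0 = 0" using module_hom.zero[OF flinear_Fdiv[OF assms]] module_hom.zero[OF flinear_trk] by blast+
  have "trk (Fd e' i a lam) = 0" if "\<not> plen lam \<le> k"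
    by (rule long_Fd[OF that flinear_trk]) (simp add: trk_basis)
  then show "trk (Fdiv e' i a (trk (basis lam))) = trk (Fdiv e' i a (basis lam))"
    unfolding trk_basis Fdiv_basis[OF assms] by (cases "plen lam \<le> k") (simp_all only: if_True if_False simp_thms z Fdiv_basis[OF assms])
qed

section \<open>Residues before and after the insertion\<close>

lemma site_iff:
  assumes "i < e"
  shows "q mod int e = int i \<longleftrightarrow> (q + int k - int \<alpha>) mod int e = (int i + int k - int \<alpha>) mod int e"
proof -
  have "int i = int i mod int e" using assms by simp
  then have "q mod int e = int i \<longleftrightarrow> int e dvd q - int i" by (metis mod_eq_dvd_iff)
  also have "q - int i = (q + int k - int \<alpha>) - (int i + int k - int \<alpha>)" by simp
  finally show ?thesis unfolding mod_eq_dvd_iff .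
qed

text \<open>The residue for \<open>e + 1\<close> of the steps that arrive on runner \<open>\<alpha> + t\<close>, counted cyclically.\<close>

definition residue_plus :: "int \<Rightarrow> nat" where
  "residue_plus t = nat ((t - int k + int \<alpha>) mod int (e + 1))"

lemma residue_plus_less: "residue_plus t < e + 1"
proof -
  have "(t - int k + int \<alpha>) mod int (e + 1) < int (e + 1)" by (rule pos_mod_bound) simp
  then show ?thesis unfolding residue_plus_def by linarith
qed

lemma residue_plus_iff:
  assumes "0 \<le> t" "t < int (e + 1)"
  shows "Q mod int (e + 1) = int (residue_plus t) \<longleftrightarrow> (Q + int k - int \<alpha>) mod int (e + 1) = t"
proof -
  let ?m = "int (e + 1)"
  have "int (residue_plus t) = (t - int k + int \<alpha>) mod ?m" unfolding residue_plus_def by (simp only: nat_0_le pos_mod_sign of_nat_0_less_iff zero_less_Suc Suc_eq_plus1[symmetric])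
  then have "Q mod ?m = int (residue_plus t) \<longleftrightarrow> ?m dvd Q - (t - int k + int \<alpha>)" by (simp only: mod_eq_dvd_iff)
  also have "Q - (t - int k + int \<alpha>) = (Q + int k - int \<alpha>) - t" by simp
  also have "?m dvd (Q + int k - int \<alpha>) - t \<longleftrightarrow> (Q + int k - int \<alpha>) mod ?m = t mod ?m" by (rule mod_eq_dvd_iff[symmetric])
  also have "t mod ?m = t" by (rule mod_pos_pos_trivial[OF assms])
  finally show ?thesis .
qed

lemma Phi_pred_mod:
  assumes "(p + 1 + int k - int \<alpha>) mod int e = 0"
  shows "(Phi p + 1 + int k - int \<alpha>) mod int (e + 1) = 0"
proof -
  have "Phi p + 1 + int k - int \<alpha> = (Phi (p + 1) + int k - int \<alpha>) - 1"
    using Phi_Suc[of p] assms by simp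
  also have "\<dots> mod int (e + 1) = ((Phi (p + 1) + int k - int \<alpha>) mod int (e + 1) - 1) mod int (e + 1)"
    by (simp only: mod_diff_left_eq)
  also have "\<dots> = 0" unfolding Phi_mod assms by simp
  finally show ?thesis .
qed

lemma Phi_Suc_special: "(p + 1 + int k - int \<alpha>) mod int e = 0 \<Longrightarrow> Phi (p + 1) = Phi p + 2"
  and Phi_Suc_nonspecial: "(p + 1 + int k - int \<alpha>) mod int e \<noteq> 0 \<Longrightarrow> Phi (p + 1) = Phi p + 1"
  using Phi_Suc[of p] by simp_all

lemma Phi_site:
  assumes "0 < t" "t < int e"
  shows "(Phi p + 1) mod int (e + 1) = int (residue_plus (t + 1)) \<longleftrightarrow> (p + 1 + int k - int \<alpha>) mod int e = t"
proof -
  have t: "0 \<le> t + 1" "t + 1 < int (e + 1)" using assms by simp_all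
  show ?thesis
  proof (cases "(p + 1 + int k - int \<alpha>) mod int e = 0")
    case True
    from Phi_pred_mod[OF True] show ?thesis unfolding residue_plus_iff[OF t] using True assms by linarith
  next
    case False
    have "(Phi p + 1 + int k - int \<alpha>) mod int (e + 1) = (p + 1 + int k - int \<alpha>) mod int e + 1"
      unfolding Phi_Suc_nonspecial[OF False, symmetric] by (rule Phi_mod)
    then show ?thesis unfolding residue_plus_iff[OF t] by linarith
  qed
qed

lemma Phi_site_0:
  "(Phi p + 1) mod int (e + 1) = int (residue_plus 0) \<longleftrightarrow> (p + 1 + int k - int \<alpha>) mod int e = 0"
proof -
  have t: "(0::int) \<le> 0" "0 < int (e + 1)" by simp_all
  show ?thesis
  proof (cases "(p + 1 + int k - int \<alpha>) mod int e = 0")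
    case True
    from Phi_pred_mod[OF True] True show ?thesis unfolding residue_plus_iff[OF t] by blast
  next
    case False
    have "(Phi p + 1 + int k - int \<alpha>) mod int (e + 1) = (p + 1 + int k - int \<alpha>) mod int e + 1"
      unfolding Phi_Suc_nonspecial[OF False, symmetric] by (rule Phi_mod)
    moreover have "0 \<le> (p + 1 + int k - int \<alpha>) mod int e" using e2 by simp
    ultimately show ?thesis unfolding residue_plus_iff[OF t] using False by linarith
  qed
qed

lemma plus_eqI:
  assumes "plen \<nu> \<le> k" "plen lam \<le> k" "maya \<nu> \<inter> {- int k..} = Phi ` (maya lam \<inter> {- int k..})"
  shows "\<nu> = plus lam"
proof -
  have "maya \<nu> \<inter> {- int k..} = maya (plus lam) \<inter> {- int k..}"
    unfolding maya_plus_ge[OF assms(2)] by (rule assms(3))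
  then have "maya \<nu> = maya (plus lam)"
    using maya_split[OF assms(1)] maya_split[OF plen_plus] by metis
  then show ?thesis by (simp only: maya_inject)
qed

lemma subsets_image:
  "{T. T \<subseteq> Phi ` A \<and> card T = a} = (`) Phi ` {S. S \<subseteq> A \<and> card S = a}"
proof (intro equalityI subsetI)
  fix T assume "T \<in> {T. T \<subseteq> Phi ` A \<and> card T = a}"
  then obtain S where "S \<subseteq> A" "T = Phi ` S" "card T = a" by (auto simp: subset_image_iff)
  then show "T \<in> (`) Phi ` {S. S \<subseteq> A \<and> card S = a}" using card_image[OF inj_Phi, of S] by auto
next
  fix T assume "T \<in> (`) Phi ` {S. S \<subseteq> A \<and> card S = a}"
  then obtain S where "S \<subseteq> A" "card S = a" "T = Phi ` S" by blast
  then show "T \<in> {T. T \<subseteq> Phi ` A \<and> card T = a}" using card_image[OF inj_Phi, of S] by auto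
qed

lemma sum_subsets_image:
  "(\<Sum>T | T \<subseteq> Phi ` A \<and> card T = a. f T) = (\<Sum>S | S \<subseteq> A \<and> card S = a. f (Phi ` S))"
proof -
  have "inj_on ((`) Phi) {S. S \<subseteq> A \<and> card S = a}"
    by (intro inj_onI) (simp only: inj_image_eq_iff[OF inj_Phi])
  then show ?thesis unfolding subsets_image by (rule sum.reindex_cong) auto
qed

text \<open>Addable places before -k lie to the left of every bead of S and do not enter the
  exponent, so it can be computed from the places from -k on.\<close>

lemma dwt_adm:
  assumes "S \<subseteq> {- int k..}"
  shows "dwt e' i M S = (\<Sum>p\<in>S. int (card {q \<in> Add e' i M \<inter> {- int k..} - S. p < q}) - int (card {q \<in> Rem e' i M. p < q}))"
  unfolding dwt_def
proof (rule sum.cong[OF refl])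
  fix p assume "p \<in> S"
  then have "- int k \<le> p" using assms by auto
  then have "{q \<in> Add e' i M - S. p < q} = {q \<in> Add e' i M \<inter> {- int k..} - S. p < q}" by auto
  then show "int (card {q \<in> Add e' i M - S. p < q}) - int (card {q \<in> Rem e' i M. p < q}) =
    int (card {q \<in> Add e' i M \<inter> {- int k..} - S. p < q}) - int (card {q \<in> Rem e' i M. p < q})" by (simp only:)
qed

lemma card_Phi_up: "card {Q \<in> Phi ` A. Phi p < Q} = card {q \<in> A. p < q}"
proof -
  have "{Q \<in> Phi ` A. Phi p < Q} = Phi ` {q \<in> A. p < q}"
    by (auto simp only: mem_Collect_eq image_iff Phi_less_iff)
  then show ?thesis by (simp only: card_image[OF inj_Phi])
qed

text \<open>Away from the new runner \<open>Phi\<close> carries the addable places from -k on and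
  all removable places of the residue onto those of the new residue. It preserves their order, so
  the exponents agree term by term.\<close>

lemma trk_Fd_plus:
  assumes i: "i < e" and t: "(int i + int k - int \<alpha>) mod int e = t" "t \<noteq> 0" and lam: "plen lam \<le> k"
  shows "trk (Fd (e + 1) (residue_plus (t + 1)) a (plus lam)) = Th (Fd e i a lam)"
proof -
  let ?M = "maya lam" and ?P = "maya (plus lam)" and ?i = "residue_plus (t + 1)" and ?I = "{- int k..}"
  have "0 \<le> t" and te: "t < int e" unfolding t(1)[symmetric] using e2 by simp_all
  then have t01: "0 < t" "t < int e" using t(2) by linarith+
  have t0: "0 \<le> t + 1" "t + 1 < int (e + 1)" using t01 by simp_all
  have site: "(p + 1) mod int e = int i \<longleftrightarrow> (p + 1 + int k - int \<alpha>) mod int e = t" for p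
    using site_iff[OF i, of "p + 1"] unfolding t(1) .
  have Psite: "(Phi p + 1) mod int (e + 1) = int ?i \<longleftrightarrow> (p + 1) mod int e = int i" for p
    unfolding site by (rule Phi_site[OF t01])
  have Psuc: "Phi (p + 1) = Phi p + 1" if "(p + 1) mod int e = int i" for p
    using that t(2) unfolding site by (intro Phi_Suc_nonspecial) simp
  let ?A = "Add e i ?M \<inter> ?I"
  have adm: "Add (e + 1) ?i ?P \<inter> ?I = Phi ` ?A"
  proof (intro equalityI subsetI)
    fix P assume P: "P \<in> Add (e + 1) ?i ?P \<inter> ?I"
    then have P': "P \<in> ?P" "P + 1 \<notin> ?P" "(P + 1) mod int (e + 1) = int ?i" "- int k \<le> P"
      unfolding Add_def by blast+
    from in_plusE[OF lam P'(1,4)] obtain p where p: "p \<in> ?M" "P = Phi p" "p \<ge> - int k" .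
    have s: "(p + 1) mod int e = int i" using P'(3) unfolding p(2) Psite .
    then have "p + 1 \<notin> ?M" using P'(2) Phi_in_plus[OF lam, of "p + 1"] unfolding p(2) Psuc[OF s] by blast
    then show "P \<in> Phi ` ?A" using p s by (simp add: Add_def)
  next
    fix P assume "P \<in> Phi ` ?A"
    then obtain p where p: "P = Phi p" "p \<in> ?M" "p + 1 \<notin> ?M" "(p + 1) mod int e = int i" "- int k \<le> p"
      unfolding Add_def by blast
    have "P \<in> ?P" unfolding p(1) Phi_in_plus[OF lam] by fact
    moreover have "P + 1 \<notin> ?P" unfolding p(1) Psuc[OF p(4), symmetric] Phi_in_plus[OF lam] by fact
    moreover have "(P + 1) mod int (e + 1) = int ?i" unfolding p(1) Psite by fact
    moreover have "- int k \<le> P" unfolding p(1) Phi_ge_iff by fact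
    ultimately show "P \<in> Add (e + 1) ?i ?P \<inter> ?I" unfolding Add_def by blast
  qed
  have Rem: "Rem (e + 1) ?i ?P = Phi ` Rem e i ?M"
  proof (intro equalityI subsetI)
    fix P assume "P \<in> Rem (e + 1) ?i ?P"
    then have P: "P \<notin> ?P" "P + 1 \<in> ?P" "(P + 1) mod int (e + 1) = int ?i" unfolding Rem_def by blast+
    \<comment> \<open>Everything before -k is occupied, so a free place lies inside the
      abacus.\<close>
    have "- int k \<le> P" using P(1) maya_low[OF plen_plus, of P lam] by (meson not_le)
    then have "- int k \<le> P + 1" by simp
    from in_plusE[OF lam P(2) this] obtain p where p: "p \<in> ?M" "P + 1 = Phi p" .
    have "t + 1 = (p + int k - int \<alpha>) mod int e + 1"
      using P(3) unfolding residue_plus_iff[OF t0] p(2) Phi_mod by simp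
    then have s: "(p - 1 + 1) mod int e = int i" unfolding site by simp
    have P': "P = Phi (p - 1)" using Psuc[OF s] p(2) by simp
    have "p - 1 \<notin> ?M" using P(1) unfolding P' Phi_in_plus[OF lam] .
    then have "p - 1 \<in> Rem e i ?M" using p(1) s by (simp add: Rem_def)
    then show "P \<in> Phi ` Rem e i ?M" unfolding P' by blast
  next
    fix P assume "P \<in> Phi ` Rem e i ?M"
    then obtain p where p: "P = Phi p" "p \<notin> ?M" "p + 1 \<in> ?M" "(p + 1) mod int e = int i"
      unfolding Rem_def by blast
    have "P \<notin> ?P" unfolding p(1) Phi_in_plus[OF lam] by fact
    moreover have "P + 1 \<in> ?P" unfolding p(1) Psuc[OF p(4), symmetric] Phi_in_plus[OF lam] by fact
    moreover have "(P + 1) mod int (e + 1) = int ?i" unfolding p(1) Psite by fact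
    ultimately show "P \<in> Rem (e + 1) ?i ?P" unfolding Rem_def by blast
  qed
  have dwt: "dwt (e + 1) ?i ?P (Phi ` S) = dwt e i ?M S" if S: "S \<subseteq> ?A" for S
  proof -
    have S1: "Phi ` S \<subseteq> ?I" using S adm by blast
    have S2: "S \<subseteq> ?I" using S by blast
    have diff: "Phi ` ?A - Phi ` S = Phi ` (?A - S)" by (rule image_set_diff[OF inj_Phi, symmetric])
    show ?thesis
      unfolding dwt_adm[OF S1] dwt_adm[OF S2] adm Rem diff sum.reindex[OF inj_Phi] comp_def by (simp only: card_Phi_up)
  qed
  have mv: "plen (move S lam) \<le> k" "plen (move (Phi ` S) (plus lam)) \<le> k" "move (Phi ` S) (plus lam) = plus (move S lam)"
    if S: "S \<subseteq> ?A" for S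
  proof -
    have S1: "S \<subseteq> Add e i ?M" "S \<subseteq> ?I" using S by blast+
    have S2: "Phi ` S \<subseteq> Add (e + 1) ?i ?P" "Phi ` S \<subseteq> ?I" using S adm by blast+
    show l1: "plen (move S lam) \<le> k"
      using plen_move_le_iff[OF subset_trans[OF S1(1) Add_movable] lam] S1(2) by blast
    show l2: "plen (move (Phi ` S) (plus lam)) \<le> k"
      using plen_move_le_iff[OF subset_trans[OF S2(1) Add_movable] plen_plus] S2(2) by blast
    have suc: "(\<lambda>p. p + 1) ` Phi ` S = Phi ` (\<lambda>p. p + 1) ` S"
      unfolding image_image using S1(1) Psuc by (intro image_cong refl) (auto simp: Add_def)
    have "mv ?P (Phi ` S) \<inter> ?I = ((?P \<inter> ?I) - Phi ` S) \<union> (\<lambda>p. p + 1) ` Phi ` S"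
      using S2(2) by (auto simp: mv_def)
    also have "\<dots> = Phi ` ((?M \<inter> ?I) - S) \<union> Phi ` (\<lambda>p. p + 1) ` S"
      unfolding maya_plus_ge[OF lam] suc by (simp only: image_set_diff[OF inj_Phi])
    also have "\<dots> = Phi ` (mv ?M S \<inter> ?I)"
      unfolding image_Un[symmetric] using S1(2) by (intro arg_cong[where f="image Phi"]) (auto simp: mv_def)
    finally have "maya (move (Phi ` S) (plus lam)) \<inter> ?I = Phi ` (maya (move S lam) \<inter> ?I)"
      unfolding maya_move_Add[OF S1(1)] maya_move_Add[OF S2(1)] .
    then show "move (Phi ` S) (plus lam) = plus (move S lam)" by (rule plus_eqI[OF l2 l1])
  qed
  have "trk (Fd (e + 1) ?i a (plus lam)) = (\<Sum>S | S \<subseteq> Phi ` ?A \<and> card S = a.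
      scale (vpow (dwt (e + 1) ?i ?P S)) (trk (basis (move S (plus lam)))))"
    unfolding adm[symmetric] by (rule trunc_Fd[OF plen_plus flinear_trk]) (simp only: trk_basis if_False)
  also have "\<dots> = (\<Sum>S | S \<subseteq> ?A \<and> card S = a.
      scale (vpow (dwt (e + 1) ?i ?P (Phi ` S))) (trk (basis (move (Phi ` S) (plus lam)))))"
    by (rule sum_subsets_image)
  also have "\<dots> = (\<Sum>S | S \<subseteq> ?A \<and> card S = a. scale (vpow (dwt e i ?M S)) (Th (basis (move S lam))))"
  proof (rule sum.cong[OF refl])
    fix S assume "S \<in> {S. S \<subseteq> ?A \<and> card S = a}"
    then have S: "S \<subseteq> ?A" by blast
    show "scale (vpow (dwt (e + 1) ?i ?P (Phi ` S))) (trk (basis (move (Phi ` S) (plus lam)))) =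
        scale (vpow (dwt e i ?M S)) (Th (basis (move S lam)))"
      unfolding dwt[OF S] trk_basis Th_basis using mv[OF S] by simp
  qed
  also have "\<dots> = Th (Fd e i a lam)"
    by (rule trunc_Fd[OF lam flinear_Th, symmetric]) (simp only: Th_basis if_False)
  finally show ?thesis .
qed

context
  fixes i :: nat and lam :: partition
  assumes i: "i < e" and i0: "(int i + int k - int \<alpha>) mod int e = 0" and lam: "plen lam \<le> k"
begin

text \<open>
  For this residue the step crosses the empty runner. The beads first move onto it, even when
  the next position is taken; those blocked in this way cannot leave it in the second step, and
  their terms vanish.
\<close>

definition sites :: "int set" where
  "sites = {p \<in> maya lam. - int k \<le> p \<and> (p + 1) mod int e = int i}"

lemma site0: "(p + 1) mod int e = int i \<longleftrightarrow> (p + 1 + int k - int \<alpha>) mod int e = 0"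
  using site_iff[OF i, of "p + 1"] unfolding i0 .

lemma Phi_site0: "(Phi p + 1 + int k - int \<alpha>) mod int (e + 1) = 0 \<longleftrightarrow> (p + 1) mod int e = int i"
proof -
  have "(0::int) \<le> 0" "0 < int (e + 1)" by simp_all
  from residue_plus_iff[OF this, of "Phi p + 1"] show ?thesis using Phi_site_0[of p] unfolding site0 by (simp only:)
qed

lemma Phi_suc0: "(p + 1) mod int e = int i \<Longrightarrow> Phi (p + 1) = Phi p + 2"
  unfolding site0 by (rule Phi_Suc_special)

lemma Phi_site1: "(Phi q + int k - int \<alpha>) mod int (e + 1) = 1 \<longleftrightarrow> q mod int e = int i"
  unfolding Phi_mod site_iff[OF i] i0 by simp

lemma sitesD: "p \<in> sites \<Longrightarrow> p \<in> maya lam \<and> - int k \<le> p \<and> (p + 1) mod int e = int i"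
  unfolding sites_def by blast

lemma finite_sites: "finite sites"
proof (rule finite_subset)
  show "sites \<subseteq> maya lam \<inter> {- int k..}" unfolding sites_def by auto
  show "finite (maya lam \<inter> {- int k..})" unfolding maya_ge_eq[OF lam] by simp
qed

lemma Add_sites: "Add e i (maya lam) \<inter> {- int k..} = {p \<in> sites. p + 1 \<notin> maya lam}"
  by (auto simp: Add_def sites_def)

lemma Add_first: "Add (e + 1) (residue_plus 0) (maya (plus lam)) \<inter> {- int k..} = Phi ` sites"
proof (intro equalityI subsetI)
  have t: "(0::int) \<le> 0" "0 < int (e + 1)" by simp_all
  fix P assume P: "P \<in> Add (e + 1) (residue_plus 0) (maya (plus lam)) \<inter> {- int k..}"
  then have P': "P \<in> maya (plus lam)" "(P + 1) mod int (e + 1) = int (residue_plus 0)" "- int k \<le> P"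
    unfolding Add_def by blast+
  from in_plusE[OF lam P'(1,3)] obtain p where p: "p \<in> maya lam" "P = Phi p" "p \<ge> - int k" .
  have "(p + 1) mod int e = int i" using P'(2) unfolding p(2) residue_plus_iff[OF t] Phi_site0 .
  then show "P \<in> Phi ` sites" using p by (simp add: sites_def)
next
  have t: "(0::int) \<le> 0" "0 < int (e + 1)" by simp_all
  fix P assume "P \<in> Phi ` sites"
  then obtain p where p: "P = Phi p" "p \<in> maya lam" "- int k \<le> p" "(p + 1) mod int e = int i"
    using sitesD by blast
  have c: "(P + 1 + int k - int \<alpha>) mod int (e + 1) = 0" unfolding p(1) Phi_site0 by fact
  have ge: "- int k \<le> P" unfolding p(1) Phi_ge_iff by fact
  have "P \<in> maya (plus lam)" unfolding p(1) Phi_in_plus[OF lam] by fact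
  moreover have "P + 1 \<notin> maya (plus lam)" by (rule empty_runner[OF lam _ c]) (use ge in simp)
  moreover have "(P + 1) mod int (e + 1) = int (residue_plus 0)" unfolding residue_plus_iff[OF t] by (rule c)
  ultimately show "P \<in> Add (e + 1) (residue_plus 0) (maya (plus lam)) \<inter> {- int k..}" using ge unfolding Add_def by blast
qed

text \<open>Such a bead would sit on the new runner, which is empty.\<close>

lemma Rem_first: "Rem (e + 1) (residue_plus 0) (maya (plus lam)) = {}"
proof (rule ccontr)
  have t: "(0::int) \<le> 0" "0 < int (e + 1)" by simp_all
  assume "Rem (e + 1) (residue_plus 0) (maya (plus lam)) \<noteq> {}"
  then obtain P where P: "P \<notin> maya (plus lam)" "P + 1 \<in> maya (plus lam)" "(P + 1) mod int (e + 1) = int (residue_plus 0)"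
    unfolding Rem_def by blast
  have "- int k \<le> P" using P(1) maya_low[OF plen_plus, of P lam] by (meson not_le)
  then have ge: "- int k \<le> P + 1" by simp
  show False using empty_runner[OF lam ge] P(2,3) unfolding residue_plus_iff[OF t] by blast
qed

lemma dwt_first:
  assumes S: "S \<subseteq> sites"
  shows "dwt (e + 1) (residue_plus 0) (maya (plus lam)) (Phi ` S) = (\<Sum>p\<in>S. int (card {q \<in> sites - S. p < q}))"
proof -
  have S1: "Phi ` S \<subseteq> {- int k..}" using S Add_first by blast
  have diff: "Phi ` sites - Phi ` S = Phi ` (sites - S)" by (rule image_set_diff[OF inj_Phi, symmetric])
  have e: "{q \<in> {}. P q} = {}" for P :: "int \<Rightarrow> bool" by blast
  show ?thesis unfolding dwt_adm[OF S1] Add_first Rem_first diff sum.reindex[OF inj_Phi] comp_def card_Phi_up e by simp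
qed

context
  fixes S :: "int set"
  assumes S: "S \<subseteq> sites"
begin

text \<open>The partition between the two divided powers, when the beads of S sit on the new
  runner.\<close>

definition mid :: partition where "mid = move (Phi ` S) (plus lam)"

lemma S_Add: "Phi ` S \<subseteq> Add (e + 1) (residue_plus 0) (maya (plus lam))" "Phi ` S \<subseteq> {- int k..}"
  using Add_first S by blast+

lemma plen_mid: "plen mid \<le> k"
  unfolding mid_def using plen_move_le_iff[OF subset_trans[OF S_Add(1) Add_movable] plen_plus] S_Add(2) by blast

lemma maya_mid: "maya mid = (maya (plus lam) - Phi ` S) \<union> (\<lambda>p. Phi p + 1) ` S"
  unfolding mid_def maya_move_Add[OF S_Add(1)] mv_def image_image ..

lemma finite_S: "finite S"
  using S finite_sites by (rule finite_subset)

lemma Phi_1_mid: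
  assumes "(p + 1) mod int e = int i" "- int k \<le> p"
  shows "Phi p + 1 \<in> maya mid \<longleftrightarrow> p \<in> S"
proof -
  have ge: "- int k \<le> Phi p + 1" using assms(2) Phi_ge_iff[of p] by linarith
  have "(Phi p + 1 + int k - int \<alpha>) mod int (e + 1) = 0" unfolding Phi_site0 by (rule assms(1))
  from empty_runner[OF lam ge this] have "Phi p + 1 \<notin> maya (plus lam)" .
  then show ?thesis unfolding maya_mid by (auto simp: image_iff)
qed

lemma Phi_2_mid:
  assumes "q mod int e = int i" "- int k \<le> q"
  shows "Phi q \<in> maya mid \<longleftrightarrow> q \<in> maya lam"
proof -
  have c: "(Phi q + int k - int \<alpha>) mod int (e + 1) = 1" unfolding Phi_site1 by (rule assms(1))
  have "Phi q \<noteq> Phi p + 1" if "p \<in> S" for p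
  proof
    assume "Phi q = Phi p + 1"
    moreover have "(Phi p + 1 + int k - int \<alpha>) mod int (e + 1) = 0"
      unfolding Phi_site0 using that S sitesD by blast
    ultimately show False using c by simp
  qed
  moreover have "q \<notin> S"
  proof
    assume "q \<in> S"
    then have "(q + 1) mod int e = int i" using S sitesD by blast
    then show False using adjacent_classes[OF e2] assms(1) by blast
  qed
  then have "Phi q \<notin> Phi ` S" by (auto simp: image_iff)
  ultimately show ?thesis unfolding maya_mid using Phi_in_plus[OF lam, of q] by blast
qed

lemma class0_midE:
  assumes "P \<in> maya mid" "- int k \<le> P" "(P + int k - int \<alpha>) mod int (e + 1) = 0"
  obtains p where "p \<in> S" "P = Phi p + 1"
proof -
  have "P \<notin> maya (plus lam)" by (rule empty_runner[OF lam assms(2,3)])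
  then show ?thesis using assms(1) that unfolding maya_mid by blast
qed

lemma one_class: "(P + 1 + int k - int \<alpha>) mod int (e + 1) = 1 \<longleftrightarrow> (P + int k - int \<alpha>) mod int (e + 1) = 0"
proof -
  let ?x = "P + int k - int \<alpha>"
  have "(1::int) mod int (e + 1) = 1" using e2 by (intro mod_pos_pos_trivial) auto
  moreover have "(?x + 1) mod int (e + 1) = 1 mod int (e + 1) \<longleftrightarrow> int (e + 1) dvd (?x + 1) - 1" by (rule mod_eq_dvd_iff)
  moreover have "P + 1 + int k - int \<alpha> = ?x + 1" "(?x + 1) - 1 = ?x" by simp_all
  ultimately show ?thesis by (simp only: mod_eq_0_iff_dvd)
qed

lemma residue_plus_1: "(P + 1) mod int (e + 1) = int (residue_plus 1) \<longleftrightarrow> (P + int k - int \<alpha>) mod int (e + 1) = 0"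
proof -
  have "(0::int) \<le> 1" "1 < int (e + 1)" using e2 by simp_all
  from residue_plus_iff[OF this, of "P + 1"] show ?thesis unfolding one_class .
qed

lemma Add_second:
  "Add (e + 1) (residue_plus 1) (maya mid) \<inter> {- int k..} = (\<lambda>p. Phi p + 1) ` {p \<in> S. p + 1 \<notin> maya lam}"
proof (intro equalityI subsetI)
  fix P assume P: "P \<in> Add (e + 1) (residue_plus 1) (maya mid) \<inter> {- int k..}"
  then have P': "P \<in> maya mid" "P + 1 \<notin> maya mid" "(P + int k - int \<alpha>) mod int (e + 1) = 0" "- int k \<le> P"
    unfolding Add_def residue_plus_1 by blast+
  from class0_midE[OF P'(1,4,3)] obtain p where p: "p \<in> S" "P = Phi p + 1" .
  have s: "(p + 1) mod int e = int i" "- int k \<le> p" using p(1) S sitesD by blast+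
  then have ge: "- int k \<le> p + 1" by simp
  have "P + 1 = Phi (p + 1)" unfolding p(2) Phi_suc0[OF s(1)] by simp
  then have "p + 1 \<notin> maya lam" using P'(2) Phi_2_mid[OF s(1) ge] by simp
  then show "P \<in> (\<lambda>p. Phi p + 1) ` {p \<in> S. p + 1 \<notin> maya lam}" using p by blast
next
  fix P assume "P \<in> (\<lambda>p. Phi p + 1) ` {p \<in> S. p + 1 \<notin> maya lam}"
  then obtain p where p: "P = Phi p + 1" "p \<in> S" "p + 1 \<notin> maya lam" by blast
  have s: "(p + 1) mod int e = int i" "- int k \<le> p" using p(2) S sitesD by blast+
  then have ge: "- int k \<le> p + 1" by simp
  have "P + 1 = Phi (p + 1)" unfolding p(1) Phi_suc0[OF s(1)] by simp
  then have "P + 1 \<notin> maya mid" using p(3) Phi_2_mid[OF s(1) ge] by simp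
  moreover have "P \<in> maya mid" unfolding p(1) Phi_1_mid[OF s] by (rule p(2))
  moreover have "(P + 1) mod int (e + 1) = int (residue_plus 1)" unfolding residue_plus_1 p(1) Phi_site0 by (rule s(1))
  moreover have "- int k \<le> P" unfolding p(1) using s(2) Phi_ge_iff[of p] by linarith
  ultimately show "P \<in> Add (e + 1) (residue_plus 1) (maya mid) \<inter> {- int k..}" unfolding Add_def by blast
qed

lemma inj_Phi1: "inj_on (\<lambda>p. Phi p + 1) A"
  by (intro inj_onI) simp

text \<open>The second step needs a beads that can leave the new runner, but a blocked one leaves
  fewer than a.\<close>

lemma trk_Fd_mid_zero:
  assumes "\<not> S \<subseteq> Add e i (maya lam)" "card S = a"
  shows "trk (Fd (e + 1) (residue_plus 1) a mid) = 0"
proof -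
  obtain p where p: "p \<in> S" "p \<notin> Add e i (maya lam)" using assms(1) by blast
  then have "p + 1 \<in> maya lam" using S sitesD unfolding Add_def by blast
  then have "{p \<in> S. p + 1 \<notin> maya lam} \<subset> S" using p(1) by blast
  then have less: "card {p \<in> S. p + 1 \<notin> maya lam} < a" unfolding assms(2)[symmetric] by (rule psubset_card_mono[OF finite_S])
  let ?X = "(\<lambda>p. Phi p + 1) ` {p \<in> S. p + 1 \<notin> maya lam}"
  have X: "finite ?X" using finite_S by simp
  have "card ?X < a" unfolding card_image[OF inj_Phi1] by (rule less)
  then have "\<not> (T \<subseteq> ?X \<and> card T = a)" for T using card_mono[OF X, of T] by linarith
  then have "{T. T \<subseteq> ?X \<and> card T = a} = {}" by blast
  moreover have "trk (Fd (e + 1) (residue_plus 1) a mid) = (\<Sum>T | T \<subseteq> ?X \<and> card T = a.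
     scale (vpow (dwt (e + 1) (residue_plus 1) (maya mid) T)) (trk (basis (move T mid))))"
    unfolding Add_second[symmetric] by (rule trunc_Fd[OF plen_mid flinear_trk]) (simp only: trk_basis if_False)
  ultimately show ?thesis by (simp only: sum.empty)
qed

context
  assumes SA: "S \<subseteq> Add e i (maya lam)"
begin

lemma Add_second': "Add (e + 1) (residue_plus 1) (maya mid) \<inter> {- int k..} = (\<lambda>p. Phi p + 1) ` S"
proof -
  have "{p \<in> S. p + 1 \<notin> maya lam} = S" using SA unfolding Add_def by blast
  then show ?thesis unfolding Add_second by (simp only:)
qed

text \<open>A bead on the runner after the new one is removable exactly when its left neighbour on
  the new runner is free, and this holds here because S contains no blocked bead. What the old left
  neighbour carries does not matter, so these sites are more than the images of
  \<open>Rem e i (maya lam)\<close>.\<close>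

lemma Rem_second:
  assumes "p \<in> S"
  shows "{Q \<in> Rem (e + 1) (residue_plus 1) (maya mid). Phi p + 1 < Q} =
    (\<lambda>q. Phi q + 1) ` {q. p < q \<and> q + 1 \<in> maya lam \<and> (q + 1) mod int e = int i}"
proof (intro equalityI subsetI)
  fix Q assume "Q \<in> {Q \<in> Rem (e + 1) (residue_plus 1) (maya mid). Phi p + 1 < Q}"
  then have Q: "Q \<notin> maya mid" "Q + 1 \<in> maya mid" "(Q + int k - int \<alpha>) mod int (e + 1) = 0" "Phi p + 1 < Q"
    unfolding Rem_def residue_plus_1 by blast+
  have "- int k \<le> p" using assms S sitesD by blast
  then have ge: "- int k \<le> Q + 1" using Q(4) Phi_ge_iff[of p] by linarith
  have c1: "(Q + 1 + int k - int \<alpha>) mod int (e + 1) = 1" using Q(3) unfolding one_class .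
  have "Q + 1 \<noteq> Phi r + 1" if "r \<in> S" for r
  proof
    assume "Q + 1 = Phi r + 1"
    moreover have "(Phi r + 1 + int k - int \<alpha>) mod int (e + 1) = 0"
      unfolding Phi_site0 using that S sitesD by blast
    ultimately show False using c1 by simp
  qed
  then have "Q + 1 \<in> maya (plus lam)" using Q(2) unfolding maya_mid by blast
  from in_plusE[OF lam this ge] obtain q' where q': "q' \<in> maya lam" "Q + 1 = Phi q'" .
  define q where "q = q' - 1"
  have qq: "q' = q + 1" by (simp add: q_def)
  have s: "(q + 1) mod int e = int i" using c1 unfolding q'(2) Phi_site1 qq .
  have QP: "Q = Phi q + 1" using q'(2) unfolding qq Phi_suc0[OF s] by simp
  have "p < q" using Q(4) Phi_less_iff[of p q] unfolding QP by simp
  then show "Q \<in> (\<lambda>q. Phi q + 1) ` {q. p < q \<and> q + 1 \<in> maya lam \<and> (q + 1) mod int e = int i}"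
    using s q'(1) unfolding QP qq by blast
next
  fix Q assume "Q \<in> (\<lambda>q. Phi q + 1) ` {q. p < q \<and> q + 1 \<in> maya lam \<and> (q + 1) mod int e = int i}"
  then obtain q where q: "Q = Phi q + 1" "p < q" "q + 1 \<in> maya lam" "(q + 1) mod int e = int i" by blast
  have "- int k \<le> p" using assms S sitesD by blast
  then have ge: "- int k \<le> q" "- int k \<le> q + 1" using q(2) by simp_all
  have "q \<notin> S" using SA q(3) unfolding Add_def by blast
  then have "Q \<notin> maya mid" unfolding q(1) Phi_1_mid[OF q(4) ge(1)] .
  moreover have "Q + 1 = Phi (q + 1)" unfolding q(1) Phi_suc0[OF q(4)] by simp
  then have "Q + 1 \<in> maya mid" using Phi_2_mid[OF q(4) ge(2)] q(3) by simp
  moreover have "(Q + 1) mod int (e + 1) = int (residue_plus 1)" unfolding residue_plus_1 q(1) Phi_site0 by (rule q(4))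
  moreover have "Phi p + 1 < Q" unfolding q(1) using Phi_less_iff[of p q] q(2) by simp
  ultimately show "Q \<in> {Q \<in> Rem (e + 1) (residue_plus 1) (maya mid). Phi p + 1 < Q}" unfolding Rem_def by blast
qed

lemma dwt_second:
  "dwt (e + 1) (residue_plus 1) (maya mid) ((\<lambda>p. Phi p + 1) ` S) =
     - (\<Sum>p\<in>S. int (card {q. p < q \<and> q + 1 \<in> maya lam \<and> (q + 1) mod int e = int i}))"
proof -
  have S1: "(\<lambda>p. Phi p + 1) ` S \<subseteq> {- int k..}" using Add_second' by blast
  have "dwt (e + 1) (residue_plus 1) (maya mid) ((\<lambda>p. Phi p + 1) ` S) =
    (\<Sum>p\<in>S. - int (card {Q \<in> Rem (e + 1) (residue_plus 1) (maya mid). Phi p + 1 < Q}))"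
    unfolding dwt_adm[OF S1] Add_second' sum.reindex[OF inj_Phi1] comp_def by simp
  also have "\<dots> = (\<Sum>p\<in>S. - int (card {q. p < q \<and> q + 1 \<in> maya lam \<and> (q + 1) mod int e = int i}))"
    by (intro sum.cong refl) (simp only: Rem_second card_image[OF inj_Phi1])
  finally show ?thesis unfolding sum_negf .
qed

text \<open>The blocked beads, collected in B, count as addable in the first step, while their right
  neighbours count as removable in the second. The two contributions cancel and leave the old
  exponent.\<close>

lemma dwt_total:
  "dwt (e + 1) (residue_plus 0) (maya (plus lam)) (Phi ` S) + dwt (e + 1) (residue_plus 1) (maya mid) ((\<lambda>p. Phi p + 1) ` S) = dwt e i (maya lam) S"
proof -
  let ?M = "maya lam"
  have "int (card {q \<in> sites - S. p < q}) - int (card {q. p < q \<and> q + 1 \<in> ?M \<and> (q + 1) mod int e = int i}) =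
     int (card {q \<in> Add e i ?M - S. p < q}) - int (card {q \<in> Rem e i ?M. p < q})" if p: "p \<in> S" for p
  proof -
    have pk: "- int k \<le> p" using p S sitesD by blast
    define B where "B = {q. p < q \<and> q \<in> ?M \<and> q + 1 \<in> ?M \<and> (q + 1) mod int e = int i}"
    have BS: "B \<subseteq> sites" using pk unfolding B_def sites_def by auto
    then have finB: "finite B" using finite_sites by (rule finite_subset)
    have "{q \<in> sites - S. p < q} = {q \<in> Add e i ?M - S. p < q} \<union> B"
      using pk SA BS unfolding B_def Add_def sites_def by auto
    moreover have "{q \<in> Add e i ?M - S. p < q} \<inter> B = {}" unfolding B_def Add_def by blast
    ultimately have 1: "card {q \<in> sites - S. p < q} = card {q \<in> Add e i ?M - S. p < q} + card B"
      using finB by (simp only: card_Un_disjoint finite_Add_maya finite_Diff finite_Collect_conjI Collect_mem_eq simp_thms)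
    have "{q. p < q \<and> q + 1 \<in> ?M \<and> (q + 1) mod int e = int i} = {q \<in> Rem e i ?M. p < q} \<union> B"
      unfolding B_def Rem_def by blast
    moreover have "{q \<in> Rem e i ?M. p < q} \<inter> B = {}" unfolding B_def Rem_def by blast
    ultimately have 2: "card {q. p < q \<and> q + 1 \<in> ?M \<and> (q + 1) mod int e = int i} = card {q \<in> Rem e i ?M. p < q} + card B"
      using finB by (simp only: card_Un_disjoint finite_Rem_maya finite_Collect_conjI Collect_mem_eq simp_thms)
    show ?thesis unfolding 1 2 by simp
  qed
  then have "(\<Sum>p\<in>S. int (card {q \<in> sites - S. p < q}) - int (card {q. p < q \<and> q + 1 \<in> ?M \<and> (q + 1) mod int e = int i})) =
     dwt e i ?M S" unfolding dwt_def by (intro sum.cong refl) blast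
  then show ?thesis unfolding dwt_first[OF S] dwt_second sum_subtractf by linarith
qed

lemma move_second:
  "plen (move S lam) \<le> k" "move ((\<lambda>p. Phi p + 1) ` S) mid = plus (move S lam)"
proof -
  let ?I = "{- int k..}" and ?T = "(\<lambda>p. Phi p + 1) ` S"
  have SI: "S \<subseteq> ?I" using S unfolding sites_def by auto
  show l1: "plen (move S lam) \<le> k"
    using plen_move_le_iff[OF subset_trans[OF SA Add_movable] lam] SI by blast
  have T: "?T \<subseteq> Add (e + 1) (residue_plus 1) (maya mid)" "?T \<subseteq> ?I" using Add_second' by blast+
  have l2: "plen (move ?T mid) \<le> k"
    using plen_move_le_iff[OF subset_trans[OF T(1) Add_movable] plen_mid] T(2) by blast
  have T0: "?T \<inter> maya (plus lam) = {}"
  proof -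
    have "Phi p + 1 \<notin> maya (plus lam)" if "p \<in> S" for p
    proof (rule empty_runner[OF lam])
      show "- int k \<le> Phi p + 1" using that S sitesD[of p] Phi_ge_iff[of p] by fastforce
      show "(Phi p + 1 + int k - int \<alpha>) mod int (e + 1) = 0" unfolding Phi_site0 using that S sitesD by blast
    qed
    then show ?thesis by blast
  qed
  have suc: "(\<lambda>P. P + 1) ` ?T = Phi ` (\<lambda>p. p + 1) ` S"
    unfolding image_image
  proof (rule image_cong[OF refl])
    fix p assume "p \<in> S"
    then have "(p + 1) mod int e = int i" using S sitesD by blast
    from Phi_suc0[OF this] show "Phi p + 1 + 1 = Phi (p + 1)" by simp
  qed
  have ge: "Phi ` (\<lambda>p. p + 1) ` S \<subseteq> ?I" unfolding suc[symmetric] using T(2) by auto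
  have "mv (maya mid) ?T = (maya (plus lam) - Phi ` S) \<union> Phi ` (\<lambda>p. p + 1) ` S"
    unfolding mv_def suc maya_mid using T0 by blast
  then have "mv (maya mid) ?T \<inter> ?I = ((maya (plus lam) \<inter> ?I) - Phi ` S) \<union> Phi ` (\<lambda>p. p + 1) ` S"
    using ge by blast
  also have "\<dots> = Phi ` ((maya lam \<inter> ?I) - S) \<union> Phi ` (\<lambda>p. p + 1) ` S"
    unfolding maya_plus_ge[OF lam] by (simp only: image_set_diff[OF inj_Phi])
  also have "\<dots> = Phi ` (mv (maya lam) S \<inter> ?I)"
    unfolding image_Un[symmetric] using SI by (intro arg_cong[where f="image Phi"]) (auto simp: mv_def)
  finally have "maya (move ?T mid) \<inter> ?I = Phi ` (maya (move S lam) \<inter> ?I)"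
    unfolding maya_move_Add[OF T(1)] maya_move_Add[OF SA] .
  then show "move ?T mid = plus (move S lam)" by (rule plus_eqI[OF l2 l1])
qed

text \<open>Exactly a beads from -k on can leave the new runner, so all of S moves and a single term
  survives.\<close>

lemma trk_Fd_mid:
  assumes "card S = a"
  shows "trk (Fd (e + 1) (residue_plus 1) a mid) =
    scale (vpow (dwt (e + 1) (residue_plus 1) (maya mid) ((\<lambda>p. Phi p + 1) ` S))) (Th (basis (move S lam)))"
proof -
  let ?X = "(\<lambda>p. Phi p + 1) ` S"
  have X: "finite ?X" using finite_S by simp
  have c: "card ?X = a" unfolding card_image[OF inj_Phi1] by (rule assms)
  have "T = ?X" if "T \<subseteq> ?X" "card T = a" for T using card_subset_eq[OF X that(1)] that(2) c by simp
  then have "{T. T \<subseteq> ?X \<and> card T = a} = {?X}" using c by blast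
  moreover have "trk (Fd (e + 1) (residue_plus 1) a mid) = (\<Sum>T | T \<subseteq> ?X \<and> card T = a.
     scale (vpow (dwt (e + 1) (residue_plus 1) (maya mid) T)) (trk (basis (move T mid))))"
    unfolding Add_second'[symmetric] by (rule trunc_Fd[OF plen_mid flinear_trk]) (simp only: trk_basis if_False)
  ultimately have "trk (Fd (e + 1) (residue_plus 1) a mid) =
     scale (vpow (dwt (e + 1) (residue_plus 1) (maya mid) ?X)) (trk (basis (move ?X mid)))"
    by (simp only: sum.insert[OF finite.emptyI] empty_iff simp_thms sum.empty add_0_right)
  then show ?thesis unfolding move_second(2) trk_basis Th_basis using move_second(1) plen_plus by (simp only: if_True)
qed

end

end

lemma trk_Fdiv_Fd_plus:
  "trk (Fdiv (e + 1) (residue_plus 1) a (Fd (e + 1) (residue_plus 0) a (plus lam))) = Th (Fd e i a lam)"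
proof -
  let ?T = "\<lambda>x. trk (Fdiv (e + 1) (residue_plus 1) a x)"
  have e_plus_1: "e + 1 \<ge> 2" using e2 by simp
  have T: "flinear ?T" by (rule flinear_compose[OF flinear_trk flinear_Fdiv[OF e_plus_1]])
  have long: "?T (basis \<nu>) = 0" if "\<not> plen \<nu> \<le> k" for \<nu>
    unfolding Fdiv_basis[OF e_plus_1] by (rule long_Fd[OF that flinear_trk]) (simp only: trk_basis if_False)
  let ?w = "\<lambda>X. dwt (e + 1) (residue_plus 0) (maya (plus lam)) X"
  have "?T (Fd (e + 1) (residue_plus 0) a (plus lam)) = (\<Sum>X | X \<subseteq> Phi ` sites \<and> card X = a.
      scale (vpow (?w X)) (?T (basis (move X (plus lam)))))"
    unfolding Add_first[symmetric] by (rule trunc_Fd[OF plen_plus T long])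
  also have "\<dots> = (\<Sum>S | S \<subseteq> sites \<and> card S = a. scale (vpow (?w (Phi ` S))) (?T (basis (move (Phi ` S) (plus lam)))))"
    by (rule sum_subsets_image)
  also have "\<dots> = (\<Sum>S | S \<subseteq> Add e i (maya lam) \<inter> {- int k..} \<and> card S = a.
      scale (vpow (dwt e i (maya lam) S)) (Th (basis (move S lam))))"
  proof (rule sum.mono_neutral_cong_right)
    have "{S. S \<subseteq> sites \<and> card S = a} \<subseteq> Pow sites" by blast
    then show "finite {S. S \<subseteq> sites \<and> card S = a}" using finite_sites by (rule finite_subset[OF _ finite_Pow_iff[THEN iffD2]])
    show "{S. S \<subseteq> Add e i (maya lam) \<inter> {- int k..} \<and> card S = a} \<subseteq> {S. S \<subseteq> sites \<and> card S = a}"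
      unfolding Add_sites by blast
    show "\<forall>S\<in>{S. S \<subseteq> sites \<and> card S = a} - {S. S \<subseteq> Add e i (maya lam) \<inter> {- int k..} \<and> card S = a}.
      scale (vpow (?w (Phi ` S))) (?T (basis (move (Phi ` S) (plus lam)))) = 0"
    proof
      fix S assume "S \<in> {S. S \<subseteq> sites \<and> card S = a} - {S. S \<subseteq> Add e i (maya lam) \<inter> {- int k..} \<and> card S = a}"
      then have S: "S \<subseteq> sites" "card S = a" "\<not> S \<subseteq> Add e i (maya lam) \<inter> {- int k..}" by blast+
      have "sites \<subseteq> {- int k..}" using sitesD by auto
      then have "\<not> S \<subseteq> Add e i (maya lam)" using S(1,3) by blast
      from trk_Fd_mid_zero[OF S(1) this S(2)] have "?T (basis (move (Phi ` S) (plus lam))) = 0"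
        unfolding mid_def[OF S(1)] Fdiv_basis[OF e_plus_1] .
      then show "scale (vpow (?w (Phi ` S))) (?T (basis (move (Phi ` S) (plus lam)))) = 0"
        by (simp only: fock.scale_zero_right)
    qed
    fix S assume "S \<in> {S. S \<subseteq> Add e i (maya lam) \<inter> {- int k..} \<and> card S = a}"
    then have S': "S \<subseteq> Add e i (maya lam) \<inter> {- int k..}" and c: "card S = a" by simp_all
    have "S \<subseteq> sites" using S' unfolding Add_sites by blast
    then have SA: "S \<subseteq> Add e i (maya lam)" "S \<subseteq> sites" "card S = a" using S' c by simp_all
    show "scale (vpow (?w (Phi ` S))) (?T (basis (move (Phi ` S) (plus lam)))) =
        scale (vpow (dwt e i (maya lam) S)) (Th (basis (move S lam)))"
      unfolding Fdiv_basis[OF e_plus_1] mid_def[OF SA(2), symmetric] trk_Fd_mid[OF SA(2,1,3)] fock.scale_scale vpow_mult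
        dwt_total[OF SA(2,1)] ..
  qed
  also have "\<dots> = Th (Fd e i a lam)"
    by (rule trunc_Fd[OF lam flinear_Th, symmetric]) (simp only: Th_basis if_False)
  finally show ?thesis .
qed

end

end

section \<open>Lifting elements of \<open>L e\<close> to \<open>L (e + 1)\<close>\<close>

lemma bar_bar: "e \<ge> 2 \<Longrightarrow> x \<in> L e \<Longrightarrow> bar e (bar e x) = x"
proof -
  assume e: "e \<ge> 2" and "x \<in> L e"
  from this(2) show ?thesis
  proof (induction rule: L_induct)
    case empty
    show ?case by (simp only: bar_empty[OF e])
  next
    case (add x y)
    then show ?case by (simp only: bar_add[OF e] bar_in_L[OF e])
  next
    case (scale c x)
    then show ?case by (simp only: bar_scale[OF e] bar_in_L[OF e] laurent_bar_bar)
  next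
    case (Fdiv i a x)
    then show ?case by (simp only: bar_Fdiv[OF e] bar_in_L[OF e])
  qed
qed

context runner_insertion
begin

lemma e_plus_1: "e + 1 \<ge> 2" using e2 by simp

lemma operator_lift:
  assumes G: "flinear G" "\<And>x. trk (G (trk x)) = trk (G x)"
    and base: "\<And>lam. plen lam \<le> k \<Longrightarrow> trk (G (basis (plus lam))) = Th (Fd e i a lam)"
    and x: "trk x' = Th x"
  shows "trk (G x') = Th (Fdiv e i a x)"
proof -
  have "trk (G (Th x)) = Th (Fdiv e i a x)"
  proof (rule flinear_ext[where T="\<lambda>x. trk (G (Th x))" and T'="\<lambda>x. Th (Fdiv e i a x)"])
    show "flinear (\<lambda>x. trk (G (Th x)))"
      by (rule flinear_compose[OF flinear_trk flinear_compose[OF G(1) flinear_Th]])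
    show "flinear (\<lambda>x. Th (Fdiv e i a x))"
      by (rule flinear_compose[OF flinear_Th flinear_Fdiv[OF e2]])
    fix lam
    show "trk (G (Th (basis lam))) = Th (Fdiv e i a (basis lam))"
    proof (cases "plen lam \<le> k")
      case True
      then show ?thesis unfolding Fdiv_basis[OF e2] base[OF True, symmetric] Th_basis by (simp only: if_True)
    next
      case False
      have "Th (Fd e i a lam) = 0"
        by (rule long_Fd[OF False flinear_Th]) (simp only: Th_basis if_False)
      moreover have "trk (G 0) = 0" by (simp only: module_hom.zero[OF G(1)] module_hom.zero[OF flinear_trk])
      ultimately show ?thesis unfolding Fdiv_basis[OF e2] Th_basis using False by (simp only: if_False)
    qed
  qed
  then show ?thesis unfolding x[symmetric] G(2) .
qed

text \<open>Packages the case of one divided power and the case of two that cross the new runner, so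
  that the lift needs only these four properties of G.\<close>

lemma operator_exists:
  assumes i: "i < e" and a: "a \<ge> 1"
  obtains G where "flinear G" "\<And>x. x \<in> L (e + 1) \<Longrightarrow> G x \<in> L (e + 1)"
    "\<And>x. x \<in> L (e + 1) \<Longrightarrow> bar (e + 1) (G x) = G (bar (e + 1) x)"
    "\<And>x x'. trk x' = Th x \<Longrightarrow> trk (G x') = Th (Fdiv e i a x)"
proof (cases "(int i + int k - int \<alpha>) mod int e = 0")
  case True
  let ?G = "\<lambda>x. Fdiv (e + 1) (residue_plus 1) a (Fdiv (e + 1) (residue_plus 0) a x)"
  have fl: "flinear ?G" by (rule flinear_compose[OF flinear_Fdiv[OF e_plus_1] flinear_Fdiv[OF e_plus_1]])
  have tr: "trk (?G (trk x)) = trk (?G x)" for x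
    using trk_Fdiv_trk[OF e_plus_1, of "residue_plus 1" a "Fdiv (e + 1) (residue_plus 0) a (trk x)"]
      trk_Fdiv_trk[OF e_plus_1, of "residue_plus 1" a "Fdiv (e + 1) (residue_plus 0) a x"] trk_Fdiv_trk[OF e_plus_1, of "residue_plus 0" a x]
    by (simp only:)
  show ?thesis
  proof (rule that)
    show "flinear ?G" by (rule fl)
    show "?G x \<in> L (e + 1)" if "x \<in> L (e + 1)" for x
      by (intro Fdiv_in_L e_plus_1 residue_plus_less that)
    show "bar (e + 1) (?G x) = ?G (bar (e + 1) x)" if "x \<in> L (e + 1)" for x
      using that by (simp only: bar_Fdiv[OF e_plus_1] residue_plus_less a Fdiv_in_L[OF e_plus_1])
    show "trk (?G x') = Th (Fdiv e i a x)" if "trk x' = Th x" for x x'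
      by (rule operator_lift[where G="?G", OF fl tr _ that]) (simp only: Fdiv_basis[OF e_plus_1] trk_Fdiv_Fd_plus[OF i True])
  qed
next
  case False
  let ?r = "residue_plus ((int i + int k - int \<alpha>) mod int e + 1)"
  let ?G = "Fdiv (e + 1) ?r a"
  have fl: "flinear ?G" by (rule flinear_Fdiv[OF e_plus_1])
  show ?thesis
  proof (rule that)
    show "flinear ?G" by (rule fl)
    show "?G x \<in> L (e + 1)" if "x \<in> L (e + 1)" for x
      by (intro Fdiv_in_L e_plus_1 residue_plus_less that)
    show "bar (e + 1) (?G x) = ?G (bar (e + 1) x)" if "x \<in> L (e + 1)" for x
      using that by (simp only: bar_Fdiv[OF e_plus_1] residue_plus_less a)
    show "trk (?G x') = Th (Fdiv e i a x)" if "trk x' = Th x" for x x'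
      by (rule operator_lift[where G="?G", OF fl trk_Fdiv_trk[OF e_plus_1] _ that])
        (simp only: Fdiv_basis[OF e_plus_1] trk_Fd_plus[OF i refl False])
  qed
qed

lemma plen_empty_le: "plen empty_partition \<le> k"
  by simp

text \<open>In row c the vacuum gains one column for each new place before its bead. The d-th column
  appears when c + e(d - 1) is at most k - \<alpha>, and the left side is the ladder number for e +
  1. For k <= \<alpha> both sides are empty, in accordance with truncated subtraction.\<close>

lemma diagram_plus_empty:
  "diagram (plus empty_partition) = {(c, d). 1 \<le> c \<and> 1 \<le> d \<and> ladder (e + 1) (c, d) \<le> k - \<alpha>}"
proof -
  have "d \<le> part (plus empty_partition) c \<longleftrightarrow> ladder (e + 1) (c, d) \<le> k - \<alpha>" if cd: "1 \<le> c" "1 \<le> d" for c d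
  proof -
    obtain d' where d: "d = Suc d'" using cd(2) by (cases d) auto
    have r: "ladder (e + 1) (c, d) \<le> k - \<alpha> \<longleftrightarrow> c + e * d' + \<alpha> \<le> k"
      using cd unfolding ladder_def d by auto
    show ?thesis
    proof (cases "c \<le> k")
      case True
      have "d \<le> part (plus empty_partition) c \<longleftrightarrow> d \<le> ((k - c) + (e - \<alpha>)) div e"
        using True cd by (simp add: part_plus part_empty)
      also have "\<dots> \<longleftrightarrow> d * e \<le> (k - c) + (e - \<alpha>)"
        using e2 by (intro less_eq_div_iff_mult_less_eq) simp
      also have "d * e = e * d' + e" unfolding d by simp
      also have "e * d' + e \<le> (k - c) + (e - \<alpha>) \<longleftrightarrow> c + e * d' + \<alpha> \<le> k"
        using True \<alpha>e by linarith
      finally show ?thesis unfolding r .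
    next
      case False
      then show ?thesis unfolding r using cd by (simp add: part_plus)
    qed
  qed
  then show ?thesis unfolding diagram_def by blast
qed

lemma empty_monomial: "basis (plus empty_partition) \<in> monomials (e + 1)"
  by (rule complete_ladders_monomial[OF regular_plus[OF plen_empty_le] e_plus_1 diagram_plus_empty])

text \<open>The statement about the bar image is carried through the induction, because it cannot be
  read off from \<open>trk x'\<close>: truncation and the bar involution are not compared
  directly.\<close>

lemma lift_exists:
  assumes "x \<in> L e"
  shows "\<exists>x'\<in>L (e + 1). trk x' = Th x \<and> trk (bar (e + 1) x') = Th (bar e x)"
  using assms
proof (induction rule: L_induct)
  case empty
  have "trk (basis (plus empty_partition)) = Th (basis empty_partition)"
    unfolding trk_basis Th_basis using plen_plus plen_empty_le by (simp only: if_True)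
  then show ?case
    using monomials_in_L[OF e_plus_1 empty_monomial] bar_monomial[OF e_plus_1 empty_monomial] bar_empty[OF e2] by (intro bexI) simp_all
next
  case (add x y)
  then obtain x' y' where x': "x' \<in> L (e + 1)" "trk x' = Th x" "trk (bar (e + 1) x') = Th (bar e x)"
    and y': "y' \<in> L (e + 1)" "trk y' = Th y" "trk (bar (e + 1) y') = Th (bar e y)" by blast
  have "trk (x' + y') = Th (x + y)" "trk (bar (e + 1) (x' + y')) = Th (bar e (x + y))"
    unfolding bar_add[OF e_plus_1 x'(1) y'(1)] bar_add[OF e2 add.hyps(1,2)]
    by (simp_all only: module_hom.add[OF flinear_trk] module_hom.add[OF flinear_Th] x' y')
  then show ?case using L_add[OF x'(1) y'(1)] by blast
next
  case (scale c x)
  then obtain x' where x': "x' \<in> L (e + 1)" "trk x' = Th x" "trk (bar (e + 1) x') = Th (bar e x)" by blast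
  have "trk (scale c x') = Th (scale c x)" "trk (bar (e + 1) (scale c x')) = Th (bar e (scale c x))"
    unfolding bar_scale[OF e_plus_1 x'(1)] bar_scale[OF e2 scale.hyps(1)]
    by (simp_all only: module_hom.scale[OF flinear_trk] module_hom.scale[OF flinear_Th] x')
  then show ?case using L_scale[OF x'(1)] by blast
next
  case (Fdiv i a x)
  then obtain x' where x': "x' \<in> L (e + 1)" "trk x' = Th x" "trk (bar (e + 1) x') = Th (bar e x)" by blast
  obtain G where G: "\<And>x. x \<in> L (e + 1) \<Longrightarrow> G x \<in> L (e + 1)"
    "\<And>x. x \<in> L (e + 1) \<Longrightarrow> bar (e + 1) (G x) = G (bar (e + 1) x)"
    "\<And>x x'. trk x' = Th x \<Longrightarrow> trk (G x') = Th (Fdiv e i a x)"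
    using operator_exists[OF Fdiv.hyps(2,3)] by metis
  have "trk (G x') = Th (Fdiv e i a x)" by (rule G(3)[OF x'(2)])
  moreover have "trk (bar (e + 1) (G x')) = Th (bar e (Fdiv e i a x))"
    unfolding G(2)[OF x'(1)] bar_Fdiv[OF e2 Fdiv.hyps(1,2,3)] by (rule G(3)[OF x'(3)])
  ultimately show ?case using G(1)[OF x'(1)] by blast
qed

lemma invariant_lift:
  assumes "x \<in> L e" "bar e x = x"
  obtains y where "y \<in> L (e + 1)" "bar (e + 1) y = y" "trk y = Th x"
proof -
  obtain x' where x': "x' \<in> L (e + 1)" "trk x' = Th x" "trk (bar (e + 1) x') = Th x"
    using lift_exists[OF assms(1)] unfolding assms(2) by blast
  \<comment> \<open>The constant 1/2, for the average of a lift and its bar image.\<close>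
  define h :: laurent where "h = Poly_Mapping.single 0 (1 / 2)"
  have h: "h + h = 1" unfolding h_def single_add[symmetric] by (simp add: single_one)
  have hb: "laurent_bar h = h" unfolding h_def by simp
  let ?s = "x' + bar (e + 1) x'"
  have sL: "?s \<in> L (e + 1)" by (intro L_add x' bar_in_L[OF e_plus_1])
  have "bar (e + 1) ?s = ?s"
    unfolding bar_add[OF e_plus_1 x'(1) bar_in_L[OF e_plus_1 x'(1)]] bar_bar[OF e_plus_1 x'(1)] by (rule add.commute)
  then have "bar (e + 1) (scale h ?s) = scale h ?s" unfolding bar_scale[OF e_plus_1 sL] hb by (simp only:)
  moreover have "trk (scale h ?s) = Th x"
    unfolding module_hom.scale[OF flinear_trk] module_hom.add[OF flinear_trk] x'
    by (simp only: fock.scale_right_distrib fock.scale_left_distrib[symmetric] h fock.scale_one)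
  ultimately show ?thesis using that L_scale[OF sL] by blast
qed

lemma canonical_plus:
  assumes \<mu>: "plen \<mu> \<le> k" "regular e \<mu>" and lam: "plen lam \<le> k"
  shows "b e lam \<mu> = b (e + 1) (plus lam) (plus \<mu>)"
proof -
  define B where "B = canonical_basis e \<mu>"
  define C where "C = canonical_basis (e + 1) (plus \<mu>)"
  have B: "is_canonical e \<mu> B" unfolding B_def by (rule canonical_basis[OF e2 \<mu>(2)])
  have C: "is_canonical (e + 1) (plus \<mu>) C" unfolding C_def by (rule canonical_basis[OF e_plus_1 regular_plus[OF \<mu>(1)]])
  have BL: "B \<in> L e" "bar e B = B" using B integral_form_L[OF e2] by (simp_all add: is_canonical_def)
  have CL: "C \<in> L (e + 1)" "bar (e + 1) C = C" using C integral_form_L[OF e_plus_1] unfolding is_canonical_def by blast+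
  from invariant_lift[OF BL] obtain y where y: "y \<in> L (e + 1)" "bar (e + 1) y = y" "trk y = Th B" .
  have y_plus: "Poly_Mapping.lookup y (plus \<nu>) = Poly_Mapping.lookup B \<nu>" if "plen \<nu> \<le> k" for \<nu>
    using lookup_trk[OF plen_plus, of y \<nu>] lookup_Th[OF that, of B] y(3) by (simp only:)
  have y_v: "Poly_Mapping.lookup y \<nu> \<in> v_poly" if \<nu>: "plen \<nu> \<le> k" "\<nu> \<noteq> plus \<mu>" for \<nu>
  proof (cases "\<exists>\<kappa>. plen \<kappa> \<le> k \<and> \<nu> = plus \<kappa>")
    case True
    then obtain \<kappa> where \<kappa>: "plen \<kappa> \<le> k" "\<nu> = plus \<kappa>" by blast
    then have "\<kappa> \<noteq> \<mu>" using \<nu>(2) by blast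
    then have "Poly_Mapping.lookup B \<kappa> \<in> v_int_poly" using B unfolding is_canonical_def by blast
    then show ?thesis unfolding \<kappa>(2) y_plus[OF \<kappa>(1)] v_int_poly_iff by blast
  next
    case False
    then have "Poly_Mapping.lookup (Th B) \<nu> = 0" by (intro lookup_Th_other) blast
    then have "Poly_Mapping.lookup y \<nu> = 0" using lookup_trk[OF \<nu>(1), of y] y(3) by (simp only:)
    then show ?thesis by (simp add: v_poly_def)
  qed
  have "Poly_Mapping.lookup (y - C) (plus lam) = 0"
  proof (rule bar_invariant_small[OF e_plus_1 L_diff[OF y(1) CL(1)], where k=k])
    show "bar (e + 1) (y - C) = y - C" unfolding bar_diff[OF e_plus_1 y(1) CL(1)] y(2) CL(2) ..
    show "plen (plus lam) \<le> k" by (rule plen_plus)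
    fix \<nu> assume \<nu>: "plen \<nu> \<le> k"
    show "Poly_Mapping.lookup (y - C) \<nu> \<in> v_poly"
    proof (cases "\<nu> = plus \<mu>")
      case True
      \<comment> \<open>At the leading partition neither coefficient is in \<open>v_poly\<close>,
        but their difference is 0.\<close>
      have "Poly_Mapping.lookup y \<nu> = 1" "Poly_Mapping.lookup C \<nu> = 1"
        unfolding True y_plus[OF \<mu>(1)] using B C unfolding is_canonical_def by blast+
      then show ?thesis by (simp add: lookup_minus v_poly_def)
    next
      case False
      then have "Poly_Mapping.lookup C \<nu> \<in> v_poly" using C unfolding is_canonical_def v_int_poly_iff by blast
      with y_v[OF \<nu> False] show ?thesis by (simp add: lookup_minus v_poly_def)
    qed
  qed
  then have "Poly_Mapping.lookup y (plus lam) = Poly_Mapping.lookup C (plus lam)" by (simp add: lookup_minus)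
  then show ?thesis unfolding b_def B_def[symmetric] C_def[symmetric] y_plus[OF lam] .
qed

end

theorem theorem3p2:
  fixes e k \<alpha> n :: nat and lam \<mu> :: partition
  assumes "e \<ge> 2" and "\<alpha> \<le> e"
    and "psize lam = n" and "psize \<mu> = n"
    and "plen lam \<le> k" and "plen \<mu> \<le> k"
    and "regular e \<mu>"
  shows "b e lam \<mu> = b (e + 1) (insert_runner e k \<alpha> lam) (insert_runner e k \<alpha> \<mu>)"
proof -
  interpret runner_insertion e k \<alpha> by unfold_locales (fact assms)+
  show ?thesis
    unfolding insert_runner_eq[OF assms(5)] insert_runner_eq[OF assms(6)]
    by (rule canonical_plus[OF assms(6,7,5)])
qed

end
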